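(* The double series $$\Phi_2(s_1,s_2;1,\Lambda)=\sum_{m_1=1}^\infty\sum_{m_2=1}^\infty\frac{\Lambda(m_2)}{m_1^{s_1}(m_1+m_2)^{s_2}},$$ which converges absolutely for $\Re s_2>1$, $\Re(s_1+s_2)>2$, can be continued meromorphically to the whole space $\mathbb{C}^2$ by the following expression, where $N\in\mathbb{N}$ is arbitrary, $\varepsilon$ is a small positive number, and the expression is understood in the region $\{(s_1,s_2)\in\mathbb{C}^2 : \Re s_2>-N+\varepsilon,\ \Re(s_1+s_2)>1-N+\varepsilon\}$: $$\begin{aligned} \Phi_2(s_1,s_2;1,\Lambda) ={}&\frac{\zeta(s_1+s_2-1)}{s_2-1}-(\log 2\pi)\,\zeta(s_1+s_2) +\sum_{\substack{1\le k\le N-1\\ k\ \mathrm{odd}}}\binom{-s_2}{k}M(-k)\,\zeta(s_1+s_2+k)\\ &-\sum_{\substack{1\le k\le N-1\\ k\ \mathrm{even}}}\bigg[\binom{-s_2}{k}\Big\{(-a_k+k!\,b_k)\,\zeta(s_1+s_2+k)-\zeta'(s_1+s_2+k)\Big\}\\ &\qquad\qquad-\frac{1}{k!}\frac{\Gamma'(s_2+k)}{\Gamma(s_2)}\,\zeta(s_1+s_2+k)\bigg]\\ &-\frac{1}{\Gamma(s_2)}\sum_{n=1}^\infty \mathrm{ord}(\rho_n)\,\Gamma(s_2-\rho_n)\,\Gamma(\rho_n)\,\zeta(s_1+s_2-\rho_n)\\ &+\frac{1}{2\pi i\,\Gamma(s_2)}\int_{(N-\varepsilon)}\Gamma(s_2+z)\,\Gamma(-z)\,M(-z)\,\zeta(s_1+s_2+z)\,dz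 . \end{aligned}$$
   Context: $\mathbb{N}=\{1,2,3,\dots\}$, $\mathbb{N}_0=\mathbb{N}\cup\{0\}$, $i=\sqrt{-1}$. $\zeta$ is the Riemann zeta function and $\Gamma$ the gamma function. $\Lambda$ is the von Mangoldt function: $\Lambda(n)=\log p$ if $n=p^m$ with $p$ prime and $m\in\mathbb{N}$, and $\Lambda(n)=0$ otherwise. $M(s)=-\zeta'(s)/\zeta(s)$, so $M(s)=\sum_{n\ge1}\Lambda(n)n^{-s}$ for $\Re s>1$. $\{\rho_n\}_{n\ge1}$ are the (distinct) non-trivial zeros of $\zeta(s)$, numbered by the size of the absolute values of their imaginary parts, and $\mathrm{ord}(\rho_n)$ is the order of $\rho_n$ as a zero of $\zeta$. For even $k\in\mathbb{N}$, $a_k=\frac{1}{2\pi i}\int_{|\xi+k|=1/2}\frac{M(\xi)}{\xi+k}\,d\xi$ is the constant term of the Laurent series of $M(s)$ at $s=-k$. For $l\in\mathbb{N}_0$, $b_l=\frac{1}{2\pi i}\int_{|\xi+l|=1/2}\frac{\Gamma(\xi)}{\xi+l}\,d\xi$ is the constant term of the Laurent series of $\Gamma(s)$ at $s=-l$. $\binom{-s}{k}=\frac{(-s)(-s-1)\cdots(-s-k+1)}{k!}$. $\int_{(c)}$ denotes integration along the vertical line from $c-i\infty$ to $c+i\infty$. *)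

theory Defs
  imports
    "HOL-Complex_Analysis.Complex_Analysis"
    "HOL-Number_Theory.Prime_Powers"
begin

text \<open>
  The Riemann zeta function is the analytic continuation of \<open>\<Sum> n\<^sup>-\<^sup>s\<close> to the plane without \<open>1\<close>;
  such a continuation is unique by the identity theorem. The value \<open>0\<close> at the pole is a dummy,
  needed only to make the description determine a function on the whole type.
\<close>

definition riemann_zeta :: "complex \<Rightarrow> complex" where
  "riemann_zeta = (THE f. f holomorphic_on (- {1}) \<and>
     (\<forall>s. Re s > 1 \<longrightarrow> (\<lambda>n. 1 / of_nat (Suc n) powr s) sums f s) \<and> f 1 = 0)"

definition M_zeta :: "complex \<Rightarrow> complex" where
  "M_zeta s = - deriv riemann_zeta s / riemann_zeta s"

text \<open>The point \<open>1\<close> has to be left out because of the dummy value at the pole.\<close>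

definition nontrivial_zeta_zeros :: "complex set" where
  "nontrivial_zeta_zeros =
     {r. r \<noteq> 1 \<and> riemann_zeta r = 0 \<and> (\<forall>k::nat. k \<ge> 1 \<longrightarrow> r \<noteq> - of_nat (2 * k))}"

text \<open>
  Only \<open>\<rho> n\<close> with \<open>n \<ge> 1\<close> matters. Zeros with equal absolute value of the imaginary part may come
  in any order.
\<close>

definition enumerates_zeta_zeros :: "(nat \<Rightarrow> complex) \<Rightarrow> bool" where
  "enumerates_zeta_zeros \<rho> \<longleftrightarrow>
     bij_betw \<rho> {1..} nontrivial_zeta_zeros \<and> mono_on {1..} (\<lambda>n. \<bar>Im (\<rho> n)\<bar>)"

definition a_coeff :: "nat \<Rightarrow> complex" where
  "a_coeff k = 1 / (2 * of_real pi * \<i>) *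
     contour_integral (circlepath (- of_nat k) (1 / 2)) (\<lambda>\<xi>. M_zeta \<xi> / (\<xi> + of_nat k))"

definition b_coeff :: "nat \<Rightarrow> complex" where
  "b_coeff l = 1 / (2 * of_real pi * \<i>) *
     contour_integral (circlepath (- of_nat l) (1 / 2)) (\<lambda>\<xi>. Gamma \<xi> / (\<xi> + of_nat l))"

definition Phi2_term :: "complex \<Rightarrow> complex \<Rightarrow> nat \<Rightarrow> nat \<Rightarrow> complex" where
  "Phi2_term s1 s2 m1 m2 = mangoldt m2 / (of_nat m1 powr s1 * of_nat (m1 + m2) powr s2)"

definition Phi2 :: "complex \<Rightarrow> complex \<Rightarrow> complex" where
  "Phi2 s1 s2 = (\<Sum>\<^sub>\<infinity>m1\<in>{1..}. \<Sum>\<^sub>\<infinity>m2\<in>{1..}. Phi2_term s1 s2 m1 m2)"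

text \<open>Integration along the line from \<open>c - \<i>\<infinity>\<close> to \<open>c + \<i>\<infinity>\<close>; with \<open>z = c + \<i> t\<close>, \<open>dz = \<i> dt\<close>.\<close>

definition vertical_integrable :: "real \<Rightarrow> (complex \<Rightarrow> complex) \<Rightarrow> bool" where
  "vertical_integrable c f \<longleftrightarrow> integrable lborel (\<lambda>t. f (Complex c t))"

definition vertical_integral :: "real \<Rightarrow> (complex \<Rightarrow> complex) \<Rightarrow> complex" where
  "vertical_integral c f = \<i> * (LINT t|lborel. f (Complex c t))"

definition zero_term :: "complex \<Rightarrow> complex \<Rightarrow> complex \<Rightarrow> complex" where
  "zero_term s1 s2 r =
     of_int (zorder riemann_zeta r) * Gamma (s2 - r) * Gamma r * riemann_zeta (s1 + s2 - r)"

definition line_integrand :: "complex \<Rightarrow> complex \<Rightarrow> complex \<Rightarrow> complex" where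
  "line_integrand s1 s2 z = Gamma (s2 + z) * Gamma (- z) * M_zeta (- z) * riemann_zeta (s1 + s2 + z)"

text \<open>
  Points at which no factor occurring in the continuation formula is evaluated at a pole. The
  factor \<open>1 / Gamma s2\<close> is entire, and its value \<open>0\<close> at nonpositive integers agrees with
  the library conventions \<open>Gamma s2 = 0\<close> and \<open>1 / 0 = 0\<close>; so these points are not excluded.
\<close>

definition regular_point :: "nat \<Rightarrow> complex \<Rightarrow> complex \<Rightarrow> bool" where
  "regular_point N s1 s2 \<longleftrightarrow>
     s2 \<noteq> 1 \<and> s1 + s2 - 1 \<noteq> 1 \<and>
     (\<forall>k<N. s1 + s2 + of_nat k \<noteq> 1) \<and>
     (\<forall>k\<in>{1..N - 1}. even k \<longrightarrow> s2 + of_nat k \<notin> \<int>\<^sub>\<le>\<^sub>0) \<and>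
     (\<forall>r\<in>nontrivial_zeta_zeros. s2 - r \<notin> \<int>\<^sub>\<le>\<^sub>0 \<and> s1 + s2 - r \<noteq> 1)"

text \<open>
  Holomorphy in two variables is differentiability with a complex-linear derivative; a function is
  meromorphic if it is locally a quotient of holomorphic functions. As for the library's
  \<open>meromorphic_on\<close>, no condition is put on the values of \<open>F\<close> where the denominator vanishes.
\<close>

definition holomorphic2_on :: "(complex \<times> complex \<Rightarrow> complex) \<Rightarrow> (complex \<times> complex) set \<Rightarrow> bool" where
  "holomorphic2_on f U \<longleftrightarrow>
     (\<forall>p\<in>U. \<exists>a b. (f has_derivative (\<lambda>(h1, h2). a * h1 + b * h2)) (at p))"

definition meromorphic2_on :: "(complex \<times> complex \<Rightarrow> complex) \<Rightarrow> (complex \<times> complex) set \<Rightarrow> bool" where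
  "meromorphic2_on F U \<longleftrightarrow>
     (\<forall>p\<in>U. \<exists>V g h. open V \<and> connected V \<and> p \<in> V \<and>
        holomorphic2_on g V \<and> holomorphic2_on h V \<and> (\<exists>q\<in>V. h q \<noteq> 0) \<and>
        (\<forall>q\<in>V. h q \<noteq> 0 \<longrightarrow> F q = g q / h q))"

end

theory Submission
  imports Defs "HOL-Probability.Probability" "HOL-Real_Asymp.Real_Asymp"
begin

text \<open>
  In the coordinates \<open>s = s2\<close>, \<open>w = s1 + s2\<close>, the Mellin--Barnes formula for
  \<open>(1 + m2 / m1) powr (- s)\<close> turns the double series, for \<open>Re s > 1\<close> and \<open>Re w > 2\<close>, into
  \<open>1 / (2 pi i Gamma(s))\<close> times the integral of \<open>Gamma(s + z) Gamma(- z) M(- z) zeta(w + z)\<close>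
  along a line \<open>Re z = c\<close> with \<open>c < -1\<close>. Shifting the line to \<open>Re z = N - \<epsilon>\<close> crosses
  the pole of \<open>M(- z)\<close> at \<open>-1\<close>, its poles at the points \<open>- \<rho>\<close>, the simple poles of \<open>Gamma(- z)\<close> at
  \<open>0\<close> and at odd \<open>k\<close>, and double poles at even \<open>k \<ge> 2\<close>, where \<open>M(- z)\<close> has a pole as well;
  the residues are the terms of the formula.
  The shift needs \<open>zeta\<close> itself: its continuation and functional equation come from the theta
  function, and Jensen-type bounds for the number of zeros give heights on which \<open>M\<close> grows only
  polynomially, while the two gamma factors decay exponentially.

  For fixed \<open>N\<close> the formula defines a function that is holomorphic in each of \<open>s\<close> and \<open>w\<close> away
  from a discrete set of values. By the identity theorem, applied first in \<open>w\<close> and then in \<open>s\<close>,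
  different \<open>N\<close> give the same function. Clearing the poles along \<open>s = a\<close> and \<open>w = b\<close>
  leaves a locally bounded, separately holomorphic numerator, which is jointly holomorphic by
  Osgood's lemma.
\<close>

subsection \<open>Parameter integrals and Osgood's lemma\<close>

text \<open>The coordinates \<open>s\<close>, \<open>w\<close> are chosen because in them every
  polar set of the formula is a union of lines \<open>s = a\<close> or \<open>w = b\<close>; in
  \<open>s1\<close>, \<open>s2\<close> the second family would be oblique. Both families are
  infinite, since every zero \<rho> contributes, but locally finite: only finitely many zeros lie
  below a given height, so on a bounded set all but finitely many terms of the sum over the zeros
  are regular and dominated by one convergent series. The growth bounds are crude and exponential;
  only the balance of the exponents matters. With \<open>t = Im z\<close> the gamma factors give
  \<open>exp (-3 |t|)\<close> and zeta at most \<open>exp (3/2 |t|)\<close>. An exponential bound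
  for zeta yields O(1 + |T|) zeros near height T, and a pigeonhole argument then finds heights at
  distance of order 1 / T from all of them, on which M loses only a power of T. The term with log(2
  pi) is M(0). It comes from comparing the derivatives of (s - 1) zeta(s) at 0 and at 1: the theta
  integral has the same value at both points, and at 1 the derivative is Euler's constant.\<close>

lemma holomorphic_bounded_deriv_le:
  fixes f :: "complex \<Rightarrow> complex"
  assumes holo: "f holomorphic_on ball a r" and bd: "\<And>x. x \<in> ball a r \<Longrightarrow> norm (f x) \<le> B"
    and z: "z \<in> ball a (r/2)"
  shows "norm (deriv f z) \<le> 4 * B / r"
proof -
  have r: "r > 0"
    using order.strict_trans1[OF zero_le_dist, of a z "r/2"] z by simp
  have sub: "cball z (r/4) \<subseteq> ball a r"
  proof
    fix x assume "x \<in> cball z (r/4)"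
    then show "x \<in> ball a r"
      using z r dist_triangle[of a x z] by (auto simp: dist_commute)
  qed
  have "norm ((deriv ^^ 1) f z) \<le> fact 1 * B / (r/4) ^ 1"
  proof (rule Cauchy_inequality)
    show "f holomorphic_on ball z (r/4)"
      using holo sub ball_subset_cball by (meson holomorphic_on_subset order_trans)
    show "continuous_on (cball z (r/4)) f"
      using holo sub by (meson holomorphic_on_imp_continuous_on holomorphic_on_subset)
    show "norm (f x) \<le> B" if "norm (z - x) = r/4" for x
      using that sub by (intro bd) (auto simp: dist_norm)
  qed (use r in auto)
  then show ?thesis by (simp add: field_simps)
qed

lemma holomorphic_bounded_lipschitz:
  fixes f :: "complex \<Rightarrow> complex"
  assumes holo: "f holomorphic_on ball a r" and bd: "\<And>x. x \<in> ball a r \<Longrightarrow> norm (f x) \<le> B"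
    and xy: "x \<in> ball a (r/2)" "y \<in> ball a (r/2)"
  shows "norm (f x - f y) \<le> 4 * B / r * norm (x - y)"
proof (rule field_differentiable_bound[where f' = "deriv f"])
  have r: "r > 0"
    using order.strict_trans1[OF zero_le_dist, of a x "r/2"] xy by simp
  show "(f has_field_derivative deriv f z) (at z within ball a (r/2))" if "z \<in> ball a (r/2)" for z
    by (rule has_field_derivative_at_within[OF holomorphic_derivI[OF holo]]) (use that r in simp_all)
  show "norm (deriv f z) \<le> 4 * B / r" if "z \<in> ball a (r/2)" for z
    by (rule holomorphic_bounded_deriv_le[OF holo bd that])
qed (use xy in simp_all)

text \<open>Only the integrand itself has to be dominated: a holomorphic function bounded by
  \<open>g t\<close> on a ball is Lipschitz with constant \<open>4 * g t / r\<close> on the ball of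
  half the radius, so the difference quotients are dominated by a multiple of \<open>g\<close>. The
  measure is general because the lemma serves line integrals over \<open>lborel\<close> as well as
  series, over the counting measure.\<close>

lemma has_field_derivative_integral_dominated:
  fixes f :: "complex \<Rightarrow> 'a \<Rightarrow> complex"
  assumes r: "r > 0"
    and meas: "\<And>s. s \<in> ball a r \<Longrightarrow> f s \<in> borel_measurable M"
    and holo: "\<And>t. t \<in> space M \<Longrightarrow> (\<lambda>s. f s t) holomorphic_on ball a r"
    and g: "integrable M g" and dom: "\<And>s t. s \<in> ball a r \<Longrightarrow> t \<in> space M \<Longrightarrow> norm (f s t) \<le> g t"
  shows "((\<lambda>s. LINT t|M. f s t) has_field_derivative (LINT t|M. deriv (\<lambda>s. f s t) a)) (at a)"
    and "integrable M (\<lambda>t. deriv (\<lambda>s. f s t) a)"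
proof -
  define Q where "Q = (\<lambda>h t. (f (a + h) t - f a t) / h)"
  have int: "integrable M (f s)" if "s \<in> ball a r" for s
    by (rule Bochner_Integration.integrable_bound[OF g meas[OF that]], rule AE_I2)
      (use dom[OF that] in \<open>fastforce simp: abs_le_iff intro: order_trans\<close>)
  have Qb: "norm (Q h t) \<le> 4 / r * g t" if "norm h < r/2" "t \<in> space M" for h t
  proof (cases "h = 0")
    case True
    have "norm (f a t) \<le> g t" using dom that r by auto
    then have "0 \<le> g t" using norm_ge_zero order_trans by blast
    then show ?thesis using True r by (auto simp: Q_def)
  next
    case False
    have "norm (f (a+h) t - f a t) \<le> 4 * g t / r * norm (a + h - a)"
      by (rule holomorphic_bounded_lipschitz[OF holo[OF that(2)]]) (use dom that r in \<open>auto simp: dist_norm\<close>)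
    then show ?thesis using False by (simp add: Q_def norm_divide field_simps)
  qed
  have Qlim: "((\<lambda>h. Q h t) \<longlongrightarrow> deriv (\<lambda>s. f s t) a) (at 0)" if "t \<in> space M" for t
    using DERIV_D[OF holomorphic_derivI[OF holo[OF that], of a]] r by (simp add: Q_def)
  have key: "(\<lambda>n. LINT t|M. Q (X n) t) \<longlonglongrightarrow> (LINT t|M. deriv (\<lambda>s. f s t) a) \<and> integrable M (\<lambda>t. deriv (\<lambda>s. f s t) a)"
    if X: "\<And>n. X n \<noteq> 0" "X \<longlonglongrightarrow> 0" "\<And>n. norm (X n) < r/2" for X
  proof -
    have XX: "filterlim X (at 0) sequentially"
      by (rule filterlim_atI) (simp_all add: X)
    have L: "(\<lambda>n. Q (X n) t) \<longlonglongrightarrow> deriv (\<lambda>s. f s t) a" if "t \<in> space M" for t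
      by (rule filterlim_compose[OF Qlim[OF that] XX])
    have m: "Q (X n) \<in> borel_measurable M" for n
    proof -
      have "a + X n \<in> ball a r" using X(3)[of n] r by (auto simp: dist_norm)
      moreover have "a \<in> ball a r" using r by simp
      ultimately show ?thesis unfolding Q_def
        by (intro borel_measurable_divide borel_measurable_diff meas) simp_all
    qed
    have m2: "(\<lambda>t. deriv (\<lambda>s. f s t) a) \<in> borel_measurable M"
      by (rule borel_measurable_LIMSEQ_metric[OF m L])
    have g2: "integrable M (\<lambda>t. 4 / r * g t)" using g by auto
    show ?thesis
    proof
      have AE: "AE t in M. (\<lambda>n. Q (X n) t) \<longlonglongrightarrow> deriv (\<lambda>s. f s t) a"
        "AE t in M. norm (Q (X n) t) \<le> 4 / r * g t" for n
        by (rule AE_I2, erule L) (rule AE_I2, erule Qb[OF X(3)])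
      show "(\<lambda>n. LINT t|M. Q (X n) t) \<longlonglongrightarrow> (LINT t|M. deriv (\<lambda>s. f s t) a)"
        by (rule integral_dominated_convergence[OF m2 m g2 AE])
      show "integrable M (\<lambda>t. deriv (\<lambda>s. f s t) a)"
        by (rule integrable_dominated_convergence[OF m2 m g2 AE])
    qed
  qed
  \<comment> \<open>One concrete null sequence of nonzero points inside the ball of radius
    \<open>r / 2\<close> exhibits the derivative as a dominated limit and hence as
    integrable.\<close>
  have "(\<lambda>n. of_real (r / 4 / (real n + 1)) :: complex) \<longlonglongrightarrow> of_real 0"
    by (intro tendsto_of_real) real_asymp
  then show "integrable M (\<lambda>t. deriv (\<lambda>s. f s t) a)"
  proof (intro conjunct2[OF key])
    fix n
    have "norm (of_real (r / 4 / (real n + 1)) :: complex) = r / 4 / (real n + 1)"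
      unfolding norm_of_real using r by simp
    also have "\<dots> \<le> r / 4 / 1" using r by (intro divide_left_mono) auto
    also have "\<dots> < r / 2" using r by simp
    finally show "norm (of_real (r / 4 / (real n + 1)) :: complex) < r / 2" .
    have "r / 4 / (real n + 1) \<noteq> 0" using r by simp
    then show "(of_real (r / 4 / (real n + 1)) :: complex) \<noteq> 0" by (metis of_real_eq_0_iff)
  qed auto
  have "((\<lambda>h. LINT t|M. Q h t) \<longlongrightarrow> (LINT t|M. deriv (\<lambda>s. f s t) a)) (at 0)"
    unfolding tendsto_at_iff_sequentially
  proof (intro allI impI)
    fix X :: "nat \<Rightarrow> complex" assume X: "\<forall>i. X i \<in> UNIV - {0}" "X \<longlonglongrightarrow> 0"
    have "\<forall>\<^sub>F n in sequentially. dist (X n) 0 < r/2"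
      using X(2) r by (metis half_gt_zero tendstoD)
    then obtain K where K: "\<And>n. n \<ge> K \<Longrightarrow> norm (X n) < r/2"
      unfolding eventually_sequentially by auto
    have "(\<lambda>n. LINT t|M. Q (X (n + K)) t) \<longlonglongrightarrow> (LINT t|M. deriv (\<lambda>s. f s t) a)"
      by (rule conjunct1[OF key]) (use X K in \<open>auto intro: LIMSEQ_ignore_initial_segment\<close>)
    then show "((\<lambda>h. LINT t|M. Q h t) \<circ> X) \<longlonglongrightarrow> (LINT t|M. deriv (\<lambda>s. f s t) a)"
      unfolding o_def by (rule LIMSEQ_offset)
  qed
  then have "((\<lambda>h. ((LINT t|M. f (a + h) t) - (LINT t|M. f a t)) / h) \<longlongrightarrow> (LINT t|M. deriv (\<lambda>s. f s t) a)) (at 0)"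
  proof (rule Lim_transform_eventually)
    have "\<forall>\<^sub>F h in at 0. norm (h::complex) < r"
      using r by (auto simp: eventually_at intro!: exI[of _ r])
    then show "\<forall>\<^sub>F h in at 0. (LINT t|M. Q h t) = ((LINT t|M. f (a + h) t) - (LINT t|M. f a t)) / h"
    proof eventually_elim
      case (elim h)
      then show ?case unfolding Q_def using int[of "a + h"] int[of a] r
        by (simp add: dist_norm)
    qed
  qed
  then show "((\<lambda>s. LINT t|M. f s t) has_field_derivative (LINT t|M. deriv (\<lambda>s. f s t) a)) (at a)"
    by (simp add: DERIV_def)
qed

lemma holomorphic_on_integral_dominated:
  fixes f :: "complex \<Rightarrow> 'a \<Rightarrow> complex"
  assumes loc: "\<And>a. a \<in> U \<Longrightarrow> \<exists>r>0. \<exists>g. (\<forall>s\<in>ball a r. f s \<in> borel_measurable M) \<and>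
      (\<forall>t\<in>space M. (\<lambda>s. f s t) holomorphic_on ball a r) \<and>
      integrable M g \<and> (\<forall>s\<in>ball a r. \<forall>t\<in>space M. norm (f s t) \<le> g t)"
  shows "(\<lambda>s. LINT t|M. f s t) holomorphic_on U"
proof (unfold holomorphic_on_def, intro ballI)
  fix a assume "a \<in> U"
  from loc[OF this] obtain r g where "r > 0" "\<forall>s\<in>ball a r. f s \<in> borel_measurable M"
      "\<forall>t\<in>space M. (\<lambda>s. f s t) holomorphic_on ball a r"
      "integrable M g" "\<forall>s\<in>ball a r. \<forall>t\<in>space M. norm (f s t) \<le> g t" by blast
  then have "((\<lambda>s. LINT t|M. f s t) has_field_derivative (LINT t|M. deriv (\<lambda>s. f s t) a)) (at a)"
    by (intro has_field_derivative_integral_dominated(1)[of r a f M g]) auto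
  then show "(\<lambda>s. LINT t|M. f s t) field_differentiable at a within U"
    using field_differentiable_at_within field_differentiable_def by blast
qed

text \<open>The mixed difference \<open>E\<close> is of the order of the product of both increments:
  the Lipschitz bound for bounded holomorphic functions applies once in each variable. Hence
  \<open>E\<close> has derivative 0 at the centre, and \<open>f\<close> differs from
  \<open>E\<close> only by functions of one variable.\<close>

lemma osgood:
  fixes f :: "complex \<times> complex \<Rightarrow> complex"
  assumes r: "r > 0"
    and bd: "\<And>x y. x \<in> ball a r \<Longrightarrow> y \<in> ball b r \<Longrightarrow> norm (f (x, y)) \<le> B"
    and h1: "\<And>y. y \<in> ball b r \<Longrightarrow> (\<lambda>x. f (x, y)) holomorphic_on ball a r"
    and h2: "\<And>x. x \<in> ball a r \<Longrightarrow> (\<lambda>y. f (x, y)) holomorphic_on ball b r"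
  shows "\<exists>A C. (f has_derivative (\<lambda>(u, v). A * u + C * v)) (at (a, b))"
proof -
  define E where "E = (\<lambda>(x, y). f (x, y) - f (x, b) - f (a, y) + f (a, b))"
  define L where "L = 4 * B / r"
  define K where "K = 8 * L / r"
  have "norm (f (a, b)) \<le> B" using bd r by auto
  then have B: "B \<ge> 0" using norm_ge_zero order_trans by blast
  then have L: "L \<ge> 0" "K \<ge> 0" using r by (auto simp: L_def K_def)
  have E: "norm (E (x, y)) \<le> K * norm (x - a) * norm (y - b)"
    if x: "x \<in> ball a (r/2)" and y: "y \<in> ball b (r/4)" for x y
  proof -
    define g where "g = (\<lambda>y. f (x, y) - f (a, y))"
    \<comment> \<open>The bound for the increment in \<open>x\<close> holds for all \<open>y\<close>
      of the ball, so it bounds a holomorphic function of \<open>y\<close>, and the Lipschitz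
      estimate applies a second time.\<close>
    have gb: "norm (g y) \<le> L * norm (x - a)" if "y \<in> ball b r" for y
      unfolding g_def L_def
      by (rule holomorphic_bounded_lipschitz[OF h1]) (use that x r bd in auto)
    have xr: "x \<in> ball a r" using x r by auto
    have "norm (g y - g b) \<le> 4 * (L * norm (x - a)) / (r/2) * norm (y - b)"
    proof (rule holomorphic_bounded_lipschitz[of g b "r/2"])
      show "g holomorphic_on ball b (r/2)"
        unfolding g_def using x r
        by (intro holomorphic_intros holomorphic_on_subset[OF h2] xr) auto
      show "norm (g y) \<le> L * norm (x - a)" if "y \<in> ball b (r/2)" for y
        using gb that r by auto
    qed (use y r in auto)
    also have "g y - g b = E (x, y)" by (simp add: g_def E_def)
    finally show ?thesis by (simp add: K_def field_simps)
  qed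
  have dE: "(E has_derivative (\<lambda>_. 0)) (at (a, b))"
  proof (rule has_derivativeI_sandwich[where H = "\<lambda>p. K * norm (p - (a, b))"])
    show "(0::real) < r/4" using r by auto
    show "((\<lambda>p. K * norm (p - (a, b))) \<longlongrightarrow> 0) (at (a, b))"
      by (rule tendsto_eq_rhs, (rule tendsto_intros)+) simp
    fix p :: "complex \<times> complex"
    assume p: "p \<noteq> (a, b)" "dist p (a, b) < r/4"
    obtain x y where xy: "p = (x, y)" by force
    have n: "norm (x - a) \<le> norm (p - (a, b))" "norm (y - b) \<le> norm (p - (a, b))"
      using norm_fst_le[of "x - a" "y - b"] norm_snd_le[of "y - b" "x - a"] by (auto simp: xy)
    have "norm (E p) \<le> K * norm (x - a) * norm (y - b)"
      unfolding xy using n p r by (intro E) (auto simp: dist_norm norm_minus_commute)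
    also have "\<dots> \<le> K * norm (p - (a, b)) * norm (p - (a, b))"
      using n L by (intro mult_mono) auto
    finally show "norm (E p - E (a, b) - 0) / norm (p - (a, b)) \<le> K * norm (p - (a, b))"
      using p by (simp add: E_def divide_simps)
  qed auto
  define A C where "A = deriv (\<lambda>x. f (x, b)) a" and "C = deriv (\<lambda>y. f (a, y)) b"
  have "((\<lambda>x. f (x, b)) has_field_derivative A) (at a)" "((\<lambda>y. f (a, y)) has_field_derivative C) (at b)"
    unfolding A_def C_def using r by (auto intro!: holomorphic_derivI[OF h1] holomorphic_derivI[OF h2])
  then have d: "((\<lambda>x. f (x, b)) has_derivative (*) A) (at a)"
    "((\<lambda>y. f (a, y)) has_derivative (*) C) (at b)"
    by (auto simp: has_field_derivative_def)
  have d1: "((\<lambda>p. f (fst p, b)) has_derivative (\<lambda>p. A * fst p)) (at (a, b))"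
    using has_derivative_compose[OF has_derivative_fst[OF has_derivative_ident], of "\<lambda>x. f (x, b)" "(*) A" "(a, b)" UNIV] d by simp
  have d2: "((\<lambda>p. f (a, snd p)) has_derivative (\<lambda>p. C * snd p)) (at (a, b))"
    using has_derivative_compose[OF has_derivative_snd[OF has_derivative_ident], of "\<lambda>y. f (a, y)" "(*) C" "(a, b)" UNIV] d by simp
  have "((\<lambda>p. E p + f (fst p, b) + f (a, snd p) - f (a, b)) has_derivative (\<lambda>p. 0 + A * fst p + C * snd p - 0)) (at (a, b))"
    by (intro has_derivative_add has_derivative_diff dE has_derivative_const d1 d2)
  also have "(\<lambda>p. E p + f (fst p, b) + f (a, snd p) - f (a, b)) = f"
    by (auto simp: E_def)
  also have "(\<lambda>p. 0 + A * fst p + C * snd p - 0) = (\<lambda>(u, v). A * u + C * v)"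
    by auto
  finally show ?thesis by blast
qed

subsection \<open>Residues in a vertical strip\<close>

lemma tendsto_LINT_symmetric_intervals:
  fixes f :: "real \<Rightarrow> complex"
  assumes f: "integrable lborel f" and T: "filterlim T at_top sequentially"
  shows "(\<lambda>j. integral {- T j..T j} f) \<longlonglongrightarrow> (LINT t|lborel. f t)"
proof -
  have eq: "integral {- T j..T j} f = (LINT t|lborel. indicator {- T j..T j} t *\<^sub>R f t)" for j
    using set_borel_integral_eq_integral(2)[of "{- T j..T j}" f]
      integrable_mult_indicator[OF _ f, of "{- T j..T j}"]
    by (simp add: set_integrable_def set_lebesgue_integral_def)
  have "(\<lambda>j. LINT t|lborel. indicator {- T j..T j} t *\<^sub>R f t) \<longlonglongrightarrow> (LINT t|lborel. f t)"
  proof (rule integral_dominated_convergence[where w = "\<lambda>t. norm (f t)"])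
    show "AE t in lborel. (\<lambda>j. indicator {- T j..T j} t *\<^sub>R f t) \<longlonglongrightarrow> f t"
    proof (rule AE_I2, rule tendsto_eventually)
      fix t :: real
      have "\<forall>\<^sub>F j in sequentially. \<bar>t\<bar> \<le> T j"
        using T by (auto simp: filterlim_at_top)
      then show "\<forall>\<^sub>F j in sequentially. indicator {- T j..T j} t *\<^sub>R f t = f t"
        by eventually_elim (auto simp: indicator_def)
    qed
  qed (use f in \<open>auto simp: indicator_def\<close>)
  then show ?thesis by (simp add: eq)
qed

text \<open>The vertical sides give the two integrals, with opposite orientation and
  \<open>dz = i dt\<close>; what remains are the two horizontal sides, each of length
  \<open>b - a\<close>.\<close>

lemma rectpath_integral_bound:
  fixes f :: "complex \<Rightarrow> complex"
  assumes cont: "continuous_on (path_image (rectpath (Complex a (-T)) (Complex b T))) f"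
    and ab: "a < b" and T: "T > 0" and E0: "E \<ge> 0"
    and E: "\<And>x. x \<in> {a..b} \<Longrightarrow> norm (f (Complex x T)) \<le> E"
           "\<And>x. x \<in> {a..b} \<Longrightarrow> norm (f (Complex x (-T))) \<le> E"
  shows "norm (contour_integral (rectpath (Complex a (-T)) (Complex b T)) f -
      \<i> * (integral {-T..T} (\<lambda>t. f (Complex b t)) - integral {-T..T} (\<lambda>t. f (Complex a t))))
    \<le> 2 * E * (b - a)"
proof -
  define a1 a2 a3 a4 where "a1 = Complex a (-T)" and "a2 = Complex b (-T)"
    and "a3 = Complex b T" and "a4 = Complex a T"
  note a = a1_def a2_def a3_def a4_def
  have rp: "rectpath a1 a3 = linepath a1 a2 +++ linepath a2 a3 +++ linepath a3 a4 +++ linepath a4 a1"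
    by (simp add: rectpath_def Let_def a)
  have pi: "path_image (rectpath a1 a3) = closed_segment a1 a2 \<union> closed_segment a2 a3 \<union>
      closed_segment a3 a4 \<union> closed_segment a4 a1"
    by (simp add: rp path_image_join Un_assoc)
  have c: "continuous_on (closed_segment a1 a2) f" "continuous_on (closed_segment a2 a3) f"
     "continuous_on (closed_segment a3 a4) f" "continuous_on (closed_segment a4 a1) f"
    using cont unfolding a1_def[symmetric] a3_def[symmetric] pi by (auto elim: continuous_on_subset)
  note ci = c[THEN contour_integrable_continuous_linepath]
  have "contour_integral (rectpath a1 a3) f = contour_integral (linepath a1 a2) f
     + (contour_integral (linepath a2 a3) f + (contour_integral (linepath a3 a4) f + contour_integral (linepath a4 a1) f))"
    unfolding rp by (subst contour_integral_join; simp add: ci valid_path_join contour_integrable_join)+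
  also have "contour_integral (linepath a2 a3) f = \<i> * integral {-T..T} (\<lambda>t. f (Complex b t))"
    by (rule contour_integral_linepath_same_Re) (use T in \<open>auto simp: a\<close>)
  also have "contour_integral (linepath a4 a1) f = - contour_integral (linepath a1 a4) f"
    using contour_integral_reversepath[of "linepath a1 a4" f] by simp
  also have "contour_integral (linepath a1 a4) f = \<i> * integral {-T..T} (\<lambda>t. f (Complex a t))"
    by (rule contour_integral_linepath_same_Re) (use T in \<open>auto simp: a\<close>)
  finally have eq: "contour_integral (rectpath a1 a3) f -
      \<i> * (integral {-T..T} (\<lambda>t. f (Complex b t)) - integral {-T..T} (\<lambda>t. f (Complex a t)))
     = contour_integral (linepath a1 a2) f + contour_integral (linepath a3 a4) f"
    by (simp add: algebra_simps)
  have "norm (contour_integral (linepath a1 a2) f) \<le> E * norm (a2 - a1)"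
  proof (rule contour_integral_bound_linepath[OF ci(1) E0])
    fix x assume "x \<in> closed_segment a1 a2"
    then have "Re x \<in> {a..b}" "x = Complex (Re x) (-T)"
      using ab by (auto simp: a closed_segment_same_Im closed_segment_eq_real_ivl complex_eq_iff)
    then show "norm (f x) \<le> E" using E(2) by metis
  qed
  moreover have "norm (contour_integral (linepath a3 a4) f) \<le> E * norm (a4 - a3)"
  proof (rule contour_integral_bound_linepath[OF ci(3) E0])
    fix x assume "x \<in> closed_segment a3 a4"
    then have "Re x \<in> {a..b}" "x = Complex (Re x) T"
      using ab by (auto simp: a closed_segment_same_Im closed_segment_eq_real_ivl complex_eq_iff)
    then show "norm (f x) \<le> E" using E(1) by metis
  qed
  moreover have "norm (a2 - a1) = b - a" "norm (a4 - a3) = b - a"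
    using ab by (auto simp: a cmod_def)
  ultimately show ?thesis
    unfolding a1_def[symmetric] a3_def[symmetric] eq
    by (intro order_trans[OF norm_triangle_ineq]) simp
qed

text \<open>The residue theorem on rectangles of half-height \<open>T j\<close>, whose horizontal
  sides contribute at most \<open>2 * E j * (b - a)\<close>. The set \<open>S\<close> may be
  infinite, hence a limit of truncated residue sums along heights that avoid \<open>S\<close>. The
  factor is \<open>2 * pi\<close> and not \<open>2 * pi * \<i>\<close>, as the line integrals are
  taken in \<open>t\<close>. The margin \<open>\<delta>\<close> provides an open neighbourhood of
  the closed strip.\<close>

lemma strip_shift:
  fixes f :: "complex \<Rightarrow> complex" and a b \<delta> :: real
  assumes ab: "a < b" and \<delta>: "\<delta> > 0"
    and S: "\<And>s. s \<in> S \<Longrightarrow> a < Re s \<and> Re s < b"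
    and fin: "\<And>T. finite {s \<in> S. \<bar>Im s\<bar> \<le> T}"
    and holo: "f holomorphic_on {z. a - \<delta> < Re z \<and> Re z < b + \<delta>} - S"
    and T: "filterlim T at_top sequentially" and Tpos: "\<And>j. T j > 0"
    and avoid: "\<And>j s. s \<in> S \<Longrightarrow> \<bar>Im s\<bar> \<noteq> T j"
    and E0: "E \<longlonglongrightarrow> 0"
    and E: "\<And>j x. x \<in> {a..b} \<Longrightarrow> norm (f (Complex x (T j))) \<le> E j"
           "\<And>j x. x \<in> {a..b} \<Longrightarrow> norm (f (Complex x (- T j))) \<le> E j"
    and inta: "integrable lborel (\<lambda>t. f (Complex a t))"
    and intb: "integrable lborel (\<lambda>t. f (Complex b t))"
  shows "(\<lambda>j. of_real (2 * pi) * (\<Sum>s | s \<in> S \<and> \<bar>Im s\<bar> < T j. residue f s)) \<longlonglongrightarrow>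
     (LINT t|lborel. f (Complex b t)) - (LINT t|lborel. f (Complex a t))"
proof -
  define R where "R j = (\<Sum>s | s \<in> S \<and> \<bar>Im s\<bar> < T j. residue f s)" for j
  define A where "A j = integral {- T j..T j} (\<lambda>t. f (Complex b t)) - integral {- T j..T j} (\<lambda>t. f (Complex a t))" for j
  have bound: "norm (of_real (2 * pi) * R j - A j) \<le> 2 * E j * (b - a)" for j
  proof -
    define a1 a3 where "a1 = Complex a (- T j)" and "a3 = Complex b (T j)"
    define U where "U = {z. a - \<delta> < Re z \<and> Re z < b + \<delta>} \<inter> {z. - T j - 1 < Im z \<and> Im z < T j + 1}"
    \<comment> \<open>All singularities in the enlarged open box have to be removed, also those
      above and below the rectangle; these get winding number 0.\<close>
    define pts where "pts = {s \<in> S. \<bar>Im s\<bar> \<le> T j + 1}"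
    have U1: "U = box (Complex (a - \<delta>) (- T j - 1)) (Complex (b + \<delta>) (T j + 1))"
      by (auto simp: U_def in_box_complex_iff)
    have box: "box a1 a3 = {z. a < Re z \<and> Re z < b \<and> \<bar>Im z\<bar> < T j}"
      by (auto simp: in_box_complex_iff a1_def a3_def)
    have cbox: "cbox a1 a3 = {z. a \<le> Re z \<and> Re z \<le> b \<and> \<bar>Im z\<bar> \<le> T j}"
      by (auto simp: in_cbox_complex_iff a1_def a3_def)
    have le: "Re a1 \<le> Re a3" "Im a1 \<le> Im a3" using ab Tpos[of j] by (auto simp: a1_def a3_def)
    have pth: "path_image (rectpath a1 a3) \<subseteq> U - pts"
    proof -
      have "path_image (rectpath a1 a3) = cbox a1 a3 - box a1 a3"
        by (rule path_image_rectpath_cbox_minus_box) (use le in auto)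
      also have "\<dots> \<subseteq> U - pts"
        unfolding box cbox U_def pts_def using \<delta> S avoid[of _ j] by force
      finally show ?thesis .
    qed
    have holoU: "f holomorphic_on U - pts"
      by (rule holomorphic_on_subset[OF holo]) (auto simp: U_def pts_def)
    have wn: "winding_number (rectpath a1 a3) p = (if \<bar>Im p\<bar> < T j then 1 else 0)" if "p \<in> pts" for p
      using that S[of p] avoid[of p j] winding_number_rectpath[of p a1 a3] winding_number_rectpath_outside[OF le, of p]
      unfolding box cbox pts_def by auto
    have "contour_integral (rectpath a1 a3) f = 2 * pi * \<i> * (\<Sum>p\<in>pts. winding_number (rectpath a1 a3) p * residue f p)"
    proof (rule Residue_theorem[OF _ _ _ holoU _ _ pth])
      show "open U" "connected U" unfolding U1 by (auto simp: open_box convex_box convex_connected)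
      show "finite pts" unfolding pts_def by (rule fin)
      show "\<forall>z. z \<notin> U \<longrightarrow> winding_number (rectpath a1 a3) z = 0"
        by (intro allI impI winding_number_rectpath_outside[OF le]) (use \<delta> in \<open>auto simp: cbox U_def abs_le_iff\<close>)
    qed auto
    also have "(\<Sum>p\<in>pts. winding_number (rectpath a1 a3) p * residue f p) = R j"
      unfolding R_def by (rule sum.mono_neutral_cong_right) (auto simp: wn pts_def fin)
    finally have ci: "contour_integral (rectpath a1 a3) f = 2 * pi * \<i> * R j" .
    have "norm (contour_integral (rectpath a1 a3) f - \<i> * A j) \<le> 2 * E j * (b - a)"
      unfolding a1_def a3_def A_def
    proof (rule rectpath_integral_bound[OF _ ab Tpos])
      show "continuous_on (path_image (rectpath (Complex a (- T j)) (Complex b (T j)))) f"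
        using holomorphic_on_imp_continuous_on[OF holomorphic_on_subset[OF holoU pth]] by (simp add: a1_def a3_def)
      show "E j \<ge> 0" using E(1)[of a j] ab norm_ge_zero order_trans by (metis atLeastAtMost_iff less_eq_real_def)
    qed (use E in auto)
    also have "contour_integral (rectpath a1 a3) f - \<i> * A j = \<i> * (of_real (2 * pi) * R j - A j)"
      unfolding ci by (simp add: algebra_simps)
    finally show ?thesis by (simp add: norm_mult)
  qed
  have "(\<lambda>j. of_real (2 * pi) * R j - A j) \<longlonglongrightarrow> 0"
  proof (rule Lim_null_comparison)
    show "\<forall>\<^sub>F j in sequentially. norm (of_real (2 * pi) * R j - A j) \<le> 2 * E j * (b - a)"
      using bound by simp
    show "(\<lambda>j. 2 * E j * (b - a)) \<longlonglongrightarrow> 0"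
      using tendsto_mult[OF tendsto_mult[OF tendsto_const E0, of 2] tendsto_const, of "b - a"] by simp
  qed
  moreover have "A \<longlonglongrightarrow> (LINT t|lborel. f (Complex b t)) - (LINT t|lborel. f (Complex a t))"
    unfolding A_def using tendsto_LINT_symmetric_intervals[OF inta T] tendsto_LINT_symmetric_intervals[OF intb T]
    by (rule tendsto_diff[rotated])
  ultimately have "(\<lambda>j. (of_real (2 * pi) * R j - A j) + A j) \<longlonglongrightarrow>
      0 + ((LINT t|lborel. f (Complex b t)) - (LINT t|lborel. f (Complex a t)))"
    by (rule tendsto_add)
  then show ?thesis by (simp add: R_def)
qed

subsection \<open>Growth of the gamma function in vertical strips\<close>

text \<open>By the product for the gamma function, the ratio is the limit of the products of
  \<open>(x + k) / sqrt ((x + k)\<^sup>2 + y\<^sup>2)\<close>, and every factor increases with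
  \<open>x\<close>.\<close>

lemma Gamma_norm_ratio_mono:
  assumes x: "0 < x" "x \<le> x'"
  shows "norm (Gamma (Complex x y)) / Gamma x \<le> norm (Gamma (Complex x' y)) / Gamma x'"
proof -
  define q where "q x n = (\<Prod>k\<le>n. (x + real k) / sqrt ((x + real k)\<^sup>2 + y\<^sup>2))" for x n
  have conv: "q x \<longlonglongrightarrow> norm (Gamma (Complex x y)) / Gamma x" if x: "x > 0" for x
  proof -
    have eq: "norm (Gamma_series (Complex x y) n) / Gamma_series x n = q x n" for n
    proof -
      have "norm (exp (Complex x y * of_real (ln (real n)))) = exp (x * ln (real n))"
        by (simp add: norm_exp_eq_Re)
      moreover have "norm (pochhammer (Complex x y) (Suc n)) = (\<Prod>k\<le>n. sqrt ((x + real k)\<^sup>2 + y\<^sup>2))"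
      proof -
        have "norm (pochhammer (Complex x y) (Suc n)) = (\<Prod>k\<le>n. norm (Complex x y + of_nat k))"
          by (simp add: pochhammer_Suc_prod prod_norm [symmetric] atLeast0AtMost)
        then show ?thesis by (simp add: cmod_def)
      qed
      moreover have "pochhammer x (Suc n) = (\<Prod>k\<le>n. x + real k)"
        by (simp add: pochhammer_Suc_prod atLeast0AtMost)
      moreover have "(\<Prod>k\<le>n. x + real k) > 0"
        using x by (intro prod_pos) auto
      ultimately show ?thesis
        unfolding Gamma_series_def q_def
        by (simp add: norm_mult norm_divide prod_dividef)
    qed
    have "(\<lambda>n. norm (Gamma_series (Complex x y) n) / Gamma_series x n) \<longlonglongrightarrow> norm (Gamma (Complex x y)) / Gamma x"
      by (intro tendsto_intros Gamma_series_LIMSEQ) (use Gamma_real_pos[OF x] in linarith)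
    then show ?thesis by (simp add: eq)
  qed
  have "q x n \<le> q x' n" for n
    unfolding q_def
  proof (intro prod_mono conjI)
    fix k
    have pos: "x + real k > 0" "x' + real k > 0" using x by auto
    have le: "(x + real k) * sqrt ((x' + real k)\<^sup>2 + y\<^sup>2) \<le> (x' + real k) * sqrt ((x + real k)\<^sup>2 + y\<^sup>2)"
    proof (rule power2_le_imp_le)
      have sq: "(a * sqrt (b\<^sup>2 + y\<^sup>2))\<^sup>2 = a\<^sup>2 * b\<^sup>2 + a\<^sup>2 * y\<^sup>2" for a b :: real
        by (simp add: power_mult_distrib distrib_left)
      have "(x + real k)\<^sup>2 * y\<^sup>2 \<le> (x' + real k)\<^sup>2 * y\<^sup>2"
        using x pos by (intro mult_right_mono power_mono) auto
      then show "((x + real k) * sqrt ((x' + real k)\<^sup>2 + y\<^sup>2))\<^sup>2 \<le> ((x' + real k) * sqrt ((x + real k)\<^sup>2 + y\<^sup>2))\<^sup>2"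
        unfolding sq by (simp add: mult.commute)
    qed (use pos in auto)
    have "sqrt ((x + real k)\<^sup>2 + y\<^sup>2) > 0" "sqrt ((x' + real k)\<^sup>2 + y\<^sup>2) > 0"
      using pos by (auto intro!: add_pos_nonneg)
    then show "(x + real k) / sqrt ((x + real k)\<^sup>2 + y\<^sup>2) \<le> (x' + real k) / sqrt ((x' + real k)\<^sup>2 + y\<^sup>2)"
      using le by (simp add: field_simps)
  qed (use x in auto)
  then show ?thesis
    using x by (intro LIMSEQ_le[OF conv conv]) auto
qed

text \<open>On the line of real part \<open>1/2\<close> the point \<open>1 - z\<close> is the
  conjugate of \<open>z\<close>, so the reflection formula gives the squared modulus as
  \<open>pi / norm (sin (pi * z))\<close>.\<close>

lemma norm_Gamma_half_le: "norm (Gamma (Complex (1/2) y)) \<le> sqrt (2 * pi) * exp (- (pi / 2) * \<bar>y\<bar>)"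
proof -
  define z where "z = Complex (1/2) y"
  have "1 - z = cnj z" by (simp add: z_def complex_eq_iff)
  then have "Gamma z * cnj (Gamma z) = of_real pi / sin (of_real pi * z)"
    using Gamma_reflection_complex[of z] by (simp add: cnj_Gamma)
  then have "norm (Gamma z * cnj (Gamma z)) = pi / norm (sin (of_real pi * z))"
    by (simp add: norm_divide)
  then have g: "norm (Gamma z) ^ 2 = pi / norm (sin (of_real pi * z))"
    by (simp add: norm_mult power2_eq_square)
  have e: "exp (pi * \<bar>y\<bar>) / 2 \<le> norm (sin (of_real pi * z))"
  proof (rule power2_le_imp_le)
    have 1: "norm (sin (of_real pi * z)) ^ 2 = (exp (2 * (pi * y)) + inverse (exp (2 * (pi * y))) + 2) / 4"
      by (subst norm_sin_squared) (simp add: z_def)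
    have 2: "exp (2 * (pi * \<bar>y\<bar>)) \<le> exp (2 * (pi * y)) + inverse (exp (2 * (pi * y)))"
      by (cases "y \<ge> 0") (auto simp: exp_minus[symmetric])
 have 3: "(exp (pi * \<bar>y\<bar>) / 2)\<^sup>2 = exp (2 * (pi * \<bar>y\<bar>)) / 4"
      by (simp add: power_divide exp_double)
    show "(exp (pi * \<bar>y\<bar>) / 2)\<^sup>2 \<le> (norm (sin (of_real pi * z)))\<^sup>2"
      unfolding 1 3 using 2 by simp
  qed auto
  have "norm (Gamma z) ^ 2 \<le> pi / (exp (pi * \<bar>y\<bar>) / 2)"
    unfolding g using e by (intro divide_left_mono mult_pos_pos) (auto intro: less_le_trans[OF _ e])
  also have "\<dots> = (sqrt (2 * pi) * exp (- (pi / 2) * \<bar>y\<bar>))\<^sup>2"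
    by (simp add: power_mult_distrib exp_double[symmetric] exp_minus field_simps)
  finally show ?thesis
    unfolding z_def by (rule power2_le_imp_le) auto
qed

text \<open>The inequality \<open>u \<le> exp u\<close> at \<open>u = \<delta> * v / n\<close>,
  raised to the power \<open>n\<close>. It lets an arbitrarily small exponential rate absorb a
  polynomial.\<close>

lemma power_le_exp:
  fixes v \<delta> :: real
  assumes "v \<ge> 0" "\<delta> > 0"
  shows "v ^ n \<le> (real n / \<delta>) ^ n * exp (\<delta> * v)"
proof (cases "n = 0")
  case False
  have "\<delta> * v / real n \<le> exp (\<delta> * v / real n)"
    using exp_ge_add_one_self[of "\<delta> * v / real n"] by linarith
  then have "(\<delta> * v / real n) ^ n \<le> exp (\<delta> * v / real n) ^ n"
    using assms by (intro power_mono) auto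
  also have "exp (\<delta> * v / real n) ^ n = exp (\<delta> * v)"
    using False by (simp add: exp_of_nat_mult[symmetric])
  finally have "(real n / \<delta>) ^ n * (\<delta> * v / real n) ^ n \<le> (real n / \<delta>) ^ n * exp (\<delta> * v)"
    using assms by (intro mult_left_mono) auto
  also have "(real n / \<delta>) ^ n * (\<delta> * v / real n) ^ n = v ^ n"
    using assms False by (simp add: power_mult_distrib[symmetric])
  finally show ?thesis .
qed (use assms in auto)

lemma norm_pochhammer_le:
  fixes z :: complex
  shows "norm (pochhammer z n) \<le> (norm z + real n) ^ n"
proof -
  have "norm (pochhammer z n) = (\<Prod>k<n. norm (z + of_nat k))"
    by (simp add: pochhammer_prod prod_norm[symmetric] atLeast0LessThan)
  also have "\<dots> \<le> (\<Prod>k<n. norm z + real n)"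
  proof (intro prod_mono conjI)
    fix k assume "k \<in> {..<n}"
    then show "norm (z + of_nat k) \<le> norm z + real n"
      using norm_triangle_ineq[of z "of_nat k"] by simp
  qed auto
  finally show ?thesis by simp
qed

lemma Im_nonzero_not_nonpos_Int: "Im z \<noteq> 0 \<Longrightarrow> z \<notin> \<int>\<^sub>\<le>\<^sub>0"
  by (auto elim!: nonpos_Ints_cases)

text \<open>
  \<open>3/2\<close> is an arbitrary choice below \<open>pi / 2\<close>. Two gamma factors then decay like \<open>exp (- 3 \<bar>t\<bar>)\<close>,
  which beats the growth \<open>exp (3/2 \<bar>t\<bar>)\<close> of zeta.
\<close>

lemma norm_Gamma_strip_le:
  "\<exists>C>0. \<forall>z. \<bar>Re z\<bar> \<le> A \<and> \<bar>Im z\<bar> \<ge> 1 \<longrightarrow> norm (Gamma z) \<le> C * exp (- (3/2) * \<bar>Im z\<bar>)"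
proof -
  obtain a :: nat where a: "A \<le> real a" using real_arch_simple by blast
  \<comment> \<open>Adding \<open>m\<close> moves the real part into \<open>[1, n]\<close>. There
    the monotone ratio compares with the abscissa \<open>1/2 + n\<close>, which is an integer shift
    of the line of real part \<open>1/2\<close> where the decay is known.\<close>
  define m where "m = Suc a"
  define n where "n = 2 * m"
  obtain G where G: "\<And>x. x \<in> {1..real n} \<Longrightarrow> Gamma x \<le> G"
  proof -
    have "compact (Gamma ` {1..real n})"
      by (intro compact_continuous_image continuous_on_Gamma) (auto elim!: nonpos_Ints_cases)
    then obtain G where "\<forall>x\<in>Gamma ` {1..real n}. norm x \<le> G"
      using compact_imp_bounded bounded_iff by metis
    then show ?thesis by (intro that[of G]) (auto simp: abs_le_iff)
  qed
  \<comment> \<open>The gap between the rate \<open>pi / 2\<close> on the line of real part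
    \<open>1/2\<close> and the rate aimed at; it pays for the polynomial factor of degree
    \<open>n\<close> coming from the shift.\<close>
  define \<delta> where "\<delta> = pi / 2 - 3 / 2"
  have \<delta>: "\<delta> > 0" using pi_gt3 by (simp add: \<delta>_def)
  define h where "h = Gamma (1/2 + real n)"
  have h: "h > 0" by (simp add: h_def)
  define c where "c = 1 + real n"
  define K where "K = (real n / \<delta>) ^ n * exp (\<delta> * c)"
  define C where "C = \<bar>G\<bar> / h * K * sqrt (2 * pi) + 1"
  have K: "K \<ge> 0" using \<delta> by (simp add: K_def)
  have main: "norm (Gamma z) \<le> C * exp (- (3/2) * \<bar>Im z\<bar>)" if z: "\<bar>Re z\<bar> \<le> A" "\<bar>Im z\<bar> \<ge> 1" for z
  proof -
    define y where "y = Im z"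
    define x where "x = Re z + real m"
    have x: "1 \<le> x" "x \<le> real n" using z a by (auto simp: x_def m_def n_def)
    have nz: "z \<notin> \<int>\<^sub>\<le>\<^sub>0" using z by (intro Im_nonzero_not_nonpos_Int) auto
    have zm: "z + of_nat m = Complex x y" by (simp add: complex_eq_iff x_def y_def)
    have "pochhammer z m \<noteq> 0" using nz pochhammer_eq_0_imp_nonpos_Int by blast
    \<comment> \<open>Every factor has imaginary part of modulus at least 1, so the shift back to
      the original strip costs nothing.\<close>
    have "1 \<le> norm (pochhammer z m)"
    proof -
      have "(\<Prod>k<m. (1::real)) \<le> (\<Prod>k<m. norm (z + of_nat k))"
      proof (intro prod_mono conjI)
        fix k show "1 \<le> norm (z + of_nat k)"
          using abs_Im_le_cmod[of "z + of_nat k"] z by simp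
      qed auto
      then show ?thesis by (simp add: pochhammer_prod prod_norm[symmetric] atLeast0LessThan)
    qed
    then have "norm (Gamma z) \<le> norm (pochhammer z m) * norm (Gamma z)"
      by (simp add: mult_le_cancel_right1)
    also have "\<dots> = norm (Gamma (Complex x y))"
      using pochhammer_Gamma[OF nz, of m] nz by (simp add: zm norm_mult[symmetric] Gamma_eq_zero_iff)
    also have "\<dots> = Gamma x * (norm (Gamma (Complex x y)) / Gamma x)"
      using order.strict_implies_not_eq[OF Gamma_real_pos[of x]] x by auto
    also have "\<dots> \<le> \<bar>G\<bar> * (norm (Gamma (Complex (1/2 + real n) y)) / h)"
    proof (intro mult_mono)
      show "Gamma x \<le> \<bar>G\<bar>" using G[of x] x by auto
      show "norm (Gamma (Complex x y)) / Gamma x \<le> norm (Gamma (Complex (1/2 + real n) y)) / h"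
        unfolding h_def using x by (intro Gamma_norm_ratio_mono) auto
    qed (use x in auto)
    also have "norm (Gamma (Complex (1/2 + real n) y)) \<le> K * exp (\<delta> * \<bar>y\<bar>) * (sqrt (2 * pi) * exp (- (pi / 2) * \<bar>y\<bar>))"
    proof -
      define w where "w = Complex (1/2) y"
      have w: "w \<notin> \<int>\<^sub>\<le>\<^sub>0" using z by (intro Im_nonzero_not_nonpos_Int) (auto simp: w_def y_def)
      have wn: "w + of_nat n = Complex (1/2 + real n) y" by (simp add: w_def complex_eq_iff)
      have "norm (Gamma (Complex (1/2 + real n) y)) = norm (pochhammer w n) * norm (Gamma w)"
        using pochhammer_Gamma[OF w, of n] w by (simp add: wn norm_mult[symmetric] Gamma_eq_zero_iff)
      also have "\<dots> \<le> (K * exp (\<delta> * \<bar>y\<bar>)) * (sqrt (2 * pi) * exp (- (pi / 2) * \<bar>y\<bar>))"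
      proof (intro mult_mono)
        have "norm (pochhammer w n) \<le> (norm w + real n) ^ n" by (rule norm_pochhammer_le)
        also have "\<dots> \<le> (\<bar>y\<bar> + c) ^ n"
          using cmod_le[of w] by (intro power_mono) (auto simp: w_def c_def)
        also have "\<dots> \<le> (real n / \<delta>) ^ n * exp (\<delta> * (\<bar>y\<bar> + c))"
          by (rule power_le_exp) (use \<delta> in \<open>auto simp: c_def\<close>)
        also have "\<dots> = K * exp (\<delta> * \<bar>y\<bar>)"
          by (simp add: K_def exp_add[symmetric] algebra_simps)
        finally show "norm (pochhammer w n) \<le> K * exp (\<delta> * \<bar>y\<bar>)" .
        show "norm (Gamma w) \<le> sqrt (2 * pi) * exp (- (pi / 2) * \<bar>y\<bar>)"
          unfolding w_def by (rule norm_Gamma_half_le)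
      qed (use K in auto)
      finally show ?thesis .
    qed
    also have "K * exp (\<delta> * \<bar>y\<bar>) * (sqrt (2 * pi) * exp (- (pi / 2) * \<bar>y\<bar>))
        = K * sqrt (2 * pi) * exp (- (3/2) * \<bar>y\<bar>)"
      by (simp add: \<delta>_def exp_add[symmetric] algebra_simps flip: exp_add)
    finally have "norm (Gamma z) \<le> \<bar>G\<bar> * (K * sqrt (2 * pi) * exp (- (3/2) * \<bar>y\<bar>) / h)"
      using h by (simp add: divide_right_mono mult_left_mono)
    also have "\<dots> = (\<bar>G\<bar> / h * K * sqrt (2 * pi)) * exp (- (3/2) * \<bar>y\<bar>)" by simp
    also have "\<dots> \<le> C * exp (- (3/2) * \<bar>y\<bar>)"
      unfolding C_def by (intro mult_right_mono) auto
    finally show ?thesis by (simp add: y_def)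
  qed
  have "C > 0" using h K unfolding C_def by (intro add_nonneg_pos mult_nonneg_nonneg) auto
  then show ?thesis using main by blast
qed

lemma norm_sin_le_exp_Im: "norm (sin z) \<le> exp \<bar>Im z\<bar>" for z :: complex
proof -
  have "norm (sin z) \<le> (norm (exp (\<i> * z)) + norm (exp (- (\<i> * z)))) / 2"
    unfolding sin_exp_eq using norm_triangle_ineq4[of "exp (\<i> * z)" "exp (- (\<i> * z))"]
    by (simp add: norm_divide norm_mult)
  also have "\<dots> \<le> exp \<bar>Im z\<bar>"
  proof -
    have "exp (- Im z) + exp (Im z) \<le> exp \<bar>Im z\<bar> + exp \<bar>Im z\<bar>" by (intro add_mono) auto
    then show ?thesis by (simp add: norm_exp_eq_Re)
  qed
  finally show ?thesis .
qed

text \<open>By reflection \<open>rGamma z\<close> is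
  \<open>Gamma (1 - z) * sin (pi * z) / pi\<close>, of rate \<open>pi - 3/2\<close>, and
  \<open>5/2\<close> is \<open>4 - 3/2\<close> with the bound 4 for pi. The part near the real axis
  is covered by compactness, as \<open>rGamma\<close> is entire.\<close>

lemma norm_rGamma_strip_le:
  "\<exists>C>0. \<forall>z. \<bar>Re z\<bar> \<le> A \<longrightarrow> norm (rGamma z) \<le> C * exp ((5/2) * \<bar>Im z\<bar>)"
proof -
  obtain C where C: "C > 0" "\<And>z. \<bar>Re z\<bar> \<le> \<bar>A\<bar> + 1 \<and> \<bar>Im z\<bar> \<ge> 1 \<Longrightarrow> norm (Gamma z) \<le> C * exp (- (3/2) * \<bar>Im z\<bar>)"
    using norm_Gamma_strip_le[of "\<bar>A\<bar> + 1"] by blast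
  have "compact (rGamma ` cbox (Complex (-A) (-1)) (Complex A 1))"
    by (intro compact_continuous_image continuous_intros) auto
  then obtain D where D: "\<And>z. z \<in> cbox (Complex (-A) (-1)) (Complex A 1) \<Longrightarrow> norm (rGamma z) \<le> D"
    using compact_imp_bounded bounded_iff by (metis image_eqI)
  have big: "norm (rGamma z) \<le> C * exp ((5/2) * \<bar>Im z\<bar>)" if z: "\<bar>Re z\<bar> \<le> A" "\<bar>Im z\<bar> \<ge> 1" for z
  proof -
    have nz: "1 - z \<notin> \<int>\<^sub>\<le>\<^sub>0" using z by (intro Im_nonzero_not_nonpos_Int) auto
    have "rGamma z = Gamma (1 - z) * sin (of_real pi * z) / of_real pi"
      using rGamma_reflection_complex[of z] nz
      by (simp add: rGamma_inverse_Gamma[of "1 - z"] Gamma_eq_zero_iff field_simps)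
    then have "norm (rGamma z) = norm (Gamma (1 - z)) * norm (sin (of_real pi * z)) / pi"
      by (simp add: norm_mult norm_divide)
    also have "\<dots> \<le> (C * exp (- (3/2) * \<bar>Im (1 - z)\<bar>)) * exp (pi * \<bar>Im z\<bar>) / 1"
    proof (intro frac_le mult_mono)
      show "norm (Gamma (1 - z)) \<le> C * exp (- (3/2) * \<bar>Im (1 - z)\<bar>)"
        by (rule C(2)) (use z in auto)
      show "norm (sin (of_real pi * z)) \<le> exp (pi * \<bar>Im z\<bar>)"
        using norm_sin_le_exp_Im[of "of_real pi * z"] by (simp add: abs_mult)
    qed (use C pi_gt3 in auto)
    also have "\<dots> = C * exp ((pi - 3/2) * \<bar>Im z\<bar>)"
      by (simp add: exp_add[symmetric] algebra_simps flip: exp_add)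
    also have "\<dots> \<le> C * exp ((5/2) * \<bar>Im z\<bar>)"
    proof -
      have "(pi - 3/2) * \<bar>Im z\<bar> \<le> (5/2) * \<bar>Im z\<bar>"
        using pi_less_4 by (intro mult_right_mono) auto
      then show ?thesis using C by simp
    qed
    finally show ?thesis .
  qed
  have small: "norm (rGamma z) \<le> \<bar>D\<bar> * exp ((5/2) * \<bar>Im z\<bar>)" if z: "\<bar>Re z\<bar> \<le> A" "\<bar>Im z\<bar> \<le> 1" for z
  proof -
    have "norm (rGamma z) \<le> D" using z by (intro D) (auto simp: in_cbox_complex_iff)
    also have "D \<le> \<bar>D\<bar> * 1" by simp
    also have "\<dots> \<le> \<bar>D\<bar> * exp ((5/2) * \<bar>Im z\<bar>)" by (intro mult_left_mono) auto
    finally show ?thesis .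
  qed
  have "norm (rGamma z) \<le> (C + \<bar>D\<bar>) * exp ((5/2) * \<bar>Im z\<bar>)" if z: "\<bar>Re z\<bar> \<le> A" for z
  proof -
    have "0 \<le> C * exp ((5/2) * \<bar>Im z\<bar>)" "0 \<le> \<bar>D\<bar> * exp ((5/2) * \<bar>Im z\<bar>)" using C by auto
    then show ?thesis
      using big[of z] small[of z] z unfolding distrib_right by linarith
  qed
  moreover have "C + \<bar>D\<bar> > 0" using C by auto
  ultimately show ?thesis by blast
qed

subsection \<open>Zeros of an entire function in a disc\<close>

text \<open>A list and not a set, so that zeros are counted with multiplicity.\<close>

abbreviation prod_roots :: "complex list \<Rightarrow> complex \<Rightarrow> complex" where
  "prod_roots zs s \<equiv> (\<Prod>z\<leftarrow>zs. s - z)"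

lemma prod_roots_lower:
  assumes "\<And>z. z \<in> set zs \<Longrightarrow> norm (s - z) \<ge> \<delta>" "\<delta> \<ge> 0"
  shows "norm (prod_roots zs s) \<ge> \<delta> ^ length zs"
  using assms by (induction zs) (auto simp: norm_mult intro!: mult_mono)

lemma prod_roots_upper:
  assumes "\<And>z. z \<in> set zs \<Longrightarrow> norm (s - z) \<le> \<delta>" "\<delta> \<ge> 0"
  shows "norm (prod_roots zs s) \<le> \<delta> ^ length zs"
  using assms by (induction zs) (auto simp: norm_mult intro!: mult_mono)

lemma prod_roots_eq_0_iff: "prod_roots zs s = 0 \<longleftrightarrow> s \<in> set zs"
  by (induction zs) auto

lemma holomorphic_on_prod_roots [holomorphic_intros]: "(\<lambda>s. prod_roots zs s) holomorphic_on A"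
  by (induction zs) (auto intro!: holomorphic_intros)

lemma logderiv_prod_roots:
  assumes "s \<notin> set zs"
  shows "((\<lambda>s. prod_roots zs s) has_field_derivative (prod_roots zs s * (\<Sum>z\<leftarrow>zs. 1 / (s - z)))) (at s)"
  using assms
proof (induction zs)
  case (Cons z zs)
  have "((\<lambda>s. (s - z) * prod_roots zs s) has_field_derivative
     (1 * prod_roots zs s + (prod_roots zs s * (\<Sum>z\<leftarrow>zs. 1 / (s - z))) * (s - z))) (at s)"
    by (rule DERIV_mult) (use Cons in \<open>auto intro!: derivative_eq_intros\<close>)
  also have "1 * prod_roots zs s + (prod_roots zs s * (\<Sum>z\<leftarrow>zs. 1 / (s - z))) * (s - z) =
     prod_roots (z # zs) s * (\<Sum>z\<leftarrow>z # zs. 1 / (s - z))"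
    using Cons.prems by (simp add: field_simps)
  finally show ?case by simp
qed auto

lemma prod_roots_split:
  "prod_roots zs s = (s - z) ^ count_list zs z * prod_roots (filter (\<lambda>x. x \<noteq> z) zs) s"
  by (induction zs) (auto simp: mult_ac)

text \<open>On the circle of radius \<open>3 * r\<close> every root is at distance at least
  \<open>2 * r\<close>, which bounds \<open>g\<close> there and, by the maximum principle, inside;
  seen from \<open>s0\<close> every root is at distance at most \<open>r\<close>, which bounds
  \<open>g s0\<close> from below. Comparing the two at \<open>s0\<close> gives Jensen's bound for
  the number of roots.\<close>

lemma factor_roots_bound:
  assumes r: "r > 0" and g: "g holomorphic_on UNIV" and zs: "set zs \<subseteq> cball s0 r"
    and f: "\<And>s. f s = g s * prod_roots zs s" and f0: "f s0 \<noteq> 0"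
    and B: "\<And>s. dist s0 s = 3 * r \<Longrightarrow> norm (f s) \<le> B"
  shows "s \<in> cball s0 (3 * r) \<Longrightarrow> norm (g s) \<le> B / (2 * r) ^ length zs"
    and "norm (g s0) \<ge> norm (f s0) / r ^ length zs"
    and "2 ^ length zs \<le> B / norm (f s0)"
proof -
  show A: "norm (g s) \<le> B / (2 * r) ^ length zs" if s: "s \<in> cball s0 (3 * r)" for s
  proof (rule maximum_modulus_frontier[where f = g and \<xi> = s and S = "cball s0 (3 * r)"])
    fix z assume "z \<in> frontier (cball s0 (3 * r))"
    then have z: "dist s0 z = 3 * r" using r by (simp add: frontier_cball)
    have "(2 * r) ^ length zs \<le> norm (prod_roots zs z)"
    proof (rule prod_roots_lower)
      fix x assume "x \<in> set zs"
      then have "dist s0 x \<le> r" using zs by auto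
      then show "2 * r \<le> norm (z - x)"
        using z dist_triangle[of s0 z x] by (simp add: dist_norm norm_minus_commute)
    qed (use r in auto)
    then have "norm (g z) * (2 * r) ^ length zs \<le> norm (f z)"
      unfolding f norm_mult by (intro mult_left_mono) auto
    also have "\<dots> \<le> B" by (rule B[OF z])
    finally show "norm (g z) \<le> B / (2 * r) ^ length zs"
      using r by (simp add: field_simps)
  qed (use s g in \<open>auto intro: holomorphic_on_subset holomorphic_on_imp_continuous_on continuous_on_subset\<close>)
  have "norm (prod_roots zs s0) \<le> r ^ length zs"
    by (rule prod_roots_upper) (use zs r in \<open>auto simp: dist_norm\<close>)
  then have "norm (f s0) \<le> norm (g s0) * r ^ length zs"
    unfolding f norm_mult by (intro mult_left_mono) auto
  then show L: "norm (g s0) \<ge> norm (f s0) / r ^ length zs"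
    using r by (simp add: field_simps)
  have "norm (f s0) / r ^ length zs \<le> B / (2 * r) ^ length zs"
    using A[of s0] L r by simp
  then show "2 ^ length zs \<le> B / norm (f s0)"
    using r f0 by (simp add: field_simps power_mult_distrib)
qed

text \<open>Zeros in the disc are divided out one at a time; Jensen's bound limits the number of
  factors, so a factorization with the maximal number exists, and its quotient has no further zero
  in the disc.\<close>

lemma entire_factor_roots:
  assumes r: "r > 0" and f: "f holomorphic_on UNIV" and f0: "f s0 \<noteq> 0"
    and B: "\<And>s. dist s0 s = 3 * r \<Longrightarrow> norm (f s) \<le> B"
  obtains zs g where "set zs \<subseteq> cball s0 r" "g holomorphic_on UNIV" "\<And>s. f s = g s * prod_roots zs s"
    "\<And>s. s \<in> cball s0 r \<Longrightarrow> g s \<noteq> 0"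
proof -
  define P where "P n \<longleftrightarrow> (\<exists>zs g. length zs = n \<and> set zs \<subseteq> cball s0 r \<and> g holomorphic_on UNIV \<and>
      (\<forall>s. f s = g s * prod_roots zs s))" for n :: nat
  obtain N :: nat where N: "B / norm (f s0) < 2 ^ N"
    using real_arch_pow[of 2] by auto
  have bnd: "n \<le> N" if Pn: "P n" for n
  proof -
    from Pn obtain zs g where zs: "length zs = n" "set zs \<subseteq> cball s0 r" "g holomorphic_on UNIV"
      "\<And>s. f s = g s * prod_roots zs s" unfolding P_def by blast
    have "2 ^ n \<le> B / norm (f s0)"
      using factor_roots_bound(3)[OF r zs(3,2) zs(4) f0 B] zs(1) by simp
    then have "(2::real) ^ n < 2 ^ N" using N by linarith
    then have "n < N" by (rule power_less_imp_less_exp[rotated]) simp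
    then show ?thesis by simp
  qed
  have P0: "P 0" unfolding P_def using f by (intro exI[of _ "[]"] exI[of _ f]) auto
  define n where "n = (GREATEST n. P n)"
  have Pn: "P n" unfolding n_def using P0 bnd by (rule GreatestI_nat)
  have mx: "\<not> P (Suc n)" unfolding n_def using Greatest_le_nat[of P "Suc (GREATEST n. P n)" N] bnd by auto
  from Pn obtain zs g where zs: "length zs = n" "set zs \<subseteq> cball s0 r" "g holomorphic_on UNIV"
      "\<And>s. f s = g s * prod_roots zs s" unfolding P_def by blast
  have "g z \<noteq> 0" if z: "z \<in> cball s0 r" for z
  proof
    assume gz: "g z = 0"
    define h where "h = (\<lambda>s. if s = z then deriv g z else (g s - g z) / (s - z))"
    have "h holomorphic_on UNIV" unfolding h_def by (rule pole_lemma_open[OF zs(3)]) auto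
    moreover have "f s = h s * prod_roots (z # zs) s" for s
      using zs(4)[of s] gz by (auto simp: h_def)
    ultimately have "P (Suc n)" unfolding P_def using zs(1,2) z
      by (intro exI[of _ "z # zs"] exI[of _ h]) auto
    then show False using mx by blast
  qed
  then show ?thesis using that zs by blast
qed

text \<open>The map sending \<open>k\<close> to \<open>k / (2 * L - k)\<close> takes the half-plane
  \<open>Re k < L\<close> into the unit disc, so the Schwarz lemma applies. At relative radius
  \<open>3/4\<close> it reads \<open>norm k \<le> (3/4) * (2 * L + norm k)\<close>, that is
  \<open>norm k \<le> 6 * L\<close>. The derivative bound on half of that disc then gives
  \<open>4 * (6 * L) / (3 * r / 4)\<close>, which explains both \<open>32\<close> and
  \<open>3 * r / 8\<close>.\<close>

lemma borel_caratheodory_deriv: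
  assumes r: "r > 0" and k: "k holomorphic_on ball s0 r" and k0: "k s0 = 0"
    and re: "\<And>s. s \<in> ball s0 r \<Longrightarrow> Re (k s) < L" and s: "s \<in> ball s0 (3 * r / 8)"
  shows "norm (deriv k s) \<le> 32 * L / r"
proof -
  have L: "L > 0" using re[of s0] k0 r by simp
  define \<phi> where "\<phi> w = k (s0 + of_real r * w) / (2 * L - k (s0 + of_real r * w))" for w
  have mem: "s0 + of_real r * w \<in> ball s0 r" if "norm w < 1" for w
    using that r by (simp add: dist_norm norm_mult)
  have ne: "2 * of_real L - k (s0 + of_real r * w) \<noteq> 0" if "norm w < 1" for w
  proof
    assume "2 * of_real L - k (s0 + of_real r * w) = 0"
    then have "Re (2 * of_real L - k (s0 + of_real r * w)) = 0" by simp
    then show False using re[OF mem[OF that]] L by simp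
  qed
  have \<phi>1: "norm (\<phi> w) < 1" if w: "norm w < 1" for w
  proof -
    define u where "u = k (s0 + of_real r * w)"
    have u: "Re u < L" unfolding u_def by (rule re[OF mem[OF w]])
    have "norm u < norm (2 * of_real L - u)"
    proof (rule power2_less_imp_less)
      have "(2 * L - Re u)\<^sup>2 - (Re u)\<^sup>2 = 4 * L * (L - Re u)" by (simp add: power2_eq_square algebra_simps)
      moreover have "\<dots> > 0" using u L by simp
      ultimately show "(norm u)\<^sup>2 < (norm (2 * of_real L - u))\<^sup>2"
        unfolding cmod_power2 by simp
    qed auto
    then show ?thesis unfolding \<phi>_def u_def[symmetric] by (simp add: norm_divide divide_simps)
  qed
  have "(\<lambda>w. k (s0 + of_real r * w)) holomorphic_on ball 0 1"
    by (intro holomorphic_on_compose_gen[OF _ k, of "\<lambda>w. s0 + of_real r * w" "ball 0 1", unfolded o_def]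
        image_subsetI mem holomorphic_intros) simp
  then have \<phi>h: "\<phi> holomorphic_on ball 0 1"
    unfolding \<phi>_def using ne by (intro holomorphic_intros) auto
  have \<phi>0: "\<phi> 0 = 0" by (simp add: \<phi>_def k0)
  have sch: "norm (\<phi> w) \<le> norm w" if "norm w < 1" for w
    by (rule Schwarz_Lemma(1)[OF \<phi>h \<phi>0 \<phi>1 that])
  have kb: "norm (k x) \<le> 6 * L" if x: "x \<in> ball s0 (3 * r / 4)" for x
  proof -
    define w where "w = (x - s0) / of_real r"
    have w: "norm w < 3/4" using x r by (simp add: w_def norm_divide dist_norm norm_minus_commute field_simps)
    have xw: "s0 + of_real r * w = x" using r by (simp add: w_def)
    have "norm (k x) \<le> norm (2 * of_real L - k x) * (3/4)"
    proof -
      have "norm (k x) \<le> norm (2 * of_real L - k x) * norm w"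
        using sch[of w] w ne[of w] unfolding \<phi>_def xw norm_divide by (simp add: field_simps)
      also have "\<dots> \<le> norm (2 * of_real L - k x) * (3/4)"
        using w by (intro mult_left_mono) auto
      finally show ?thesis .
    qed
    also have "norm (2 * of_real L - k x) \<le> 2 * L + norm (k x)"
      using norm_triangle_ineq4[of "2 * of_real L" "k x"] L by (simp add: norm_mult)
    finally show ?thesis by simp
  qed
  have "norm (deriv k s) \<le> 4 * (6 * L) / (3 * r / 4)"
    by (rule holomorphic_bounded_deriv_le[of k s0 "3 * r / 4"])
      (use s kb r in \<open>auto intro: holomorphic_on_subset[OF k]\<close>)
  then show ?thesis by simp
qed

text \<open>After the zeros in the disc are divided out, the quotient has a logarithm there, whose
  real part relative to the centre is controlled by \<open>ln (B / norm (f s0))\<close>. The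
  logarithmic derivative of \<open>f\<close> minus the partial fractions is the derivative of that
  logarithm, and the Borel-Caratheodory bound applies to it.\<close>

lemma entire_local_logderiv:
  fixes f :: "complex \<Rightarrow> complex"
  assumes r: "r > 0" and f: "f holomorphic_on UNIV" and f0: "f s0 \<noteq> 0"
    and B: "\<And>s. dist s0 s = 3 * r \<Longrightarrow> norm (f s) \<le> B"
  obtains zs where "set zs = {z \<in> cball s0 r. f z = 0}"
    "2 ^ length zs \<le> B / norm (f s0)"
    "\<And>z. z \<in> cball s0 r \<Longrightarrow> zorder f z = int (count_list zs z)"
    "\<And>s. s \<in> ball s0 (3 * r / 8) \<Longrightarrow> f s \<noteq> 0 \<Longrightarrow>
       norm (deriv f s / f s - (\<Sum>z\<leftarrow>zs. 1 / (s - z))) \<le> 32 * (ln (B / norm (f s0)) + 1) / r"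
proof -
  obtain zs g where zs: "set zs \<subseteq> cball s0 r" and g: "g holomorphic_on UNIV"
    and fg: "\<And>s. f s = g s * prod_roots zs s" and gnz: "\<And>s. s \<in> cball s0 r \<Longrightarrow> g s \<noteq> 0"
    using entire_factor_roots[OF r f f0 B] by metis
  note bd = factor_roots_bound[OF r g zs fg f0 B]
  have 1: "set zs = {z \<in> cball s0 r. f z = 0}"
    using zs gnz fg by (auto simp: prod_roots_eq_0_iff)
  have pos: "B / norm (f s0) \<ge> 1"
    using bd(3) one_le_power[of "2::real" "length zs"] by linarith
  have 3: "zorder f z = int (count_list zs z)" if z: "z \<in> cball s0 r" for z
  proof (rule zorder_eqI[of UNIV z "\<lambda>s. g s * prod_roots (filter (\<lambda>x. x \<noteq> z) zs) s"])
    show "g z * prod_roots (filter (\<lambda>x. x \<noteq> z) zs) z \<noteq> 0"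
      using gnz[OF z] by (simp add: prod_roots_eq_0_iff)
    show "f w = g w * prod_roots (filter (\<lambda>x. x \<noteq> z) zs) w * (w - z) powi int (count_list zs z)" for w
      unfolding fg prod_roots_split[where s = w and z = z and zs = zs] by simp
  qed (auto intro!: holomorphic_intros g)
  have 4: "norm (deriv f s / f s - (\<Sum>z\<leftarrow>zs. 1 / (s - z))) \<le> 32 * (ln (B / norm (f s0)) + 1) / r"
    if s: "s \<in> ball s0 (3 * r / 8)" "f s \<noteq> 0" for s
  proof -
    obtain h where h: "h holomorphic_on ball s0 r" "\<And>x. x \<in> ball s0 r \<Longrightarrow> exp (h x) = g x"
    proof (rule holomorphic_logarithm_exists[of "ball s0 r" g s0])
      show "g holomorphic_on ball s0 r" using g by (rule holomorphic_on_subset) auto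
      show "\<And>x. x \<in> ball s0 r \<Longrightarrow> g x \<noteq> 0" using gnz by auto
    qed (use r in auto)
    define k where "k x = h x - h s0" for x
    have k: "k holomorphic_on ball s0 r" unfolding k_def by (intro holomorphic_intros h)
    have sr: "s \<in> ball s0 r" using s r by auto
    \<comment> \<open>Adding 1 makes the inequality strict also when \<open>B\<close> equals
      \<open>norm (f s0)\<close>.\<close>
    have re: "Re (k x) < ln (B / norm (f s0)) + 1" if x: "x \<in> ball s0 r" for x
    proof -
      have "exp (Re (k x)) = norm (g x) / norm (g s0)"
        using h(2)[OF x, symmetric] h(2)[of s0, symmetric] r
        by (simp add: k_def norm_exp_eq_Re exp_diff)
      also have "\<dots> \<le> (B / (2 * r) ^ length zs) / (norm (f s0) / r ^ length zs)"
        using bd(1)[of x] bd(2) x r f0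
        by (intro frac_le order_trans[OF norm_ge_zero[of "g x"] bd(1)]) auto
      also have "\<dots> = B / norm (f s0) / 2 ^ length zs"
        using r by (simp add: power_mult_distrib field_simps)
      also have "\<dots> \<le> B / norm (f s0) / 1" using pos by (intro divide_left_mono) auto
      finally have "exp (Re (k x)) \<le> B / norm (f s0)" by simp
      then have "Re (k x) \<le> ln (B / norm (f s0))"
        using pos by (subst ln_ge_iff) auto
      then show ?thesis by simp
    qed
    have "norm (deriv k s) \<le> 32 * (ln (B / norm (f s0)) + 1) / r"
      by (rule borel_caratheodory_deriv[OF r k _ re s(1)]) (auto simp: k_def)
    moreover have "deriv f s / f s - (\<Sum>z\<leftarrow>zs. 1 / (s - z)) = deriv k s"
    proof -
      have ff: "f = (\<lambda>x. g x * prod_roots zs x)" using fg by blast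
      have snz: "s \<notin> set zs" and pnz: "prod_roots zs s \<noteq> 0" using s fg by (auto simp: prod_roots_eq_0_iff)
      have gs: "g s \<noteq> 0" using gnz[of s] sr by auto
      have dh: "(h has_field_derivative deriv h s) (at s)" using holomorphic_derivI[OF h(1) _ sr] by simp
      have "((\<lambda>x. exp (h x)) has_field_derivative exp (h s) * deriv h s) (at s)"
        by (rule DERIV_chain2[OF DERIV_exp dh])
      then have "(g has_field_derivative exp (h s) * deriv h s) (at s)"
        by (rule has_field_derivative_transform_within_open[of _ _ _ "ball s0 r"]) (use sr h in auto)
      then have dg: "(g has_field_derivative g s * deriv h s) (at s)" using h(2)[OF sr] by simp
      have "((\<lambda>x. g x * prod_roots zs x) has_field_derivative
         (g s * deriv h s) * prod_roots zs s + (prod_roots zs s * (\<Sum>z\<leftarrow>zs. 1 / (s - z))) * g s) (at s)"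
        by (rule DERIV_mult[OF dg logderiv_prod_roots[OF snz]])
      then have "deriv f s = g s * deriv h s * prod_roots zs s + (prod_roots zs s * (\<Sum>z\<leftarrow>zs. 1 / (s - z))) * g s"
        unfolding ff[symmetric] by (rule DERIV_imp_deriv)
      then have "deriv f s / f s = deriv h s + (\<Sum>z\<leftarrow>zs. 1 / (s - z))"
        using gs pnz unfolding fg by (simp add: add_divide_distrib)
      moreover have "deriv k s = deriv h s"
        unfolding k_def by (rule DERIV_imp_deriv) (auto intro!: derivative_eq_intros dh)
      ultimately show ?thesis by simp
    qed
    ultimately show ?thesis by simp
  qed
  show ?thesis by (rule that[OF 1 bd(3) 3 4])
qed

subsection \<open>The theta inversion formula\<close>

lemma gaussian_integral:
  assumes t: "t > 0"
  shows "integrable lborel (\<lambda>y::real. exp (- (pi * t * y\<^sup>2)))"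
    and "(LINT y|lborel. exp (- (pi * t * y\<^sup>2))) = 1 / sqrt t"
proof -
  define \<sigma> where "\<sigma> = 1 / sqrt (2 * pi * t)"
  have \<sigma>: "\<sigma> > 0" using t by (simp add: \<sigma>_def)
  have s2: "\<sigma>\<^sup>2 = 1 / (2 * pi * t)" using t by (simp add: \<sigma>_def power_divide)
  have eq: "exp (- (pi * t * y\<^sup>2)) = (1 / sqrt t) * normal_density 0 \<sigma> y" for y
  proof -
    have "sqrt (2 * pi * \<sigma>\<^sup>2) = 1 / sqrt t"
      using t by (simp add: s2 real_sqrt_divide)
    moreover have "(y - 0)\<^sup>2 / (2 * \<sigma>\<^sup>2) = pi * t * y\<^sup>2"
      using t by (simp add: s2 field_simps)
    ultimately show ?thesis using t unfolding normal_density_def by simp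
  qed
  show "integrable lborel (\<lambda>y::real. exp (- (pi * t * y\<^sup>2)))"
    unfolding eq using \<sigma> by auto
  show "(LINT y|lborel. exp (- (pi * t * y\<^sup>2))) = 1 / sqrt t"
    unfolding eq using \<sigma> by simp
qed

section \<open>The Gaussian along vertical lines\<close>

lemma borel_measurable_vertical:
  fixes f :: "complex \<Rightarrow> complex"
  assumes "continuous_on {z. Re z = c} f"
  shows "(\<lambda>t. f (Complex c t)) \<in> borel_measurable borel"
proof (rule borel_measurable_continuous_onI)
  have "continuous_on UNIV (\<lambda>t. Complex c t)"
    unfolding Complex_eq by (intro continuous_intros)
  then show "continuous_on UNIV (\<lambda>t. f (Complex c t))"
    by (rule continuous_on_compose2[OF assms]) auto
qed

text \<open>With the positive sign in the exponent the function decays along vertical lines, where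
  the real part of \<open>z\<^sup>2\<close> is \<open>x\<^sup>2 - y\<^sup>2\<close>.\<close>

definition gauss :: "real \<Rightarrow> complex \<Rightarrow> complex" where
  "gauss t z = exp (of_real (pi * t) * z\<^sup>2)"

lemma norm_gauss: "norm (gauss t (Complex x y)) = exp (pi * t * x\<^sup>2) * exp (- (pi * t * y\<^sup>2))"
  by (simp add: gauss_def norm_exp_eq_Re power2_eq_square exp_add[symmetric] algebra_simps flip: exp_add)

lemma gauss_holomorphic [holomorphic_intros]: "g holomorphic_on A \<Longrightarrow> (\<lambda>z. gauss t (g z)) holomorphic_on A"
  unfolding gauss_def by (intro holomorphic_intros)

lemma integrable_gauss:
  assumes t: "t > 0"
  shows "integrable lborel (\<lambda>y. gauss t (Complex x y))"
proof (rule Bochner_Integration.integrable_bound)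
  show "integrable lborel (\<lambda>y. exp (pi * t * x\<^sup>2) * exp (- (pi * t * y\<^sup>2)))"
    using gaussian_integral(1)[OF t] by simp
  show "(\<lambda>y. gauss t (Complex x y)) \<in> borel_measurable lborel"
    using borel_measurable_vertical[of x "gauss t"]
    by (simp add: holomorphic_on_imp_continuous_on gauss_holomorphic)
qed (simp add: norm_gauss)

lemma tendsto_gauss_bound:
  fixes T :: "nat \<Rightarrow> real"
  assumes t: "t > 0" and T: "filterlim T at_top sequentially"
  shows "(\<lambda>j. C * exp (- (pi * t * (T j)\<^sup>2))) \<longlonglongrightarrow> 0"
proof -
  have "((\<lambda>y. C * exp (- (pi * t * y\<^sup>2))) \<longlongrightarrow> 0) at_top"
    using t by real_asymp
  then show ?thesis using T by (rule filterlim_compose)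
qed

lemma gauss_line_integral_mono:
  assumes t: "t > 0" and ab: "a < b"
  shows "(LINT y|lborel. gauss t (Complex a y)) = (LINT y|lborel. gauss t (Complex b y))"
proof -
  define T where "T j = real j + 1" for j
  have Tl: "filterlim T at_top sequentially" unfolding T_def by real_asymp
  define M where "M = max (a\<^sup>2) (b\<^sup>2)"
  have x2: "x\<^sup>2 \<le> M" if "x \<in> {a..b}" for x
    using that unfolding M_def le_max_iff_disj abs_le_square_iff[symmetric] by auto
  have E: "norm (gauss t (Complex x y)) \<le> exp (pi * t * M) * exp (- (pi * t * y\<^sup>2))" if "x \<in> {a..b}" for x y
    unfolding norm_gauss using t x2[OF that] by (intro mult_right_mono) auto
  have "(\<lambda>j. of_real (2 * pi) * (\<Sum>s | s \<in> {} \<and> \<bar>Im s\<bar> < T j. residue (gauss t) s)) \<longlonglongrightarrow>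
     (LINT y|lborel. gauss t (Complex b y)) - (LINT y|lborel. gauss t (Complex a y))"
  proof (rule strip_shift[where \<delta> = 1 and E = "\<lambda>j. exp (pi * t * M) * exp (- (pi * t * (T j)\<^sup>2))"])
    show "(\<lambda>j. exp (pi * t * M) * exp (- (pi * t * (T j)\<^sup>2))) \<longlonglongrightarrow> 0"
      by (rule tendsto_gauss_bound[OF t Tl])
    show "norm (gauss t (Complex x (T j))) \<le> exp (pi * t * M) * exp (- (pi * t * (T j)\<^sup>2))"
      "norm (gauss t (Complex x (- T j))) \<le> exp (pi * t * M) * exp (- (pi * t * (T j)\<^sup>2))"
      if "x \<in> {a..b}" for j x
      using E[OF that, of "T j"] E[OF that, of "- T j"] by auto
    show "filterlim T at_top sequentially" by (rule Tl)
  qed (use ab in \<open>auto simp: T_def intro!: holomorphic_intros integrable_gauss t\<close>)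
  then have "(LINT y|lborel. gauss t (Complex b y)) - (LINT y|lborel. gauss t (Complex a y)) = 0"
    by (simp add: LIMSEQ_const_iff)
  then show ?thesis by simp
qed

lemma gauss_line_integral:
  assumes t: "t > 0"
  shows "(LINT y|lborel. gauss t (Complex x y)) = of_real (1 / sqrt t)"
proof -
  have "(LINT y|lborel. gauss t (Complex 0 y)) = of_real (1 / sqrt t)"
  proof -
    have "gauss t (Complex 0 y) = of_real (exp (- (pi * t * y\<^sup>2)))" for y
      unfolding gauss_def exp_of_real[symmetric]
      by (rule arg_cong[where f = exp]) (simp add: complex_eq_iff power2_eq_square)
    then show ?thesis using gaussian_integral(2)[OF t] by simp
  qed
  then show ?thesis
    using gauss_line_integral_mono[OF t, of x 0] gauss_line_integral_mono[OF t, of 0 x]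
    by (cases x "0::real" rule: linorder_cases) auto
qed

lemma gauss_shift:
  assumes t: "t > 0"
  shows "gauss t z * exp (2 * of_real pi * of_real m * z) = of_real (exp (- (pi * m\<^sup>2 / t))) * gauss t (z + of_real (m / t))"
  unfolding gauss_def exp_of_real[symmetric] exp_add[symmetric]
  by (rule arg_cong[where f = exp]) (use t in \<open>simp add: power2_eq_square field_simps\<close>)

text \<open>Completing the square trades the exponential for a shift of the line by
  \<open>m / t\<close>, and the integral of the Gaussian is the same on all vertical lines.\<close>

lemma gauss_exp_integral:
  assumes t: "t > 0"
  shows "integrable lborel (\<lambda>y. gauss t (Complex x y) * exp (2 * of_real pi * of_real m * Complex x y))"
    and "(LINT y|lborel. gauss t (Complex x y) * exp (2 * of_real pi * of_real m * Complex x y)) = of_real (exp (- (pi * m\<^sup>2 / t)) / sqrt t)"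
proof -
  have eq: "Complex x y + of_real (m / t) = Complex (x + m / t) y" for y by (simp add: complex_eq_iff)
  show "integrable lborel (\<lambda>y. gauss t (Complex x y) * exp (2 * of_real pi * of_real m * Complex x y))"
    unfolding gauss_shift[OF t] eq using integrable_gauss[OF t] by simp
  show "(LINT y|lborel. gauss t (Complex x y) * exp (2 * of_real pi * of_real m * Complex x y)) = of_real (exp (- (pi * m\<^sup>2 / t)) / sqrt t)"
    unfolding gauss_shift[OF t] eq using gauss_line_integral[OF t, of "x + m / t"] by simp
qed

text \<open>Half of the theta series without its middle term: the sum of
  \<open>exp (- pi * n\<^sup>2 * t)\<close> over all integers is
  \<open>1 + 2 * omega t\<close>.\<close>

definition omega :: "real \<Rightarrow> real" where
  "omega t = (\<Sum>n. exp (- (pi * (real (Suc n))\<^sup>2 * t)))"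

lemma omega_term_le:
  assumes "t > 0"
  shows "exp (- (pi * (real (Suc n))\<^sup>2 * t)) \<le> exp (- (pi * t)) * exp (- (pi * t)) ^ n"
proof -
  have "real (Suc n) \<le> (real (Suc n))\<^sup>2" by (simp add: power2_eq_square)
  then have "pi * t * real (Suc n) \<le> pi * t * (real (Suc n))\<^sup>2"
    using assms by (intro mult_left_mono) auto
  then have "exp (- (pi * (real (Suc n))\<^sup>2 * t)) \<le> exp (- (pi * t * real (Suc n)))" by (simp add: mult_ac)
  also have "\<dots> = exp (- (pi * t)) ^ Suc n"
    unfolding exp_of_nat_mult[symmetric] by (rule arg_cong[where f = exp]) (simp add: algebra_simps)
  finally show ?thesis by simp
qed

lemma summable_omega:
  assumes "t > 0"
  shows "summable (\<lambda>n. exp (- (pi * (real (Suc n))\<^sup>2 * t)))"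
proof (rule summable_comparison_test'[where N = 0])
  show "summable (\<lambda>n. exp (- (pi * t)) * exp (- (pi * t)) ^ n)"
    using assms by (intro summable_mult summable_geometric) auto
qed (use omega_term_le[OF assms] in simp)

lemma omega_nonneg: "t > 0 \<Longrightarrow> omega t \<ge> 0"
  unfolding omega_def by (intro suminf_nonneg summable_omega) auto

text \<open>
  Poisson summation by residues: \<open>gauss t z / (exp (2 pi z) - 1)\<close> has its poles at the points \<open>i n\<close>,
  and its integrals along two vertical lines on either side of the imaginary axis are evaluated by
  expanding the denominator into geometric series.
\<close>

lemma theta_inversion:
  assumes t: "t > 0"
  shows "1 + 2 * omega t = (1 + 2 * omega (1 / t)) / sqrt t"
proof -
  define f where "f z = gauss t z / (exp (2 * of_real pi * z) - 1)" for z
  define S where "S = range (\<lambda>n::int. Complex 0 (of_int n))"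
  \<comment> \<open>These heights lie midway between the poles; there
    \<open>exp (2 * pi * z)\<close> is a negative real, so the denominator has modulus at least
    1.\<close>
  define T where "T j = real j + 1 / 2" for j
  have Tl: "filterlim T at_top sequentially" unfolding T_def by real_asymp
  have zero_iff: "exp (2 * of_real pi * z) = 1 \<longleftrightarrow> z \<in> S" for z
  proof -
    have "exp (2 * of_real pi * z) = 1 \<longleftrightarrow> (\<exists>n::int. 2 * pi * Re z = 0 \<and> 2 * pi * Im z = of_int (2 * n) * pi)"
      by (simp add: exp_eq_1)
    also have "\<dots> \<longleftrightarrow> z \<in> S" by (auto simp: S_def complex_eq_iff)
    finally show ?thesis .
  qed
  \<comment> \<open>The denominator has derivative \<open>2 * pi\<close> at each of its zeros, and
    the Gaussian at the point \<open>n\<close> of the imaginary axis is the \<open>n\<close>-th term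
    of the theta series.\<close>
  have res: "residue f (Complex 0 (of_int n)) = of_real (exp (- (pi * t * (of_int n)\<^sup>2))) / of_real (2 * pi)" for n
  proof -
    define p where "p = Complex 0 (of_int n)"
    have p1: "exp (2 * of_real pi * p) = 1" using zero_iff by (auto simp: p_def S_def)
    have "residue (\<lambda>z. gauss t z / (exp (2 * of_real pi * z) - 1)) p = gauss t p / (2 * of_real pi)"
    proof (rule residue_simple_pole_deriv[where s = UNIV])
      have "((\<lambda>z. exp (2 * of_real pi * z) - 1) has_field_derivative exp (2 * of_real pi * p) * (2 * of_real pi)) (at p)"
        by (auto intro!: derivative_eq_intros)
      then show "((\<lambda>z. exp (2 * of_real pi * z) - 1) has_field_derivative 2 * of_real pi) (at p)" using p1 by simp
      show "gauss t p \<noteq> 0" by (simp add: gauss_def)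
    qed (auto intro!: holomorphic_intros simp: p1)
    also have "gauss t p = of_real (exp (- (pi * t * (of_int n)\<^sup>2)))"
      unfolding gauss_def exp_of_real[symmetric]
      by (rule arg_cong[where f = exp]) (simp add: p_def complex_eq_iff power2_eq_square)
    finally show ?thesis by (simp add: f_def[abs_def] p_def)
  qed
  have holo: "f holomorphic_on A - S" for A
    unfolding f_def by (intro holomorphic_intros) (use zero_iff in auto)
  have T0: "\<bar>T j\<bar> = T j" for j by (simp add: T_def)
  define q where "q = exp (- (2 * pi))"
  have q: "0 < q" "q < 1" by (auto simp: q_def)
  have Tj: "norm (f (Complex x y)) \<le> exp (pi * t) * exp (- (pi * t * y\<^sup>2))"
    if x: "x \<in> {-1..1}" and y: "\<bar>y\<bar> = T j" for x y j
  proof -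
    have "exp (2 * of_real pi * Complex x y) = - of_real (exp (2 * pi * x))"
    proof -
      have c: "cos (2 * pi * y) = -1" and s: "sin (2 * pi * y) = 0"
      proof -
        have "2 * pi * \<bar>y\<bar> = pi * real (2 * j + 1)" unfolding y T_def by (simp add: field_simps)
        then have "cos (2 * pi * \<bar>y\<bar>) = -1" "sin (2 * pi * \<bar>y\<bar>) = 0"
          by (simp_all only: cos_npi2 sin_npi2) simp
        then show "cos (2 * pi * y) = -1" "sin (2 * pi * y) = 0"
          by (auto simp: abs_if split: if_splits)
      qed
      show ?thesis using c s by (simp add: complex_eq_iff Re_exp Im_exp)
    qed
    then have "norm (exp (2 * of_real pi * Complex x y) - 1) = norm (- of_real (exp (2 * pi * x) + 1) :: complex)"
      by simp
    also have "\<dots> = exp (2 * pi * x) + 1" unfolding norm_minus_cancel norm_of_real by simp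
    finally have n: "norm (exp (2 * of_real pi * Complex x y) - 1) \<ge> 1" by simp
    have "norm (f (Complex x y)) \<le> norm (gauss t (Complex x y)) / 1"
      unfolding f_def norm_divide using n by (intro divide_left_mono mult_pos_pos) auto
    also have "\<dots> = exp (pi * t * x\<^sup>2) * exp (- (pi * t * y\<^sup>2))" by (simp add: norm_gauss)
    also have "\<dots> \<le> exp (pi * t) * exp (- (pi * t * y\<^sup>2))"
    proof -
      have "x\<^sup>2 \<le> 1" using x by (simp add: abs_square_le_1 abs_le_iff)
      then show ?thesis using t by (auto simp: mult_left_le)
    qed
    finally show ?thesis .
  qed
  \<comment> \<open>Both lines at once. On the line \<open>x = 1\<close> the expansion runs over
    \<open>exp (- 2 * pi * m * z)\<close> from \<open>m = 1\<close> (so \<open>a = -1\<close>,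
    \<open>d = 1\<close>), on the line \<open>x = -1\<close> over
    \<open>exp (2 * pi * m * z)\<close> from \<open>m = 0\<close> with a minus sign (so
    \<open>a = 1\<close>, \<open>d = 0\<close>). The condition \<open>a * x = -1\<close> makes
    either series geometric with ratio of modulus \<open>exp (- 2 * pi)\<close>.\<close>
  have half: "integrable lborel (\<lambda>y. \<Sum>m. gauss t (Complex x y) * exp (2 * of_real pi * of_real (a * real (m + d)) * Complex x y))"
      "(\<lambda>m. of_real (exp (- (pi * (real (m + d))\<^sup>2 / t)) / sqrt t)) sums
       (LINT y|lborel. (\<Sum>m. gauss t (Complex x y) * exp (2 * of_real pi * of_real (a * real (m + d)) * Complex x y)))"
    if ax: "a * x = -1" "a\<^sup>2 = 1" for a x :: real and d :: nat
  proof -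
    let ?F = "\<lambda>m y. gauss t (Complex x y) * exp (2 * of_real pi * of_real (a * real (m + d)) * Complex x y)"
    have int: "integrable lborel (?F m)" for m by (rule gauss_exp_integral[OF t])
    have nrm: "norm (?F m y) = norm (gauss t (Complex x y)) * q ^ (m + d)" for m y
    proof -
      have "norm (exp (2 * of_real pi * of_real (a * real (m + d)) * Complex x y)) = exp (2 * pi * real (m + d) * (a * x))"
        by (simp add: norm_exp_eq_Re mult_ac)
      also have "\<dots> = q ^ (m + d)" unfolding ax q_def exp_of_nat_mult[symmetric]
        by (rule arg_cong[where f = exp]) (simp add: algebra_simps)
      finally show ?thesis by (simp add: norm_mult)
    qed
    have sq: "summable (\<lambda>m. q ^ (m + d))"
      using q by (intro summable_ignore_initial_segment summable_geometric) auto
    have AE: "AE y in lborel. summable (\<lambda>m. norm (?F m y))"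
      unfolding nrm using sq by (intro AE_I2 summable_mult)
    have sm: "summable (\<lambda>m. LINT y|lborel. norm (?F m y))"
      unfolding nrm using sq by (simp add: summable_mult2 mult.commute)
    show "integrable lborel (\<lambda>y. \<Sum>m. ?F m y)" by (rule integrable_suminf[OF int AE sm])
    have "(\<lambda>m. LINT y|lborel. ?F m y) sums (LINT y|lborel. (\<Sum>m. ?F m y))" by (rule sums_integral[OF int AE sm])
    moreover have "(LINT y|lborel. ?F m y) = of_real (exp (- (pi * (real (m + d))\<^sup>2 / t)) / sqrt t)" for m
      using gauss_exp_integral(2)[OF t, of x "a * real (m + d)"] ax by (simp add: power_mult_distrib)
    ultimately show "(\<lambda>m. of_real (exp (- (pi * (real (m + d))\<^sup>2 / t)) / sqrt t)) sums
       (LINT y|lborel. (\<Sum>m. ?F m y))" by simp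
  qed
  have geo: "(\<Sum>m. g * w ^ (m + d)) = g * w ^ d / (1 - w)" if "norm w < 1" for g w :: complex and d
  proof -
    have "(\<lambda>m. (g * w ^ d) * w ^ m) sums ((g * w ^ d) * (1 / (1 - w)))"
      by (intro sums_mult geometric_sums that)
    then show ?thesis by (simp add: sums_iff power_add mult_ac)
  qed
  have f1: "f (Complex 1 y) = (\<Sum>m. gauss t (Complex 1 y) * exp (2 * of_real pi * of_real (-1 * real (m + 1)) * Complex 1 y))" for y
  proof -
    define w where "w = exp (- (2 * of_real pi * Complex 1 y))"
    have w: "norm w < 1" by (simp add: w_def norm_exp_eq_Re)
    have "exp (2 * of_real pi * of_real (-1 * real (m + 1)) * Complex 1 y) = w ^ (m + 1)" for m
      unfolding w_def exp_of_nat_mult[symmetric] by (rule arg_cong[where f = exp]) (simp add: algebra_simps)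
    then have "(\<Sum>m. gauss t (Complex 1 y) * exp (2 * of_real pi * of_real (-1 * real (m + 1)) * Complex 1 y))
       = gauss t (Complex 1 y) * w ^ 1 / (1 - w)" using geo[OF w, of _ 1] by simp
    also have "\<dots> = f (Complex 1 y)"
    proof -
      have E: "exp (2 * of_real pi * Complex 1 y) = 1 / w" by (simp add: w_def exp_minus field_simps)
      have "w \<noteq> 0" by (simp add: w_def)
      moreover have "1 - w \<noteq> 0" using w by auto
      ultimately show ?thesis unfolding f_def E by (simp add: field_simps)
    qed
    finally show ?thesis by simp
  qed
  have f2: "f (Complex (-1) y) = - (\<Sum>m. gauss t (Complex (-1) y) * exp (2 * of_real pi * of_real (1 * real (m + 0)) * Complex (-1) y))" for y
  proof -
    define w where "w = exp (2 * of_real pi * Complex (-1) y)"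
    have w: "norm w < 1" by (simp add: w_def norm_exp_eq_Re)
    have "exp (2 * of_real pi * of_real (1 * real (m + 0)) * Complex (-1) y) = w ^ (m + 0)" for m
      unfolding w_def exp_of_nat_mult[symmetric] by (rule arg_cong[where f = exp]) (simp add: algebra_simps)
    then have "(\<Sum>m. gauss t (Complex (-1) y) * exp (2 * of_real pi * of_real (1 * real (m + 0)) * Complex (-1) y))
       = gauss t (Complex (-1) y) * w ^ 0 / (1 - w)" using geo[OF w, of _ 0] by simp
    also have "\<dots> = - f (Complex (-1) y)"
      using w unfolding f_def w_def[symmetric] by (simp add: minus_divide_right)
    finally show ?thesis by simp
  qed
  have I1: "integrable lborel (\<lambda>y. f (Complex 1 y))"
    unfolding f1 by (rule half(1)) auto
  have I2: "integrable lborel (\<lambda>y. f (Complex (-1) y))"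
    unfolding f2 by (rule integrable_minus, rule half(1)) auto
  define a where "a n = exp (- (pi * (real n)\<^sup>2 / t))" for n
  have sa: "(\<lambda>n. a (Suc n)) sums omega (1 / t)"
    using summable_sums[OF summable_omega[of "1/t"]] t by (simp add: a_def omega_def field_simps)
  have v1: "(LINT y|lborel. f (Complex 1 y)) = of_real (omega (1 / t) / sqrt t)"
  proof -
    have "(\<lambda>m. of_real (a (m + 1) / sqrt t) :: complex) sums (LINT y|lborel. f (Complex 1 y))"
      unfolding f1 a_def by (rule half(2)) auto
    moreover have "(\<lambda>m. of_real (a (m + 1) / sqrt t) :: complex) sums of_real (omega (1/t) / sqrt t)"
      using sums_divide[OF sa, of "sqrt t"] by (subst sums_of_real_iff) simp
    ultimately show ?thesis by (rule sums_unique2)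
  qed
  have v2: "- (LINT y|lborel. f (Complex (-1) y)) = of_real ((1 + omega (1 / t)) / sqrt t)"
  proof -
    have "(\<lambda>m. of_real (a (m + 0) / sqrt t) :: complex) sums (LINT y|lborel. - f (Complex (-1) y))"
      unfolding f2 a_def minus_minus by (rule half(2)) auto
    moreover have "(\<lambda>m. of_real (a m / sqrt t) :: complex) sums of_real ((1 + omega (1/t)) / sqrt t)"
    proof -
      have "a sums (omega (1/t) + a 0)" using sa by (subst (asm) sums_Suc_iff)
      then have "a sums (1 + omega (1/t))" by (simp add: a_def add.commute)
      then show ?thesis using sums_divide by (subst sums_of_real_iff) blast
    qed
    ultimately show ?thesis using sums_unique2 I2 by simp
  qed
  have lim: "(\<lambda>j. of_real (2 * pi) * (\<Sum>s | s \<in> S \<and> \<bar>Im s\<bar> < T j. residue f s)) \<longlonglongrightarrow>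
     (LINT y|lborel. f (Complex 1 y)) - (LINT y|lborel. f (Complex (-1) y))"
  proof (rule strip_shift[where \<delta> = 1 and E = "\<lambda>j. exp (pi * t) * exp (- (pi * t * (T j)\<^sup>2))"])
    show "finite {s \<in> S. \<bar>Im s\<bar> \<le> r}" for r
    proof (rule finite_subset)
      show "{s \<in> S. \<bar>Im s\<bar> \<le> r} \<subseteq> (\<lambda>n::int. Complex 0 (of_int n)) ` {-\<lceil>r\<rceil>..\<lceil>r\<rceil>}"
        by (auto simp: S_def abs_le_iff) (smt (verit) atLeastAtMost_iff image_eqI le_of_int_ceiling of_int_le_iff of_int_minus)
    qed auto
    show "\<bar>Im s\<bar> \<noteq> T j" if "s \<in> S" for s j
    proof
      assume "\<bar>Im s\<bar> = T j"
      moreover obtain n :: int where "s = Complex 0 (of_int n)" using \<open>s \<in> S\<close> unfolding S_def by blast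
      ultimately have "\<bar>real_of_int n\<bar> = real j + 1/2" by (simp add: T_def)
      then have "real_of_int (2 * \<bar>n\<bar>) = real_of_int (2 * int j + 1)" by simp
      then have "2 * \<bar>n\<bar> = 2 * int j + 1" by linarith
      then show False by presburger
    qed
    show "(\<lambda>j. exp (pi * t) * exp (- (pi * t * (T j)\<^sup>2))) \<longlonglongrightarrow> 0"
      by (rule tendsto_gauss_bound[OF t Tl])
    show "norm (f (Complex x (T j))) \<le> exp (pi * t) * exp (- (pi * t * (T j)\<^sup>2))" if "x \<in> {-1..1}" for j x
      using Tj[OF that, of "T j" j] T0[of j] by simp
    show "norm (f (Complex x (- T j))) \<le> exp (pi * t) * exp (- (pi * t * (T j)\<^sup>2))" if "x \<in> {-1..1}" for j x
      using Tj[OF that, of "- T j" j] T0[of j] by simp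
    show "filterlim T at_top sequentially" by (rule Tl)
  qed (use I1 I2 holo in \<open>auto simp: T_def S_def\<close>)
  \<comment> \<open>The residues at opposite poles agree, which pairs them off and leaves the one at
    0 as the leading 1.\<close>
  have Rsum: "of_real (2 * pi) * (\<Sum>s | s \<in> S \<and> \<bar>Im s\<bar> < T j. residue f s) =
      of_real (1 + 2 * (\<Sum>n<j. exp (- (pi * (real (Suc n))\<^sup>2 * t))))" for j
  proof -
    define e where "e n = exp (- (pi * t * (real_of_int n)\<^sup>2))" for n :: int
    have "(\<Sum>s | s \<in> S \<and> \<bar>Im s\<bar> < T j. residue f s) = (\<Sum>n\<in>{-int j..int j}. of_real (e n) / of_real (2 * pi))"
    proof (rule sum.reindex_bij_witness[of _ "\<lambda>n. Complex 0 (of_int n)" "\<lambda>s. \<lfloor>Im s\<rfloor>"])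
      fix s assume s: "s \<in> {s. s \<in> S \<and> \<bar>Im s\<bar> < T j}"
      then obtain n :: int where n: "s = Complex 0 (of_int n)" "\<bar>real_of_int n\<bar> < real j + 1/2"
        by (auto simp: S_def T_def)
      show "Complex 0 (of_int \<lfloor>Im s\<rfloor>) = s" using n by simp
      show "\<lfloor>Im s\<rfloor> \<in> {-int j..int j}" using n by simp linarith
      show "of_real (e \<lfloor>Im s\<rfloor>) / of_real (2 * pi) = residue f s" using n res[of n] by (simp add: e_def)
    next
      fix n assume "n \<in> {-int j..int j}"
      then show "\<lfloor>Im (Complex 0 (of_int n))\<rfloor> = n" "Complex 0 (of_int n) \<in> {s. s \<in> S \<and> \<bar>Im s\<bar> < T j}"
        by (auto simp: S_def T_def abs_if)
    qed
    also have "of_real (2 * pi) * \<dots> = of_real (\<Sum>n\<in>{-int j..int j}. e n)"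
      by (simp add: sum_divide_distrib[symmetric])
    also have "(\<Sum>n\<in>{-int j..int j}. e n) = 1 + 2 * (\<Sum>n<j. exp (- (pi * (real (Suc n))\<^sup>2 * t)))"
    proof (induction j)
      case (Suc j)
      have "{- int (Suc j)..int (Suc j)} = insert (- int (Suc j)) (insert (int (Suc j)) {-int j..int j})" by auto
      then have "(\<Sum>n\<in>{-int (Suc j)..int (Suc j)}. e n) = e (- int (Suc j)) + (e (int (Suc j)) + (\<Sum>n\<in>{-int j..int j}. e n))"
        by simp
      moreover have "e (- int (Suc j)) = exp (- (pi * (real (Suc j))\<^sup>2 * t))" "e (int (Suc j)) = exp (- (pi * (real (Suc j))\<^sup>2 * t))"
        unfolding e_def of_int_minus power2_minus by (simp_all add: mult_ac)
      ultimately show ?case using Suc by simp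
    qed (simp add: e_def)
    finally show ?thesis .
  qed
  have "(\<lambda>j. of_real (1 + 2 * (\<Sum>n<j. exp (- (pi * (real (Suc n))\<^sup>2 * t)))) :: complex) \<longlonglongrightarrow> of_real (1 + 2 * omega t)"
    unfolding omega_def using summable_LIMSEQ[OF summable_omega[OF t]]
    by (intro tendsto_of_real tendsto_add tendsto_mult tendsto_const)
  then have "of_real (1 + 2 * omega t) = (LINT y|lborel. f (Complex 1 y)) - (LINT y|lborel. f (Complex (-1) y))"
    using lim unfolding Rsum by (rule LIMSEQ_unique)
  also have "\<dots> = of_real (omega (1 / t) / sqrt t + (1 + omega (1 / t)) / sqrt t)"
    by (simp only: diff_conv_add_uminus v1 v2 of_real_add)
  finally show ?thesis unfolding of_real_eq_iff by (simp add: add_divide_distrib[symmetric] algebra_simps)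
qed

subsection \<open>Continuation of the zeta function\<close>

text \<open>A series is an integral over the counting measure, so this is the dominated parameter
  integral once more.\<close>

lemma holomorphic_on_suminf_dominated:
  fixes f :: "nat \<Rightarrow> complex \<Rightarrow> complex"
  assumes loc: "\<And>a. a \<in> U \<Longrightarrow> \<exists>r>0. \<exists>g. (\<forall>n. f n holomorphic_on ball a r) \<and>
      summable g \<and> (\<forall>s\<in>ball a r. \<forall>n. norm (f n s) \<le> g n)"
  shows "(\<lambda>s. \<Sum>n. f n s) holomorphic_on U"
proof -
  have "(\<lambda>s. LINT n|count_space UNIV. f n s) holomorphic_on U"
  proof (rule holomorphic_on_integral_dominated)
    fix a assume "a \<in> U"
    from loc[OF this] obtain r g where r: "r > 0" "\<forall>n. f n holomorphic_on ball a r" "summable g"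
      "\<forall>s\<in>ball a r. \<forall>n. norm (f n s) \<le> g n" by blast
    have "0 \<le> g n" for n using r(1,4) by (metis centre_in_ball norm_ge_zero order_trans)
    then have "integrable (count_space UNIV) g"
      using r(3) by (simp add: integrable_count_space_nat_iff)
    then show "\<exists>r>0. \<exists>g. (\<forall>s\<in>ball a r. (\<lambda>n. f n s) \<in> borel_measurable (count_space UNIV)) \<and>
      (\<forall>n\<in>space (count_space UNIV). f n holomorphic_on ball a r) \<and>
      integrable (count_space UNIV) g \<and> (\<forall>s\<in>ball a r. \<forall>n\<in>space (count_space UNIV). norm (f n s) \<le> g n)"
      using r by (intro exI[of _ r] conjI exI[of _ g]) auto
  qed
  also have "?this \<longleftrightarrow> ?thesis"
  proof (rule holomorphic_cong)
    fix a assume "a \<in> U"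
    from loc[OF this] obtain r g where r: "r > 0" "summable g"
      "\<forall>s\<in>ball a r. \<forall>n. norm (f n s) \<le> g n" by blast
    have "summable (\<lambda>n. norm (f n a))"
      by (rule summable_comparison_test'[OF r(2), of 0]) (use r in auto)
    then show "(LINT n|count_space UNIV. f n a) = (\<Sum>n. f n a)"
      by (intro integral_count_space_nat) (simp add: integrable_count_space_nat_iff)
  qed auto
  finally show ?thesis .
qed

lemma norm_nat_powr: "norm (of_nat (Suc n) powr s) = real (Suc n) powr Re s"
  by (subst norm_powr_real_powr) auto

lemma holomorphic_zeta_series: "(\<lambda>s. \<Sum>n. 1 / of_nat (Suc n) powr s :: complex) holomorphic_on {s. Re s > 1}"
proof (rule holomorphic_on_suminf_dominated)
  fix a :: complex assume "a \<in> {s. Re s > 1}"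
  then have a: "Re a > 1" by simp
  define c where "c = (1 + Re a) / 2"
  have c: "c > 1" using a by (simp add: c_def)
  have "norm (1 / of_nat (Suc n) powr s) \<le> real (Suc n) powr (-c)" if "s \<in> ball a (Re a - c)" for s n
  proof -
    have "\<bar>Re a - Re s\<bar> < Re a - c"
      using that abs_Re_le_cmod[of "a - s"] by (simp add: dist_norm)
    then have "c \<le> Re s" by linarith
    then show ?thesis
      by (simp add: norm_inverse norm_nat_powr powr_minus divide_inverse powr_mono le_imp_inverse_le del: of_nat_Suc)
  qed
  moreover have "summable (\<lambda>n. real (Suc n) powr (-c))"
    using c by (subst summable_Suc_iff) (simp add: summable_real_powr_iff)
  ultimately show "\<exists>r>0. \<exists>g. (\<forall>n. (\<lambda>s. 1 / of_nat (Suc n) powr s :: complex) holomorphic_on ball a r) \<and>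
      summable g \<and> (\<forall>s\<in>ball a r. \<forall>n. norm (1 / of_nat (Suc n) powr s) \<le> g n)"
    using a by (intro exI[of _ "Re a - c"] conjI exI[of _ "\<lambda>n. real (Suc n) powr (-c)"])
      (auto simp: c_def intro!: holomorphic_intros)
qed

lemma summable_zeta_series:
  assumes "Re s > 1"
  shows "summable (\<lambda>n. norm (1 / of_nat (Suc n) powr s :: complex))"
proof -
  have "summable (\<lambda>n. real (Suc n) powr (- Re s))"
    using assms by (subst summable_Suc_iff) (simp add: summable_real_powr_iff)
  then show ?thesis
    by (simp add: norm_inverse norm_nat_powr powr_minus divide_inverse del: of_nat_Suc)
qed

subsection \<open>The theta integral\<close>

text \<open>For \<open>t \<ge> 1\<close> the geometric majorant has ratio at most
  \<open>1/2\<close>, so it is at most twice its first term.\<close>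

lemma omega_le:
  assumes "t \<ge> 1"
  shows "omega t \<le> 2 * exp (- (pi * t))"
proof -
  define q where "q = exp (- (pi * t))"
  have "pi * t \<ge> pi * 1" using assms by (intro mult_left_mono) auto
  then have "2 \<le> 1 + pi * t" using pi_gt3 by linarith
  also have "\<dots> \<le> exp (pi * t)" by (rule exp_ge_add_one_self)
  finally have q: "0 < q" "q \<le> 1/2" by (auto simp: q_def exp_minus field_simps)
  have "omega t \<le> (\<Sum>n. q * q ^ n)"
    unfolding omega_def using assms q
    by (intro suminf_le summable_omega summable_mult summable_geometric omega_term_le[of t, folded q_def]) auto
  also have "\<dots> = q * (1 / (1 - q))"
    using q by (simp add: suminf_mult suminf_geometric summable_geometric)
  also have "\<dots> \<le> q * 2" using q by (intro mult_left_mono) (auto simp: field_simps)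
  finally show ?thesis by (simp add: q_def)
qed

lemma omega_measurable [measurable]: "omega \<in> borel_measurable borel"
  unfolding omega_def by measurable

text \<open>Riemann's integrand: the Mellin integral of \<open>omega\<close> at
  \<open>s / 2\<close>, with the part over the unit interval folded onto \<open>{1..}\<close> by
  inversion. The second power is the first one with \<open>s\<close> replaced by
  \<open>1 - s\<close>, and the cut at 1 makes the integral converge for all
  \<open>s\<close>.\<close>

definition theta_kernel :: "complex \<Rightarrow> real \<Rightarrow> complex" where
  "theta_kernel s u = indicator {1..} u *\<^sub>R
     ((of_real u powr (s / 2 - 1) + of_real u powr ((1 - s) / 2 - 1)) * of_real (omega u))"

definition theta_integral :: "complex \<Rightarrow> complex" where
  "theta_integral s = (LINT u|lborel. theta_kernel s u)"

lemma theta_kernel_measurable [measurable]: "theta_kernel s \<in> borel_measurable borel"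
  unfolding theta_kernel_def by measurable

lemma powr_omega_le:
  assumes u: "u \<ge> 1" and c: "c \<le> real n"
  shows "u powr c * omega u \<le> 2 * real n ^ n * exp (- u)"
proof -
  have "u powr c \<le> u ^ n" using assms by (subst powr_realpow[symmetric]) (auto intro: powr_mono)
  also have "\<dots> \<le> real n ^ n * exp u" using power_le_exp[of u 1 n] u by simp
  finally have "u powr c * omega u \<le> (real n ^ n * exp u) * (2 * exp (- (pi * u)))"
    using u by (intro mult_mono omega_le omega_nonneg) auto
  also have "\<dots> = 2 * real n ^ n * exp (u - pi * u)" by (simp add: exp_diff exp_minus field_simps)
  also have "\<dots> \<le> 2 * real n ^ n * exp (- u)"
  proof -
    have "2 * u \<le> pi * u" using u pi_gt3 by (intro mult_right_mono) auto
    then show ?thesis by (intro mult_left_mono) auto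
  qed
  finally show ?thesis .
qed

lemma theta_kernel_bound:
  assumes "\<bar>Re s\<bar> \<le> real n"
  shows "norm (theta_kernel s u) \<le> indicator {1..} u * (4 * real n ^ n * exp (- u))"
proof (cases "u \<ge> 1")
  case True
  have "norm (theta_kernel s u) \<le> (u powr (Re s / 2 - 1) + u powr ((1 - Re s) / 2 - 1)) * omega u"
  proof -
    have "norm ((of_real u powr (s / 2 - 1) + of_real u powr ((1 - s) / 2 - 1)) :: complex) \<le> u powr (Re s / 2 - 1) + u powr ((1 - Re s) / 2 - 1)"
      using True by (intro order_trans[OF norm_triangle_ineq]) (simp add: norm_powr_real_powr)
    then show ?thesis using True
      by (auto simp: theta_kernel_def norm_mult omega_nonneg intro!: mult_right_mono)
  qed
  also have "\<dots> \<le> 4 * real n ^ n * exp (- u)"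
  proof -
    have "Re s / 2 - 1 \<le> real n" using assms by linarith
    moreover have "(1 - Re s) / 2 - 1 \<le> real n"
    proof -
      have "- Re s \<le> real n" using assms by linarith
      moreover have "0 \<le> real n" by simp
      ultimately have "1 - Re s \<le> 2 * (real n + 1)" by argo
      then show ?thesis by (simp add: field_simps)
    qed
    ultimately show ?thesis
      using powr_omega_le[OF True, of "Re s / 2 - 1" n] powr_omega_le[OF True, of "(1 - Re s) / 2 - 1" n]
      unfolding distrib_right by linarith
  qed
  finally show ?thesis using True by simp
qed (auto simp: theta_kernel_def)

lemma integrable_indicator_exp: "integrable lborel (\<lambda>u::real. indicator {1..} u * (C * exp (- u)))"
proof -
  have "((\<lambda>x::real. exp (- x)) has_integral exp (- 1)) {1..}"
    using has_integral_exp_minus_to_infinity[of 1 1] by simp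
  then have "(\<lambda>x::real. exp (- x)) absolutely_integrable_on {1..}"
    by (subst absolutely_integrable_on_iff_nonneg) auto
  then have "integrable lebesgue (\<lambda>u::real. indicator {1..} u *\<^sub>R exp (- u))"
    by (simp add: set_integrable_def)
  then have "integrable lborel (\<lambda>u::real. indicator {1..} u *\<^sub>R exp (- u))"
    by (subst (asm) integrable_completion) auto
  then have "integrable lborel (\<lambda>u::real. C * (indicator {1..} u *\<^sub>R exp (- u)))" by simp
  then show ?thesis by (simp add: mult_ac)
qed

lemma integrable_theta_kernel: "integrable lborel (theta_kernel s)"
proof -
  obtain n :: nat where n: "\<bar>Re s\<bar> \<le> real n" using real_arch_simple by blast
  show ?thesis
    by (rule Bochner_Integration.integrable_bound[OF integrable_indicator_exp[of "4 * real n ^ n"]])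
       (auto intro!: AE_I2 order_trans[OF theta_kernel_bound[OF n]])
qed

lemma theta_integral_bound: "\<exists>C. \<forall>s. \<bar>Re s\<bar> \<le> A \<longrightarrow> norm (theta_integral s) \<le> C"
proof -
  obtain n :: nat where n: "A \<le> real n" using real_arch_simple by blast
  have "norm (theta_integral s) \<le> (LINT u|lborel. indicator {1..} u * (4 * real n ^ n * exp (- u)))"
    if "\<bar>Re s\<bar> \<le> A" for s
    unfolding theta_integral_def
    by (rule Bochner_Integration.integral_norm_bound_integral[OF integrable_theta_kernel integrable_indicator_exp])
       (use theta_kernel_bound that n in auto)
  then show ?thesis by blast
qed

lemma holomorphic_theta_integral [holomorphic_intros]: "theta_integral holomorphic_on A"
proof -
  have "theta_integral holomorphic_on UNIV"
    unfolding theta_integral_def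
  proof (rule holomorphic_on_integral_dominated)
    fix a :: complex
    obtain n :: nat where n: "\<bar>Re a\<bar> + 1 \<le> real n" using real_arch_simple by blast
    have "norm (theta_kernel s u) \<le> indicator {1..} u * (4 * real n ^ n * exp (- u))" if "s \<in> ball a 1" for s u
    proof (rule theta_kernel_bound)
      show "\<bar>Re s\<bar> \<le> real n" using that n abs_Re_le_cmod[of "a - s"] by (simp add: dist_norm)
    qed
    moreover have "(\<lambda>s. theta_kernel s u) holomorphic_on ball a 1" for u
    proof (cases "u \<ge> 1")
      case True
      then show ?thesis unfolding theta_kernel_def
        by (intro holomorphic_intros) auto
    qed (auto simp: theta_kernel_def)
    ultimately show "\<exists>r>0. \<exists>g. (\<forall>s\<in>ball a r. theta_kernel s \<in> borel_measurable lborel) \<and>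
      (\<forall>t\<in>space lborel. (\<lambda>s. theta_kernel s t) holomorphic_on ball a r) \<and>
      integrable lborel g \<and> (\<forall>s\<in>ball a r. \<forall>t\<in>space lborel. norm (theta_kernel s t) \<le> g t)"
      using integrable_indicator_exp[of "4 * real n ^ n"]
      by (intro exI[of _ 1] conjI exI[of _ "\<lambda>u. indicator {1..} u * (4 * real n ^ n * exp (- u))"]) auto
  qed
  then show ?thesis by (rule holomorphic_on_subset) auto
qed

lemma theta_integral_symmetric: "theta_integral (1 - s) = theta_integral s"
  unfolding theta_integral_def theta_kernel_def by (simp add: add.commute)

subsection \<open>Mellin transform\<close>

lemma has_bochner_integral_Gamma:
  fixes a c :: real
  assumes a: "a > 0" and c: "c > 0"
  shows "has_bochner_integral lborel (\<lambda>t::real. indicator {0<..} t * (t powr (a - 1) * exp (- (c * t)))) (Gamma a * c powr (- a))"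
proof -
  define F :: "real \<Rightarrow> real" where "F = (\<lambda>t. indicator {0<..} t * (t powr (a - 1) * exp (- t)))"
  have "has_bochner_integral lborel F (Gamma a)"
  proof (rule has_bochner_integral_nn_integral)
    have "(\<integral>\<^sup>+ t. ennreal (F t) \<partial>lborel) = (\<integral>\<^sup>+ t. ennreal (indicator {0..} t * t powr (a - 1) / exp t) \<partial>lborel)"
      by (intro nn_integral_cong arg_cong[where f = ennreal]) (auto simp: F_def indicator_def exp_minus divide_inverse)
    then show "(\<integral>\<^sup>+ t. ennreal (F t) \<partial>lborel) = ennreal (Gamma a)"
      using Gamma_conv_nn_integral_real[OF a] by simp
  qed (use a in \<open>auto simp: F_def\<close>)
  then have "has_bochner_integral lborel (\<lambda>t. F (0 + c * t)) (Gamma a /\<^sub>R \<bar>c\<bar>)"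
    using c by (subst lborel_has_bochner_integral_real_affine_iff[symmetric]) auto
  then have "has_bochner_integral lborel (\<lambda>t. c powr (1 - a) * F (0 + c * t)) (c powr (1 - a) * (Gamma a /\<^sub>R \<bar>c\<bar>))"
    by (rule has_bochner_integral_mult_right)
  also have "(\<lambda>t. c powr (1 - a) * F (0 + c * t)) = (\<lambda>t. indicator {0<..} t * (t powr (a - 1) * exp (- (c * t))))"
    using c by (auto simp: F_def fun_eq_iff indicator_def zero_less_mult_iff powr_mult powr_add[symmetric] mult.assoc[symmetric])
  also have "c powr (1 - a) * (Gamma a /\<^sub>R \<bar>c\<bar>) = Gamma a * c powr (- a)"
    using c by (simp add: powr_diff powr_minus field_simps)
  finally show ?thesis .
qed

text \<open>Termwise integration. For real exponents all terms are nonnegative, so the values of the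
  single integrals already give the absolute convergence that the exchange requires; complex
  arguments are reached afterwards by analytic continuation.\<close>

lemma mellin_omega:
  assumes a: "a > 1 / 2"
  shows "has_bochner_integral lborel (\<lambda>t. indicator {0<..} t * (t powr (a - 1) * omega t))
     (Gamma a * pi powr (- a) * (\<Sum>n. real (Suc n) powr (- (2 * a))))"
proof -
  define f where "f n t = indicator {0<..} t * (t powr (a - 1) * exp (- (pi * (real (Suc n))\<^sup>2 * t)))" for n and t :: real
  have hb: "has_bochner_integral lborel (f n) (Gamma a * pi powr (- a) * real (Suc n) powr (- (2 * a)))" for n
  proof -
    have "has_bochner_integral lborel (f n) (Gamma a * (pi * (real (Suc n))\<^sup>2) powr (- a))"
      unfolding f_def using a by (intro has_bochner_integral_Gamma) auto
    also have "(pi * (real (Suc n))\<^sup>2) powr (- a) = pi powr (- a) * real (Suc n) powr (- (2 * a))"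
      by (simp add: powr_mult powr_power powr_powr[symmetric] del: of_nat_Suc)
         (metis of_nat_0_le_iff powr_numeral powr_powr mult_minus_right)
    finally show ?thesis by (simp add: mult.assoc)
  qed
  have nn: "f n t \<ge> 0" for n t by (auto simp: f_def)
  have int: "integrable lborel (f n)" for n using hb[of n] by (simp add: has_bochner_integral_iff)
  have val: "(LINT t|lborel. f n t) = Gamma a * pi powr (- a) * real (Suc n) powr (- (2 * a))" for n
    using hb[of n] by (simp add: has_bochner_integral_iff)
  have s: "summable (\<lambda>n. real (Suc n) powr (- (2 * a)))"
    using a by (subst summable_Suc_iff) (simp add: summable_real_powr_iff)
  have AE: "AE t in lborel. summable (\<lambda>n. norm (f n t))"
  proof (rule AE_I2)
    fix t :: real
    show "summable (\<lambda>n. norm (f n t))"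
      using summable_omega[of t] nn
      by (cases "t > 0") (auto simp: f_def intro!: summable_mult)
  qed
  have sm: "summable (\<lambda>n. LINT t|lborel. norm (f n t))"
    using s nn by (simp add: val summable_mult)
  have fs: "(\<Sum>n. f n t) = indicator {0<..} t * (t powr (a - 1) * omega t)" for t
    using summable_omega[of t] by (cases "t > 0") (auto simp: f_def omega_def suminf_mult)
  have "integrable lborel (\<lambda>t. \<Sum>n. f n t)" by (rule integrable_suminf[OF int AE sm])
  moreover have "(LINT t|lborel. (\<Sum>n. f n t)) = (\<Sum>n. LINT t|lborel. f n t)" by (rule integral_suminf[OF int AE sm])
  ultimately show ?thesis
    using s by (simp add: has_bochner_integral_iff fs val suminf_mult)
qed

lemma powr_omega_integrable: "(\<lambda>u. u powr b * omega u) integrable_on {1..}"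
proof -
  obtain n :: nat where n: "b \<le> real n" using real_arch_simple by blast
  have "integrable lborel (\<lambda>u. indicator {1..} u *\<^sub>R (u powr b * omega u))"
    by (rule Bochner_Integration.integrable_bound[OF integrable_indicator_exp[of "2 * real n ^ n"]])
       (use powr_omega_le[OF _ n] in \<open>auto intro!: AE_I2 simp: indicator_def abs_mult omega_nonneg\<close>)
  then show ?thesis
    using set_borel_integral_eq_integral(1)[of "{1..}" "\<lambda>u. u powr b * omega u"] by (simp add: set_integrable_def)
qed

lemma theta_integral_real:
  "theta_integral (of_real x) = of_real (integral {1..} (\<lambda>u. u powr (x / 2 - 1) * omega u) + integral {1..} (\<lambda>u. u powr ((1 - x) / 2 - 1) * omega u))"
proof -
  define k where "k u = u powr (x / 2 - 1) * omega u + u powr ((1 - x) / 2 - 1) * omega u" for u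
  have e: "theta_kernel (of_real x) u = of_real (indicator {1..} u * k u)" for u
  proof (cases "u \<ge> 1")
    case True
    then show ?thesis
      by (simp add: theta_kernel_def k_def distrib_right powr_of_real[symmetric])
  qed (simp add: theta_kernel_def)
  have "integrable lborel (\<lambda>u. complex_of_real (indicator {1..} u * k u))"
    using integrable_theta_kernel[of "of_real x"] unfolding e[abs_def] by simp
  then have "set_integrable lborel {1..} k"
    unfolding set_integrable_def complex_of_real_integrable_eq by simp
  then have "theta_integral (of_real x) = of_real (integral {1..} k)"
    unfolding theta_integral_def e integral_complex_of_real
    by (simp add: set_borel_integral_eq_integral(2)[symmetric] set_lebesgue_integral_def)
  also have "integral {1..} k = integral {1..} (\<lambda>u. u powr (x / 2 - 1) * omega u) + integral {1..} (\<lambda>u. u powr ((1 - x) / 2 - 1) * omega u)"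
    unfolding k_def by (intro integral_add powr_omega_integrable)
  finally show ?thesis .
qed

text \<open>Riemann's computation: the part of the Mellin integral over the unit interval is carried
  to \<open>{1..}\<close> by inversion, where the theta formula turns it into an integral of the
  same kind and two elementary ones.\<close>

lemma mellin_omega_split:
  assumes x: "x > 1"
  shows "Gamma (x / 2) * pi powr (- x / 2) * (\<Sum>n. real (Suc n) powr (- x)) =
    integral {1..} (\<lambda>u. u powr (x / 2 - 1) * omega u) + integral {1..} (\<lambda>u. u powr ((1 - x) / 2 - 1) * omega u)
    + 1 / (x - 1) - 1 / x"
proof -
  define a where "a = x / 2"
  have a: "a > 1 / 2" using x by (simp add: a_def)
  define h where "h t = t powr (a - 1) * omega t" for t
  define V where "V = Gamma a * pi powr (- a) * (\<Sum>n. real (Suc n) powr (- (2 * a)))"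
  have hb: "has_bochner_integral lborel (\<lambda>t. indicator {0<..} t * h t) V"
    unfolding h_def V_def by (rule mellin_omega[OF a])
  then have si: "set_integrable lborel {0<..} h"
    by (simp add: set_integrable_def has_bochner_integral_iff)
  have hV: "h integrable_on {0<..}" "integral {0<..} h = V"
    using set_borel_integral_eq_integral[OF si] hb
    by (auto simp: set_lebesgue_integral_def has_bochner_integral_iff)
  have si1: "set_integrable lborel {0<..<1} h" and si2: "set_integrable lborel {1..} h"
    by (rule set_integrable_subset[OF si]; auto)+
  note h1 = set_borel_integral_eq_integral(1)[OF si1] and h2 = set_borel_integral_eq_integral(1)[OF si2]
  have "{0<..} = {0<..<1} \<union> {1::real..}" by auto
  then have "V = integral {0<..<1} h + integral {1..} h"
    using hV integral_Un[OF h1 h2] by (metis (no_types, lifting) Int_emptyI atLeast_iff greaterThanLessThan_iff negligible_empty not_le)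
  also have "integral {0<..<1} h = integral {1<..} (\<lambda>u. \<bar>- (1 / u\<^sup>2)\<bar> * h (1 / u))"
  proof -
    have img: "(\<lambda>u. 1 / u) ` {1<..} = {0<..<1::real}"
    proof (intro equalityI subsetI)
      fix y :: real assume "y \<in> {0<..<1}"
      then show "y \<in> (\<lambda>u. 1 / u) ` {1<..}" by (intro image_eqI[of _ _ "1 / y"]) auto
    qed auto
    have "h absolutely_integrable_on {0<..<1}"
      using h1 by (subst absolutely_integrable_on_iff_nonneg) (auto simp: h_def omega_nonneg)
    then have "h absolutely_integrable_on (\<lambda>u. 1 / u) ` {1<..} \<and>
       integral ((\<lambda>u. 1 / u) ` {1<..}) h = integral {0<..<1} h" unfolding img by simp
    then show ?thesis
      by (subst (asm) has_absolute_integral_change_of_variables_1'[symmetric, where g' = "\<lambda>u. - (1 / u\<^sup>2)"])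
        (auto intro!: derivative_eq_intros inj_onI simp: power2_eq_square)
  qed
  also have "\<dots> = integral {1..} (\<lambda>u. \<bar>- (1 / u\<^sup>2)\<bar> * h (1 / u))"
    by (rule integral_spike_set) (auto intro: negligible_subset[of "{1}"])
  also have "\<dots> = integral {1..} (\<lambda>u. u powr ((1 - x) / 2 - 1) * omega u + (1/2) * u powr (- a - 1/2) - (1/2) * u powr (- a - 1))"
  proof (rule integral_cong)
    fix u :: real assume "u \<in> {1..}"
    then have u: "u \<ge> 1" by simp
    \<comment> \<open>The inversion formula solved for the value at \<open>1 / u\<close>; its part
      without \<open>omega\<close> produces the terms \<open>1 / (x - 1)\<close> and
      \<open>- 1 / x\<close>.\<close>
    have "omega (1 / u) = sqrt u * omega u + (sqrt u - 1) / 2"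
      using theta_inversion[of u] u by (simp add: field_simps)
    then have "\<bar>- (1 / u\<^sup>2)\<bar> * h (1 / u) = u powr (-2) * u powr (1 - a) * (u powr (1/2) * omega u + (u powr (1/2) - 1) / 2)"
    proof -
      have "\<bar>- (1 / u\<^sup>2)\<bar> = u powr (-2)" using u by (simp add: powr_minus divide_inverse)
      moreover have "(1 / u) powr (a - 1) = u powr (1 - a)" using u by (simp add: powr_divide powr_diff)
      ultimately show ?thesis using \<open>omega (1 / u) = _\<close> u by (simp add: h_def powr_half_sqrt)
    qed
    also have "u powr (-2) * u powr (1 - a) = u powr (- a - 1)"
      unfolding powr_add[symmetric] by (rule arg_cong[where f = "(powr) u"]) simp
    also have "u powr (- a - 1) * (u powr (1/2) * omega u + (u powr (1/2) - 1) / 2) =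
       (u powr (- a - 1) * u powr (1/2)) * omega u + (1/2) * (u powr (- a - 1) * u powr (1/2)) - (1/2) * u powr (- a - 1)"
      by (simp add: algebra_simps diff_divide_distrib)
    also have "u powr (- a - 1) * u powr (1/2) = u powr (- a - 1/2)"
      unfolding powr_add[symmetric] by (rule arg_cong[where f = "(powr) u"]) simp
    also have "- a - 1/2 = (1 - x) / 2 - 1" by (simp add: a_def field_simps)
    finally show "\<bar>- (1 / u\<^sup>2)\<bar> * h (1 / u) = u powr ((1 - x) / 2 - 1) * omega u + (1/2) * u powr (- a - 1/2) - (1/2) * u powr (- a - 1)"
      unfolding \<open>- a - 1/2 = (1 - x) / 2 - 1\<close> .
  qed
  also have "\<dots> = integral {1..} (\<lambda>u. u powr ((1 - x) / 2 - 1) * omega u) + (1/2) * (1 / (a - 1/2)) - (1/2) * (1 / a)"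
  proof -
    have p1: "((\<lambda>u. u powr (- a - 1/2)) has_integral 1 / (a - 1/2)) {1..}"
      using has_integral_powr_to_inf[of "- a - 1/2" 1] a by (auto elim!: has_integral_eq_rhs simp: field_simps)
    have p2: "((\<lambda>u. u powr (- a - 1)) has_integral 1 / a) {1..}"
      using has_integral_powr_to_inf[of "- a - 1" 1] a by (auto elim!: has_integral_eq_rhs simp: field_simps)
    show ?thesis
      by (intro integral_unique has_integral_add has_integral_diff has_integral_mult_right p1 p2
         integrable_integral powr_omega_integrable)
  qed
  finally have "V = integral {1..} (\<lambda>u. u powr ((1 - x) / 2 - 1) * omega u) + (1/2) * (1 / (a - 1/2)) - (1/2) * (1 / a)
     + integral {1..} h" .
  moreover have "(1/2) * (1 / (a - 1/2)) = 1 / (x - 1)" "(1/2) * (1 / a) = 1 / x"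
    using x by (auto simp: a_def field_simps)
  ultimately show ?thesis by (simp add: V_def h_def[abs_def] a_def)
qed

section \<open>The entire function (s - 1) zeta(s) and the functional equation\<close>

text \<open>
  The function \<open>(s - 1) zeta(s)\<close>, obtained by solving
  \<open>pi powr (- s / 2) * Gamma (s / 2) * zeta s = theta_integral s + 1 / (s - 1) - 1 / s\<close>; the quotient
  \<open>rGamma (s / 2) / s\<close> is written as \<open>rGamma (s / 2 + 1) / 2\<close>, which is entire.
\<close>

definition zeta_entire :: "complex \<Rightarrow> complex" where
  "zeta_entire s = of_real pi powr (s / 2) *
     (rGamma (s / 2) * ((s - 1) * theta_integral s + 1) - (s - 1) * rGamma (s / 2 + 1) / 2)"

definition completed_zeta :: "complex \<Rightarrow> complex" where
  "completed_zeta s = theta_integral s + 1 / (s - 1) - 1 / s"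

text \<open>The functional equation: the kernel is symmetric, and the two elementary terms change
  places.\<close>

lemma completed_zeta_symmetric: "completed_zeta (1 - s) = completed_zeta s"
proof -
  have "1 / (1 - s - 1) = - (1 / s)" by simp
  moreover have "1 / (1 - s) = - (1 / (s - 1))"
    by (metis minus_diff_eq minus_divide_right)
  ultimately show ?thesis by (simp add: completed_zeta_def theta_integral_symmetric)
qed

lemma holomorphic_zeta_entire [holomorphic_intros]: "zeta_entire holomorphic_on A"
  unfolding zeta_entire_def by (intro holomorphic_intros) auto

lemma zeta_entire_completed:
  assumes "s \<noteq> 0" "s \<noteq> 1"
  shows "zeta_entire s / (s - 1) = of_real pi powr (s / 2) * rGamma (s / 2) * completed_zeta s"
proof -
  have r: "rGamma (s / 2) = (s / 2) * rGamma (s / 2 + 1)" by (rule rGamma_plus1[symmetric])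
  show ?thesis
    using assms unfolding zeta_entire_def completed_zeta_def r by (simp add: divide_simps) (simp add: algebra_simps)
qed

lemma zeta_entire_real:
  assumes x: "x > 1"
  shows "zeta_entire (of_real x) / (of_real x - 1) = (\<Sum>n. 1 / of_nat (Suc n) powr of_real x)"
proof -
  define D where "D = (\<Sum>n. real (Suc n) powr (- x))"
  have s: "summable (\<lambda>n. real (Suc n) powr (- x))"
    using x by (subst summable_Suc_iff) (simp add: summable_real_powr_iff)
  have t: "(1 / of_nat (Suc n) powr of_real x :: complex) = of_real (real (Suc n) powr (- x))" for n
    by (simp add: powr_minus divide_inverse powr_of_real[symmetric] del: of_nat_Suc)
  have "(\<Sum>n. 1 / of_nat (Suc n) powr of_real x :: complex) = of_real D"
    unfolding t D_def using s by (rule suminf_of_real[symmetric])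
  moreover have "completed_zeta (of_real x) = of_real (Gamma (x / 2) * pi powr (- x / 2) * D)"
    unfolding completed_zeta_def theta_integral_real D_def mellin_omega_split[OF x] by simp
  moreover have "of_real pi powr (of_real x / 2) * rGamma (of_real x / 2) * of_real (Gamma (x / 2) * pi powr (- x / 2) * D) = (of_real D :: complex)"
  proof -
    have "of_real pi powr (of_real x / 2) = (of_real (pi powr (x / 2)) :: complex)"
      using powr_of_real[of pi "x / 2"] by simp
    moreover have "rGamma (of_real x / 2) = (of_real (rGamma (x / 2)) :: complex)"
      using rGamma_complex_of_real[of "x / 2"] by simp
    moreover have "pi powr (x / 2) * rGamma (x / 2) * (Gamma (x / 2) * pi powr (- x / 2) * D) = D"
    proof -
      have "Gamma (x / 2) > 0" using x by (intro Gamma_real_pos) auto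
      then have "rGamma (x / 2) * Gamma (x / 2) = 1" by (simp add: rGamma_inverse_Gamma)
      moreover have "pi powr (x / 2) * pi powr (- x / 2) = 1"
        by (simp add: powr_add[symmetric])
      moreover have "pi powr (x / 2) * rGamma (x / 2) * (Gamma (x / 2) * pi powr (- x / 2) * D)
         = (rGamma (x / 2) * Gamma (x / 2)) * (pi powr (x / 2) * pi powr (- x / 2)) * D" by (simp add: mult_ac)
      ultimately show ?thesis by simp
    qed
    ultimately show ?thesis by (simp flip: of_real_mult)
  qed
  ultimately show ?thesis using x zeta_entire_completed[of "of_real x"] by auto
qed

text \<open>Both sides are holomorphic in the half-plane and agree on the real half-line, which
  accumulates at 2.\<close>

lemma zeta_entire_series:
  assumes s: "Re s > 1"
  shows "zeta_entire s / (s - 1) = (\<Sum>n. 1 / of_nat (Suc n) powr s)"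
proof -
  define f where "f s = zeta_entire s / (s - 1) - (\<Sum>n. 1 / of_nat (Suc n) powr s)" for s
  have "f s = 0"
  proof (rule analytic_continuation[of f "{s. Re s > 1}" "of_real ` {1<..}" 2])
    show "f holomorphic_on {s. Re s > 1}"
      unfolding f_def by (intro holomorphic_on_diff holomorphic_zeta_series holomorphic_intros) auto
    show "connected {s. Re s > 1}" by (intro convex_connected convex_halfspace_Re_gt)
    show "open {s. Re s > 1}" by (rule open_halfspace_Re_gt)
    show "(2::complex) islimpt of_real ` {1<..}"
      unfolding islimpt_sequential
    proof (intro exI conjI allI)
      show "of_real (2 + 1 / (real n + 1)) \<in> of_real ` {1<..} - {2::complex}" for n
      proof
        show "(of_real (2 + 1 / (real n + 1)) :: complex) \<in> of_real ` {1<..}"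
          by (intro imageI) (simp add: add_pos_pos)
        have "1 / (real n + 1) \<noteq> 0" by simp
        then have "2 + 1 / (real n + 1) \<noteq> 2" by linarith
        then show "(of_real (2 + 1 / (real n + 1)) :: complex) \<notin> {2}"
          by (metis of_real_eq_iff of_real_numeral singletonD)
      qed
      have "(\<lambda>n. 2 + 1 / (real n + 1)) \<longlonglongrightarrow> 2" by real_asymp
      then have "(\<lambda>n. of_real (2 + 1 / (real n + 1)) :: complex) \<longlonglongrightarrow> of_real 2" by (rule tendsto_of_real)
      then show "(\<lambda>n. of_real (2 + 1 / (real n + 1)) :: complex) \<longlonglongrightarrow> 2" by simp
    qed
    show "f z = 0" if "z \<in> of_real ` {1<..}" for z
      using that zeta_entire_real by (auto simp: f_def)
  qed (use s in auto)
  then show ?thesis by (simp add: f_def)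
qed

text \<open>This resolves the definite description: the quotient is a continuation, and the identity
  theorem on the connected punctured plane leaves no other.\<close>

lemma riemann_zeta_altdef: "riemann_zeta = (\<lambda>s. if s = 1 then 0 else zeta_entire s / (s - 1))" (is "_ = ?f")
  unfolding riemann_zeta_def
proof (rule the_equality)
  have 1: "?f holomorphic_on (- {1})"
    by (rule holomorphic_transform[of "\<lambda>s. zeta_entire s / (s - 1)"]) (auto intro!: holomorphic_intros)
  have 2: "(\<lambda>n. 1 / of_nat (Suc n) powr s) sums ?f s" if s: "Re s > 1" for s
  proof -
    have "summable (\<lambda>n. 1 / of_nat (Suc n) powr s :: complex)"
      using summable_zeta_series[OF s] by (rule summable_norm_cancel)
    then have "(\<lambda>n. 1 / of_nat (Suc n) powr s) sums (\<Sum>n. 1 / of_nat (Suc n) powr s)" by (rule summable_sums)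
    moreover have "s \<noteq> 1" using s by auto
    ultimately show ?thesis using zeta_entire_series[OF s] by simp
  qed
  show "?f holomorphic_on - {1} \<and> (\<forall>s. 1 < Re s \<longrightarrow> (\<lambda>n. 1 / of_nat (Suc n) powr s) sums ?f s) \<and> ?f 1 = 0"
    using 1 2 by simp
  fix g assume g: "g holomorphic_on - {1} \<and> (\<forall>s. 1 < Re s \<longrightarrow> (\<lambda>n. 1 / of_nat (Suc n) powr s) sums g s) \<and> g 1 = 0"
  show "g = ?f"
  proof
    fix s
    show "g s = ?f s"
    proof (cases "s = 1")
      case False
      show ?thesis
      proof (rule analytic_continuation_open[of "{s. Re s > 1}" "- {1}" g ?f])
        show "open {s. Re s > 1}" by (rule open_halfspace_Re_gt)
        have "(2::complex) \<in> {s. Re s > 1}" by simp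
        then show "{s::complex. Re s > 1} \<noteq> {}" by blast
        show "connected (- {1::complex})" by (rule connected_punctured_universe) simp
        show "g z = ?f z" if "z \<in> {s. Re s > 1}" for z
          using g 2[of z] that sums_unique2 by blast
      qed (use g 1 False in auto)
    qed (use g in simp)
  qed
qed

lemma riemann_zeta_eq: "s \<noteq> 1 \<Longrightarrow> riemann_zeta s = zeta_entire s / (s - 1)"
  by (simp add: riemann_zeta_altdef)

lemma zeta_entire_eq: "s \<noteq> 1 \<Longrightarrow> zeta_entire s = (s - 1) * riemann_zeta s"
  by (simp add: riemann_zeta_eq)

lemma holomorphic_riemann_zeta: "riemann_zeta holomorphic_on - {1}"
  unfolding riemann_zeta_altdef
  by (rule holomorphic_transform[of "\<lambda>s. zeta_entire s / (s - 1)"]) (auto intro!: holomorphic_intros)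

lemma holomorphic_riemann_zeta' [holomorphic_intros]:
  assumes "g holomorphic_on A" "\<And>z. z \<in> A \<Longrightarrow> g z \<noteq> 1"
  shows "(\<lambda>z. riemann_zeta (g z)) holomorphic_on A"
  using holomorphic_on_compose_gen[OF assms(1) holomorphic_riemann_zeta] assms(2) by (force simp: o_def)

lemma riemann_zeta_sums:
  assumes "Re s > 1"
  shows "(\<lambda>n. 1 / of_nat (Suc n) powr s) sums riemann_zeta s"
proof -
  have "summable (\<lambda>n. 1 / of_nat (Suc n) powr s :: complex)"
    using summable_zeta_series[OF assms] by (rule summable_norm_cancel)
  then have "(\<lambda>n. 1 / of_nat (Suc n) powr s) sums (\<Sum>n. 1 / of_nat (Suc n) powr s)" by (rule summable_sums)
  moreover have "s \<noteq> 1" using assms by auto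
  ultimately show ?thesis using zeta_entire_series[OF assms] by (simp add: riemann_zeta_eq)
qed

lemma zeta_entire_1: "zeta_entire 1 = 1"
proof -
  have "rGamma (1 / 2 :: complex) = 1 / of_real (sqrt pi)"
    using Gamma_one_half_complex by (simp add: rGamma_inverse_Gamma inverse_eq_divide)
  moreover have "of_real pi powr (1 / 2 :: complex) = of_real (sqrt pi)"
    using powr_of_real[of pi "1/2"] by (simp add: powr_half_sqrt)
  ultimately show ?thesis by (simp add: zeta_entire_def)
qed

lemma riemann_zeta_0: "riemann_zeta 0 = - 1 / 2"
  by (subst riemann_zeta_eq) (auto simp: zeta_entire_def)

text \<open>The argument \<open>s / 2\<close> halves the rate \<open>5/2\<close> of
  \<open>rGamma\<close> to \<open>5/4\<close>; a further \<open>1/4\<close> pays for the linear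
  factor \<open>s - 1\<close>, and the theta integral is bounded in vertical strips.\<close>

lemma zeta_entire_growth: "\<exists>C>0. \<forall>s. \<bar>Re s\<bar> \<le> A \<longrightarrow> norm (zeta_entire s) \<le> C * exp ((3/2) * \<bar>Im s\<bar>)"
proof -
  define A' where "A' = \<bar>A\<bar> + 2"
  obtain C1 where C1: "C1 > 0" "\<And>z. \<bar>Re z\<bar> \<le> A' \<Longrightarrow> norm (rGamma z) \<le> C1 * exp ((5/2) * \<bar>Im z\<bar>)"
    using norm_rGamma_strip_le[of A'] by blast
  obtain C2 where C2: "\<And>s. \<bar>Re s\<bar> \<le> A \<Longrightarrow> norm (theta_integral s) \<le> C2"
    using theta_integral_bound[of A] by blast
  define P where "P = pi powr A'"
  define L where "L = 4 * exp (A' / 4 + 1 / 4) * (\<bar>C2\<bar> + 1)"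
  have main: "norm (zeta_entire s) \<le> (P * C1 * (2 * L)) * exp ((3/2) * \<bar>Im s\<bar>)" if s: "\<bar>Re s\<bar> \<le> A" for s
  proof -
    define y where "y = \<bar>Im s\<bar>"
    have n1: "norm (s - 1) + 1 \<le> 4 * exp (A' / 4 + 1 / 4) * exp (y / 4)"
    proof -
      have "norm (s - 1) \<le> \<bar>Re (s - 1)\<bar> + \<bar>Im (s - 1)\<bar>" by (rule cmod_le)
      also have "\<dots> \<le> (\<bar>Re s\<bar> + 1) + y" unfolding y_def by (intro add_mono) auto
      finally have "norm (s - 1) + 1 \<le> A' + y" using s unfolding A'_def by (simp add: abs_le_iff) argo
      also have "\<dots> \<le> 4 * (1 + (A' / 4 + y / 4))" by simp
      also have "\<dots> \<le> 4 * exp (A' / 4 + y / 4)" by (intro mult_left_mono exp_ge_add_one_self) auto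
      also have "\<dots> \<le> 4 * exp (A' / 4 + 1 / 4 + y / 4)" by simp
      finally show ?thesis by (simp add: exp_add)
    qed
    have p: "norm (of_real pi powr (s / 2) :: complex) \<le> P"
    proof -
      have "norm (of_real pi powr (s / 2) :: complex) = pi powr (Re s / 2)"
        by (simp add: norm_powr_real_powr)
      also have "\<dots> \<le> P" unfolding P_def using s pi_gt3 by (intro powr_mono) (auto simp: A'_def)
      finally show ?thesis .
    qed
    have g1: "norm (rGamma (s / 2)) \<le> C1 * exp ((5/4) * y)"
      using C1(2)[of "s / 2"] s by (simp add: A'_def y_def)
    have g2: "norm (rGamma (s / 2 + 1)) \<le> C1 * exp ((5/4) * y)"
      using C1(2)[of "s / 2 + 1"] s by (simp add: A'_def y_def)
    have L0: "0 \<le> L" by (auto simp: L_def)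
    have a1: "norm ((s - 1) * theta_integral s + 1) \<le> L * exp (y / 4)"
    proof -
      have "norm ((s - 1) * theta_integral s + 1) \<le> norm (s - 1) * norm (theta_integral s) + 1"
        by (metis norm_mult norm_one norm_triangle_ineq)
      also have "\<dots> \<le> norm (s - 1) * (\<bar>C2\<bar> + 1) + 1 * (\<bar>C2\<bar> + 1)"
        using C2[OF s] by (intro add_mono mult_left_mono) auto
      also have "\<dots> = (norm (s - 1) + 1) * (\<bar>C2\<bar> + 1)" by (simp add: algebra_simps)
      also have "\<dots> \<le> (4 * exp (A' / 4 + 1 / 4) * exp (y / 4)) * (\<bar>C2\<bar> + 1)"
        by (intro mult_right_mono n1) auto
      finally show ?thesis by (simp add: L_def mult_ac)
    qed
    have a2: "norm ((s - 1) / 2) \<le> L * exp (y / 4)"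
    proof -
      have "norm ((s - 1) / 2) \<le> norm (s - 1) + 1" by (simp add: norm_divide)
      also have "\<dots> \<le> (4 * exp (A' / 4 + 1 / 4) * exp (y / 4)) * 1" using n1 by simp
      also have "\<dots> \<le> (4 * exp (A' / 4 + 1 / 4) * exp (y / 4)) * (\<bar>C2\<bar> + 1)" by (intro mult_left_mono) auto
      finally show ?thesis by (simp add: L_def mult_ac)
    qed
    have "norm (zeta_entire s) = norm (of_real pi powr (s / 2) :: complex) *
       norm (rGamma (s / 2) * ((s - 1) * theta_integral s + 1) - rGamma (s / 2 + 1) * ((s - 1) / 2))"
      by (simp add: zeta_entire_def norm_mult mult_ac)
    also have "\<dots> \<le> P * ((C1 * exp ((5/4) * y)) * (L * exp (y / 4)) + (C1 * exp ((5/4) * y)) * (L * exp (y / 4)))"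
    proof (intro mult_mono p)
      show "norm (rGamma (s / 2) * ((s - 1) * theta_integral s + 1) - rGamma (s / 2 + 1) * ((s - 1) / 2))
        \<le> (C1 * exp ((5/4) * y)) * (L * exp (y / 4)) + (C1 * exp ((5/4) * y)) * (L * exp (y / 4))"
        by (rule order_trans[OF norm_triangle_ineq4], unfold norm_mult, intro add_mono mult_mono g1 g2)
           (use a1 a2 C1(1) in \<open>auto simp: norm_mult\<close>)
    qed (auto simp: P_def)
    also have "\<dots> = (P * C1 * (2 * L)) * (exp ((5/4) * y) * exp (y / 4))" by (simp add: algebra_simps)
    also have "exp ((5/4) * y) * exp (y / 4) = exp ((3/2) * y)" by (simp add: exp_add[symmetric])
    finally show ?thesis by (simp add: y_def)
  qed
  show ?thesis
  proof (intro exI conjI allI impI)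
    show "0 < P * C1 * (2 * L)" using C1 by (auto simp: P_def L_def intro!: mult_pos_pos)
  qed (rule main)
qed

lemma riemann_zeta_growth:
  "\<exists>C>0. \<forall>s. \<bar>Re s\<bar> \<le> A \<and> norm (s - 1) \<ge> 1 \<longrightarrow> norm (riemann_zeta s) \<le> C * exp ((3/2) * \<bar>Im s\<bar>)"
proof -
  obtain C where C: "C > 0" "\<And>s. \<bar>Re s\<bar> \<le> A \<Longrightarrow> norm (zeta_entire s) \<le> C * exp ((3/2) * \<bar>Im s\<bar>)"
    using zeta_entire_growth[of A] by blast
  have "norm (riemann_zeta s) \<le> C * exp ((3/2) * \<bar>Im s\<bar>)" if s: "\<bar>Re s\<bar> \<le> A" "norm (s - 1) \<ge> 1" for s
  proof -
    have "norm (riemann_zeta s) = norm (zeta_entire s) / norm (s - 1)"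
      using s by (subst riemann_zeta_eq) (auto simp: norm_divide)
    also have "\<dots> \<le> norm (zeta_entire s) / 1" using s by (intro divide_left_mono) auto
    finally show ?thesis using C(2)[OF s(1)] by simp
  qed
  then show ?thesis using C(1) by blast
qed

subsection \<open>Dirichlet series of the logarithmic derivative\<close>

lemma one_plus_ln_powr_le:
  fixes x \<eta> \<sigma> :: real
  assumes x: "x \<ge> 1" and \<eta>: "\<eta> > 0"
  shows "(1 + ln x) * x powr (- \<sigma>) \<le> (1 + 1 / \<eta>) * x powr (\<eta> - \<sigma>)"
proof -
  have "ln x \<le> x powr \<eta> / \<eta>" using x \<eta> by (rule ln_powr_bound)
  moreover have "1 \<le> x powr \<eta>" using x \<eta> by (simp add: ge_one_powr_ge_zero)
  ultimately have "1 + ln x \<le> (1 + 1 / \<eta>) * x powr \<eta>" using \<eta> by (simp add: algebra_simps add_mono)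
  then have "(1 + ln x) * x powr (- \<sigma>) \<le> (1 + 1 / \<eta>) * x powr \<eta> * x powr (- \<sigma>)"
    by (intro mult_right_mono) auto
  also have "\<dots> = (1 + 1 / \<eta>) * x powr (\<eta> - \<sigma>)" by (simp add: mult.assoc powr_add[symmetric])
  finally show ?thesis .
qed

text \<open>The bound on the coefficients covers the three series that occur: coefficients 1,
  \<open>ln\<close> and the von Mangoldt function.\<close>

context
  fixes c :: "nat \<Rightarrow> complex"
  assumes c: "\<And>n. norm (c n) \<le> 1 + ln (real (Suc n))"
begin

lemma norm_dirichlet_term_le:
  assumes "\<eta> > 0" "\<sigma> \<le> Re s"
  shows "norm (c n / of_nat (Suc n) powr s) \<le> (1 + 1 / \<eta>) * real (Suc n) powr (\<eta> - \<sigma>)"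
proof -
  have "norm (c n / of_nat (Suc n) powr s) = norm (c n) * real (Suc n) powr (- Re s)"
    by (simp add: norm_mult norm_inverse norm_nat_powr powr_minus divide_inverse del: of_nat_Suc)
  also have "\<dots> \<le> (1 + ln (real (Suc n))) * real (Suc n) powr (- \<sigma>)"
    using assms by (intro mult_mono c powr_mono) auto
  also have "\<dots> \<le> (1 + 1 / \<eta>) * real (Suc n) powr (\<eta> - \<sigma>)"
    using assms by (intro one_plus_ln_powr_le) auto
  finally show ?thesis .
qed

lemma dirichlet_local_majorant:
  assumes a: "Re a > 1"
  shows "\<exists>r>0. \<exists>g. ball a r \<subseteq> {s. Re s > 1} \<and> (\<forall>n. (\<lambda>s. c n / of_nat (Suc n) powr s) holomorphic_on ball a r) \<and>
     summable g \<and> (\<forall>s\<in>ball a r. \<forall>n. norm (c n / of_nat (Suc n) powr s) \<le> g n)"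
proof -
  define \<sigma> where "\<sigma> = (1 + Re a) / 2"
  define \<eta> where "\<eta> = (\<sigma> - 1) / 2"
  define r where "r = Re a - \<sigma>"
  have p: "\<sigma> > 1" "\<eta> > 0" "\<sigma> - \<eta> > 1" "r > 0" using a by (auto simp: \<sigma>_def \<eta>_def r_def field_simps)
  have Re: "\<sigma> \<le> Re s" if "s \<in> ball a r" for s
  proof -
    have "\<bar>Re a - Re s\<bar> < Re a - \<sigma>"
      using that abs_Re_le_cmod[of "a - s"] by (simp add: dist_norm r_def)
    then show ?thesis by linarith
  qed
  have "summable (\<lambda>n. real (Suc n) powr (\<eta> - \<sigma>))"
    using p by (subst summable_Suc_iff) (simp add: summable_real_powr_iff)
  then have "summable (\<lambda>n. (1 + 1 / \<eta>) * real (Suc n) powr (\<eta> - \<sigma>))" by (rule summable_mult)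
  moreover have "(\<lambda>s. c n / of_nat (Suc n) powr s) holomorphic_on ball a r" for n
    by (intro holomorphic_intros) auto
  moreover have "s \<in> {s. Re s > 1}" if "s \<in> ball a r" for s using Re[OF that] p(1) by simp
  then have "ball a r \<subseteq> {s. Re s > 1}" by (rule subsetI)
  moreover have "norm (c n / of_nat (Suc n) powr s) \<le> (1 + 1 / \<eta>) * real (Suc n) powr (\<eta> - \<sigma>)"
    if "s \<in> ball a r" for s n
    by (rule norm_dirichlet_term_le[OF p(2) Re[OF that]])
  ultimately show ?thesis using p(4)
    by (intro exI[of _ r] exI[of _ "\<lambda>n. (1 + 1 / \<eta>) * real (Suc n) powr (\<eta> - \<sigma>)"] conjI allI ballI)
qed

lemma summable_dirichlet:
  assumes "Re s > 1"
  shows "summable (\<lambda>n. norm (c n / of_nat (Suc n) powr s))"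
proof -
  from dirichlet_local_majorant[OF assms] obtain r g where r: "r > 0" "summable g"
    "\<forall>x\<in>ball s r. \<forall>n. norm (c n / of_nat (Suc n) powr x) \<le> g n" by blast
  show ?thesis by (rule summable_comparison_test'[OF r(2), of 0]) (use r in auto)
qed

lemma holomorphic_dirichlet: "(\<lambda>s. \<Sum>n. c n / of_nat (Suc n) powr s) holomorphic_on {s. Re s > 1}"
proof (rule holomorphic_on_suminf_dominated)
  fix a :: complex assume "a \<in> {s. Re s > 1}"
  then show "\<exists>r>0. \<exists>g. (\<forall>n. (\<lambda>s. c n / of_nat (Suc n) powr s) holomorphic_on ball a r) \<and>
     summable g \<and> (\<forall>s\<in>ball a r. \<forall>n. norm (c n / of_nat (Suc n) powr s) \<le> g n)"
    using dirichlet_local_majorant[of a] by blast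
qed

end

section \<open>Unordered sums over the positive integers\<close>

lemma has_sum_atLeast_1: "(f has_sum S) {1::nat..} \<longleftrightarrow> ((\<lambda>n. f (Suc n)) has_sum S) UNIV"
proof -
  have "bij_betw Suc UNIV {1..}"
    by (intro bij_betwI[of _ _ _ "\<lambda>n. n - 1"]) auto
  then show ?thesis by (rule has_sum_reindex_bij_betw[symmetric])
qed

lemma summable_on_atLeast_1: "f summable_on {1::nat..} \<longleftrightarrow> (\<lambda>n. f (Suc n)) summable_on UNIV"
  unfolding summable_on_def has_sum_atLeast_1 ..

lemma abs_summable_on_atLeast_1:
  assumes "summable (\<lambda>n. norm (f (Suc n)))"
  shows "(\<lambda>n. norm (f n)) summable_on {1::nat..}"
  unfolding summable_on_atLeast_1 using norm_summable_imp_summable_on[of "\<lambda>n. norm (f (Suc n))"] assms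
  by simp

lemma infsum_atLeast_1:
  fixes f :: "nat \<Rightarrow> complex"
  assumes "summable (\<lambda>n. norm (f (Suc n)))"
  shows "infsum f {1..} = (\<Sum>n. f (Suc n))"
proof -
  have "((\<lambda>n. f (Suc n)) has_sum (\<Sum>n. f (Suc n))) UNIV"
    using assms by (intro norm_summable_imp_has_sum summable_sums summable_norm_cancel[of "\<lambda>n. f (Suc n)"])
  then have "(f has_sum (\<Sum>n. f (Suc n))) {1..}" unfolding has_sum_atLeast_1 .
  then show ?thesis by (rule infsumI)
qed

text \<open>Termwise differentiation, with the series read as an integral over the counting
  measure.\<close>

lemma deriv_riemann_zeta:
  assumes s: "Re s > 1"
  shows "deriv riemann_zeta s = - (\<Sum>n. of_real (ln (real (Suc n))) / of_nat (Suc n) powr s)"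
proof -
  define f where "f s n = 1 / of_nat (Suc n) powr s" for s :: complex and n
  have loc: "\<exists>r>0. \<exists>g. ball s r \<subseteq> {s. Re s > 1} \<and> (\<forall>n. (\<lambda>s. f s n) holomorphic_on ball s r) \<and>
     summable g \<and> (\<forall>x\<in>ball s r. \<forall>n. norm (f x n) \<le> g n)"
    unfolding f_def by (rule dirichlet_local_majorant[of "\<lambda>_. 1"]) (use s in auto)
  then obtain r g where r: "r > 0" "ball s r \<subseteq> {s. Re s > 1}" "\<forall>n. (\<lambda>s. f s n) holomorphic_on ball s r"
     "summable g" "\<forall>x\<in>ball s r. \<forall>n. norm (f x n) \<le> g n" by blast
  have g0: "0 \<le> g n" for n using r(1,5) by (metis centre_in_ball norm_ge_zero order_trans)
  have dd: "((\<lambda>s. LINT n|count_space UNIV. f s n) has_field_derivative (LINT n|count_space UNIV. deriv (\<lambda>s. f s n) s)) (at s)"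
    and di: "integrable (count_space UNIV) (\<lambda>n. deriv (\<lambda>s. f s n) s)"
    by (rule has_field_derivative_integral_dominated[OF r(1), where f = f and g = g];
        use r g0 in \<open>auto simp: integrable_count_space_nat_iff\<close>)+
  have df: "deriv (\<lambda>s. f s n) s = - (of_real (ln (real (Suc n))) / of_nat (Suc n) powr s)" for n
    unfolding f_def by (rule DERIV_imp_deriv)
      (auto intro!: derivative_eq_intros simp: power2_eq_square field_simps Ln_of_nat simp del: of_nat_Suc)
  have "((\<lambda>s. LINT n|count_space UNIV. f s n) has_field_derivative (- (\<Sum>n. of_real (ln (real (Suc n))) / of_nat (Suc n) powr s))) (at s)"
  proof -
    have "(LINT n|count_space UNIV. deriv (\<lambda>s. f s n) s) = (\<Sum>n. deriv (\<lambda>s. f s n) s)"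
      by (rule integral_count_space_nat[OF di])
    moreover have "summable (\<lambda>n. of_real (ln (real (Suc n))) / of_nat (Suc n) powr s :: complex)"
      using di unfolding integrable_count_space_nat_iff df norm_minus_cancel by (rule summable_norm_cancel)
    ultimately show ?thesis using dd by (simp add: df suminf_minus)
  qed
  then have "(riemann_zeta has_field_derivative (- (\<Sum>n. of_real (ln (real (Suc n))) / of_nat (Suc n) powr s))) (at s)"
  proof (rule has_field_derivative_transform_within_open[of _ _ _ "{s. Re s > 1}"])
    show "open {s. Re s > 1}" by (rule open_halfspace_Re_gt)
    fix x assume x: "x \<in> {s. Re s > 1}"
    then have "summable (\<lambda>n. norm (f x n))" using summable_zeta_series[of x] by (simp add: f_def)
    then have "(LINT n|count_space UNIV. f x n) = (\<Sum>n. f x n)"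
      by (intro integral_count_space_nat) (simp add: integrable_count_space_nat_iff)
    also have "\<dots> = riemann_zeta x"
      using riemann_zeta_sums[of x] x by (simp add: sums_iff f_def)
    finally show "(LINT n|count_space UNIV. f x n) = riemann_zeta x" .
  qed (use s in auto)
  then show ?thesis by (rule DERIV_imp_deriv)
qed

definition mangoldt_series :: "complex \<Rightarrow> complex" where
  "mangoldt_series s = (\<Sum>n. mangoldt (Suc n) / of_nat (Suc n) powr s)"

lemma norm_mangoldt_le: "norm (mangoldt (Suc n) :: complex) \<le> 1 + ln (real (Suc n))"
proof -
  have "mangoldt (Suc n) \<le> ln (real (Suc n))" by (rule mangoldt_le) simp
  then show ?thesis unfolding norm_mangoldt by linarith
qed

lemmas summable_mangoldt_series = summable_dirichlet[OF norm_mangoldt_le]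

lemma holomorphic_mangoldt_series: "mangoldt_series holomorphic_on {s. Re s > 1}"
  unfolding mangoldt_series_def using holomorphic_dirichlet[OF norm_mangoldt_le] .

text \<open>Absolute convergence allows the product to be summed over pairs \<open>(d, e)\<close>;
  these correspond to a number \<open>n = d * e\<close> with a divisor \<open>e\<close>, and the von
  Mangoldt function summed over the divisors of \<open>n\<close> is \<open>ln n\<close>.\<close>

lemma zeta_times_mangoldt_series:
  assumes s: "Re s > 1"
  shows "riemann_zeta s * mangoldt_series s = - deriv riemann_zeta s"
proof -
  define B where "B = {1::nat..}"
  define f where "f d = (1 / of_nat d powr s :: complex)" for d :: nat
  define g where "g e = (mangoldt e / of_nat e powr s :: complex)" for e :: nat
  have sf: "(\<lambda>d. norm (f d)) summable_on B" and sg: "(\<lambda>e. norm (g e)) summable_on B"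
    unfolding B_def f_def g_def
    by (rule abs_summable_on_atLeast_1, rule summable_zeta_series[OF s])
       (rule abs_summable_on_atLeast_1, rule summable_mangoldt_series[OF s])
  have vf: "infsum f B = riemann_zeta s"
    unfolding B_def using riemann_zeta_sums[OF s] summable_zeta_series[OF s]
    by (subst infsum_atLeast_1) (simp_all add: f_def sums_iff)
  have vg: "infsum g B = mangoldt_series s"
    unfolding B_def using summable_mangoldt_series[OF s]
    by (subst infsum_atLeast_1) (simp_all add: g_def mangoldt_series_def)
  have sfg: "(\<lambda>p. norm (case p of (d, e) \<Rightarrow> f d * g e)) summable_on B \<times> B"
    unfolding Infinite_Sum.abs_summable_on_Sigma_iff
  proof (intro conjI ballI)
    show "(\<lambda>y. norm (case (x, y) of (d, e) \<Rightarrow> f d * g e)) summable_on B" for x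
      using summable_on_cmult_right[OF sg, of "norm (f x)"] by (simp add: norm_mult)
    have "(\<Sum>\<^sub>\<infinity>y\<in>B. norm (case (x, y) of (d, e) \<Rightarrow> f d * g e)) = norm (f x) * (\<Sum>\<^sub>\<infinity>y\<in>B. norm (g y))" for x
      by (simp add: norm_mult infsum_cmult_right')
    then show "(\<lambda>x. norm (\<Sum>\<^sub>\<infinity>y\<in>B. norm (case (x, y) of (d, e) \<Rightarrow> f d * g e))) summable_on B"
      using summable_on_cmult_left[OF sf, of "norm (\<Sum>\<^sub>\<infinity>y\<in>B. norm (g y))"] by (simp add: norm_mult abs_mult)
  qed
  define T where "T = (SIGMA n:B. {e. e dvd n})"
  define h where "h = (\<lambda>(n::nat, e::nat). mangoldt e / of_nat n powr s :: complex)"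
  have key: "h (d * e, e) = f d * g e" if "d \<in> B" "e \<in> B" for d e
  proof -
    have "of_nat (d * e) powr s = (of_nat d powr s * of_nat e powr s :: complex)"
      using powr_times_real[of "of_nat d" "of_nat e" s] by simp
    then show ?thesis by (simp add: h_def f_def g_def)
  qed
  have T: "1 \<le> n div e" "1 \<le> e" if "1 \<le> n" "e dvd n" for n e :: nat
    using that by (auto elim!: dvdE simp: Suc_le_eq)
  have "riemann_zeta s * mangoldt_series s = (\<Sum>\<^sub>\<infinity>x\<in>B. \<Sum>\<^sub>\<infinity>y\<in>B. f x * g y)"
    by (simp add: vf[symmetric] vg[symmetric] infsum_cmult_right' infsum_cmult_left')
  also have "\<dots> = (\<Sum>\<^sub>\<infinity>(d, e)\<in>B \<times> B. f d * g e)"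
    using infsum_Sigma_banach[OF abs_summable_summable[OF sfg]] by simp
  also have "\<dots> = infsum h T"
    by (rule infsum_reindex_bij_witness[of _ "\<lambda>(n, e). (n div e, e)" "\<lambda>(d, e). (d * e, e)"])
       (use key T in \<open>auto simp: B_def T_def\<close>)
  also have "\<dots> = (\<Sum>\<^sub>\<infinity>n\<in>B. \<Sum>\<^sub>\<infinity>e\<in>{e. e dvd n}. h (n, e))"
  proof -
    have "h summable_on T \<longleftrightarrow> (\<lambda>(d, e). f d * g e) summable_on B \<times> B"
      by (rule summable_on_reindex_bij_witness[symmetric, of _ "\<lambda>(n, e). (n div e, e)" "\<lambda>(d, e). (d * e, e)"])
         (use key T in \<open>auto simp: B_def T_def\<close>)
    then have "h summable_on T" using abs_summable_summable[OF sfg] by simp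
    then show ?thesis unfolding T_def by (rule infsum_Sigma_banach[symmetric])
  qed
  also have "\<dots> = (\<Sum>\<^sub>\<infinity>n\<in>B. of_real (ln (real n)) / of_nat n powr s)"
  proof (rule infsum_cong)
    fix n assume n: "n \<in> B"
    then have "finite {e. e dvd n}" by (simp add: B_def)
    then have "(\<Sum>\<^sub>\<infinity>e\<in>{e. e dvd n}. h (n, e)) = (\<Sum>e | e dvd n. mangoldt e) / of_nat n powr s"
      by (simp add: h_def sum_divide_distrib)
    then show "(\<Sum>\<^sub>\<infinity>e\<in>{e. e dvd n}. h (n, e)) = of_real (ln (real n)) / of_nat n powr s"
      using mangoldt_sum[of n] n by (simp add: B_def)
  qed
  also have "\<dots> = (\<Sum>n. of_real (ln (real (Suc n))) / of_nat (Suc n) powr s)"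
    unfolding B_def by (rule infsum_atLeast_1, rule summable_dirichlet[OF _ s]) simp
  also have "\<dots> = - deriv riemann_zeta s" using deriv_riemann_zeta[OF s] by simp
  finally show ?thesis .
qed

text \<open>For \<open>n \<ge> 2\<close> one has \<open>1 / n ^ 4 \<le> (1/4) * (1 / n ^ 2)\<close>,
  so the terms after the first add up to at most \<open>(1/4) * (pi\<^sup>2 / 6 - 1)\<close>, which
  is below \<open>1/2\<close> by the bound 4 for pi. The bound does not depend on the imaginary
  part, so all points \<open>4 + i T\<close> can serve as centres for Jensen's argument.\<close>

lemma riemann_zeta_near_1:
  assumes s: "Re s \<ge> 4"
  shows "norm (riemann_zeta s) \<ge> 1 / 2"
proof -
  define f where "f n = 1 / of_nat (Suc n) powr s" for n
  have s1: "Re s > 1" using s by simp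
  have "f sums riemann_zeta s" unfolding f_def by (rule riemann_zeta_sums[OF s1])
  then have S: "(\<lambda>n. f (Suc n)) sums (riemann_zeta s - 1)"
    by (subst sums_Suc_iff) (simp add: f_def)
  have sn: "summable (\<lambda>n. norm (f (Suc n)))"
    using summable_zeta_series[OF s1] by (subst summable_Suc_iff) (simp add: f_def)
  have i: "(\<lambda>n. 1 / (real n + 1)\<^sup>2) sums (pi\<^sup>2 / 6)"
    using inverse_squares_sums by (simp add: add.commute)
  then have i2: "(\<lambda>n. 1 / (real (Suc n) + 1)\<^sup>2) sums (pi\<^sup>2 / 6 - 1)"
    by (subst sums_Suc_iff) simp
  have le: "norm (f (Suc n)) \<le> 1/4 * (1 / (real (Suc n) + 1)\<^sup>2)" for n
  proof -
    have "norm (f (Suc n)) = real (Suc (Suc n)) powr (- Re s)"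
      by (simp add: f_def norm_inverse norm_nat_powr powr_minus divide_inverse del: of_nat_Suc)
    also have "\<dots> \<le> real (Suc (Suc n)) powr (- 4)" using s by (intro powr_mono) auto
    also have "\<dots> = 1 / (real (Suc n) + 1) ^ 4" by (simp add: powr_minus powr_numeral divide_inverse add.commute)
    also have "\<dots> \<le> 1 / (4 * (real (Suc n) + 1)\<^sup>2)"
    proof (rule divide_left_mono)
      have "(2::real)\<^sup>2 \<le> (real (Suc n) + 1)\<^sup>2" by (intro power_mono) auto
      then have "4 * (real (Suc n) + 1)\<^sup>2 \<le> (real (Suc n) + 1)\<^sup>2 * (real (Suc n) + 1)\<^sup>2"
        by (intro mult_right_mono) auto
      also have "\<dots> = (real (Suc n) + 1) ^ 4" by (simp add: power_add[symmetric])
      finally show "4 * (real (Suc n) + 1)\<^sup>2 \<le> (real (Suc n) + 1) ^ 4" .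
    qed auto
    finally show ?thesis by simp
  qed
  have "norm (riemann_zeta s - 1) \<le> (\<Sum>n. norm (f (Suc n)))"
    using S sn by (metis sums_unique summable_norm)
  also have "\<dots> \<le> (\<Sum>n. 1/4 * (1 / (real (Suc n) + 1)\<^sup>2))"
    by (intro suminf_le le sn summable_mult sums_summable[OF i2])
  also have "\<dots> = 1/4 * (pi\<^sup>2 / 6 - 1)"
    using sums_mult[OF i2, of "1/4"] by (simp add: sums_iff)
  also have "pi\<^sup>2 \<le> 4\<^sup>2" using pi_less_4 by (intro power_mono) auto
  finally have "norm (riemann_zeta s - 1) \<le> 1 / 2" by simp
  then show ?thesis using norm_triangle_ineq3[of 1 "1 - riemann_zeta s"] by (simp add: norm_minus_commute)
qed

text \<open>The previous product formula is a linear differential equation for zeta. With a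
  primitive \<open>P\<close> of the von Mangoldt series, \<open>riemann_zeta * exp P\<close> is
  constant on the half-plane, and the constant is not 0 because of the value at 4.\<close>

lemma riemann_zeta_nonzero:
  assumes s: "Re s > 1"
  shows "riemann_zeta s \<noteq> 0"
proof -
  obtain P where P: "\<And>x. x \<in> {s. Re s > 1} \<Longrightarrow> (P has_field_derivative mangoldt_series x) (at x within {s. Re s > 1})"
    by (rule holomorphic_convex_primitive'[OF convex_halfspace_Re_gt open_halfspace_Re_gt holomorphic_mangoldt_series]) blast
  have z: "(riemann_zeta has_field_derivative deriv riemann_zeta x) (at x within {s. Re s > 1})" if "Re x > 1" for x
  proof -
    have "x \<noteq> 1" using that by auto
    then show ?thesis
      by (intro has_field_derivative_at_within[OF holomorphic_derivI[OF holomorphic_riemann_zeta]]) auto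
  qed
  have "((\<lambda>x. riemann_zeta x * exp (P x)) has_field_derivative 0) (at x within {s. Re s > 1})" if "x \<in> {s. Re s > 1}" for x
  proof -
    have "((\<lambda>x. riemann_zeta x * exp (P x)) has_field_derivative
      (deriv riemann_zeta x * exp (P x) + (exp (P x) * mangoldt_series x) * riemann_zeta x)) (at x within {s. Re s > 1})"
      by (rule DERIV_mult[OF z DERIV_chain2[OF DERIV_exp P]]) (use that in auto)
    moreover have "deriv riemann_zeta x * exp (P x) + (exp (P x) * mangoldt_series x) * riemann_zeta x = 0"
    proof -
      have "deriv riemann_zeta x = - (riemann_zeta x * mangoldt_series x)"
        using zeta_times_mangoldt_series[of x] that by simp
      then show ?thesis by simp
    qed
    ultimately show ?thesis by simp
  qed
  then have "\<exists>k. \<forall>x\<in>{s. Re s > 1}. riemann_zeta x * exp (P x) = k"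
    by (rule has_field_derivative_zero_constant[OF convex_halfspace_Re_gt])
  then obtain k where k: "\<forall>x\<in>{s. Re s > 1}. riemann_zeta x * exp (P x) = k" by blast
  have "norm (riemann_zeta 4) \<ge> 1 / 2" by (rule riemann_zeta_near_1) simp
  moreover have "riemann_zeta 4 * exp (P 4) = k" using k by simp
  ultimately have "k \<noteq> 0" by auto
  moreover have "riemann_zeta s * exp (P s) = k" using k s by simp
  ultimately show ?thesis by auto
qed

lemma M_zeta_eq_mangoldt_series:
  assumes s: "Re s > 1"
  shows "M_zeta s = mangoldt_series s"
  using zeta_times_mangoldt_series[OF s] riemann_zeta_nonzero[OF s]
  by (simp add: M_zeta_def field_simps)

subsection \<open>Trivial zeros\<close>

lemma M_zeta_eq_logderiv:
  assumes "s \<noteq> 1" "zeta_entire s \<noteq> 0"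
  shows "M_zeta s = 1 / (s - 1) - deriv zeta_entire s / zeta_entire s"
proof -
  have "((\<lambda>s. zeta_entire s / (s - 1)) has_field_derivative
     (deriv zeta_entire s * (s - 1) - zeta_entire s * 1) / ((s - 1) * (s - 1))) (at s)"
    using assms by (intro DERIV_divide holomorphic_derivI[OF holomorphic_zeta_entire[of UNIV]])
      (auto intro!: derivative_eq_intros)
  then have "(riemann_zeta has_field_derivative
     (deriv zeta_entire s * (s - 1) - zeta_entire s * 1) / ((s - 1) * (s - 1))) (at s)"
    by (rule has_field_derivative_transform_within_open[of _ _ _ "- {1}"]) (use assms in \<open>auto simp: riemann_zeta_eq\<close>)
  then have "deriv riemann_zeta s = (deriv zeta_entire s * (s - 1) - zeta_entire s) / ((s - 1) * (s - 1))"
    by (simp add: DERIV_imp_deriv)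
  then show ?thesis using assms by (simp add: M_zeta_def riemann_zeta_eq divide_simps)
qed

text \<open>The functional equation reflects the point into the half-plane where zeta has no
  zeros.\<close>

lemma completed_zeta_nonzero:
  assumes "Re s < 0"
  shows "completed_zeta s \<noteq> 0"
proof
  assume "completed_zeta s = 0"
  then have "completed_zeta (1 - s) = 0" by (simp add: completed_zeta_symmetric)
  then have "zeta_entire (1 - s) / ((1 - s) - 1) = 0"
    using assms by (subst zeta_entire_completed) auto
  then have "riemann_zeta (1 - s) = 0" using assms by (subst riemann_zeta_eq) auto
  then show False using riemann_zeta_nonzero[of "1 - s"] assms by simp
qed

text \<open>To the left of the imaginary axis the only factor that can vanish is
  \<open>rGamma (s / 2)\<close>, whose zeros are the nonpositive integers.\<close>

lemma zeta_entire_eq_0_left: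
  assumes s: "Re s < 0"
  shows "zeta_entire s = 0 \<longleftrightarrow> (\<exists>k\<ge>1. s = - of_nat (2 * k))"
proof -
  have ne: "s \<noteq> 0" "s \<noteq> 1" using s by auto
  have "zeta_entire s = (of_real pi powr (s / 2) * completed_zeta s * (s - 1)) * rGamma (s / 2)"
    using zeta_entire_completed[OF ne] ne by (simp add: field_simps)
  then have "zeta_entire s = 0 \<longleftrightarrow> rGamma (s / 2) = 0"
    using ne completed_zeta_nonzero[OF s] by simp
  also have "\<dots> \<longleftrightarrow> (\<exists>k. s / 2 = - of_nat k)"
    by (auto simp: rGamma_eq_zero_iff elim!: nonpos_Ints_cases')
  also have "\<dots> \<longleftrightarrow> (\<exists>k\<ge>1. s = - of_nat (2 * k))"
  proof
    assume "\<exists>k. s / 2 = - of_nat k"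
    then obtain k :: nat where "s / 2 = - of_nat k" by blast
    then have "s = - of_nat (2 * k)" by (simp add: field_simps)
    moreover have "k \<noteq> 0" using calculation ne by auto
    ultimately show "\<exists>k\<ge>1. s = - of_nat (2 * k)" by (intro exI[of _ k]) auto
  qed auto
  finally show ?thesis .
qed

text \<open>The zeros of \<open>rGamma\<close> are simple. So the trivial zeros are simple as well,
  and the poles of \<open>M_zeta\<close> at negative even integers have residue
  \<open>-1\<close>.\<close>

lemma deriv_zeta_entire_trivial_zero:
  assumes k: "k \<ge> 1"
  shows "deriv zeta_entire (- of_nat (2 * k)) \<noteq> 0"
proof -
  define p :: complex where "p = - of_nat (2 * k)"
  define u where "u s = of_real pi powr (s / 2) * completed_zeta s * (s - 1)" for s
  have p: "Re p < 0" using k by (simp add: p_def)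
  have uh: "u holomorphic_on {s. Re s < 0}"
    unfolding u_def completed_zeta_def by (intro holomorphic_intros) auto
  have du: "(u has_field_derivative deriv u p) (at p)"
    by (rule holomorphic_derivI[OF uh open_halfspace_Re_lt]) (use p in auto)
  have rg: "((\<lambda>s. rGamma (s / 2)) has_field_derivative ((-1) ^ k * fact k * (1 / 2))) (at p)"
  proof (rule DERIV_chain2[where f = rGamma and g = "\<lambda>s. s / 2"])
    have "p / 2 = - of_nat k" by (simp add: p_def)
    then show "(rGamma has_field_derivative (-1) ^ k * fact k) (at (p / 2))"
      using has_field_derivative_rGamma_nonpos_int[of k UNIV] by simp
    show "((\<lambda>s. s / 2) has_field_derivative 1 / 2) (at p)" by (auto intro!: derivative_eq_intros)
  qed
  have r0: "rGamma (p / 2) = 0" by (simp add: p_def rGamma_zeros)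
  have "((\<lambda>s. u s * rGamma (s / 2)) has_field_derivative (u p * ((-1) ^ k * fact k * (1 / 2)))) (at p)"
    using DERIV_mult[OF du rg] r0 by (simp add: mult_ac)
  then have "(zeta_entire has_field_derivative (u p * ((-1) ^ k * fact k * (1 / 2)))) (at p)"
  proof (rule has_field_derivative_transform_within_open[of _ _ _ "{s. Re s < 0}"])
    show "open {s. Re s < 0}" by (rule open_halfspace_Re_lt)
    show "u s * rGamma (s / 2) = zeta_entire s" if s: "s \<in> {s. Re s < 0}" for s
    proof -
      have "s \<noteq> 0" "s \<noteq> 1" using s by auto
      then show ?thesis using zeta_entire_completed[of s] by (simp add: u_def field_simps)
    qed
  qed (use p in auto)
  then have "deriv zeta_entire p = u p * ((-1) ^ k * fact k * (1 / 2))" by (rule DERIV_imp_deriv)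
  moreover have "u p \<noteq> 0" using completed_zeta_nonzero[OF p] p by (auto simp: u_def)
  then have "u p * ((-1) ^ k * fact k * (1 / 2)) \<noteq> 0" by simp
  ultimately show ?thesis unfolding p_def[symmetric] by metis
qed

lemma nontrivial_zeta_zeros_iff: "r \<in> nontrivial_zeta_zeros \<longleftrightarrow> zeta_entire r = 0 \<and> 0 \<le> Re r"
proof
  assume r: "r \<in> nontrivial_zeta_zeros"
  then have "zeta_entire r = 0" by (auto simp: nontrivial_zeta_zeros_def zeta_entire_eq)
  then show "zeta_entire r = 0 \<and> 0 \<le> Re r"
    using r zeta_entire_eq_0_left[of r] unfolding nontrivial_zeta_zeros_def
    by (metis (mono_tags, lifting) linorder_not_le mem_Collect_eq)
next
  assume r: "zeta_entire r = 0 \<and> 0 \<le> Re r"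
  then have "r \<noteq> 1" using zeta_entire_1 by auto
  moreover have "r \<noteq> - of_nat (2 * k)" if "k \<ge> 1" for k using r that by auto
  ultimately show "r \<in> nontrivial_zeta_zeros"
    using r by (auto simp: nontrivial_zeta_zeros_def riemann_zeta_eq)
qed

lemma zeta_entire_nonzero_right: "Re s > 1 \<Longrightarrow> zeta_entire s \<noteq> 0"
  using riemann_zeta_nonzero[of s] by (cases "s = 1") (auto simp: zeta_entire_eq)

lemma nontrivial_zeta_zeros_Re: "r \<in> nontrivial_zeta_zeros \<Longrightarrow> 0 \<le> Re r \<and> Re r \<le> 1"
  by (metis linorder_not_le nontrivial_zeta_zeros_iff zeta_entire_nonzero_right)

subsection \<open>The value at the origin\<close>

lemma summable_Suc_powr_2: "summable (\<lambda>n. 2 * real (Suc n) powr (-2))"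
proof (rule summable_mult)
  have "summable (\<lambda>n. real n powr (-2))" by (simp add: summable_real_powr_iff)
  then show "summable (\<lambda>n. real (Suc n) powr (-2))" by (subst summable_Suc_iff)
qed

text \<open>
  The error of the \<open>n\<close>-th summand of \<open>zeta(x)\<close> against the integral of \<open>t powr (- x)\<close> over
  \<open>[n + 1, n + 2]\<close>. The terms add up to \<open>zeta(x) - 1 / (x - 1)\<close>, and for \<open>x\<close> tending to \<open>1\<close> they
  become the terms of the series for Euler's constant.
\<close>

definition zeta_em_term :: "nat \<Rightarrow> real \<Rightarrow> real" where
  "zeta_em_term n x = real (Suc n) powr (- x) - (real (Suc n) powr (1 - x) - real (Suc (Suc n)) powr (1 - x)) / (x - 1)"

text \<open>The mean value theorem twice: the integral over the unit interval is a value
  \<open>z powr (- x)\<close> inside it, and its difference to the value at the left end is again a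
  derivative. The bound is uniform in \<open>x\<close>, as dominated convergence for
  \<open>x\<close> tending to 1 requires.\<close>

lemma zeta_em_term_bound:
  assumes x: "x \<in> {1<..2}"
  shows "\<bar>zeta_em_term n x\<bar> \<le> 2 * real (Suc n) powr (-2)"
proof -
  define a b where "a = real (Suc n)" and "b = real (Suc (Suc n))"
  have ab: "a \<ge> 1" "a < b" "b - a = 1" by (auto simp: a_def b_def)
  have "\<exists>z. a < z \<and> z < b \<and> b powr (1 - x) - a powr (1 - x) = (b - a) * ((1 - x) * z powr (1 - x - 1))"
    by (rule MVT2) (use ab in \<open>auto intro!: derivative_eq_intros\<close>)
  then obtain z where z: "a < z" "z < b" "b powr (1 - x) - a powr (1 - x) = (1 - x) * z powr (- x)"
    using ab by auto
  have "(a powr (1 - x) - b powr (1 - x)) / (x - 1) = z powr (- x)"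
    using z x by (simp add: field_simps)
  then have t: "zeta_em_term n x = a powr (- x) - z powr (- x)"
    by (simp add: zeta_em_term_def a_def b_def)
  have "\<exists>w. a < w \<and> w < z \<and> z powr (- x) - a powr (- x) = (z - a) * ((- x) * w powr (- x - 1))"
    by (rule MVT2) (use ab z in \<open>auto intro!: derivative_eq_intros\<close>)
  then obtain w where w: "a < w" "w < z" "z powr (- x) - a powr (- x) = (z - a) * ((- x) * w powr (- x - 1))"
    by blast
  have "zeta_em_term n x = (z - a) * (x * w powr (- x - 1))" using w t by simp
  then have "\<bar>zeta_em_term n x\<bar> = \<bar>z - a\<bar> * (x * w powr (- x - 1))" using x by (simp add: abs_mult)
  also have "\<dots> \<le> 1 * (2 * a powr (-2))"
  proof (intro mult_mono)
    show "\<bar>z - a\<bar> \<le> 1" using z ab by simp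
    have "w powr (- x - 1) \<le> w powr (-2)" using w ab x by (intro powr_mono) auto
    also have "\<dots> \<le> a powr (-2)" using w ab by (intro powr_mono2') auto
    finally show "w powr (- x - 1) \<le> a powr (-2)" .
  qed (use x in auto)
  finally show ?thesis by (simp add: a_def)
qed

lemma zeta_em_term_limit:
  assumes X: "\<And>m. X m \<in> {1<..2}" "X \<longlonglongrightarrow> 1"
  shows "(\<lambda>m. zeta_em_term n (X m)) \<longlonglongrightarrow> 1 / real (Suc n) + ln (real (Suc n)) - ln (real (Suc (Suc n)))"
proof -
  have L: "((\<lambda>x. (a powr (1 - x) - b powr (1 - x)) / (x - 1)) \<longlongrightarrow> ln b - ln a) (at 1)" if "a > 0" "b > 0" for a b :: real
  proof -
    have "((\<lambda>x. a powr (1 - x) - b powr (1 - x)) has_real_derivative (ln b - ln a)) (at 1)"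
      using that by (auto intro!: derivative_eq_intros)
    then show ?thesis using that by (simp add: has_field_derivative_iff)
  qed
  have "filterlim X (at 1) sequentially"
    using X(2) by (rule filterlim_atI) (use X(1) in \<open>auto simp: eventually_sequentially\<close>, metis X(1) greaterThanAtMost_iff less_irrefl)
  then have "(\<lambda>m. (real (Suc n) powr (1 - X m) - real (Suc (Suc n)) powr (1 - X m)) / (X m - 1)) \<longlonglongrightarrow> ln (real (Suc (Suc n))) - ln (real (Suc n))"
    by (rule filterlim_compose[OF L, rotated 2]) auto
  moreover have "(\<lambda>m. real (Suc n) powr (- X m)) \<longlonglongrightarrow> real (Suc n) powr (- 1)"
    by (intro tendsto_intros X) auto
  ultimately have "(\<lambda>m. zeta_em_term n (X m)) \<longlonglongrightarrow> real (Suc n) powr (- 1) - (ln (real (Suc (Suc n))) - ln (real (Suc n)))"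
    unfolding zeta_em_term_def by (intro tendsto_diff)
  then show ?thesis by (simp add: powr_minus divide_inverse algebra_simps)
qed

lemma zeta_em_sums:
  assumes x: "x > 1"
  shows "(\<lambda>n. of_real (zeta_em_term n x)) sums (riemann_zeta (of_real x) - 1 / (of_real x - 1))"
proof -
  have 1: "(\<lambda>n. of_real (real (Suc n) powr (- x))) sums riemann_zeta (of_real x)"
    using riemann_zeta_sums[of "of_real x"] x
    by (simp add: powr_minus divide_inverse powr_of_real[symmetric] del: of_nat_Suc)
  have "((\<lambda>n. real (Suc n) powr (1 - x)) \<longlongrightarrow> 0) sequentially" using x by real_asymp
  then have "(\<lambda>n. real (Suc n) powr (1 - x) - real (Suc (Suc n)) powr (1 - x)) sums (real (Suc 0) powr (1 - x) - 0)"
    by (rule telescope_sums')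
  then have "(\<lambda>n. (real (Suc n) powr (1 - x) - real (Suc (Suc n)) powr (1 - x)) / (x - 1)) sums (1 / (x - 1))"
    using sums_divide by fastforce
  then have "(\<lambda>n. of_real ((real (Suc n) powr (1 - x) - real (Suc (Suc n)) powr (1 - x)) / (x - 1)) :: complex) sums of_real (1 / (x - 1))"
    unfolding sums_of_real_iff .
  from sums_diff[OF 1 this] show ?thesis
    unfolding zeta_em_term_def by simp
qed

text \<open>Since \<open>zeta_entire 1 = 1\<close>, the difference quotient at a real
  \<open>x > 1\<close> is \<open>zeta(x) - 1 / (x - 1)\<close>, the sum of the error terms; for
  \<open>x\<close> tending to 1 they pass to the series for Euler's constant under a common
  majorant.\<close>

lemma deriv_zeta_entire_1: "deriv zeta_entire 1 = euler_mascheroni"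
proof -
  define X where "X m = 1 + 1 / (real m + 1)" for m :: nat
  have X: "X m \<in> {1<..2}" for m by (auto simp: X_def field_simps)
  have Xl: "X \<longlonglongrightarrow> 1" unfolding X_def by real_asymp
  define h where "h s = (zeta_entire s - zeta_entire 1) / (s - 1)" for s
  have "(h \<longlongrightarrow> deriv zeta_entire 1) (at 1)"
  proof -
    have "(zeta_entire has_field_derivative deriv zeta_entire 1) (at 1)"
      by (rule holomorphic_derivI[OF holomorphic_zeta_entire[of UNIV]]) auto
    then show ?thesis unfolding has_field_derivative_iff h_def .
  qed
  moreover have "filterlim (\<lambda>m. of_real (X m) :: complex) (at 1) sequentially"
  proof (rule filterlim_atI)
    show "(\<lambda>m. of_real (X m) :: complex) \<longlonglongrightarrow> 1" using tendsto_of_real[OF Xl] by simp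
    show "\<forall>\<^sub>F m in sequentially. (of_real (X m) :: complex) \<noteq> 1"
    proof (rule always_eventually, rule allI)
      fix m have "X m \<noteq> 1" using X[of m] by auto
      then show "(of_real (X m) :: complex) \<noteq> 1" by (metis of_real_eq_1_iff)
    qed
  qed
  ultimately have A: "(\<lambda>m. h (of_real (X m))) \<longlonglongrightarrow> deriv zeta_entire 1" by (rule filterlim_compose)
  have hX: "h (of_real (X m)) = (LINT n|count_space UNIV. of_real (zeta_em_term n (X m)))" for m
  proof -
    have x1: "X m > 1" using X[of m] by simp
    then have x2: "(of_real (X m) :: complex) \<noteq> 1" by (metis less_irrefl of_real_eq_1_iff)
    have "h (of_real (X m)) = riemann_zeta (of_real (X m)) - 1 / (of_real (X m) - 1)"
      using x2 by (simp add: h_def zeta_entire_1 zeta_entire_eq field_simps)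
    moreover have "summable (\<lambda>n. norm (of_real (zeta_em_term n (X m)) :: complex))"
    proof (rule summable_comparison_test'[where N = 0])
      show "summable (\<lambda>n. 2 * real (Suc n) powr (-2))"
        by (rule summable_Suc_powr_2)
    qed (use zeta_em_term_bound[OF X[of m]] in auto)
    ultimately show ?thesis
      using zeta_em_sums[OF x1] by (subst integral_count_space_nat) (auto simp: integrable_count_space_nat_iff sums_iff)
  qed
  define d where "d n = 1 / real (Suc n) + ln (real (Suc n)) - ln (real (Suc (Suc n)))" for n
  have "(\<lambda>m. LINT n|count_space UNIV. complex_of_real (zeta_em_term n (X m))) \<longlonglongrightarrow> (LINT n|count_space UNIV. complex_of_real (d n))"
  proof (rule integral_dominated_convergence[where w = "\<lambda>n. 2 * real (Suc n) powr (-2)"])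
    show "integrable (count_space UNIV) (\<lambda>n. 2 * real (Suc n) powr (-2))"
    proof -
      have "norm (2 * real (Suc n) powr (-2)) = 2 * real (Suc n) powr (-2)" for n
        unfolding real_norm_def by (rule abs_of_nonneg) simp
      then show ?thesis unfolding integrable_count_space_nat_iff using summable_Suc_powr_2 by simp
    qed
    show "AE n in count_space UNIV. (\<lambda>m. complex_of_real (zeta_em_term n (X m))) \<longlonglongrightarrow> complex_of_real (d n)"
      unfolding d_def by (intro AE_I2 tendsto_of_real zeta_em_term_limit X Xl)
    show "AE n in count_space UNIV. norm (complex_of_real (zeta_em_term n (X m))) \<le> 2 * real (Suc n) powr (-2)" for m
      by (intro AE_I2) (use zeta_em_term_bound[OF X[of m]] in simp)
  qed auto
  moreover have "(LINT n|count_space UNIV. complex_of_real (d n)) = euler_mascheroni"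
  proof -
    have d: "d sums euler_mascheroni"
      using euler_mascheroni_sum_real by (simp add: d_def[abs_def] inverse_eq_divide add.commute algebra_simps)
    have bd: "\<bar>d n\<bar> \<le> 2 * real (Suc n) powr (-2)" for n
    proof (rule LIMSEQ_le_const2)
      show "(\<lambda>m. \<bar>zeta_em_term n (X m)\<bar>) \<longlonglongrightarrow> \<bar>d n\<bar>"
        unfolding d_def by (intro tendsto_rabs zeta_em_term_limit X Xl)
    qed (use zeta_em_term_bound[OF X] in auto)
    have "summable (\<lambda>n. norm (complex_of_real (d n)))"
    proof (rule summable_comparison_test'[where N = 0])
      show "summable (\<lambda>n. 2 * real (Suc n) powr (-2))"
        by (rule summable_Suc_powr_2)
    qed (use bd in auto)
    then have "(LINT n|count_space UNIV. complex_of_real (d n)) = (\<Sum>n. complex_of_real (d n))"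
      by (intro integral_count_space_nat) (simp add: integrable_count_space_nat_iff)
    also have "\<dots> = of_real euler_mascheroni"
      using d by (simp add: sums_iff suminf_of_real[symmetric])
    finally show ?thesis by simp
  qed
  ultimately show ?thesis using A unfolding hX by (metis LIMSEQ_unique)
qed

text \<open>The product rule expresses the derivatives of \<open>zeta_entire\<close> at 0 and at 1
  through the theta integral, which by symmetry has the same value \<open>I\<close> at both points.
  The derivative at 1 is Euler's constant; this determines \<open>I\<close> and with it the
  derivative at 0. The value of Digamma at \<open>1/2\<close> contributes \<open>ln 2\<close>, the
  power of pi contributes \<open>ln pi\<close>.\<close>

lemma M_zeta_0: "M_zeta 0 = - of_real (ln (2 * pi))"
proof -
  define I where "I = theta_integral 0"
  define I' where "I' x = deriv theta_integral x" for x
  have dI: "(theta_integral has_field_derivative I' x) (at x)" for x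
    unfolding I'_def by (rule holomorphic_derivI[OF holomorphic_theta_integral[of UNIV]]) auto
  have I1: "theta_integral 1 = I" using theta_integral_symmetric[of 0] by (simp add: I_def)
  define L where "L = (of_real (ln pi) :: complex)"
  define G where "G x = rGamma (x / 2) * ((x - 1) * theta_integral x + 1) - (x - 1) * rGamma (x / 2 + 1) / 2" for x
  have ze: "zeta_entire = (\<lambda>x. exp (x / 2 * L) * G x)"
    by (auto simp: zeta_entire_def fun_eq_iff G_def powr_def L_def Ln_of_real)
  \<comment> \<open>The derivative \<open>I'\<close> of the theta integral drops out at both points:
    at 0 because \<open>rGamma 0 = 0\<close>, at 1 because of the factor
    \<open>x - 1\<close>.\<close>
  have key: "deriv zeta_entire x = zeta_entire x * (L / 2) + exp (x / 2 * L) *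
     (r1 * (1 / 2) * ((x - 1) * theta_integral x + 1) + rGamma (x / 2) * (theta_integral x + (x - 1) * I' x)
       - (rGamma (x / 2 + 1) + (x - 1) * (r2 * (1 / 2))) / 2)"
    if r1: "(rGamma has_field_derivative r1) (at (x / 2))" and r2: "(rGamma has_field_derivative r2) (at (x / 2 + 1))" for x r1 r2
  proof -
    have d1: "((\<lambda>x. rGamma (x / 2)) has_field_derivative r1 * (1 / 2)) (at x)"
      by (rule DERIV_chain2[where g = "\<lambda>x. x / 2", OF r1]) (auto intro!: derivative_eq_intros)
    have d2: "((\<lambda>x. rGamma (x / 2 + 1)) has_field_derivative r2 * (1 / 2)) (at x)"
      by (rule DERIV_chain2[where g = "\<lambda>x. x / 2 + 1", OF r2]) (auto intro!: derivative_eq_intros)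
    have "(G has_field_derivative (r1 * (1 / 2) * ((x - 1) * theta_integral x + 1) + rGamma (x / 2) * (theta_integral x + (x - 1) * I' x)
       - (rGamma (x / 2 + 1) + (x - 1) * (r2 * (1 / 2))) / 2)) (at x)"
    proof -
      have d3: "((\<lambda>x. (x - 1) * theta_integral x + 1) has_field_derivative (theta_integral x + (x - 1) * I' x)) (at x)"
        by (rule DERIV_cong, rule DERIV_add, rule DERIV_mult[OF _ dI]) (auto intro!: derivative_eq_intros simp: mult.commute)
      have d4: "((\<lambda>x. x - 1) has_field_derivative 1) (at x)" by (auto intro!: derivative_eq_intros)
      show ?thesis unfolding G_def
        by (rule DERIV_cong[OF DERIV_diff[OF DERIV_mult[OF d1 d3] DERIV_cdivide[OF DERIV_mult[OF d4 d2], of 2]]])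
           (simp add: mult_ac)
    qed
    then have "(zeta_entire has_field_derivative (exp (x / 2 * L) * (L / 2) * G x + (r1 * (1 / 2) * ((x - 1) * theta_integral x + 1) + rGamma (x / 2) * (theta_integral x + (x - 1) * I' x)
       - (rGamma (x / 2 + 1) + (x - 1) * (r2 * (1 / 2))) / 2) * exp (x / 2 * L))) (at x)"
      unfolding ze by (intro DERIV_mult) (auto intro!: derivative_eq_intros)
    then have "deriv zeta_entire x = exp (x / 2 * L) * (L / 2) * G x + (r1 * (1 / 2) * ((x - 1) * theta_integral x + 1) + rGamma (x / 2) * (theta_integral x + (x - 1) * I' x)
       - (rGamma (x / 2 + 1) + (x - 1) * (r2 * (1 / 2))) / 2) * exp (x / 2 * L)" by (rule DERIV_imp_deriv)
    then show ?thesis by (simp add: ze mult_ac)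
  qed
  define g where "g = (euler_mascheroni :: complex)"
  have e0: "deriv zeta_entire 0 = L / 4 - I / 2 + g / 4"
  proof -
    have r1: "(rGamma has_field_derivative 1) (at (0 / 2 :: complex))"
      using has_field_derivative_rGamma_nonpos_int[of 0 "UNIV :: complex set"] by simp
    have "(1 :: complex) \<notin> \<int>\<^sub>\<le>\<^sub>0" by simp
    from has_field_derivative_rGamma_no_nonpos_int[OF this, of UNIV]
    have r2: "(rGamma has_field_derivative g) (at (0 / 2 + 1 :: complex))" by (simp add: g_def)
    have z0: "zeta_entire 0 = 1 / 2" by (simp add: zeta_entire_def)
    show ?thesis
      using key[OF r1 r2] by (simp add: I_def z0 algebra_simps add_divide_distrib diff_divide_distrib)
  qed
  \<comment> \<open>The product rule at 1 with Euler's constant on the left; this is the equation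
    that eliminates \<open>I\<close>.\<close>
  have e1: "g = L / 2 + (g + of_real (2 * ln 2)) / 2 + I - 1"
  proof -
    have nn: "(1 / 2 :: complex) \<notin> \<int>\<^sub>\<le>\<^sub>0" "(1 / 2 + 1 :: complex) \<notin> \<int>\<^sub>\<le>\<^sub>0"
      by (auto elim!: nonpos_Ints_cases' simp: complex_eq_iff)
    note r1 = has_field_derivative_rGamma_no_nonpos_int[OF nn(1), of UNIV]
    note r2 = has_field_derivative_rGamma_no_nonpos_int[OF nn(2), of UNIV]
    have R1: "rGamma (1 / 2 :: complex) = 1 / of_real (sqrt pi)"
      using Gamma_one_half_complex by (simp add: rGamma_inverse_Gamma inverse_eq_divide)
    have R2: "rGamma (1 / 2 + 1 :: complex) = 2 * rGamma (1 / 2)"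
      using rGamma_plus1[of "1 / 2 :: complex"] by simp
    have D: "Digamma (1 / 2 :: complex) = - (g + of_real (2 * ln 2))"
      by (simp add: Digamma_one_half g_def)
    have E: "exp (1 / 2 * L) = of_real (sqrt pi)"
    proof -
      have "exp (1 / 2 * L) = of_real (exp (ln pi / 2))" by (simp add: L_def flip: exp_of_real)
      also have "exp (ln pi / 2) = sqrt pi"
        by (rule real_sqrt_unique[symmetric]) (simp_all add: exp_double[symmetric] power2_eq_square exp_add[symmetric] flip: exp_add)
      finally show ?thesis .
    qed
    have "g = zeta_entire 1 * (L / 2) + exp (1 / 2 * L) *
     (- rGamma (1 / 2) * Digamma (1 / 2) * (1 / 2) + rGamma (1 / 2) * I - rGamma (1 / 2 + 1) / 2)"
      using key[OF r1 r2] by (simp add: deriv_zeta_entire_1 g_def I1)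
    then have "g = L / 2 + (exp (1 / 2 * L) * rGamma (1 / 2)) * (- Digamma (1 / 2) * (1 / 2) + I - 1)"
      unfolding zeta_entire_1 R2 by (simp add: algebra_simps)
    also have "exp (1 / 2 * L) * rGamma (1 / 2) = 1" unfolding E R1 by simp
    finally show ?thesis unfolding D by (simp add: algebra_simps)
  qed
  have z0: "zeta_entire 0 = 1 / 2" by (simp add: zeta_entire_def)
  have "M_zeta 0 = - 1 - deriv zeta_entire 0 / (1 / 2)"
    by (subst M_zeta_eq_logderiv) (auto simp: z0)
  also have "\<dots> = - 1 - (L / 2 - I + g / 2)" unfolding e0 by simp
  also have "\<dots> = - (L + of_real (ln 2))" using e1 by (simp add: field_simps)
  also have "L + of_real (ln 2) = of_real (ln (2 * pi))" by (simp add: L_def ln_mult)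
  finally show ?thesis .
qed

subsection \<open>Zeros in boxes and bounds for the logarithmic derivative\<close>

text \<open>Jensen's bound and the logarithmic derivative in a disc around \<open>4 + i T\<close>,
  where zeta is bounded below. The growth of zeta is exponential in the height, so the logarithm of
  the maximum is linear in \<open>T\<close>, and one constant serves all heights.\<close>

lemma zeta_entire_local:
  assumes A: "A \<ge> 0"
  shows "\<exists>C>0. \<forall>T. \<exists>zs. (\<forall>z\<in>set zs. zeta_entire z = 0 \<and> zorder zeta_entire z = int (count_list zs z)) \<and>
    (\<forall>z. zeta_entire z = 0 \<and> \<bar>Re z\<bar> \<le> A \<and> \<bar>Im z - T\<bar> \<le> 1 \<longrightarrow> z \<in> set zs) \<and>
    real (length zs) \<le> C * (1 + \<bar>T\<bar>) \<and>
    (\<forall>s. zeta_entire s \<noteq> 0 \<and> \<bar>Re s\<bar> \<le> A \<and> \<bar>Im s - T\<bar> \<le> 1 \<longrightarrow>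
       norm (deriv zeta_entire s / zeta_entire s - (\<Sum>z\<leftarrow>zs. 1 / (s - z))) \<le> C * (1 + \<bar>T\<bar>))"
proof -
  \<comment> \<open>Chosen so that the box of half-width \<open>A\<close> and half-height 1 around
    \<open>i T\<close>, at distance at most \<open>A + 5\<close> from \<open>s0\<close>, lies in the
    disc of radius \<open>3 * r / 8 = 3 * (A + 6) / 2\<close>.\<close>
  define r where "r = 4 * (A + 6)"
  have r: "r > 0" using A by (simp add: r_def)
  obtain C0 where C0: "C0 > 0" "\<And>s. \<bar>Re s\<bar> \<le> 4 + 3 * r \<Longrightarrow> norm (zeta_entire s) \<le> C0 * exp ((3/2) * \<bar>Im s\<bar>)"
    using zeta_entire_growth[of "4 + 3 * r"] by blast
  define K where "K = \<bar>ln C0\<bar> + 3/2 + (9/2) * r"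
  have K: "K > 0" using r by (simp add: K_def add_nonneg_pos)
  define C where "C = K / ln 2 + 32 * (K + 1) / r"
  have C: "C > 0" "K / ln 2 \<le> C" "32 * (K + 1) / r \<le> C" using K r by (auto simp: C_def intro!: add_pos_pos divide_nonneg_pos)
  show ?thesis
  proof (intro exI[of _ C] conjI allI C(1))
    fix T :: real
    define s0 where "s0 = Complex 4 T"
    define B where "B = C0 * exp ((3/2) * (\<bar>T\<bar> + 3 * r))"
    have B: "norm (zeta_entire s) \<le> B" if d: "dist s0 s = 3 * r" for s
    proof -
      have "\<bar>Re (s0 - s)\<bar> \<le> 3 * r" "\<bar>Im (s0 - s)\<bar> \<le> 3 * r"
        using abs_Re_le_cmod[of "s0 - s"] abs_Im_le_cmod[of "s0 - s"] d by (auto simp: dist_norm)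
      then have *: "\<bar>Re s\<bar> \<le> 4 + 3 * r" "\<bar>Im s\<bar> \<le> \<bar>T\<bar> + 3 * r" by (auto simp: s0_def)
      have "norm (zeta_entire s) \<le> C0 * exp ((3/2) * \<bar>Im s\<bar>)" by (rule C0(2)[OF *(1)])
      also have "\<dots> \<le> B" unfolding B_def using *(2) C0(1) by (intro mult_left_mono) auto
      finally show ?thesis .
    qed
    have f1: "norm (zeta_entire s0) \<ge> 1"
    proof -
      have "norm (zeta_entire s0) = norm (s0 - 1) * norm (riemann_zeta s0)"
        by (subst zeta_entire_eq) (auto simp: s0_def complex_eq_iff norm_mult)
      also have "\<dots> \<ge> 3 * (1 / 2)"
      proof (intro mult_mono)
        show "3 \<le> norm (s0 - 1)" using abs_Re_le_cmod[of "s0 - 1"] by (simp add: s0_def)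
        show "1 / 2 \<le> norm (riemann_zeta s0)" by (rule riemann_zeta_near_1) (simp add: s0_def)
      qed auto
      finally show ?thesis by simp
    qed
    then have f0: "zeta_entire s0 \<noteq> 0" by auto
    obtain zs where zs: "set zs = {z \<in> cball s0 r. zeta_entire z = 0}"
      "2 ^ length zs \<le> B / norm (zeta_entire s0)"
      "\<And>z. z \<in> cball s0 r \<Longrightarrow> zorder zeta_entire z = int (count_list zs z)"
      "\<And>s. s \<in> ball s0 (3 * r / 8) \<Longrightarrow> zeta_entire s \<noteq> 0 \<Longrightarrow>
       norm (deriv zeta_entire s / zeta_entire s - (\<Sum>z\<leftarrow>zs. 1 / (s - z))) \<le> 32 * (ln (B / norm (zeta_entire s0)) + 1) / r"
      by (rule entire_local_logderiv[OF r holomorphic_zeta_entire f0 B]) (assumption, (rule that; assumption))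
    have B0: "B > 0" using C0 by (simp add: B_def)
    have q1: "1 \<le> B / norm (zeta_entire s0)"
      using zs(2) one_le_power[of "2::real" "length zs"] by linarith
    have "B / norm (zeta_entire s0) \<le> B / 1" using B0 f1 by (intro divide_left_mono) auto
    then have "ln (B / norm (zeta_entire s0)) \<le> ln B" using q1 B0 by (subst ln_le_cancel_iff) auto
    also have "ln B = ln C0 + (3/2) * \<bar>T\<bar> + (9/2) * r"
      using C0(1) by (simp add: B_def ln_mult)
    also have "\<dots> \<le> K * (1 + \<bar>T\<bar>)"
    proof -
      have "ln C0 * 1 \<le> \<bar>ln C0\<bar> * (1 + \<bar>T\<bar>)" by (intro mult_mono) auto
      moreover have "(9/2) * r * 1 \<le> (9/2) * r * (1 + \<bar>T\<bar>)" using r by (intro mult_left_mono) auto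
      moreover have "(3/2) * \<bar>T\<bar> \<le> (3/2) * (1 + \<bar>T\<bar>)" by simp
      ultimately show ?thesis unfolding K_def distrib_right by linarith
    qed
    finally have lnB: "ln (B / norm (zeta_entire s0)) \<le> K * (1 + \<bar>T\<bar>)" .
    have near: "s \<in> ball s0 (3 * r / 8)" if "\<bar>Re s\<bar> \<le> A" "\<bar>Im s - T\<bar> \<le> 1" for s
    proof -
      have "dist s0 s \<le> \<bar>Re (s0 - s)\<bar> + \<bar>Im (s0 - s)\<bar>" unfolding dist_norm by (rule cmod_le)
      also have "\<dots> \<le> (4 + A) + 1" using that unfolding s0_def by (intro add_mono) auto
      also have "\<dots> < 3 * r / 8" using A by (simp add: r_def)
      finally show ?thesis by simp
    qed
    have len: "real (length zs) \<le> C * (1 + \<bar>T\<bar>)"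
    proof -
      have "real (length zs) * ln 2 = ln (2 ^ length zs)" by (simp add: ln_realpow)
      also have "\<dots> \<le> ln (B / norm (zeta_entire s0))" using zs(2) q1 by (subst ln_le_cancel_iff) auto
      finally have "real (length zs) * ln 2 \<le> K * (1 + \<bar>T\<bar>)" using lnB by linarith
      then have "real (length zs) \<le> K / ln 2 * (1 + \<bar>T\<bar>)" by (simp add: field_simps)
      also have "\<dots> \<le> C * (1 + \<bar>T\<bar>)" using C by (intro mult_right_mono) auto
      finally show ?thesis .
    qed
    show "\<exists>zs. (\<forall>z\<in>set zs. zeta_entire z = 0 \<and> zorder zeta_entire z = int (count_list zs z)) \<and>
      (\<forall>z. zeta_entire z = 0 \<and> \<bar>Re z\<bar> \<le> A \<and> \<bar>Im z - T\<bar> \<le> 1 \<longrightarrow> z \<in> set zs) \<and>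
      real (length zs) \<le> C * (1 + \<bar>T\<bar>) \<and>
      (\<forall>s. zeta_entire s \<noteq> 0 \<and> \<bar>Re s\<bar> \<le> A \<and> \<bar>Im s - T\<bar> \<le> 1 \<longrightarrow>
       norm (deriv zeta_entire s / zeta_entire s - (\<Sum>z\<leftarrow>zs. 1 / (s - z))) \<le> C * (1 + \<bar>T\<bar>))"
    proof (intro exI[of _ zs] conjI allI ballI impI len)
      fix z assume "z \<in> set zs"
      then show "zeta_entire z = 0" "zorder zeta_entire z = int (count_list zs z)" using zs(1,3) by auto
    next
      fix z assume z: "zeta_entire z = 0 \<and> \<bar>Re z\<bar> \<le> A \<and> \<bar>Im z - T\<bar> \<le> 1"
      then have "z \<in> ball s0 (3 * r / 8)" by (intro near) auto
      then show "z \<in> set zs" using zs(1) z r by auto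
    next
      fix s assume s: "zeta_entire s \<noteq> 0 \<and> \<bar>Re s\<bar> \<le> A \<and> \<bar>Im s - T\<bar> \<le> 1"
      then have "s \<in> ball s0 (3 * r / 8)" by (intro near) auto
      then have "norm (deriv zeta_entire s / zeta_entire s - (\<Sum>z\<leftarrow>zs. 1 / (s - z))) \<le> 32 * (ln (B / norm (zeta_entire s0)) + 1) / r"
        using s by (intro zs(4)) auto
      also have "\<dots> \<le> 32 * (K * (1 + \<bar>T\<bar>) + 1 * (1 + \<bar>T\<bar>)) / r"
        using lnB r by (intro divide_right_mono mult_left_mono add_mono) auto
      also have "\<dots> = 32 * (K + 1) / r * (1 + \<bar>T\<bar>)" by (simp add: algebra_simps)
      also have "\<dots> \<le> C * (1 + \<bar>T\<bar>)" using C by (intro mult_right_mono) auto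
      finally show "norm (deriv zeta_entire s / zeta_entire s - (\<Sum>z\<leftarrow>zs. 1 / (s - z))) \<le> C * (1 + \<bar>T\<bar>)" .
    qed
  qed
qed

text \<open>Near height \<open>Im s\<close> the logarithmic derivative is a sum of at most
  \<open>C * (1 + |Im s|)\<close> partial fractions, each of modulus at most
  \<open>1 / \<delta>\<close>, up to an error of the same order; the pole at 1 adds one more
  fraction.\<close>

lemma M_zeta_bound:
  "\<exists>C>0. \<forall>s \<delta>. \<bar>Re s\<bar> \<le> A \<and> 0 < \<delta> \<and> \<delta> \<le> 1 \<and> \<delta> \<le> norm (s - 1) \<and> (\<forall>z. zeta_entire z = 0 \<longrightarrow> \<delta> \<le> norm (s - z)) \<longrightarrow>
     norm (M_zeta s) \<le> C * (1 + \<bar>Im s\<bar>) / \<delta>"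
proof -
  obtain C where C: "C > 0" "\<And>T. \<exists>zs. (\<forall>z\<in>set zs. zeta_entire z = 0 \<and> zorder zeta_entire z = int (count_list zs z)) \<and>
    (\<forall>z. zeta_entire z = 0 \<and> \<bar>Re z\<bar> \<le> \<bar>A\<bar> \<and> \<bar>Im z - T\<bar> \<le> 1 \<longrightarrow> z \<in> set zs) \<and>
    real (length zs) \<le> C * (1 + \<bar>T\<bar>) \<and>
    (\<forall>s. zeta_entire s \<noteq> 0 \<and> \<bar>Re s\<bar> \<le> \<bar>A\<bar> \<and> \<bar>Im s - T\<bar> \<le> 1 \<longrightarrow>
       norm (deriv zeta_entire s / zeta_entire s - (\<Sum>z\<leftarrow>zs. 1 / (s - z))) \<le> C * (1 + \<bar>T\<bar>))"
    using zeta_entire_local[of "\<bar>A\<bar>"] by (auto simp del: of_nat_Suc)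
  have "norm (M_zeta s) \<le> (1 + 2 * C) * (1 + \<bar>Im s\<bar>) / \<delta>"
    if s: "\<bar>Re s\<bar> \<le> A" "0 < \<delta>" "\<delta> \<le> 1" "\<delta> \<le> norm (s - 1)" "\<And>z. zeta_entire z = 0 \<Longrightarrow> \<delta> \<le> norm (s - z)" for s \<delta>
  proof -
    define Y where "Y = 1 + \<bar>Im s\<bar>"
    obtain zs where zs: "\<forall>z\<in>set zs. zeta_entire z = 0" "real (length zs) \<le> C * Y"
      "\<forall>x. zeta_entire x \<noteq> 0 \<and> \<bar>Re x\<bar> \<le> \<bar>A\<bar> \<and> \<bar>Im x - Im s\<bar> \<le> 1 \<longrightarrow>
       norm (deriv zeta_entire x / zeta_entire x - (\<Sum>z\<leftarrow>zs. 1 / (x - z))) \<le> C * Y"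
      using C(2)[of "Im s"] unfolding Y_def by blast
    have s0: "zeta_entire s \<noteq> 0" using s(2) s(5)[of s] by auto
    have s1: "s \<noteq> 1" using s(2,4) by auto
    define S where "S = (\<Sum>z\<leftarrow>zs. 1 / (s - z))"
    have "norm S \<le> real (length zs) / \<delta>"
      unfolding S_def using zs(1)
    proof (induction zs)
      case (Cons z zs)
      have "norm (1 / (s - z)) \<le> 1 / \<delta>"
        unfolding norm_divide norm_one using s(2) s(5)[of z] Cons.prems by (intro divide_left_mono mult_pos_pos) auto
      moreover have "norm (\<Sum>z\<leftarrow>zs. 1 / (s - z)) \<le> real (length zs) / \<delta>" using Cons by auto
      ultimately show ?case using norm_triangle_ineq[of "1 / (s - z)" "\<Sum>z\<leftarrow>zs. 1 / (s - z)"]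
        by (simp add: add_divide_distrib)
    qed auto
    also have "\<dots> \<le> C * Y / \<delta>" using zs(2) s(2) by (intro divide_right_mono) auto
    finally have S: "norm S \<le> C * Y / \<delta>" .
    have Y: "Y \<ge> 1" by (simp add: Y_def)
    have D: "norm (deriv zeta_entire s / zeta_entire s - S) \<le> C * Y / \<delta>"
    proof -
      have "norm (deriv zeta_entire s / zeta_entire s - S) \<le> C * Y"
        using zs(3) s0 s(1) unfolding S_def by auto
      also have "C * Y \<le> C * Y / \<delta>"
        using s(2,3) C(1) Y by (simp add: le_divide_eq mult_left_le)
      finally show ?thesis .
    qed
    have E: "norm (1 / (s - 1)) \<le> Y / \<delta>"
      unfolding norm_divide norm_one using s(2,4) Y by (intro frac_le) auto
    have "M_zeta s = 1 / (s - 1) - (deriv zeta_entire s / zeta_entire s - S) - S"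
      by (subst M_zeta_eq_logderiv[OF s1 s0]) simp
    also have "norm \<dots> \<le> norm (1 / (s - 1)) + norm (deriv zeta_entire s / zeta_entire s - S) + norm S"
      by (intro order_trans[OF norm_triangle_ineq4] add_mono norm_triangle_ineq4) auto
    also have "\<dots> \<le> Y / \<delta> + C * Y / \<delta> + C * Y / \<delta>" by (intro add_mono E D S)
    also have "\<dots> = (1 + 2 * C) * Y / \<delta>" by (simp add: add_divide_distrib algebra_simps)
    finally show ?thesis by (simp add: Y_def)
  qed
  moreover have "1 + 2 * C > 0" using C(1) by simp
  ultimately show ?thesis by blast
qed

text \<open>The midpoints of \<open>n + 1\<close> equal subintervals are \<open>1 / (n + 1)\<close>
  apart, so a point of \<open>H\<close> is closer than half of that to at most one of them; with at
  most \<open>n\<close> points some midpoint is free.\<close>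

lemma pigeonhole_gap:
  fixes H :: "real set" and a :: real
  assumes H: "finite H" "card H \<le> n"
  shows "\<exists>T. a \<le> T \<and> T \<le> a + 1 \<and> (\<forall>h\<in>H. 1 / (2 * (real n + 1)) \<le> \<bar>h - T\<bar>)"
proof (rule ccontr)
  assume neg: "\<not> ?thesis"
  define d where "d = 1 / (real n + 1)"
  have d: "d > 0" "(real n + 1) * d = 1" by (auto simp: d_def)
  define T where "T k = a + (real k + 1/2) * d" for k
  have "\<exists>h\<in>H. \<bar>h - T k\<bar> < d / 2" if "k \<le> n" for k
  proof -
    have "(real k + 1/2) * d \<le> (real n + 1) * d" using that d by (intro mult_right_mono) auto
    then have "a \<le> T k" "T k \<le> a + 1" using d by (auto simp: T_def)
    then have "\<not> (\<forall>h\<in>H. 1 / (2 * (real n + 1)) \<le> \<bar>h - T k\<bar>)" using neg by blast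
    moreover have "1 / (2 * (real n + 1)) = d / 2" by (simp add: d_def)
    ultimately show ?thesis by (metis not_le)
  qed
  then obtain h where h: "\<And>k. k \<le> n \<Longrightarrow> h k \<in> H \<and> \<bar>h k - T k\<bar> < d / 2" by metis
  have "inj_on h {..n}"
  proof (rule inj_onI)
    fix k l assume kl: "k \<in> {..n}" "l \<in> {..n}" "h k = h l"
    have "\<bar>h k - T k\<bar> < d / 2" "\<bar>h k - T l\<bar> < d / 2" using h[of k] h[of l] kl by auto
    then have "\<bar>T k - T l\<bar> < d" by linarith
    also have "T k - T l = (real k - real l) * d" by (simp add: T_def algebra_simps)
    finally have "\<bar>real k - real l\<bar> * d < 1 * d" using d by (simp add: abs_mult)
    then have "\<bar>real k - real l\<bar> < 1" using d by (simp only: mult_less_cancel_right_pos)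
    then show "k = l" by linarith
  qed
  moreover have "h ` {..n} \<subseteq> H" using h by auto
  ultimately have "card {..n} \<le> card H" using H(1) by (metis card_image card_mono)
  then show False using H(2) by simp
qed

text \<open>The number of zeros near height \<open>j\<close> is of order \<open>1 + j\<close>, so a
  gap of order \<open>1 / (1 + j)\<close> exists among their ordinates. Absolute values are taken so
  that one height is free above and below the real axis.\<close>

lemma zeta_entire_heights:
  "\<exists>K>0. \<forall>j::nat. \<exists>T. real j \<le> T \<and> T \<le> real j + 1 \<and>
     (\<forall>z. zeta_entire z = 0 \<and> \<bar>Re z\<bar> \<le> A \<longrightarrow> 1 / (K * (1 + real j)) \<le> \<bar>\<bar>Im z\<bar> - T\<bar>)"
proof -
  obtain C where C: "C > 0" "\<And>T. \<exists>zs. 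
    (\<forall>z. zeta_entire z = 0 \<and> \<bar>Re z\<bar> \<le> \<bar>A\<bar> \<and> \<bar>Im z - T\<bar> \<le> 1 \<longrightarrow> z \<in> set zs) \<and>
    real (length zs) \<le> C * (1 + \<bar>T\<bar>)"
    using zeta_entire_local[of "\<bar>A\<bar>"] abs_ge_zero[of A] by meson
  then obtain Z where Z: "\<And>T z. zeta_entire z = 0 \<Longrightarrow> \<bar>Re z\<bar> \<le> \<bar>A\<bar> \<Longrightarrow> \<bar>Im z - T\<bar> \<le> 1 \<Longrightarrow> z \<in> set (Z T)"
    "\<And>T. real (length (Z T)) \<le> C * (1 + \<bar>T\<bar>)" by metis
  define K where "K = 2 * (8 * C + 1)"
  have K: "K > 0" using C by (simp add: K_def)
  show ?thesis
  proof (rule exI[of _ K], intro conjI K allI)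
    fix j :: nat
    \<comment> \<open>Unit neighbourhoods of these four heights contain all ordinates whose modulus
      is between \<open>j - 1\<close> and \<open>j + 2\<close>; the other zeros are at distance at
      least 1 from any height in \<open>[j, j + 1]\<close>.\<close>
    define L where "L = Z (real j) @ Z (real j + 1) @ Z (- real j) @ Z (- (real j + 1))"
    define H where "H = (\<lambda>z. \<bar>Im z\<bar>) ` set L"
    have "card H \<le> card (set L)" unfolding H_def by (rule card_image_le) auto
    also have "\<dots> \<le> length L" by (rule card_length)
    finally have cH: "card H \<le> length L" .
    have "real (length L) = real (length (Z (real j))) + real (length (Z (real j + 1))) + real (length (Z (- real j))) + real (length (Z (- (real j + 1))))"
      by (simp add: L_def)
    also have "\<dots> \<le> C * (2 + real j) + C * (2 + real j) + C * (2 + real j) + C * (2 + real j)"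
    proof (intro add_mono)
      have *: "real (length (Z T)) \<le> C * (2 + real j)" if "\<bar>T\<bar> \<le> 1 + real j" for T
      proof -
        have "C * (1 + \<bar>T\<bar>) \<le> C * (2 + real j)" using that C(1) by (intro mult_left_mono) auto
        then show ?thesis using Z(2)[of T] by linarith
      qed
      show "real (length (Z (real j))) \<le> C * (2 + real j)" "real (length (Z (real j + 1))) \<le> C * (2 + real j)"
        "real (length (Z (- real j))) \<le> C * (2 + real j)" "real (length (Z (- (real j + 1)))) \<le> C * (2 + real j)"
        by (rule *, simp)+
    qed
    also have "\<dots> = 4 * C * (2 + real j)" by simp
    also have "\<dots> \<le> 8 * C * (1 + real j)"
      using C(1) by (simp add: algebra_simps)
    finally have len: "real (length L) \<le> 8 * C * (1 + real j)" .
    have "2 * (real (length L) + 1) \<le> 2 * (8 * C * (1 + real j) + 1 * (1 + real j))"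
      using len by (intro mult_left_mono add_mono) auto
    also have "\<dots> = K * (1 + real j)" by (simp add: K_def algebra_simps)
    finally have KL: "1 / (K * (1 + real j)) \<le> 1 / (2 * (real (length L) + 1))"
      by (intro divide_left_mono mult_pos_pos) (use K in auto)
    obtain T where T: "real j \<le> T" "T \<le> real j + 1" "\<And>h. h \<in> H \<Longrightarrow> 1 / (2 * (real (length L) + 1)) \<le> \<bar>h - T\<bar>"
      using pigeonhole_gap[OF _ cH, of "real j"] unfolding H_def by (auto simp del: of_nat_add)
    have K1: "1 / (K * (1 + real j)) \<le> 1"
    proof -
      have "1 / (2 * (real (length L) + 1)) \<le> 1 / 1" by (intro divide_left_mono) auto
      from order_trans[OF KL this] show ?thesis by simp
    qed
    show "\<exists>T. real j \<le> T \<and> T \<le> real j + 1 \<and>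
     (\<forall>z. zeta_entire z = 0 \<and> \<bar>Re z\<bar> \<le> A \<longrightarrow> 1 / (K * (1 + real j)) \<le> \<bar>\<bar>Im z\<bar> - T\<bar>)"
    proof (intro exI[of _ T] conjI T(1) T(2) allI impI)
      fix z assume z: "zeta_entire z = 0 \<and> \<bar>Re z\<bar> \<le> A"
      show "1 / (K * (1 + real j)) \<le> \<bar>\<bar>Im z\<bar> - T\<bar>"
      proof (cases "\<bar>Im z\<bar> \<in> {real j - 1..real j + 2}")
        case True
        then have "\<bar>Im z - real j\<bar> \<le> 1 \<or> \<bar>Im z - (real j + 1)\<bar> \<le> 1 \<or> \<bar>Im z - (- real j)\<bar> \<le> 1 \<or> \<bar>Im z - (- (real j + 1))\<bar> \<le> 1"
          by (auto simp: abs_le_iff abs_if split: if_splits)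
        then have "z \<in> set L" unfolding L_def using Z(1)[of z] z by auto
        then have "1 / (2 * (real (length L) + 1)) \<le> \<bar>\<bar>Im z\<bar> - T\<bar>" by (intro T(3)) (auto simp: H_def)
        then show ?thesis using KL by linarith
      next
        case False
        then have "1 \<le> \<bar>\<bar>Im z\<bar> - T\<bar>" using T(1,2) by auto
        then show ?thesis using K1 by linarith
      qed
    qed
  qed
qed

subsection \<open>Summation over the non-trivial zeros\<close>

text \<open>Near \<open>r\<close> the two functions differ by the factor \<open>1 / (s - 1)\<close>,
  which is holomorphic and nonzero there.\<close>

lemma zorder_riemann_zeta:
  assumes r: "r \<noteq> 1"
  shows "zorder riemann_zeta r = zorder zeta_entire r"
proof -
  have w: "zeta_entire 1 \<noteq> 0" by (simp add: zeta_entire_1)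
  have A: "(if zeta_entire r = 0 then zorder zeta_entire r > 0 else zorder zeta_entire r = 0) \<and>
      (\<exists>e>0. cball r e \<subseteq> UNIV \<and> zor_poly zeta_entire r holomorphic_on cball r e \<and>
      (\<forall>w\<in>cball r e. zeta_entire w = zor_poly zeta_entire r w * (w - r) ^ nat (zorder zeta_entire r) \<and> zor_poly zeta_entire r w \<noteq> 0))"
    by (rule zorder_exist_zero[OF holomorphic_zeta_entire]) (use w in auto)
  define g where "g = zor_poly zeta_entire r"
  obtain e where g: "0 < e" "g holomorphic_on cball r e"
     "\<forall>z\<in>cball r e. zeta_entire z = g z * (z - r) ^ nat (zorder zeta_entire r) \<and> g z \<noteq> 0"
    using conjunct2[OF A] unfolding g_def by blast
  have n0: "zorder zeta_entire r \<ge> 0"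
    using conjunct1[OF A] by (simp split: if_splits)
  define e' where "e' = min e (norm (r - 1))"
  show ?thesis
  proof (rule zorder_eqI[of "ball r e'" r "\<lambda>z. g z / (z - 1)"])
    have ne: "z \<noteq> 1" if "z \<in> ball r e'" for z using that by (auto simp: e'_def dist_norm)
    show "r \<in> ball r e'" using g(1) r by (simp add: e'_def)
    show "(\<lambda>z. g z / (z - 1)) holomorphic_on ball r e'"
      by (intro holomorphic_intros holomorphic_on_subset[OF g(2)]) (use ne in \<open>auto simp: e'_def\<close>)
    show "g r / (r - 1) \<noteq> 0" using g r by simp
    fix z assume z: "z \<in> ball r e'" "z \<noteq> r"
    then have "zeta_entire z = g z * (z - r) ^ nat (zorder zeta_entire r)" using g(3) by (simp add: e'_def)
    then show "riemann_zeta z = g z / (z - 1) * (z - r) powi zorder zeta_entire r"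
      using ne[OF z(1)] n0 by (simp add: riemann_zeta_eq power_int_def)
  qed auto
qed

text \<open>The zeros are grouped by the integer part \<open>k\<close> of the modulus of the
  ordinate. A group has total multiplicity at most \<open>2 * C * (1 + k)\<close>, the 2 for the two
  half-planes, against the weight \<open>exp (- c * k)\<close>.\<close>

lemma zero_sum_bounded:
  assumes c: "c > 0"
  shows "\<exists>B. \<forall>F. finite F \<and> F \<subseteq> nontrivial_zeta_zeros \<longrightarrow>
     (\<Sum>z\<in>F. \<bar>real_of_int (zorder riemann_zeta z)\<bar> * exp (- c * \<bar>Im z\<bar>)) \<le> B"
proof -
  obtain C where C: "C > 0" "\<And>T. \<exists>zs. (\<forall>z\<in>set zs. zorder zeta_entire z = int (count_list zs z)) \<and>
    (\<forall>z. zeta_entire z = 0 \<and> \<bar>Re z\<bar> \<le> 1 \<and> \<bar>Im z - T\<bar> \<le> 1 \<longrightarrow> z \<in> set zs) \<and>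
    real (length zs) \<le> C * (1 + \<bar>T\<bar>)"
    using zeta_entire_local[of 1] zero_le_one by meson
  then obtain Z where Z: "\<And>T z. z \<in> set (Z T) \<Longrightarrow> zorder zeta_entire z = int (count_list (Z T) z)"
    "\<And>T z. zeta_entire z = 0 \<Longrightarrow> \<bar>Re z\<bar> \<le> 1 \<Longrightarrow> \<bar>Im z - T\<bar> \<le> 1 \<Longrightarrow> z \<in> set (Z T)"
    "\<And>T. real (length (Z T)) \<le> C * (1 + \<bar>T\<bar>)" by metis
  define a where "a z = \<bar>real_of_int (zorder riemann_zeta z)\<bar>" for z
  define w where "w k = 2 * C * (1 + real k) * exp (- c * real k)" for k :: nat
  have sw: "summable w"
  proof (rule summable_comparison_test'[where N = 0])
    define q where "q = exp (- (c / 2))"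
    show "summable (\<lambda>k. 2 * C * (1 / (c / 2)) * exp (c / 2) * q ^ k)"
      using c by (intro summable_mult summable_geometric) (simp add: q_def)
    fix k :: nat
    have "1 + real k \<le> (1 / (c / 2)) * exp (c / 2 * (1 + real k))"
      using power_le_exp[of "1 + real k" "c / 2" 1] c by simp
    then have "(1 + real k) * exp (- c * real k) \<le> ((1 / (c / 2)) * exp (c / 2 * (1 + real k))) * exp (- c * real k)"
      by (intro mult_right_mono) auto
    also have "\<dots> = (1 / (c / 2)) * (exp (c / 2 * (1 + real k)) * exp (- c * real k))" by simp
    also have "exp (c / 2 * (1 + real k)) * exp (- c * real k) = exp (c / 2) * q ^ k"
      unfolding q_def exp_of_nat_mult[symmetric] exp_add[symmetric] by (rule arg_cong[where f = exp]) (simp add: field_simps)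
    finally have "2 * C * ((1 + real k) * exp (- c * real k)) \<le> 2 * C * ((1 / (c / 2)) * (exp (c / 2) * q ^ k))"
      using C(1) by (intro mult_left_mono) auto
    moreover have "norm (w k) = 2 * C * ((1 + real k) * exp (- c * real k))"
      using C(1) by (simp add: w_def abs_mult)
    ultimately show "norm (w k) \<le> 2 * C * (1 / (c / 2)) * exp (c / 2) * q ^ k"
      by (simp only: mult.assoc)
  qed
  have w0: "w k \<ge> 0" for k using C(1) by (simp add: w_def)
  have "(\<Sum>z\<in>F. a z * exp (- c * \<bar>Im z\<bar>)) \<le> suminf w" if F: "finite F" "F \<subseteq> nontrivial_zeta_zeros" for F
  proof -
    define \<kappa> where "\<kappa> z = nat \<lfloor>\<bar>Im z\<bar>\<rfloor>" for z :: complex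
    have \<kappa>: "real (\<kappa> z) \<le> \<bar>Im z\<bar>" "\<bar>Im z\<bar> \<le> real (\<kappa> z) + 1" for z
      unfolding \<kappa>_def by linarith+
    have blk: "(\<Sum>z\<in>{z\<in>F. \<kappa> z = k}. a z * exp (- c * \<bar>Im z\<bar>)) \<le> w k" for k
    proof -
      define S where "S = {z\<in>F. \<kappa> z = k}"
      have sub: "S \<subseteq> set (Z (real k)) \<union> set (Z (- real k))"
      proof
        fix z assume z: "z \<in> S"
        then have "z \<in> nontrivial_zeta_zeros" using F by (auto simp: S_def)
        then have "zeta_entire z = 0" "\<bar>Re z\<bar> \<le> 1"
          using nontrivial_zeta_zeros_Re[of z] by (auto simp: nontrivial_zeta_zeros_iff)
        moreover have "\<bar>Im z - real k\<bar> \<le> 1 \<or> \<bar>Im z - (- real k)\<bar> \<le> 1"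
          using \<kappa>[of z] z by (auto simp: S_def)
        ultimately show "z \<in> set (Z (real k)) \<union> set (Z (- real k))" using Z(2) by blast
      qed
      have az: "a z = real (count_list (Z T) z)" if "z \<in> set (Z T)" "z \<in> S" for z T
      proof -
        have "z \<in> nontrivial_zeta_zeros" using F that by (auto simp: S_def)
        then have "z \<noteq> 1" by (auto simp: nontrivial_zeta_zeros_def)
        then show ?thesis using Z(1)[OF that(1)] by (simp add: a_def zorder_riemann_zeta)
      qed
      \<comment> \<open>The orders are the multiplicities in the list, so summed over distinct zeros
        they do not exceed its length.\<close>
      have cnt: "(\<Sum>z\<in>S \<inter> set (Z T). a z) \<le> C * (1 + \<bar>T\<bar>)" for T
      proof -
        have "(\<Sum>z\<in>S \<inter> set (Z T). a z) = (\<Sum>z\<in>S \<inter> set (Z T). real (count_list (Z T) z))"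
          by (intro sum.cong) (auto simp: az)
        also have "\<dots> \<le> (\<Sum>z\<in>set (Z T). real (count_list (Z T) z))" by (intro sum_mono2) auto
        also have "\<dots> = real (length (Z T))" using sum_count_set[of "Z T" "set (Z T)"] by (simp flip: of_nat_sum)
        finally show ?thesis using Z(3)[of T] by linarith
      qed
      have "(\<Sum>z\<in>S. a z * exp (- c * \<bar>Im z\<bar>)) \<le> (\<Sum>z\<in>S. a z * exp (- c * real k))"
        using \<kappa>(1) c by (intro sum_mono mult_left_mono) (auto simp: S_def a_def)
      also have "\<dots> = (\<Sum>z\<in>S. a z) * exp (- c * real k)" by (rule sum_distrib_right[symmetric])
      also have "(\<Sum>z\<in>S. a z) \<le> (\<Sum>z\<in>S \<inter> set (Z (real k)). a z) + (\<Sum>z\<in>S \<inter> set (Z (- real k)). a z)"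
      proof -
        have "S = (S \<inter> set (Z (real k))) \<union> (S \<inter> set (Z (- real k)))" using sub by blast
        then have "(\<Sum>z\<in>S. a z) = sum a ((S \<inter> set (Z (real k))) \<union> (S \<inter> set (Z (- real k))))" by metis
        also have "\<dots> \<le> sum a (S \<inter> set (Z (real k))) + sum a (S \<inter> set (Z (- real k)))"
          by (subst sum.union_inter[symmetric]) (auto simp: a_def intro!: sum_nonneg)
        finally show ?thesis .
      qed
      also have "\<dots> \<le> C * (1 + real k) + C * (1 + real k)"
        using cnt[of "real k"] cnt[of "- real k"] by simp
      finally show ?thesis unfolding S_def w_def by (simp add: mult_right_mono mult_ac)
    qed
    have "(\<Sum>z\<in>F. a z * exp (- c * \<bar>Im z\<bar>)) = (\<Sum>k\<in>\<kappa> ` F. \<Sum>z\<in>{z\<in>F. \<kappa> z = k}. a z * exp (- c * \<bar>Im z\<bar>))"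
      by (rule sum.image_gen[OF F(1)])
    also have "\<dots> \<le> (\<Sum>k\<in>\<kappa> ` F. w k)" by (intro sum_mono blk)
    also have "\<dots> \<le> suminf w" using F(1) w0 by (intro sum_le_suminf sw) auto
    finally show ?thesis .
  qed
  then show ?thesis unfolding a_def by blast
qed

lemma finite_nontrivial_zeros: "finite {z \<in> nontrivial_zeta_zeros. \<bar>Im z\<bar> \<le> T}"
proof -
  have "finite {z \<in> cbox (Complex 0 (-T)) (Complex 1 T). zeta_entire z = 0}"
  proof (rule holomorphic_compact_finite_zeros[of _ UNIV])
    show "\<not> zeta_entire constant_on UNIV"
    proof
      assume "zeta_entire constant_on UNIV"
      then obtain y where y: "\<And>x. zeta_entire x = y" unfolding constant_on_def by blast
      have "zeta_entire (- of_nat (2 * 1)) = 0" by (subst zeta_entire_eq_0_left) auto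
      then show False using zeta_entire_1 y by simp
    qed
  qed (auto intro!: holomorphic_intros)
  then show ?thesis
    by (rule finite_subset[rotated])
       (use nontrivial_zeta_zeros_Re in \<open>auto simp: in_cbox_complex_iff nontrivial_zeta_zeros_iff abs_le_iff\<close>)
qed

subsection \<open>Integrals along vertical lines\<close>

lemma integrable_exp_abs:
  assumes c: "c > 0"
  shows "integrable lborel (\<lambda>t::real. C * exp (- c * \<bar>t\<bar>))"
proof -
  define g where "g t = indicator {0..} t *\<^sub>R exp (- c * t)" for t :: real
  have "((\<lambda>x::real. exp (- c * x)) has_integral exp (- c * 0) / c) {0..}"
    by (rule has_integral_exp_minus_to_infinity[OF c])
  then have "(\<lambda>x::real. exp (- c * x)) absolutely_integrable_on {0..}"
    by (subst absolutely_integrable_on_iff_nonneg) auto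
  then have "integrable lebesgue g"
    by (simp add: set_integrable_def g_def[abs_def])
  then have g: "integrable lborel g"
    unfolding g_def by (subst (asm) integrable_completion) auto
  then have g': "integrable lborel (\<lambda>t. g (0 + (-1) * t))"
    by (subst lborel_integrable_real_affine_iff) auto
  have "integrable lborel (\<lambda>t::real. exp (- c * \<bar>t\<bar>))"
    by (rule Bochner_Integration.integrable_bound[OF Bochner_Integration.integrable_add[OF g g']])
       (auto simp: g_def indicator_def intro!: AE_I2)
  then show ?thesis by simp
qed

lemma continuous_on_Complex_line: "continuous_on A (\<lambda>t. Complex c t)"
  unfolding Complex_eq by (intro continuous_intros)

text \<open>Compactness bounds the function on the middle part of the line, the hypothesis bounds it
  outside; the weight \<open>exp (d * |t|)\<close> brings both into one majorant, uniform for
  parameters in a compact set.\<close>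

lemma line_dominated:
  fixes f :: "'a::metric_space \<Rightarrow> complex \<Rightarrow> complex"
  assumes K: "compact K" and cont: "continuous_on (K \<times> {z. Re z = c}) (\<lambda>p. f (fst p) (snd p))"
    and dec: "\<And>s z. s \<in> K \<Longrightarrow> Re z = c \<Longrightarrow> \<bar>Im z\<bar> \<ge> R \<Longrightarrow> norm (f s z) \<le> C * exp (- d * \<bar>Im z\<bar>)"
  shows "\<exists>C'>0. \<forall>s\<in>K. \<forall>t. norm (f s (Complex c t)) \<le> C' * exp (- d * \<bar>t\<bar>)"
proof -
  define g where "g p = norm (f (fst p) (Complex c (snd p))) * exp (d * \<bar>snd p\<bar>)" for p :: "'a \<times> real"
  have "continuous_on (K \<times> {-\<bar>R\<bar>..\<bar>R\<bar>}) (\<lambda>p. f (fst p) (Complex c (snd p)))"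
  proof (rule continuous_on_compose2[OF cont, of _ "\<lambda>p. (fst p, Complex c (snd p))", simplified])
    show "continuous_on (K \<times> {-\<bar>R\<bar>..\<bar>R\<bar>}) (\<lambda>p. (fst p, Complex c (snd p)))"
      unfolding Complex_eq by (intro continuous_intros)
  qed auto
  then have "continuous_on (K \<times> {-\<bar>R\<bar>..\<bar>R\<bar>}) g"
    unfolding g_def by (intro continuous_intros)
  then have "compact (g ` (K \<times> {-\<bar>R\<bar>..\<bar>R\<bar>}))"
    using K by (intro compact_continuous_image compact_Times) auto
  then obtain M where M: "\<And>p. p \<in> K \<times> {-\<bar>R\<bar>..\<bar>R\<bar>} \<Longrightarrow> norm (g p) \<le> M"
    using compact_imp_bounded bounded_iff by (metis image_eqI)
  have "norm (f s (Complex c t)) \<le> (\<bar>M\<bar> + \<bar>C\<bar> + 1) * exp (- d * \<bar>t\<bar>)" if s: "s \<in> K" for s t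
  proof (cases "\<bar>t\<bar> \<le> \<bar>R\<bar>")
    case True
    then have "norm (g (s, t)) \<le> M" using s by (intro M) auto
    then have "norm (f s (Complex c t)) * exp (d * \<bar>t\<bar>) \<le> M" by (simp add: g_def)
    then have "norm (f s (Complex c t)) \<le> M * exp (- d * \<bar>t\<bar>)" by (simp add: exp_minus field_simps)
    also have "\<dots> \<le> (\<bar>M\<bar> + \<bar>C\<bar> + 1) * exp (- d * \<bar>t\<bar>)" by (intro mult_right_mono) auto
    finally show ?thesis .
  next
    case False
    then have "norm (f s (Complex c t)) \<le> C * exp (- d * \<bar>t\<bar>)" using dec[OF s, of "Complex c t"] by simp
    also have "\<dots> \<le> (\<bar>M\<bar> + \<bar>C\<bar> + 1) * exp (- d * \<bar>t\<bar>)" by (intro mult_right_mono) auto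
    finally show ?thesis .
  qed
  moreover have "\<bar>M\<bar> + \<bar>C\<bar> + 1 > 0" by simp
  ultimately show ?thesis by blast
qed

lemma integrable_line:
  fixes f :: "complex \<Rightarrow> complex"
  assumes cont: "continuous_on {z. Re z = c} f" and d: "d > 0"
    and dec: "\<And>z. Re z = c \<Longrightarrow> \<bar>Im z\<bar> \<ge> R \<Longrightarrow> norm (f z) \<le> C * exp (- d * \<bar>Im z\<bar>)"
  shows "integrable lborel (\<lambda>t. f (Complex c t))"
proof -
  obtain C' where C': "\<And>t. norm (f (Complex c t)) \<le> C' * exp (- d * \<bar>t\<bar>)"
  proof -
    have "\<exists>C'>0. \<forall>s\<in>{0::complex}. \<forall>t. norm (f (Complex c t)) \<le> C' * exp (- d * \<bar>t\<bar>)"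
    proof (rule line_dominated[of "{0}" c "\<lambda>_. f"])
      show "continuous_on ({0} \<times> {z. Re z = c}) (\<lambda>p. f (snd p))"
        by (rule continuous_on_compose2[OF cont]) (auto intro!: continuous_intros)
    qed (use dec in auto)
    then show ?thesis using that by blast
  qed
  have m: "(\<lambda>t. f (Complex c t)) \<in> borel_measurable lborel"
    using borel_measurable_vertical[OF cont] by simp
  show ?thesis
    by (rule Bochner_Integration.integrable_bound[OF integrable_exp_abs[OF d, of C'] m])
       (auto intro!: AE_I2 order_trans[OF C'])
qed

lemma line_integral_param:
  fixes f :: "complex \<Rightarrow> complex \<Rightarrow> complex"
  assumes U: "open U" and cont: "continuous_on (U \<times> {z. Re z = c}) (\<lambda>p. f (fst p) (snd p))"
    and hol: "\<And>z. Re z = c \<Longrightarrow> (\<lambda>s. f s z) holomorphic_on U"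
    and dec: "\<And>a. a \<in> U \<Longrightarrow> \<exists>r>0. cball a r \<subseteq> U \<and> (\<exists>R C d. d > 0 \<and>
        (\<forall>s\<in>cball a r. \<forall>z. Re z = c \<and> \<bar>Im z\<bar> \<ge> R \<longrightarrow> norm (f s z) \<le> C * exp (- d * \<bar>Im z\<bar>)))"
  shows "a \<in> U \<Longrightarrow> ((\<lambda>s. LINT t|lborel. f s (Complex c t)) has_field_derivative
            (LINT t|lborel. deriv (\<lambda>s. f s (Complex c t)) a)) (at a)" (is "_ \<Longrightarrow> ?D a")
    and "a \<in> U \<Longrightarrow> integrable lborel (\<lambda>t. f a (Complex c t))" (is "_ \<Longrightarrow> ?I a")
    and "(\<lambda>s. LINT t|lborel. f s (Complex c t)) holomorphic_on U"
proof -
  have A: "?D a \<and> ?I a" if a: "a \<in> U" for a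
  proof -
    from dec[OF a] obtain r R C d where r: "r > 0" "cball a r \<subseteq> U" "d > 0"
      "\<forall>s\<in>cball a r. \<forall>z. Re z = c \<and> \<bar>Im z\<bar> \<ge> R \<longrightarrow> norm (f s z) \<le> C * exp (- d * \<bar>Im z\<bar>)" by blast
    have "\<exists>C'>0. \<forall>s\<in>cball a r. \<forall>t. norm (f s (Complex c t)) \<le> C' * exp (- d * \<bar>t\<bar>)"
    proof (rule line_dominated[where R = R and C = C])
      show "continuous_on (cball a r \<times> {z. Re z = c}) (\<lambda>p. f (fst p) (snd p))"
        by (rule continuous_on_subset[OF cont]) (use r(2) in auto)
    qed (use r in auto)
    then obtain C' where C': "\<And>s t. s \<in> cball a r \<Longrightarrow> norm (f s (Complex c t)) \<le> C' * exp (- d * \<bar>t\<bar>)" by blast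
    have m: "(\<lambda>t. f s (Complex c t)) \<in> borel_measurable lborel" if "s \<in> cball a r" for s
    proof -
      have "continuous_on {z. Re z = c} (\<lambda>z. f (fst (s, z)) (snd (s, z)))"
        by (rule continuous_on_compose2[OF cont]) (use that r(2) in \<open>auto intro!: continuous_intros\<close>)
      then show ?thesis using borel_measurable_vertical[of c "f s"] by simp
    qed
    have hol': "(\<lambda>s. f s (Complex c t)) holomorphic_on ball a r" for t
      by (rule holomorphic_on_subset[OF hol]) (use r(2) ball_subset_cball[of a r] in auto)
    have "?D a"
      by (rule has_field_derivative_integral_dominated(1)[OF r(1), where g = "\<lambda>t. C' * exp (- d * \<bar>t\<bar>)"])
         (use hol' m C' integrable_exp_abs[OF r(3)] in auto)
    moreover have "?I a"
      by (rule Bochner_Integration.integrable_bound[OF integrable_exp_abs[OF r(3), of C'] m])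
         (use r(1) in \<open>auto intro!: AE_I2 order_trans[OF C']\<close>)
    ultimately show ?thesis ..
  qed
  show "?D a" "?I a" if "a \<in> U" using A[OF that] by auto
  show "(\<lambda>s. LINT t|lborel. f s (Complex c t)) holomorphic_on U"
    unfolding holomorphic_on_def using A field_differentiable_at_within field_differentiable_def by metis
qed

lemma Gamma_pair_bound:
  "\<exists>C>0. \<forall>a b. \<bar>Re a\<bar> \<le> A \<and> \<bar>Re b\<bar> \<le> A \<and> \<bar>Im a\<bar> \<ge> 1 \<and> \<bar>Im b\<bar> \<ge> 1 \<longrightarrow>
     norm (Gamma a * Gamma b) \<le> C * exp (- (3/2) * (\<bar>Im a\<bar> + \<bar>Im b\<bar>))"
proof -
  obtain C where C: "C > 0" "\<And>z. \<bar>Re z\<bar> \<le> A \<and> \<bar>Im z\<bar> \<ge> 1 \<Longrightarrow> norm (Gamma z) \<le> C * exp (- (3/2) * \<bar>Im z\<bar>)"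
    using norm_Gamma_strip_le[of A] by blast
  have "norm (Gamma a * Gamma b) \<le> (C * C) * exp (- (3/2) * (\<bar>Im a\<bar> + \<bar>Im b\<bar>))"
    if "\<bar>Re a\<bar> \<le> A" "\<bar>Re b\<bar> \<le> A" "\<bar>Im a\<bar> \<ge> 1" "\<bar>Im b\<bar> \<ge> 1" for a b
  proof -
    have "norm (Gamma a * Gamma b) \<le> (C * exp (- (3/2) * \<bar>Im a\<bar>)) * (C * exp (- (3/2) * \<bar>Im b\<bar>))"
      unfolding norm_mult using that C by (intro mult_mono C(2)) auto
    also have "\<dots> = (C * C) * exp (- (3/2) * \<bar>Im a\<bar> + - (3/2) * \<bar>Im b\<bar>)"
      unfolding exp_add by (simp add: mult_ac)
    also have "- (3/2) * \<bar>Im a\<bar> + - (3/2) * \<bar>Im b\<bar> = - (3/2) * (\<bar>Im a\<bar> + \<bar>Im b\<bar>)" by (simp add: algebra_simps)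
    finally show ?thesis .
  qed
  moreover have "C * C > 0" using C by simp
  ultimately show ?thesis by blast
qed

text \<open>The imaginary part of \<open>s\<close> shifts one argument and costs only the constant
  \<open>exp ((3/2) * A)\<close>. The real offset \<open>d\<close> is 0 for the kernel itself and 1
  in the recurrence behind the differential equation of the Mellin-Barnes integral.\<close>

lemma Gamma_pair_bound':
  "\<exists>C>0. \<forall>s z d. \<bar>Re s\<bar> \<le> A \<and> \<bar>Im s\<bar> \<le> A \<and> \<bar>Re z\<bar> \<le> A \<and> \<bar>d\<bar> \<le> A \<and> \<bar>Im z\<bar> \<ge> A + 1 \<longrightarrow>
     norm (Gamma (s + z) * Gamma (of_real d - z)) \<le> C * exp (- 3 * \<bar>Im z\<bar>)"
proof -
  obtain C where C: "C > 0" "\<forall>a b. \<bar>Re a\<bar> \<le> 2 * A \<and> \<bar>Re b\<bar> \<le> 2 * A \<and> \<bar>Im a\<bar> \<ge> 1 \<and> \<bar>Im b\<bar> \<ge> 1 \<longrightarrow>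
     norm (Gamma a * Gamma b) \<le> C * exp (- (3/2) * (\<bar>Im a\<bar> + \<bar>Im b\<bar>))"
    using Gamma_pair_bound[of "2 * A"] by blast
  have "norm (Gamma (s + z) * Gamma (of_real d - z)) \<le> (C * exp ((3/2) * A)) * exp (- 3 * \<bar>Im z\<bar>)"
    if h: "\<bar>Re s\<bar> \<le> A" "\<bar>Im s\<bar> \<le> A" "\<bar>Re z\<bar> \<le> A" "\<bar>d\<bar> \<le> A" "\<bar>Im z\<bar> \<ge> A + 1" for s z d
  proof -
    have im: "\<bar>Im (s + z)\<bar> \<ge> \<bar>Im z\<bar> - A" using h by auto
    have "norm (Gamma (s + z) * Gamma (of_real d - z)) \<le> C * exp (- (3/2) * (\<bar>Im (s + z)\<bar> + \<bar>Im (of_real d - z)\<bar>))"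
      by (rule C(2)[rule_format]) (use h im in auto)
    also have "\<dots> \<le> C * exp ((3/2) * A + (- 3 * \<bar>Im z\<bar>))"
      using im C(1) by (intro mult_left_mono) (auto simp: algebra_simps)
    finally show ?thesis unfolding exp_add by (simp only: mult.assoc)
  qed
  moreover have "C * exp ((3/2) * A) > 0" using C by simp
  ultimately show ?thesis by blast
qed

subsection \<open>The Mellin--Barnes integral\<close>

text \<open>The Mellin-Barnes integral at \<open>x = exp u\<close>. The variable \<open>u\<close>
  makes \<open>x powr z\<close> the entire function \<open>exp (u * z)\<close> and lets the integral
  be differentiated under the sign.\<close>

definition barnes :: "complex \<Rightarrow> real \<Rightarrow> complex \<Rightarrow> complex" where
  "barnes s c u = (LINT t|lborel. Gamma (s + Complex c t) * Gamma (- Complex c t) * exp (u * Complex c t))"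

lemma not_nonpos_Int_Re: "Re z > 0 \<Longrightarrow> z \<notin> \<int>\<^sub>\<le>\<^sub>0"
  by (auto elim!: nonpos_Ints_cases)

lemma norm_exp_mult_le:
  assumes "\<bar>Re u\<bar> \<le> B" "\<bar>Re z\<bar> \<le> A" "\<bar>Im u\<bar> \<le> 1"
  shows "norm (exp (u * z)) \<le> exp (A * B) * exp \<bar>Im z\<bar>"
proof -
  have "Re u * Re z \<le> \<bar>Re u\<bar> * \<bar>Re z\<bar>" by (simp add: abs_mult[symmetric])
  also have "\<dots> \<le> B * A" using assms by (intro mult_mono) auto
  finally have 1: "Re u * Re z \<le> A * B" by (simp add: mult.commute)
  have "- (Im u * Im z) \<le> \<bar>Im u\<bar> * \<bar>Im z\<bar>" by (simp add: abs_mult[symmetric])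
  also have "\<dots> \<le> 1 * \<bar>Im z\<bar>" using assms by (intro mult_right_mono) auto
  finally have 2: "- (Im u * Im z) \<le> \<bar>Im z\<bar>" by simp
  have "norm (exp (u * z)) = exp (Re u * Re z + - (Im u * Im z))" by (simp add: norm_exp_eq_Re)
  also have "\<dots> \<le> exp (A * B + \<bar>Im z\<bar>)" using 1 2 by (simp del: minus_mult_left)
  finally show ?thesis by (simp add: exp_add)
qed

text \<open>Complex \<open>u\<close> with imaginary part at most 1 costs a factor
  \<open>exp |Im z|\<close> out of \<open>exp (-3 * |Im z|)\<close>; this leaves an open strip of
  parameters for holomorphy in \<open>u\<close>.\<close>

lemma barnes_decay:
  assumes A: "A \<ge> 0"
  shows "\<exists>C>0. \<forall>s z d u. \<bar>Re s\<bar> \<le> A \<and> \<bar>Im s\<bar> \<le> A \<and> \<bar>Re z\<bar> \<le> A \<and> \<bar>d\<bar> \<le> A \<and> \<bar>Im z\<bar> \<ge> A + 1 \<and> \<bar>Re u\<bar> \<le> A \<and> \<bar>Im u\<bar> \<le> 1 \<longrightarrow>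
     norm (Gamma (s + z) * Gamma (of_real d - z) * exp (u * z)) \<le> C * exp (- 2 * \<bar>Im z\<bar>)"
proof -
  obtain C where C: "C > 0" "\<forall>s z d. \<bar>Re s\<bar> \<le> A \<and> \<bar>Im s\<bar> \<le> A \<and> \<bar>Re z\<bar> \<le> A \<and> \<bar>d\<bar> \<le> A \<and> \<bar>Im z\<bar> \<ge> A + 1 \<longrightarrow>
     norm (Gamma (s + z) * Gamma (of_real d - z)) \<le> C * exp (- 3 * \<bar>Im z\<bar>)"
    using Gamma_pair_bound'[of A] by blast
  have "norm (Gamma (s + z) * Gamma (of_real d - z) * exp (u * z)) \<le> (C * exp (A * A)) * exp (- 2 * \<bar>Im z\<bar>)"
    if h: "\<bar>Re s\<bar> \<le> A" "\<bar>Im s\<bar> \<le> A" "\<bar>Re z\<bar> \<le> A" "\<bar>d\<bar> \<le> A" "\<bar>Im z\<bar> \<ge> A + 1" "\<bar>Re u\<bar> \<le> A" "\<bar>Im u\<bar> \<le> 1" for s z d u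
  proof -
    have "norm (Gamma (s + z) * Gamma (of_real d - z) * exp (u * z)) \<le> (C * exp (- 3 * \<bar>Im z\<bar>)) * (exp (A * A) * exp \<bar>Im z\<bar>)"
      unfolding norm_mult[of _ "exp (u * z)"] using h C(1) by (intro mult_mono C(2)[rule_format] norm_exp_mult_le) auto
    also have "\<dots> = (C * exp (A * A)) * (exp (- 3 * \<bar>Im z\<bar>) * exp \<bar>Im z\<bar>)" by (simp add: mult_ac)
    also have "exp (- 3 * \<bar>Im z\<bar>) * exp \<bar>Im z\<bar> = exp (- 2 * \<bar>Im z\<bar>)" by (simp flip: exp_add)
    finally show ?thesis .
  qed
  moreover have "C * exp (A * A) > 0" using C by simp
  ultimately show ?thesis by blast
qed

lemma barnes_param:
  assumes c: "- Re s < c" "c < 0 \<or> (0 < c \<and> c < 1)" and u: "\<bar>Im u\<bar> < 1"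
  shows "(barnes s c has_field_derivative
      (LINT t|lborel. Complex c t * (Gamma (s + Complex c t) * Gamma (- Complex c t) * exp (u * Complex c t)))) (at u)"
    and "integrable lborel (\<lambda>t. Gamma (s + Complex c t) * Gamma (- Complex c t) * exp (u * Complex c t))"
proof -
  define U where "U = {u. \<bar>Im u\<bar> < 1}"
  define f where "f u z = Gamma (s + z) * Gamma (- z) * exp (u * z)" for u z
  have U: "open U"
    unfolding U_def by (intro open_Collect_less continuous_intros)
  have nz: "s + z \<notin> \<int>\<^sub>\<le>\<^sub>0" "- z \<notin> \<int>\<^sub>\<le>\<^sub>0" if "Re z = c" for z
  proof -
    show "s + z \<notin> \<int>\<^sub>\<le>\<^sub>0" by (rule not_nonpos_Int_Re) (use c that in auto)
    show "- z \<notin> \<int>\<^sub>\<le>\<^sub>0"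
    proof
      assume "- z \<in> \<int>\<^sub>\<le>\<^sub>0"
      then obtain n :: nat where "z = of_nat n" by (auto elim!: nonpos_Ints_cases' simp: minus_equation_iff)
      then show False using c(2) that by auto
    qed
  qed
  have cont: "continuous_on (U \<times> {z. Re z = c}) (\<lambda>p. f (fst p) (snd p))"
    unfolding f_def
    by (intro continuous_intros continuous_on_compose2[OF continuous_on_Gamma[of "{z. z \<notin> \<int>\<^sub>\<le>\<^sub>0}"]])
       (use nz in auto)
  have hol: "(\<lambda>u. f u z) holomorphic_on U" for z unfolding f_def by (intro holomorphic_intros)
  have dec: "\<exists>r>0. cball a r \<subseteq> U \<and> (\<exists>R C d. d > 0 \<and>
        (\<forall>s\<in>cball a r. \<forall>z. Re z = c \<and> \<bar>Im z\<bar> \<ge> R \<longrightarrow> norm (f s z) \<le> C * exp (- d * \<bar>Im z\<bar>)))" if a: "a \<in> U" for a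
  proof -
    obtain r where r: "r > 0" "cball a r \<subseteq> U" using U a open_contains_cball by blast
    define A where "A = \<bar>Re s\<bar> + \<bar>Im s\<bar> + \<bar>c\<bar> + (norm a + r)"
    have A: "A \<ge> 0" using r by (simp add: A_def)
    obtain C where C: "\<forall>s z d u. \<bar>Re s\<bar> \<le> A \<and> \<bar>Im s\<bar> \<le> A \<and> \<bar>Re z\<bar> \<le> A \<and> \<bar>d\<bar> \<le> A \<and> \<bar>Im z\<bar> \<ge> A + 1 \<and> \<bar>Re u\<bar> \<le> A \<and> \<bar>Im u\<bar> \<le> 1 \<longrightarrow>
     norm (Gamma (s + z) * Gamma (of_real d - z) * exp (u * z)) \<le> C * exp (- 2 * \<bar>Im z\<bar>)"
      using barnes_decay[OF A] by blast
    have "norm (f x z) \<le> C * exp (- 2 * \<bar>Im z\<bar>)" if x: "x \<in> cball a r" and z: "Re z = c" "\<bar>Im z\<bar> \<ge> A + 1" for x z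
    proof -
      have "norm x \<le> norm a + r" using x norm_triangle_ineq2[of x a] by (simp add: dist_norm norm_minus_commute)
      then have "\<bar>Re x\<bar> \<le> norm a + r" using abs_Re_le_cmod[of x] by linarith
      then have "\<bar>Re x\<bar> \<le> A" by (simp add: A_def)
      moreover have "\<bar>Im x\<bar> \<le> 1" using r(2) x by (auto simp: U_def)
      moreover have "\<bar>Re s\<bar> \<le> A" "\<bar>Im s\<bar> \<le> A" "\<bar>Re z\<bar> \<le> A" using r(1) z(1) by (auto simp: A_def)
      ultimately have "norm (Gamma (s + z) * Gamma (of_real 0 - z) * exp (x * z)) \<le> C * exp (- 2 * \<bar>Im z\<bar>)"
        using z(2) A by (intro C[rule_format]) auto
      then show ?thesis by (simp add: f_def)
    qed
    then show ?thesis using r by (intro exI[of _ r] conjI exI[of _ "A + 1"] exI[of _ C] exI[of _ "2::real"]) auto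
  qed
  have uU: "u \<in> U" using u by (simp add: U_def)
  have P: "((\<lambda>s. LINT t|lborel. f s (Complex c t)) has_field_derivative
            (LINT t|lborel. deriv (\<lambda>s. f s (Complex c t)) u)) (at u)"
    "integrable lborel (\<lambda>t. f u (Complex c t))"
    by (rule line_integral_param(1)[where U = U], rule U, rule cont, rule hol, erule dec, rule uU)
       (rule line_integral_param(2)[where U = U], rule U, rule cont, rule hol, erule dec, rule uU)
  have "deriv (\<lambda>u. f u z) u = z * f u z" for z
    unfolding f_def by (rule DERIV_imp_deriv) (auto intro!: derivative_eq_intros)
  then show "(barnes s c has_field_derivative
      (LINT t|lborel. Complex c t * (Gamma (s + Complex c t) * Gamma (- Complex c t) * exp (u * Complex c t)))) (at u)"
    using P(1) by (simp add: barnes_def[abs_def] f_def)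
  show "integrable lborel (\<lambda>t. Gamma (s + Complex c t) * Gamma (- Complex c t) * exp (u * Complex c t))"
    using P(2) by (simp add: f_def)
qed

text \<open>The margin condition on \<open>\<delta>\<close> keeps \<open>Gamma (s + z)\<close>
  regular, so only the poles of \<open>Gamma (d - z)\<close>, collected in \<open>S\<close>, are
  crossed. These are finitely many and real, and the limit over heights becomes one finite
  sum.\<close>

lemma barnes_shift:
  fixes a b d \<delta> :: real and s u :: complex
  assumes ab: "a < b" and \<delta>: "\<delta> > 0" "\<delta> < a + Re s" and u: "\<bar>Im u\<bar> \<le> 1"
    and S: "finite S" "\<And>z. z \<in> S \<Longrightarrow> a < Re z \<and> Re z < b \<and> Im z = 0"
    and nz: "\<And>z. a - \<delta> < Re z \<Longrightarrow> Re z < b + \<delta> \<Longrightarrow> z \<notin> S \<Longrightarrow> of_real d - z \<notin> \<int>\<^sub>\<le>\<^sub>0"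
  defines "f \<equiv> \<lambda>z. Gamma (s + z) * Gamma (of_real d - z) * exp (u * z)"
  shows "integrable lborel (\<lambda>t. f (Complex a t))" "integrable lborel (\<lambda>t. f (Complex b t))"
    and "of_real (2 * pi) * (\<Sum>z\<in>S. residue f z) = (LINT t|lborel. f (Complex b t)) - (LINT t|lborel. f (Complex a t))"
proof -
  define A where "A = \<bar>Re s\<bar> + \<bar>Im s\<bar> + \<bar>a\<bar> + \<bar>b\<bar> + \<bar>d\<bar> + \<bar>Re u\<bar>"
  have A: "A \<ge> 0" "\<bar>Re s\<bar> \<le> A" "\<bar>Im s\<bar> \<le> A" "\<bar>d\<bar> \<le> A" "\<bar>Re u\<bar> \<le> A" by (auto simp: A_def)
  obtain C where C: "C > 0" "\<forall>s z d u. \<bar>Re s\<bar> \<le> A \<and> \<bar>Im s\<bar> \<le> A \<and> \<bar>Re z\<bar> \<le> A \<and> \<bar>d\<bar> \<le> A \<and> \<bar>Im z\<bar> \<ge> A + 1 \<and> \<bar>Re u\<bar> \<le> A \<and> \<bar>Im u\<bar> \<le> 1 \<longrightarrow>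
     norm (Gamma (s + z) * Gamma (of_real d - z) * exp (u * z)) \<le> C * exp (- 2 * \<bar>Im z\<bar>)"
    using barnes_decay[OF A(1)] by blast
  have dec: "norm (f z) \<le> C * exp (- 2 * \<bar>Im z\<bar>)" if "Re z \<in> {a..b}" "\<bar>Im z\<bar> \<ge> A + 1" for z
  proof -
    have "\<bar>Re z\<bar> \<le> A" using that(1) by (auto simp: A_def)
    then show ?thesis unfolding f_def using A that(2) u by (intro C(2)[rule_format]) auto
  qed
  have holo: "f holomorphic_on {z. a - \<delta> < Re z \<and> Re z < b + \<delta>} - S"
    unfolding f_def
  proof (intro holomorphic_intros)
    show "s + z \<notin> \<int>\<^sub>\<le>\<^sub>0" if "z \<in> {z. a - \<delta> < Re z \<and> Re z < b + \<delta>} - S" for z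
      by (rule not_nonpos_Int_Re) (use \<delta> that in auto)
  qed (use nz in auto)
  note hc = holomorphic_on_imp_continuous_on[OF holo]
  show ia: "integrable lborel (\<lambda>t. f (Complex a t))"
  proof (rule integrable_line[of a f 2 "A + 1" C])
    show "continuous_on {z. Re z = a} f"
      by (rule continuous_on_subset[OF hc]) (use ab \<delta> S in force)
    show "norm (f z) \<le> C * exp (- 2 * \<bar>Im z\<bar>)" if "Re z = a" "A + 1 \<le> \<bar>Im z\<bar>" for z
      using that ab by (intro dec) auto
  qed simp
  show ib: "integrable lborel (\<lambda>t. f (Complex b t))"
  proof (rule integrable_line[of b f 2 "A + 1" C])
    show "continuous_on {z. Re z = b} f"
      by (rule continuous_on_subset[OF hc]) (use ab \<delta> S in force)
    show "norm (f z) \<le> C * exp (- 2 * \<bar>Im z\<bar>)" if "Re z = b" "A + 1 \<le> \<bar>Im z\<bar>" for z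
      using that ab by (intro dec) auto
  qed simp
  define T where "T j = A + 1 + real j" for j
  have Tl: "filterlim T at_top sequentially" unfolding T_def by real_asymp
  have Tp: "T j > 0" "T j \<ge> A + 1" for j using A by (auto simp: T_def)
  have "(\<lambda>j. of_real (2 * pi) * (\<Sum>z | z \<in> S \<and> \<bar>Im z\<bar> < T j. residue f z)) \<longlonglongrightarrow>
     (LINT t|lborel. f (Complex b t)) - (LINT t|lborel. f (Complex a t))"
  proof (rule strip_shift[OF ab \<delta>(1) _ _ holo Tl Tp(1), where E = "\<lambda>j. C * exp (- 2 * T j)"])
    have "((\<lambda>x. C * exp (- 2 * x)) \<longlongrightarrow> 0) at_top" by real_asymp
    then show "(\<lambda>j. C * exp (- 2 * T j)) \<longlonglongrightarrow> 0" using Tl by (rule filterlim_compose)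
    show "norm (f (Complex x (T j))) \<le> C * exp (- 2 * T j)" if "x \<in> {a..b}" for j x
      using dec[of "Complex x (T j)"] that Tp[of j] by auto
    show "norm (f (Complex x (- T j))) \<le> C * exp (- 2 * T j)" if "x \<in> {a..b}" for j x
      using dec[of "Complex x (- T j)"] that Tp[of j] by auto
    show "finite {z \<in> S. \<bar>Im z\<bar> \<le> r}" for r using S(1) by simp
    show "\<bar>Im z\<bar> \<noteq> T j" if "z \<in> S" for z j using S(2)[OF that] Tp(1)[of j] by auto
  qed (use S ia ib in auto)
  also have "(\<lambda>j. of_real (2 * pi) * (\<Sum>z | z \<in> S \<and> \<bar>Im z\<bar> < T j. residue f z)) = (\<lambda>_. of_real (2 * pi) * (\<Sum>z\<in>S. residue f z))"
  proof
    fix j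
    have "{z. z \<in> S \<and> \<bar>Im z\<bar> < T j} = S" using S(2) Tp(1)[of j] by auto
    then show "of_real (2 * pi) * (\<Sum>z | z \<in> S \<and> \<bar>Im z\<bar> < T j. residue f z) = of_real (2 * pi) * (\<Sum>z\<in>S. residue f z)" by simp
  qed
  finally show "of_real (2 * pi) * (\<Sum>z\<in>S. residue f z) = (LINT t|lborel. f (Complex b t)) - (LINT t|lborel. f (Complex a t))"
    by (simp add: LIMSEQ_const_iff)
qed

lemma one_minus_not_nonpos_Int: "Re z < 1 \<Longrightarrow> 1 - z \<notin> \<int>\<^sub>\<le>\<^sub>0"
  by (rule not_nonpos_Int_Re) simp

lemma minus_not_nonpos_Int: "Re z < 1 \<Longrightarrow> z \<noteq> 0 \<Longrightarrow> - z \<notin> \<int>\<^sub>\<le>\<^sub>0"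
proof
  assume z: "Re z < 1" "z \<noteq> 0" "- z \<in> \<int>\<^sub>\<le>\<^sub>0"
  then obtain n :: nat where "z = of_nat n" by (auto elim!: nonpos_Ints_cases' simp: minus_equation_iff)
  then show False using z by auto
qed

text \<open>Since \<open>z * Gamma (- z) = - Gamma (1 - z)\<close>, the derivative \<open>D\<close>
  is minus the integral of \<open>Gamma (s + z) * Gamma (1 - z) * exp (u * z)\<close>. That line
  moves to \<open>c + 1\<close> without meeting a pole, and replacing \<open>z\<close> by
  \<open>z + 1\<close> there, with the recurrence of \<open>Gamma (s + z)\<close>, gives
  \<open>exp u * (s * barnes s c u + D)\<close>.\<close>

lemma barnes_ode:
  assumes c: "- Re s < c" "c < 0" and u: "\<bar>Im u\<bar> < 1"
  defines "D \<equiv> (LINT t|lborel. Complex c t * (Gamma (s + Complex c t) * Gamma (- Complex c t) * exp (u * Complex c t)))"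
  shows "D * (1 + exp u) = - s * exp u * barnes s c u"
proof -
  define f where "f z = Gamma (s + z) * Gamma (of_real 1 - z) * exp (u * z)" for z
  define \<delta> where "\<delta> = min (- c) (c + Re s) / 2"
  have \<delta>: "\<delta> > 0" "\<delta> < c + Re s" "\<delta> < - c" using c by (auto simp: \<delta>_def min_def)
  have sh: "integrable lborel (\<lambda>t. f (Complex c t))" "integrable lborel (\<lambda>t. f (Complex (c + 1) t))"
    "of_real (2 * pi) * (\<Sum>z\<in>{}. residue f z) = (LINT t|lborel. f (Complex (c + 1) t)) - (LINT t|lborel. f (Complex c t))"
    unfolding f_def
    by (rule barnes_shift[of c "c + 1" \<delta> s u "{}" 1]; use \<delta> u one_minus_not_nonpos_Int in \<open>auto\<close>)+
  have 1: "Complex c t * (Gamma (s + Complex c t) * Gamma (- Complex c t) * exp (u * Complex c t)) = - f (Complex c t)" for t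
  proof -
    have "- Complex c t \<notin> \<int>\<^sub>\<le>\<^sub>0" using c by (intro minus_not_nonpos_Int) (auto simp: complex_eq_iff)
    from Gamma_plus1[OF this] have "Gamma (1 - Complex c t) = - Complex c t * Gamma (- Complex c t)" by (simp add: add.commute)
    then show ?thesis by (simp add: f_def)
  qed
  have D1: "D = - (LINT t|lborel. f (Complex c t))" unfolding D_def 1 by simp
  have iD: "integrable lborel (\<lambda>t. Complex c t * (Gamma (s + Complex c t) * Gamma (- Complex c t) * exp (u * Complex c t)))"
    unfolding 1 using sh(1) by simp
  have ib: "integrable lborel (\<lambda>t. Gamma (s + Complex c t) * Gamma (- Complex c t) * exp (u * Complex c t))"
    using c u by (intro barnes_param(2)) auto
  have "exp u * (s * barnes s c u + D) = (LINT t|lborel. exp u * (s * (Gamma (s + Complex c t) * Gamma (- Complex c t) * exp (u * Complex c t))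
     + Complex c t * (Gamma (s + Complex c t) * Gamma (- Complex c t) * exp (u * Complex c t))))"
    unfolding barnes_def D_def using iD ib by simp
  also have "\<dots> = (LINT t|lborel. f (Complex (c + 1) t))"
  proof (rule Bochner_Integration.integral_cong[OF refl])
    fix t
    define z where "z = Complex c t"
    have z1: "Complex (c + 1) t = z + 1" by (simp add: z_def complex_eq_iff)
    have "s + z \<notin> \<int>\<^sub>\<le>\<^sub>0" using c by (intro not_nonpos_Int_Re) (simp add: z_def)
    from Gamma_plus1[OF this] have "Gamma (s + (z + 1)) = (s + z) * Gamma (s + z)" by (simp add: add.assoc)
    then have "f (Complex (c + 1) t) = exp u * ((s + z) * (Gamma (s + z) * Gamma (- z) * exp (u * z)))"
      unfolding z1 f_def by (simp add: distrib_left exp_add mult_ac)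
    then show "exp u * (s * (Gamma (s + Complex c t) * Gamma (- Complex c t) * exp (u * Complex c t))
     + Complex c t * (Gamma (s + Complex c t) * Gamma (- Complex c t) * exp (u * Complex c t))) = f (Complex (c + 1) t)"
      by (simp add: z_def distrib_right)
  qed
  also have "\<dots> = - D" using sh(3) by (simp add: D1)
  finally have F: "exp u * (s * barnes s c u + D) = - D" .
  have "D * (1 + exp u) = D + exp u * (s * barnes s c u + D) - s * exp u * barnes s c u"
    by (simp add: algebra_simps)
  then show ?thesis unfolding F by simp
qed

text \<open>Between the two lines only \<open>Gamma (- z)\<close> has a pole, at 0 with residue
  \<open>-1\<close>, so the residue of the integrand is \<open>- Gamma s\<close> for every
  \<open>u\<close>.\<close>

lemma barnes_cross_pole:
  assumes c: "- Re s < c" "c < 0" and u: "\<bar>Im u\<bar> \<le> 1"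
  shows "barnes s c u = barnes s (1/2) u + of_real (2 * pi) * Gamma s"
proof -
  define f where "f z = Gamma (s + z) * Gamma (of_real 0 - z) * exp (u * z)" for z
  define \<delta> where "\<delta> = min (1/2) (c + Re s) / 2"
  have \<delta>: "\<delta> > 0" "\<delta> < c + Re s" "\<delta> < 1 / 2" using c by (auto simp: \<delta>_def min_def)
  have sh: "of_real (2 * pi) * (\<Sum>z\<in>{0}. residue f z) = (LINT t|lborel. f (Complex (1/2) t)) - (LINT t|lborel. f (Complex c t))"
    unfolding f_def
    by (rule barnes_shift[of c "1/2" \<delta> s u "{0}" 0]; use \<delta> u c minus_not_nonpos_Int in \<open>auto\<close>)
  have "residue f 0 = - Gamma s"
  proof -
    define g where "g z = - (Gamma (s + z) * Gamma (1 - z) * exp (u * z))" for z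
    define U where "U = {z. - Re s < Re z} \<inter> {z. Re z < 1}"
    have U: "open U" "0 \<in> U" unfolding U_def using c
      by (auto intro!: open_Int open_halfspace_Re_gt open_halfspace_Re_lt)
    have "g holomorphic_on U"
      unfolding g_def using one_minus_not_nonpos_Int
      by (intro holomorphic_intros) (auto simp: U_def intro!: not_nonpos_Int_Re)
    then have "residue (\<lambda>z. g z / (z - 0)) 0 = g 0" by (rule residue_simple[OF U])
    moreover have "residue f 0 = residue (\<lambda>z. g z / (z - 0)) 0"
    proof (rule residue_cong)
      have "\<forall>\<^sub>F z in at 0. z \<in> U" using U by (intro eventually_at_in_open') auto
      moreover have "\<forall>\<^sub>F z in at (0::complex). z \<noteq> 0" by (simp add: eventually_at_filter)
      ultimately show "\<forall>\<^sub>F z in at 0. f z = g z / (z - 0)"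
      proof eventually_elim
        case (elim z)
        then have "- z \<notin> \<int>\<^sub>\<le>\<^sub>0" by (intro minus_not_nonpos_Int) (auto simp: U_def)
        from Gamma_plus1[OF this] have "Gamma (1 - z) = - z * Gamma (- z)" by (simp add: add.commute)
        then show ?case using elim by (simp add: f_def g_def)
      qed
    qed auto
    ultimately show ?thesis by (simp add: g_def)
  qed
  then show ?thesis using sh by (simp add: barnes_def f_def algebra_simps)
qed

text \<open>
  The integral satisfies \<open>(1 + exp u) f' = - s exp u f\<close>, so it is a multiple of
  \<open>(1 + exp u) powr (- s)\<close>. Moving the line across the pole at \<open>0\<close> makes the integral vanish as \<open>u\<close>
  tends to \<open>-\<infinity>\<close> and leaves the residue \<open>Gamma s\<close>, which is the multiple.
\<close>

lemma barnes_eq: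
  assumes c: "- Re s < c" "c < 0"
  shows "barnes s c (of_real u) = of_real (2 * pi) * Gamma s * exp (- s * of_real (ln (1 + exp u)))"
proof -
  \<comment> \<open>The expected solution of the differential equation is divided out;
    \<open>Q\<close> is then constant.\<close>
  define Q where "Q u = barnes s c (of_real u) * exp (s * of_real (ln (1 + exp u)))" for u :: real
  have "(Q has_vector_derivative 0) (at u)" for u :: real
  proof -
    define D where "D = (LINT t|lborel. Complex c t * (Gamma (s + Complex c t) * Gamma (- Complex c t) * exp (of_real u * Complex c t)))"
    have d1: "((\<lambda>u. barnes s c (of_real u)) has_vector_derivative D) (at u)"
      unfolding D_def using c by (intro has_vector_derivative_real_field barnes_param(1)) auto
    have "((\<lambda>u. ln (1 + exp u)) has_real_derivative exp u / (1 + exp u)) (at u)"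
      by (auto intro!: derivative_eq_intros simp: add_pos_pos)
    then have "((\<lambda>u. of_real (ln (1 + exp u)) :: complex) has_vector_derivative of_real (exp u / (1 + exp u))) (at u)"
      by (intro has_vector_derivative_of_real) (simp add: has_real_derivative_iff_has_vector_derivative)
    then have d0: "((\<lambda>u. s * of_real (ln (1 + exp u))) has_vector_derivative s * of_real (exp u / (1 + exp u))) (at u)"
      by (rule has_vector_derivative_mult_right)
    have d2: "((\<lambda>u. exp (s * of_real (ln (1 + exp u)))) has_vector_derivative
        (s * of_real (exp u / (1 + exp u)) * exp (s * of_real (ln (1 + exp u))))) (at u)"
      using field_vector_diff_chain_at[OF d0 DERIV_exp] unfolding o_def .
    have "(Q has_vector_derivative (barnes s c (of_real u) * (s * of_real (exp u / (1 + exp u)) * exp (s * of_real (ln (1 + exp u))))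
       + D * exp (s * of_real (ln (1 + exp u))))) (at u)"
      unfolding Q_def by (rule has_vector_derivative_mult[OF d1 d2])
    moreover have "barnes s c (of_real u) * (s * of_real (exp u / (1 + exp u)) * exp (s * of_real (ln (1 + exp u))))
       + D * exp (s * of_real (ln (1 + exp u))) = 0"
    proof -
      have p: "(1 + exp u) \<noteq> 0" using exp_gt_zero[of u] by linarith
      then have "(of_real (1 + exp u) :: complex) \<noteq> 0" unfolding of_real_eq_0_iff .
      then have p': "1 + (of_real (exp u) :: complex) \<noteq> 0" by simp
      have "D * (1 + of_real (exp u)) = - s * of_real (exp u) * barnes s c (of_real u)"
        using barnes_ode[OF c, of "of_real u"] by (simp add: D_def exp_of_real)
      then have "D = - s * of_real (exp u) * barnes s c (of_real u) / (1 + of_real (exp u))"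
        using p' by (simp add: field_simps)
      then show ?thesis by (simp add: mult_ac)
    qed
    ultimately show ?thesis by simp
  qed
  then have Q0: "(Q has_vector_derivative 0) (at u within UNIV)" for u by simp
  obtain k where k: "\<And>u. Q u = k"
    using has_vector_derivative_zero_constant[OF convex_UNIV Q0] by (metis UNIV_I)
  define M where "M = (LINT t|lborel. norm (Gamma (s + Complex (1/2) t) * Gamma (- Complex (1/2) t)))"
  \<comment> \<open>To the right of the pole the integrand carries the factor
    \<open>exp (u / 2)\<close> in modulus, which tends to 0 with \<open>u\<close> tending to minus
    infinity.\<close>
  have lim: "((\<lambda>u. barnes s (1/2) (of_real u)) \<longlongrightarrow> 0) at_bot"
  proof (rule Lim_null_comparison)
    show "((\<lambda>u. M * exp (u / 2)) \<longlongrightarrow> 0) at_bot" by real_asymp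
    show "\<forall>\<^sub>F u in at_bot. norm (barnes s (1/2) (of_real u)) \<le> M * exp (u / 2)"
    proof (rule always_eventually, rule allI)
      fix u :: real
      have "norm (barnes s (1/2) (of_real u)) \<le> (LINT t|lborel. norm (Gamma (s + Complex (1/2) t) * Gamma (- Complex (1/2) t) * exp (of_real u * Complex (1/2) t)))"
        unfolding barnes_def by (rule integral_norm_bound)
      also have "\<dots> = M * exp (u / 2)"
        unfolding M_def by (simp add: norm_mult norm_exp_eq_Re)
      finally show "norm (barnes s (1/2) (of_real u)) \<le> M * exp (u / 2)" .
    qed
  qed
  have "((\<lambda>u::real. (barnes s (1/2) (of_real u) + of_real (2 * pi) * Gamma s) * exp (s * of_real (ln (1 + exp u)))) \<longlongrightarrow>
     (0 + of_real (2 * pi) * Gamma s) * exp (s * of_real 0)) at_bot"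
  proof (intro tendsto_intros lim)
    show "((\<lambda>u::real. ln (1 + exp u)) \<longlongrightarrow> 0) at_bot" by real_asymp
  qed
  moreover have "(barnes s (1/2) (of_real u) + of_real (2 * pi) * Gamma s) * exp (s * of_real (ln (1 + exp u))) = k" for u :: real
    using k[of u] barnes_cross_pole[OF c, of "of_real u"] by (simp add: Q_def)
  ultimately have "k = of_real (2 * pi) * Gamma s"
    by (simp add: tendsto_const_iff)
  then have "barnes s c (of_real u) * exp (s * of_real (ln (1 + exp u))) = of_real (2 * pi) * Gamma s"
    using k[of u] by (simp add: Q_def)
  then have "barnes s c (of_real u) * (exp (s * of_real (ln (1 + exp u))) * exp (- s * of_real (ln (1 + exp u)))) = of_real (2 * pi) * Gamma s * exp (- s * of_real (ln (1 + exp u)))"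
    by (simp only: mult.assoc[symmetric])
  also have "exp (s * of_real (ln (1 + exp u))) * exp (- s * of_real (ln (1 + exp u))) = 1"
    by (simp flip: exp_add)
  finally show ?thesis by simp
qed

theorem mellin_barnes:
  assumes c: "- Re s < c" "c < 0" and x: "x > 0"
  shows "(LINT t|lborel. Gamma (s + Complex c t) * Gamma (- Complex c t) * of_real x powr Complex c t)
     = of_real (2 * pi) * Gamma s * of_real (1 + x) powr (- s)"
proof -
  have "of_real x powr z = exp (of_real (ln x) * z)" for z :: complex
    using x by (simp add: powr_def Ln_of_real mult.commute)
  moreover have "of_real (1 + x) powr (- s) = exp (- s * of_real (ln (1 + exp (ln x))))"
  proof -
    have "(of_real (1 + x) :: complex) \<noteq> 0" using x by (metis add_pos_pos less_irrefl of_real_eq_0_iff zero_less_one)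
    then show ?thesis using x Ln_of_real[of "1 + x"] by (simp add: powr_def)
  qed
  ultimately show ?thesis using barnes_eq[OF c, of "ln x"] by (simp add: barnes_def)
qed

subsection \<open>The double series as a Mellin--Barnes integral\<close>

lemma norm_Phi2_term:
  assumes "m1 \<ge> 1" "m2 \<ge> 1"
  shows "norm (Phi2_term s1 s2 m1 m2) = mangoldt m2 * real m1 powr (- Re s1) * real (m1 + m2) powr (- Re s2)"
proof -
  have 1: "norm (of_nat n powr s :: complex) = real n powr Re s" if "n \<ge> 1" for n s
    using norm_nat_powr[of "n - 1" s] that by simp
  have "norm (mangoldt m2 :: complex) = mangoldt m2"
    by (simp add: mangoldt_nonneg)
  then show ?thesis
    using assms unfolding Phi2_term_def norm_divide norm_mult
    by (simp add: 1 powr_minus divide_inverse del: of_nat_add)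
qed

text \<open>A starting line: \<open>c < -1\<close> for absolute convergence of the series of
  \<open>M(- z)\<close>, \<open>1 < Re w + c\<close> for that of \<open>zeta(w + z)\<close>, and
  \<open>- Re s < c\<close> to stay to the right of the poles of
  \<open>Gamma (s + z)\<close>.\<close>

lemma abscissa_exists:
  assumes "Re s > 1" "Re w > 2"
  obtains c where "c < -1" "- Re s < c" "1 < Re w + c"
proof -
  define m where "m = max (- Re s) (1 - Re w)"
  have "m < -1" using assms by (simp add: m_def)
  then obtain c where "m < c" "c < -1" using dense by blast
  then show ?thesis using that[of c] by (simp add: m_def)
qed

text \<open>The exponent \<open>- Re s2\<close> is split into the two negative numbers
  \<open>- Re s2 - c\<close> and \<open>c\<close>. Bounding \<open>m + n\<close> below by
  \<open>m\<close> in one power and by \<open>n\<close> in the other majorizes the double series by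
  a product of two convergent single series.\<close>

lemma Phi2_abs_summable:
  assumes s: "Re s2 > 1" "Re (s1 + s2) > 2"
  shows "(\<lambda>(m1, m2). norm (Phi2_term s1 s2 m1 m2)) summable_on ({1..} \<times> {1..})"
proof -
  obtain c where c: "c < -1" "- Re s2 < c" "1 < Re (s1 + s2) + c"
    using abscissa_exists[OF s] by blast
  define \<sigma> where "\<sigma> = Re (s1 + s2) + c"
  define f where "f m = real m powr (- \<sigma>)" for m :: nat
  define g where "g m = mangoldt m * real m powr c" for m :: nat
  have f0: "f m \<ge> 0" and g0: "g m \<ge> 0" for m by (auto simp: f_def g_def mangoldt_nonneg)
  have sf: "f summable_on {1..}"
  proof -
    have "summable (\<lambda>n. norm (f (Suc n)))"
      using c(3) unfolding f_def \<sigma>_def by (subst summable_Suc_iff[of "\<lambda>n. norm (real n powr _)"]) (simp add: summable_real_powr_iff)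
    then have "(\<lambda>n. norm (f n)) summable_on {1..}" by (rule abs_summable_on_atLeast_1)
    then show ?thesis using f0 by simp
  qed
  have sg: "g summable_on {1..}"
  proof -
    have "summable (\<lambda>n. norm (mangoldt (Suc n) / of_nat (Suc n) powr (of_real (- c)) :: complex))"
      by (rule summable_mangoldt_series) (use c in auto)
    also have "(\<lambda>n. norm (mangoldt (Suc n) / of_nat (Suc n) powr (of_real (- c)) :: complex)) = (\<lambda>n. norm (g (Suc n)))"
      unfolding norm_divide norm_nat_powr by (simp add: g_def powr_minus divide_inverse mangoldt_nonneg abs_mult del: of_nat_Suc)
    finally have "(\<lambda>n. norm (g n)) summable_on {1..}" by (rule abs_summable_on_atLeast_1)
    then show ?thesis using g0 by simp
  qed
  have "(\<lambda>(m1, m2). f m1 * g m2) summable_on ({1..} \<times> {1..})"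
  proof (rule summable_on_SigmaI[where g = "\<lambda>x. f x * infsum g {1..}"])
    show "((\<lambda>y. case (x, y) of (m1, m2) \<Rightarrow> f m1 * g m2) has_sum f x * infsum g {1..}) {1..}" for x
      using has_sum_cmult_right[OF has_sum_infsum[OF sg], of "f x"] by simp
    show "(\<lambda>x. f x * infsum g {1..}) summable_on {1..}"
      using summable_on_cmult_left[OF sf] by simp
  qed (use f0 g0 in auto)
  then have "(\<lambda>p. norm (case p of (m1, m2) \<Rightarrow> norm (Phi2_term s1 s2 m1 m2))) summable_on ({1..} \<times> {1..})"
  proof (rule Infinite_Sum.abs_summable_on_comparison_test')
    fix p :: "nat \<times> nat" assume "p \<in> {1..} \<times> {1..}"
    then obtain m n where p: "p = (m, n)" "m \<ge> 1" "n \<ge> 1" by auto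
    have "real (m + n) powr (- Re s2) = real (m + n) powr (- Re s2 - c) * real (m + n) powr c"
      by (simp add: powr_add[symmetric])
    also have "\<dots> \<le> real m powr (- Re s2 - c) * real n powr c"
      using c p by (intro mult_mono powr_mono2') auto
    finally have "norm (Phi2_term s1 s2 m n) \<le> mangoldt n * real m powr (- Re s1) * (real m powr (- Re s2 - c) * real n powr c)"
      using p by (auto simp: norm_Phi2_term mangoldt_nonneg intro!: mult_left_mono)
    also have "\<dots> = (real m powr (- Re s1) * real m powr (- Re s2 - c)) * g n" by (simp add: g_def)
    also have "real m powr (- Re s1) * real m powr (- Re s2 - c) = f m"
      unfolding f_def \<sigma>_def powr_add[symmetric] by (rule arg_cong[where f = "(powr) (real m)"]) simp
    finally show "norm (case p of (m1, m2) \<Rightarrow> norm (Phi2_term s1 s2 m1 m2)) \<le> (case p of (m1, m2) \<Rightarrow> f m1 * g m2)"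
      by (simp add: p)
  qed
  then show ?thesis by (simp add: case_prod_unfold)
qed

text \<open>\<open>line_integrand\<close> in the coordinates \<open>s = s2\<close>,
  \<open>w = s1 + s2\<close>.\<close>

definition barnes_kernel :: "complex \<Rightarrow> complex \<Rightarrow> complex \<Rightarrow> complex" where
  "barnes_kernel s w z = Gamma (s + z) * Gamma (- z) * M_zeta (- z) * riemann_zeta (w + z)"

lemma Phi2_eq_suminf:
  assumes s: "Re s2 > 1" "Re (s1 + s2) > 2"
  shows "Phi2 s1 s2 = (\<Sum>m. \<Sum>n. Phi2_term s1 s2 (Suc m) (Suc n))"
    and "summable (\<lambda>n. Phi2_term s1 s2 (Suc m) (Suc n))"
    and "summable (\<lambda>m. \<Sum>n. Phi2_term s1 s2 (Suc m) (Suc n))"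
proof -
  have ab: "(\<lambda>p. norm (case p of (m, n) \<Rightarrow> Phi2_term s1 s2 m n)) summable_on ({1..} \<times> {1..})"
    using Phi2_abs_summable[OF s] by (simp add: case_prod_unfold)
  note S = ab[unfolded Infinite_Sum.abs_summable_on_Sigma_iff]
  have in1: "(\<lambda>n. norm (Phi2_term s1 s2 m n)) summable_on {1..}" if "m \<in> {1..}" for m
    using conjunct1[OF S, rule_format, OF that] by simp
  have in2: "summable (\<lambda>n. norm (Phi2_term s1 s2 (Suc m) (Suc n)))" for m
    using in1[of "Suc m"] unfolding summable_on_atLeast_1 by (intro summable_on_imp_summable) simp
  have inner: "(\<Sum>\<^sub>\<infinity>n\<in>{1..}. Phi2_term s1 s2 (Suc m) n) = (\<Sum>n. Phi2_term s1 s2 (Suc m) (Suc n))" for m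
    by (rule infsum_atLeast_1[OF in2])
  have "(\<lambda>m. norm (\<Sum>\<^sub>\<infinity>n\<in>{1..}. norm (Phi2_term s1 s2 m n))) summable_on {1..}"
    using conjunct2[OF S] by simp
  then have o1: "summable (\<lambda>m. norm (\<Sum>\<^sub>\<infinity>n\<in>{1..}. norm (Phi2_term s1 s2 (Suc m) n)))"
    unfolding summable_on_atLeast_1 by (rule summable_on_imp_summable)
  have "summable (\<lambda>m. norm (\<Sum>\<^sub>\<infinity>n\<in>{1..}. Phi2_term s1 s2 (Suc m) n))"
  proof (rule summable_comparison_test'[OF o1, of 0])
    fix m
    have "norm (\<Sum>\<^sub>\<infinity>n\<in>{1..}. Phi2_term s1 s2 (Suc m) n) \<le> (\<Sum>\<^sub>\<infinity>n\<in>{1..}. norm (Phi2_term s1 s2 (Suc m) n))"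
      by (rule norm_infsum_bound[OF in1]) simp
    then show "norm (norm (\<Sum>\<^sub>\<infinity>n\<in>{1..}. Phi2_term s1 s2 (Suc m) n)) \<le> norm (\<Sum>\<^sub>\<infinity>n\<in>{1..}. norm (Phi2_term s1 s2 (Suc m) n))"
      by simp
  qed
  note out = this
  have "Phi2 s1 s2 = (\<Sum>m. \<Sum>\<^sub>\<infinity>n\<in>{1..}. Phi2_term s1 s2 (Suc m) n)"
    unfolding Phi2_def by (rule infsum_atLeast_1[OF out])
  then show "Phi2 s1 s2 = (\<Sum>m. \<Sum>n. Phi2_term s1 s2 (Suc m) (Suc n))" unfolding inner .
  show "summable (\<lambda>n. Phi2_term s1 s2 (Suc m) (Suc n))" by (rule summable_norm_cancel[OF in2])
  show "summable (\<lambda>m. \<Sum>n. Phi2_term s1 s2 (Suc m) (Suc n))"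
    using summable_norm_cancel[OF out] unfolding inner .
qed

text \<open>On the line the moduli of the Dirichlet terms \<open>A n\<close>, \<open>B m\<close> do
  not depend on \<open>t\<close>, so both series may be exchanged with the integral over the
  integrable gamma product. Each term is the Mellin-Barnes integral at the quotient of the two
  indices, and \<open>x powr (- w) * (1 + y / x) powr (- s)\<close> equals
  \<open>x powr (- s1) * (x + y) powr (- s2)\<close>.\<close>

lemma barnes_kernel_integral_eq_Phi2:
  assumes c: "c < -1" "- Re s2 < c" "1 < Re (s1 + s2) + c"
  shows "(LINT t|lborel. barnes_kernel s2 (s1 + s2) (Complex c t)) = of_real (2 * pi) * Gamma s2 * Phi2 s1 s2"
proof -
  define s w where "s = s2" and "w = s1 + s2"
  have c': "c < -1" "- Re s < c" "1 < Re w + c" using c by (auto simp: s_def w_def)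
  define \<sigma> where "\<sigma> = Re w + c"
  define G where "G t = Gamma (s + Complex c t) * Gamma (- Complex c t)" for t
  have iG: "integrable lborel G"
    using barnes_param(2)[of s c 0] c' by (simp add: G_def[abs_def])
  have nG: "integrable lborel (\<lambda>t. norm (G t))" using iG by simp
  define A where "A n t = mangoldt (Suc n) / of_nat (Suc n) powr (- Complex c t)" for n t
  define B where "B m t = 1 / of_nat (Suc m) powr (w + Complex c t)" for m t
  have cC: "continuous_on UNIV (\<lambda>t. Complex c t)" by (rule continuous_on_Complex_line)
  have mA: "A n \<in> borel_measurable lborel" for n
  proof -
    have "A n \<in> borel_measurable borel" unfolding A_def[abs_def]
      by (intro borel_measurable_continuous_onI continuous_intros cC) (auto simp del: of_nat_Suc)
    then show ?thesis by simp
  qed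
  have mB: "B m \<in> borel_measurable lborel" for m
  proof -
    have "B m \<in> borel_measurable borel" unfolding B_def[abs_def]
      by (intro borel_measurable_continuous_onI continuous_intros cC) (auto simp del: of_nat_Suc)
    then show ?thesis by simp
  qed
  have nA: "norm (A n t) = mangoldt (Suc n) * real (Suc n) powr c" for n t
    unfolding A_def norm_divide norm_nat_powr by (simp add: powr_minus divide_inverse mangoldt_nonneg del: of_nat_Suc)
  have nB: "norm (B m t) = real (Suc m) powr (- \<sigma>)" for m t
  proof -
    have "norm (B m t) = 1 / real (Suc m) powr \<sigma>"
      unfolding B_def norm_divide norm_nat_powr by (simp add: \<sigma>_def)
    then show ?thesis by (simp add: powr_minus divide_inverse)
  qed
  have sA: "summable (\<lambda>n. norm (A n t))" for t
    unfolding A_def by (rule summable_mangoldt_series) (use c' in auto)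
  have sB: "summable (\<lambda>m. norm (B m t))" for t
    unfolding B_def by (rule summable_zeta_series) (use c' in auto)
  have SA: "(\<Sum>n. A n t) = M_zeta (- Complex c t)" for t
    using c' by (subst M_zeta_eq_mangoldt_series) (auto simp: A_def mangoldt_series_def)
  have SB: "(\<Sum>m. B m t) = riemann_zeta (w + Complex c t)" for t
    using riemann_zeta_sums[of "w + Complex c t"] c' by (simp add: B_def sums_iff)
  define KA where "KA = (\<Sum>n. mangoldt (Suc n) * real (Suc n) powr c)"
  have sKA: "summable (\<lambda>n. mangoldt (Suc n) * real (Suc n) powr c)" using sA[of 0] by (simp add: nA)
  have sKB: "summable (\<lambda>m. real (Suc m) powr (- \<sigma>))" using sB[of 0] by (simp add: nB)
  have inner_int: "integrable lborel (\<lambda>t. G t * B m t * A n t)" for m n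
  proof (rule Bochner_Integration.integrable_bound)
    show "integrable lborel (\<lambda>t. (real (Suc m) powr (- \<sigma>) * (mangoldt (Suc n) * real (Suc n) powr c)) * norm (G t))"
      using nG by simp
    show "(\<lambda>t. G t * B m t * A n t) \<in> borel_measurable lborel"
      using iG mA mB by (intro borel_measurable_times) auto
  qed (auto simp: norm_mult nA nB mangoldt_nonneg intro!: AE_I2)
  have nint: "(LINT t|lborel. norm (G t * B m t * A n t)) = real (Suc m) powr (- \<sigma>) * (mangoldt (Suc n) * real (Suc n) powr c) * (LINT t|lborel. norm (G t))" for m n
  proof -
    have "norm (G t * B m t * A n t) = real (Suc m) powr (- \<sigma>) * (mangoldt (Suc n) * real (Suc n) powr c) * norm (G t)" for t
      by (simp add: norm_mult nA nB mult_ac)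
    then show ?thesis by simp
  qed
  have inner: "integrable lborel (\<lambda>t. \<Sum>n. G t * B m t * A n t)"
    "(LINT t|lborel. (\<Sum>n. G t * B m t * A n t)) = (\<Sum>n. LINT t|lborel. G t * B m t * A n t)" for m
  proof -
    have AE: "AE t in lborel. summable (\<lambda>n. norm (G t * B m t * A n t))"
      unfolding norm_mult using sA by (intro AE_I2 summable_mult)
    have sm: "summable (\<lambda>n. LINT t|lborel. norm (G t * B m t * A n t))"
      unfolding nint using sKA by (intro summable_mult2 summable_mult)
    show "integrable lborel (\<lambda>t. \<Sum>n. G t * B m t * A n t)" by (rule integrable_suminf[OF inner_int AE sm])
    show "(LINT t|lborel. (\<Sum>n. G t * B m t * A n t)) = (\<Sum>n. LINT t|lborel. G t * B m t * A n t)"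
      by (rule integral_suminf[OF inner_int AE sm])
  qed
  have pull: "(\<Sum>n. G t * B m t * A n t) = G t * M_zeta (- Complex c t) * B m t" for m t
    using suminf_mult[OF summable_norm_cancel[OF sA[of t]], of "G t * B m t"] by (simp add: SA mult_ac)
  have nM: "norm (M_zeta (- Complex c t)) \<le> KA" for t
  proof -
    have "norm (\<Sum>n. A n t) \<le> (\<Sum>n. norm (A n t))" by (rule summable_norm[OF sA])
    then show ?thesis by (simp add: SA nA KA_def)
  qed
  have outer: "(LINT t|lborel. (\<Sum>m. \<Sum>n. G t * B m t * A n t)) = (\<Sum>m. LINT t|lborel. (\<Sum>n. G t * B m t * A n t))"
  proof (rule integral_suminf[OF inner(1)])
    show "AE t in lborel. summable (\<lambda>m. norm (\<Sum>n. G t * B m t * A n t))"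
      unfolding pull norm_mult using sB by (intro AE_I2 summable_mult)
    show "summable (\<lambda>m. LINT t|lborel. norm (\<Sum>n. G t * B m t * A n t))"
    proof (rule summable_comparison_test'[where N = 0])
      show "summable (\<lambda>m. (KA * (LINT t|lborel. norm (G t))) * real (Suc m) powr (- \<sigma>))"
        by (rule summable_mult[OF sKB])
      fix m
      have "(LINT t|lborel. norm (\<Sum>n. G t * B m t * A n t)) \<le> (LINT t|lborel. (KA * real (Suc m) powr (- \<sigma>)) * norm (G t))"
      proof (rule integral_mono)
        show "integrable lborel (\<lambda>t. norm (\<Sum>n. G t * B m t * A n t))" using inner(1) by (rule integrable_norm)
        show "integrable lborel (\<lambda>t. (KA * real (Suc m) powr (- \<sigma>)) * norm (G t))" using nG by simp
        show "norm (\<Sum>n. G t * B m t * A n t) \<le> (KA * real (Suc m) powr (- \<sigma>)) * norm (G t)" for t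
        proof -
          have "norm (\<Sum>n. G t * B m t * A n t) = norm (M_zeta (- Complex c t)) * (real (Suc m) powr (- \<sigma>) * norm (G t))"
            unfolding pull norm_mult nB by (simp add: mult_ac)
          also have "\<dots> \<le> KA * (real (Suc m) powr (- \<sigma>) * norm (G t))" using nM by (intro mult_right_mono) auto
          finally show ?thesis by (simp add: mult_ac)
        qed
      qed
      then show "norm (LINT t|lborel. norm (\<Sum>n. G t * B m t * A n t)) \<le> (KA * (LINT t|lborel. norm (G t))) * real (Suc m) powr (- \<sigma>)"
        by (simp add: mult_ac)
    qed
  qed
  have trm: "(LINT t|lborel. G t * B m t * A n t) = of_real (2 * pi) * Gamma s * Phi2_term s1 s2 (Suc m) (Suc n)" for m n
  proof -
    define x y where "x = real (Suc m)" and "y = real (Suc n)"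
    have xy: "x > 0" "y > 0" by (auto simp: x_def y_def)
    have px: "(of_real x :: complex) powr z = exp (z * of_real (ln x))" if "x > 0" for x z
      using that by (simp add: powr_def Ln_of_real)
    have BA: "B m t * A n t = mangoldt (Suc n) * of_real x powr (- w) * of_real (y / x) powr Complex c t" for t
    proof -
      have "ln (y / x) = ln y - ln x" using xy by (simp add: ln_div)
      then have "of_real x powr (- w) * of_real (y / x) powr Complex c t = of_real x powr (- (w + Complex c t)) * of_real y powr Complex c t"
        using xy by (simp only: px divide_pos_pos mult_exp_exp of_real_diff) (simp add: algebra_simps)
      moreover have "B m t * A n t = mangoldt (Suc n) * (of_real x powr (- (w + Complex c t)) * of_real y powr Complex c t)"
        by (simp only: A_def B_def x_def y_def of_real_of_nat_eq powr_minus divide_inverse mult_1_left inverse_inverse_eq mult_ac)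
      ultimately show ?thesis by (simp only: mult.assoc)
    qed
    have "(LINT t|lborel. G t * B m t * A n t) = (LINT t|lborel. (mangoldt (Suc n) * of_real x powr (- w)) * (Gamma (s + Complex c t) * Gamma (- Complex c t) * of_real (y / x) powr Complex c t))"
      by (intro Bochner_Integration.integral_cong refl) (simp add: mult.assoc BA, simp add: G_def mult_ac)
    also have "\<dots> = (mangoldt (Suc n) * of_real x powr (- w)) * (of_real (2 * pi) * Gamma s * of_real (1 + y / x) powr (- s))"
      using mellin_barnes[of s c "y / x"] c' xy by (subst integral_mult_right_zero) simp
    also have "of_real x powr (- w) * of_real (1 + y / x) powr (- s) = 1 / (of_real x powr s1 * of_real (x + y) powr s2)"
    proof -
      have "1 + y / x = (x + y) / x" using xy by (simp add: field_simps)
      then have "ln (1 + y / x) = ln (x + y) - ln x" using xy by (simp add: ln_div add_pos_pos)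
      moreover have "1 + y / x > 0" "x + y > 0" using xy by (auto intro: add_pos_pos)
      ultimately have "of_real x powr (- w) * of_real (1 + y / x) powr (- s) = exp (- (s1 * of_real (ln x)) - s2 * of_real (ln (x + y)))"
        using xy by (simp only: px mult_exp_exp) (simp add: w_def s_def algebra_simps)
      also have "\<dots> = 1 / (of_real x powr s1 * of_real (x + y) powr s2)"
        using xy \<open>x + y > 0\<close> by (simp only: px mult_exp_exp) (simp add: exp_diff exp_minus exp_add divide_inverse)
      finally show ?thesis .
    qed
    then have "(mangoldt (Suc n) * of_real x powr (- w)) * (of_real (2 * pi) * Gamma s * of_real (1 + y / x) powr (- s))
      = of_real (2 * pi) * Gamma s * (mangoldt (Suc n) * (of_real x powr (- w) * of_real (1 + y / x) powr (- s)))" by (simp only: mult_ac)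
    also have "\<dots> = of_real (2 * pi) * Gamma s * Phi2_term s1 s2 (Suc m) (Suc n)"
      unfolding \<open>of_real x powr (- w) * of_real (1 + y / x) powr (- s) = _\<close>
      by (simp add: Phi2_term_def x_def y_def)
    finally show ?thesis .
  qed
  have "barnes_kernel s2 (s1 + s2) (Complex c t) = (\<Sum>m. \<Sum>n. G t * B m t * A n t)" for t
    unfolding pull using suminf_mult[OF summable_norm_cancel[OF sB[of t]], of "G t * M_zeta (- Complex c t)"]
    by (simp add: SB barnes_kernel_def G_def s_def w_def)
  then have "(LINT t|lborel. barnes_kernel s2 (s1 + s2) (Complex c t)) = (\<Sum>m. \<Sum>n. of_real (2 * pi) * Gamma s * Phi2_term s1 s2 (Suc m) (Suc n))"
    using outer by (simp add: inner(2) trm)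
  also have "\<dots> = of_real (2 * pi) * Gamma s * (\<Sum>m. \<Sum>n. Phi2_term s1 s2 (Suc m) (Suc n))"
  proof -
    have h: "Re s2 > 1" "Re (s1 + s2) > 2" using c by auto
    show ?thesis
      using Phi2_eq_suminf(2,3)[OF h] by (simp only: suminf_mult)
  qed
  also have "(\<Sum>m. \<Sum>n. Phi2_term s1 s2 (Suc m) (Suc n)) = Phi2 s1 s2"
    using c by (intro Phi2_eq_suminf(1)[symmetric]) auto
  finally show ?thesis by (simp add: s_def)
qed

section \<open>The residue sum along an enumeration of the zeros\<close>

lemma enumerates_zeta_zeros_mem: "enumerates_zeta_zeros \<rho> \<Longrightarrow> \<rho> (Suc n) \<in> nontrivial_zeta_zeros"
  unfolding enumerates_zeta_zeros_def bij_betw_def by auto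

lemma enumerates_zeta_zeros_inj: "enumerates_zeta_zeros \<rho> \<Longrightarrow> inj (\<lambda>n. \<rho> (Suc n))"
  unfolding enumerates_zeta_zeros_def bij_betw_def by (auto intro!: injI dest: inj_onD)

lemma enumerates_zeta_zeros_surj:
  assumes "enumerates_zeta_zeros \<rho>" "r \<in> nontrivial_zeta_zeros"
  shows "\<exists>n. r = \<rho> (Suc n)"
proof -
  have "r \<in> \<rho> ` {1..}" using assms unfolding enumerates_zeta_zeros_def bij_betw_def by auto
  then obtain m where "m \<ge> 1" "r = \<rho> m" by auto
  then show ?thesis by (intro exI[of _ "m - 1"]) auto
qed

lemma summable_zeros:
  assumes \<rho>: "enumerates_zeta_zeros \<rho>" and c: "c > 0"
  shows "summable (\<lambda>n. \<bar>real_of_int (zorder riemann_zeta (\<rho> (Suc n)))\<bar> * exp (- c * \<bar>Im (\<rho> (Suc n))\<bar>))"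
proof -
  obtain B where B: "\<forall>F. finite F \<and> F \<subseteq> nontrivial_zeta_zeros \<longrightarrow>
     (\<Sum>z\<in>F. \<bar>real_of_int (zorder riemann_zeta z)\<bar> * exp (- c * \<bar>Im z\<bar>)) \<le> B"
    using zero_sum_bounded[OF c] by blast
  show ?thesis
  proof (rule summableI_nonneg_bounded)
    fix n
    have inj: "inj_on (\<lambda>n. \<rho> (Suc n)) {..<n}"
      using enumerates_zeta_zeros_inj[OF \<rho>] by (rule inj_on_subset) auto
    have "(\<Sum>n<n. \<bar>real_of_int (zorder riemann_zeta (\<rho> (Suc n)))\<bar> * exp (- c * \<bar>Im (\<rho> (Suc n))\<bar>))
      = (\<Sum>z\<in>(\<lambda>n. \<rho> (Suc n)) ` {..<n}. \<bar>real_of_int (zorder riemann_zeta z)\<bar> * exp (- c * \<bar>Im z\<bar>))"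
      unfolding sum.reindex[OF inj] o_def ..
    also have "\<dots> \<le> B"
      by (rule B[rule_format], intro conjI finite_imageI finite_lessThan image_subsetI enumerates_zeta_zeros_mem[OF \<rho>])
    finally show "(\<Sum>n<n. \<bar>real_of_int (zorder riemann_zeta (\<rho> (Suc n)))\<bar> * exp (- c * \<bar>Im (\<rho> (Suc n))\<bar>)) \<le> B" .
  qed auto
qed

text \<open>\<open>zero_term\<close> in the coordinates \<open>s = s2\<close>,
  \<open>w = s1 + s2\<close>.\<close>

definition zero_weight :: "complex \<Rightarrow> complex \<Rightarrow> complex \<Rightarrow> complex" where
  "zero_weight s w r = of_int (zorder riemann_zeta r) * Gamma (s - r) * Gamma r * riemann_zeta (w - r)"

lemma zero_term_eq: "zero_term s1 s2 r = zero_weight s2 (s1 + s2) r"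
  by (simp add: zero_term_def zero_weight_def)

text \<open>The gamma factors give the rate \<open>-3\<close> in the ordinate of the zero, zeta
  gives \<open>3/2\<close>. An ordinate above \<open>A + 1\<close> keeps the arguments away from all
  poles, uniformly for \<open>s\<close> and \<open>w\<close> in a ball.\<close>

lemma zero_weight_bound:
  "\<exists>C>0. \<forall>s w r. norm s \<le> A \<and> norm w \<le> A \<and> r \<in> nontrivial_zeta_zeros \<and> \<bar>Im r\<bar> \<ge> A + 1 \<longrightarrow>
     norm (zero_weight s w r) \<le> C * (\<bar>real_of_int (zorder riemann_zeta r)\<bar> * exp (- (3/2) * \<bar>Im r\<bar>))"
proof -
  define A' where "A' = \<bar>A\<bar> + 1"
  obtain C1 where C1: "C1 > 0" "\<forall>a b. \<bar>Re a\<bar> \<le> A' \<and> \<bar>Re b\<bar> \<le> A' \<and> \<bar>Im a\<bar> \<ge> 1 \<and> \<bar>Im b\<bar> \<ge> 1 \<longrightarrow>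
     norm (Gamma a * Gamma b) \<le> C1 * exp (- (3/2) * (\<bar>Im a\<bar> + \<bar>Im b\<bar>))"
    using Gamma_pair_bound[of A'] by blast
  obtain C2 where C2: "C2 > 0" "\<forall>s. \<bar>Re s\<bar> \<le> A' \<and> norm (s - 1) \<ge> 1 \<longrightarrow> norm (riemann_zeta s) \<le> C2 * exp ((3/2) * \<bar>Im s\<bar>)"
    using riemann_zeta_growth[of A'] by blast
  define C where "C = C1 * C2 * exp (3 * A)"
  have "norm (zero_weight s w r) \<le> C * (\<bar>real_of_int (zorder riemann_zeta r)\<bar> * exp (- (3/2) * \<bar>Im r\<bar>))"
    if h: "norm s \<le> A" "norm w \<le> A" "r \<in> nontrivial_zeta_zeros" "\<bar>Im r\<bar> \<ge> A + 1" for s w r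
  proof -
    have r: "0 \<le> Re r" "Re r \<le> 1" using nontrivial_zeta_zeros_Re[OF h(3)] by auto
    have s: "\<bar>Re s\<bar> \<le> A" "\<bar>Im s\<bar> \<le> A" using abs_Re_le_cmod[of s] abs_Im_le_cmod[of s] h(1) by linarith+
    have w: "\<bar>Re w\<bar> \<le> A" "\<bar>Im w\<bar> \<le> A" using abs_Re_le_cmod[of w] abs_Im_le_cmod[of w] h(2) by linarith+
    have i1: "\<bar>Im (s - r)\<bar> \<ge> \<bar>Im r\<bar> - A" using s by auto
    have i2: "\<bar>Im (w - r)\<bar> \<ge> \<bar>Im r\<bar> - A" "\<bar>Im (w - r)\<bar> \<le> \<bar>Im r\<bar> + A" using w by auto
    have A0: "A \<ge> 0" using h(1) norm_ge_zero order_trans by blast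
    have "norm (Gamma (s - r) * Gamma r) \<le> C1 * exp (- (3/2) * (\<bar>Im (s - r)\<bar> + \<bar>Im r\<bar>))"
      by (rule C1(2)[rule_format]) (use r s i1 h(4) A0 in \<open>auto simp: A'_def\<close>)
    also have "\<dots> \<le> C1 * exp ((3/2) * A + (- 3) * \<bar>Im r\<bar>)"
    proof (intro mult_left_mono)
      have "- (3/2) * (x + y) \<le> (3/2) * A + (- 3) * y" if "x \<ge> y - A" for x y :: real using that by argo
      from this[OF i1] show "exp (- (3/2) * (\<bar>Im (s - r)\<bar> + \<bar>Im r\<bar>)) \<le> exp ((3/2) * A + (- 3) * \<bar>Im r\<bar>)"
        unfolding exp_le_cancel_iff .
    qed (use C1(1) in simp)
    finally have g: "norm (Gamma (s - r) * Gamma r) \<le> C1 * exp ((3/2) * A + (- 3) * \<bar>Im r\<bar>)" .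
    have "norm (riemann_zeta (w - r)) \<le> C2 * exp ((3/2) * \<bar>Im (w - r)\<bar>)"
    proof (rule C2(2)[rule_format], intro conjI)
      show "\<bar>Re (w - r)\<bar> \<le> A'" using r w by (auto simp: A'_def)
      show "1 \<le> norm (w - r - 1)" using abs_Im_le_cmod[of "w - r - 1"] i2(1) h(4) by simp
    qed
    also have "\<dots> \<le> C2 * exp ((3/2) * A + (3/2) * \<bar>Im r\<bar>)"
    proof (intro mult_left_mono)
      have "(3/2) * x \<le> (3/2) * A + (3/2) * y" if "x \<le> y + A" for x y :: real using that by argo
      from this[OF i2(2)] show "exp ((3/2) * \<bar>Im (w - r)\<bar>) \<le> exp ((3/2) * A + (3/2) * \<bar>Im r\<bar>)"
        unfolding exp_le_cancel_iff .
    qed (use C2(1) in simp)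
    finally have z: "norm (riemann_zeta (w - r)) \<le> C2 * exp ((3/2) * A + (3/2) * \<bar>Im r\<bar>)" .
    have "norm (zero_weight s w r) = \<bar>real_of_int (zorder riemann_zeta r)\<bar> * (norm (Gamma (s - r) * Gamma r) * norm (riemann_zeta (w - r)))"
      by (simp add: zero_weight_def norm_mult mult.assoc)
    also have "\<dots> \<le> \<bar>real_of_int (zorder riemann_zeta r)\<bar> * ((C1 * exp ((3/2) * A + (- 3) * \<bar>Im r\<bar>)) * (C2 * exp ((3/2) * A + (3/2) * \<bar>Im r\<bar>)))"
      using C1(1) by (intro mult_left_mono mult_mono g z) auto
    also have "\<dots> = C1 * C2 * (\<bar>real_of_int (zorder riemann_zeta r)\<bar> * (exp ((3/2) * A + (- 3) * \<bar>Im r\<bar>) * exp ((3/2) * A + (3/2) * \<bar>Im r\<bar>)))"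
      by (simp add: mult_ac)
    also have "exp ((3/2) * A + (- 3) * \<bar>Im r\<bar>) * exp ((3/2) * A + (3/2) * \<bar>Im r\<bar>) = exp (3 * A) * exp (- (3/2) * \<bar>Im r\<bar>)"
      unfolding mult_exp_exp by (rule arg_cong[where f = exp]) simp
    finally show ?thesis by (simp add: C_def mult_ac)
  qed
  moreover have "C > 0" using C1 C2 by (simp add: C_def)
  ultimately show ?thesis by blast
qed

lemma finite_small_zeros:
  assumes \<rho>: "enumerates_zeta_zeros \<rho>"
  shows "finite {n. \<bar>Im (\<rho> (Suc n))\<bar> \<le> T}"
proof (rule finite_imageD)
  show "finite ((\<lambda>n. \<rho> (Suc n)) ` {n. \<bar>Im (\<rho> (Suc n))\<bar> \<le> T})"
    by (rule finite_subset[OF _ finite_nontrivial_zeros[of T]]) (use enumerates_zeta_zeros_mem[OF \<rho>] in auto)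
  show "inj_on (\<lambda>n. \<rho> (Suc n)) {n. \<bar>Im (\<rho> (Suc n))\<bar> \<le> T}"
    using enumerates_zeta_zeros_inj[OF \<rho>] by (rule inj_on_subset) auto
qed

lemma summable_zero_weight:
  assumes \<rho>: "enumerates_zeta_zeros \<rho>"
  shows "summable (\<lambda>n. norm (zero_weight s w (\<rho> (Suc n))))"
proof -
  define A where "A = max (norm s) (norm w)"
  obtain C where C: "\<forall>s w r. norm s \<le> A \<and> norm w \<le> A \<and> r \<in> nontrivial_zeta_zeros \<and> \<bar>Im r\<bar> \<ge> A + 1 \<longrightarrow>
     norm (zero_weight s w r) \<le> C * (\<bar>real_of_int (zorder riemann_zeta r)\<bar> * exp (- (3/2) * \<bar>Im r\<bar>))"
    using zero_weight_bound[of A] by blast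
  obtain n0 where n0: "{n. \<bar>Im (\<rho> (Suc n))\<bar> \<le> A + 1} \<subseteq> {..<n0}"
    using finite_nat_iff_bounded[of "{n. \<bar>Im (\<rho> (Suc n))\<bar> \<le> A + 1}"] finite_small_zeros[OF \<rho>] by auto
  show ?thesis
  proof (rule summable_comparison_test'[where N = n0])
    show "summable (\<lambda>n. C * (\<bar>real_of_int (zorder riemann_zeta (\<rho> (Suc n)))\<bar> * exp (- (3/2) * \<bar>Im (\<rho> (Suc n))\<bar>)))"
      by (intro summable_mult summable_zeros[OF \<rho>]) simp
    fix n assume "n \<ge> n0"
    then have "\<not> \<bar>Im (\<rho> (Suc n))\<bar> \<le> A + 1" using n0 by (auto simp: subset_iff)
    then show "norm (norm (zero_weight s w (\<rho> (Suc n)))) \<le> C * (\<bar>real_of_int (zorder riemann_zeta (\<rho> (Suc n)))\<bar> * exp (- (3/2) * \<bar>Im (\<rho> (Suc n))\<bar>))"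
      unfolding real_norm_def abs_norm_cancel by (intro C[rule_format]) (use enumerates_zeta_zeros_mem[OF \<rho>] in \<open>auto simp: A_def\<close>)
  qed
qed

text \<open>Absolute summability makes the order of summation irrelevant. So the truncations by
  height, which the residue theorem produces, converge to the series along any enumeration.\<close>

lemma tendsto_zero_sum:
  assumes \<rho>: "enumerates_zeta_zeros \<rho>" and T: "filterlim T at_top sequentially"
  shows "(\<lambda>j. \<Sum>r | r \<in> nontrivial_zeta_zeros \<and> \<bar>Im r\<bar> < T j. zero_weight s w r) \<longlonglongrightarrow> (\<Sum>n. zero_weight s w (\<rho> (Suc n)))"
proof -
  define f where "f n = zero_weight s w (\<rho> (Suc n))" for n
  define X where "X j = {n. \<bar>Im (\<rho> (Suc n))\<bar> < T j}" for j
  have "(f has_sum suminf f) UNIV"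
    unfolding f_def using norm_summable_imp_has_sum[OF summable_zero_weight[OF \<rho>] summable_sums[OF summable_norm_cancel[OF summable_zero_weight[OF \<rho>]]]] .
  then have "(sum f \<longlongrightarrow> suminf f) (finite_subsets_at_top UNIV)" by (simp add: has_sum_def)
  moreover have "filterlim X (finite_subsets_at_top UNIV) sequentially"
    unfolding filterlim_finite_subsets_at_top
  proof (intro allI impI)
    fix Y :: "nat set" assume Y: "finite Y \<and> Y \<subseteq> UNIV"
    then have "\<forall>\<^sub>F j in sequentially. \<forall>n\<in>Y. \<bar>Im (\<rho> (Suc n))\<bar> < T j"
      by (intro eventually_ball_finite) (simp_all add: T[unfolded filterlim_at_top_dense, rule_format])
    then show "\<forall>\<^sub>F j in sequentially. finite (X j) \<and> Y \<subseteq> X j \<and> X j \<subseteq> UNIV"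
    proof eventually_elim
      case (elim j)
      have "finite (X j)" unfolding X_def
        by (rule finite_subset[OF _ finite_small_zeros[OF \<rho>, of "T j"]]) auto
      then show ?case using elim by (auto simp: X_def)
    qed
  qed
  ultimately have "(\<lambda>j. sum f (X j)) \<longlonglongrightarrow> suminf f" by (rule filterlim_compose)
  moreover have "sum f (X j) = (\<Sum>r | r \<in> nontrivial_zeta_zeros \<and> \<bar>Im r\<bar> < T j. zero_weight s w r)" for j
  proof -
    have "{r. r \<in> nontrivial_zeta_zeros \<and> \<bar>Im r\<bar> < T j} = (\<lambda>n. \<rho> (Suc n)) ` X j"
      unfolding X_def
    proof (intro subset_antisym subsetI)
      fix r assume r: "r \<in> {r. r \<in> nontrivial_zeta_zeros \<and> \<bar>Im r\<bar> < T j}"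
      then obtain n where "r = \<rho> (Suc n)" using enumerates_zeta_zeros_surj[OF \<rho>, of r] by blast
      then show "r \<in> (\<lambda>n. \<rho> (Suc n)) ` {n. \<bar>Im (\<rho> (Suc n))\<bar> < T j}" using r by simp
    next
      fix r assume "r \<in> (\<lambda>n. \<rho> (Suc n)) ` {n. \<bar>Im (\<rho> (Suc n))\<bar> < T j}"
      then obtain n where "r = \<rho> (Suc n)" "\<bar>Im (\<rho> (Suc n))\<bar> < T j" by blast
      then show "r \<in> {r. r \<in> nontrivial_zeta_zeros \<and> \<bar>Im r\<bar> < T j}"
        using enumerates_zeta_zeros_mem[OF \<rho>, of n] by simp
    qed
    moreover have "inj_on (\<lambda>n. \<rho> (Suc n)) (X j)"
      using enumerates_zeta_zeros_inj[OF \<rho>] by (rule inj_on_subset) auto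
    ultimately show ?thesis by (simp add: sum.reindex f_def)
  qed
  ultimately show ?thesis by (simp add: f_def[abs_def])
qed

subsection \<open>Residues of the kernel\<close>

lemma zeta_entire_eq_0_iff: "zeta_entire x = 0 \<longleftrightarrow> x \<in> nontrivial_zeta_zeros \<or> (\<exists>k\<ge>1. x = - of_nat (2 * k))"
proof (cases "Re x < 0")
  case True
  then have "x \<notin> nontrivial_zeta_zeros" using nontrivial_zeta_zeros_Re[of x] by auto
  then show ?thesis using zeta_entire_eq_0_left[OF True] by simp
next
  case False
  then have "\<not> (\<exists>k\<ge>1. x = - of_nat (2 * k))" by auto
  then show ?thesis using False by (simp only: nontrivial_zeta_zeros_iff) auto
qed

lemma holomorphic_M_zeta:
  assumes "\<And>x. x \<in> A \<Longrightarrow> x \<noteq> 1 \<and> zeta_entire x \<noteq> 0"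
  shows "M_zeta holomorphic_on A"
proof -
  have "deriv zeta_entire holomorphic_on A"
    using holomorphic_deriv[OF holomorphic_zeta_entire open_UNIV] by (rule holomorphic_on_subset) auto
  then have "(\<lambda>s. 1 / (s - 1) - deriv zeta_entire s / zeta_entire s) holomorphic_on A"
    using assms by (intro holomorphic_on_diff holomorphic_on_divide holomorphic_zeta_entire holomorphic_on_const holomorphic_on_ident) auto
  then show ?thesis
    by (rule holomorphic_transform) (simp add: assms M_zeta_eq_logderiv)
qed

lemma holomorphic_M_zeta' [holomorphic_intros]:
  assumes "g holomorphic_on A" "\<And>x. x \<in> A \<Longrightarrow> g x \<noteq> 1" "\<And>x. x \<in> A \<Longrightarrow> zeta_entire (g x) \<noteq> 0"
  shows "(\<lambda>x. M_zeta (g x)) holomorphic_on A"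
proof -
  have "M_zeta holomorphic_on (g ` A)" by (rule holomorphic_M_zeta) (use assms in auto)
  from holomorphic_on_compose[OF assms(1) this] show ?thesis by (simp add: o_def)
qed

text \<open>Locally \<open>zeta_entire\<close> is a nonvanishing factor times a power of
  \<open>x - r\<close>. Points that are no zeros are included, with order 0; this serves at the pole
  of zeta.\<close>

lemma zeta_entire_logderiv_limit:
  "((\<lambda>x. (x - r) * (deriv zeta_entire x / zeta_entire x)) \<longlongrightarrow> of_int (zorder zeta_entire r)) (at r)"
proof -
  have w: "zeta_entire 1 \<noteq> 0" by (simp add: zeta_entire_1)
  have A: "(if zeta_entire r = 0 then zorder zeta_entire r > 0 else zorder zeta_entire r = 0) \<and>
      (\<exists>e>0. cball r e \<subseteq> UNIV \<and> zor_poly zeta_entire r holomorphic_on cball r e \<and>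
      (\<forall>w\<in>cball r e. zeta_entire w = zor_poly zeta_entire r w * (w - r) ^ nat (zorder zeta_entire r) \<and> zor_poly zeta_entire r w \<noteq> 0))"
    by (rule zorder_exist_zero[OF holomorphic_zeta_entire]) (use w in auto)
  define g where "g = zor_poly zeta_entire r"
  define n where "n = nat (zorder zeta_entire r)"
  obtain e where e: "e > 0" "g holomorphic_on cball r e" "\<forall>z\<in>cball r e. zeta_entire z = g z * (z - r) ^ n \<and> g z \<noteq> 0"
    using conjunct2[OF A] unfolding g_def n_def by blast
  have n0: "of_nat n = (of_int (zorder zeta_entire r) :: complex)"
    using conjunct1[OF A] by (simp add: n_def split: if_splits)
  have gb: "g holomorphic_on ball r e" using e(2) by (rule holomorphic_on_subset) auto
  have eq: "(x - r) * (deriv zeta_entire x / zeta_entire x) = of_nat n + (x - r) * (deriv g x / g x)"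
    if x: "x \<in> ball r e" "x \<noteq> r" for x
  proof -
    have dg: "(g has_field_derivative deriv g x) (at x)" using holomorphic_derivI[OF gb _ x(1)] by simp
    have "((\<lambda>z. g z * (z - r) ^ n) has_field_derivative (deriv g x * (x - r) ^ n + (of_nat n * (x - r) ^ (n - 1)) * g x)) (at x)"
      by (rule DERIV_mult[OF dg]) (auto intro!: derivative_eq_intros)
    then have "(zeta_entire has_field_derivative (deriv g x * (x - r) ^ n + (of_nat n * (x - r) ^ (n - 1)) * g x)) (at x)"
      by (rule has_field_derivative_transform_within_open[of _ _ _ "ball r e"]) (use e x in auto)
    then have d: "deriv zeta_entire x = deriv g x * (x - r) ^ n + (of_nat n * (x - r) ^ (n - 1)) * g x" by (rule DERIV_imp_deriv)
    have gx: "zeta_entire x = g x * (x - r) ^ n" "g x \<noteq> 0" using e(3) x by auto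
    have xr: "x - r \<noteq> 0" using x by simp
    have p: "(x - r) * (of_nat n * (x - r) ^ (n - 1)) = of_nat n * (x - r) ^ n"
      by (cases n) auto
    have "(x - r) * deriv zeta_entire x = (of_nat n + (x - r) * (deriv g x / g x)) * zeta_entire x"
    proof -
      have "(x - r) * deriv zeta_entire x = (x - r) * deriv g x * (x - r) ^ n + ((x - r) * (of_nat n * (x - r) ^ (n - 1))) * g x"
        unfolding d by (simp add: algebra_simps)
      also have "\<dots> = (of_nat n + (x - r) * (deriv g x / g x)) * zeta_entire x"
        unfolding p gx(1) using gx(2) by (simp add: distrib_right)
      finally show ?thesis .
    qed
    moreover have "zeta_entire x \<noteq> 0" using gx xr by simp
    ultimately show ?thesis by (simp add: field_simps)
  qed
  have "((\<lambda>x. of_nat n + (x - r) * (deriv g x / g x)) \<longlongrightarrow> of_nat n + (r - r) * (deriv g r / g r)) (at r)"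
  proof (intro tendsto_intros)
    show "(deriv g \<longlongrightarrow> deriv g r) (at r)"
    proof -
      have "continuous_on (ball r e) (deriv g)" by (intro holomorphic_on_imp_continuous_on holomorphic_deriv gb) auto
      then have "isCont (deriv g) r" using e(1) by (simp add: continuous_on_eq_continuous_at)
      then show ?thesis by (simp add: isCont_def)
    qed
    show "(g \<longlongrightarrow> g r) (at r)"
    proof -
      have "continuous_on (ball r e) g" by (intro holomorphic_on_imp_continuous_on gb)
      then have "isCont g r" using e(1) by (simp add: continuous_on_eq_continuous_at)
      then show ?thesis by (simp add: isCont_def)
    qed
    show "g r \<noteq> 0" using e by auto
  qed
  then have "((\<lambda>x. of_nat n + (x - r) * (deriv g x / g x)) \<longlongrightarrow> of_int (zorder zeta_entire r)) (at r)"
    by (simp add: n0)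
  then show ?thesis
  proof (rule Lim_transform_eventually)
    have "\<forall>\<^sub>F x in at r. x \<in> ball r e - {r}" using e(1) by (intro eventually_at_in_open) auto
    then show "\<forall>\<^sub>F x in at r. of_nat n + (x - r) * (deriv g x / g x) = (x - r) * (deriv zeta_entire x / zeta_entire x)"
      by eventually_elim (use eq in auto)
  qed
qed

lemma eventually_at_zeta_entire_nonzero: "\<forall>\<^sub>F x in at r. zeta_entire x \<noteq> 0 \<and> x \<noteq> 1"
proof -
  have "\<forall>\<^sub>F x in at r. zeta_entire x \<noteq> 0"
    using non_zero_neighbour_alt[OF holomorphic_zeta_entire[of UNIV] open_UNIV connected_UNIV, of r 1]
    by (auto simp: zeta_entire_1 elim: eventually_mono)
  moreover have "\<forall>\<^sub>F x in at r. x \<noteq> 1" by (rule eventually_neq_at_within)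
  ultimately show ?thesis by eventually_elim auto
qed

lemma M_zeta_limit_zero:
  assumes r: "r \<noteq> 1"
  shows "((\<lambda>x. (x - r) * M_zeta x) \<longlongrightarrow> - of_int (zorder zeta_entire r)) (at r)"
proof -
  have "((\<lambda>x. (x - r) * (1 / (x - 1)) - (x - r) * (deriv zeta_entire x / zeta_entire x)) \<longlongrightarrow> (r - r) * (1 / (r - 1)) - of_int (zorder zeta_entire r)) (at r)"
    by (intro tendsto_intros zeta_entire_logderiv_limit) (use r in auto)
  then have "((\<lambda>x. (x - r) * (1 / (x - 1)) - (x - r) * (deriv zeta_entire x / zeta_entire x)) \<longlongrightarrow> - of_int (zorder zeta_entire r)) (at r)" by simp
  then show ?thesis
    by (rule Lim_transform_eventually)
       (use eventually_at_zeta_entire_nonzero[of r] in \<open>eventually_elim, simp add: M_zeta_eq_logderiv right_diff_distrib\<close>)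
qed

lemma M_zeta_limit_pole: "((\<lambda>x. (x - 1) * M_zeta x) \<longlongrightarrow> 1) (at 1)"
proof -
  have "zorder zeta_entire 1 = 0"
    by (rule zorder_eqI[of UNIV _ zeta_entire]) (auto simp: zeta_entire_1 intro!: holomorphic_intros)
  then have "((\<lambda>x. 1 - (x - 1) * (deriv zeta_entire x / zeta_entire x)) \<longlongrightarrow> 1 - of_int 0) (at 1)"
    using zeta_entire_logderiv_limit[of 1] by (intro tendsto_intros) simp
  then have "((\<lambda>x. 1 - (x - 1) * (deriv zeta_entire x / zeta_entire x)) \<longlongrightarrow> 1) (at 1)" by simp
  then show ?thesis
    by (rule Lim_transform_eventually)
       (use eventually_at_zeta_entire_nonzero[of 1] in \<open>eventually_elim, simp add: M_zeta_eq_logderiv right_diff_distrib\<close>)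
qed

lemma zorder_trivial_zero:
  assumes "k \<ge> 1"
  shows "zorder zeta_entire (- of_nat (2 * k)) = 1"
proof (rule zorder_zero_eqI[OF holomorphic_zeta_entire open_UNIV])
  have "zeta_entire (- of_nat (2 * k)) = 0" using zeta_entire_eq_0_iff assms by blast
  then show "(deriv ^^ i) zeta_entire (- of_nat (2 * k)) = 0" if "i < nat 1" for i using that by simp
  show "(deriv ^^ nat 1) zeta_entire (- of_nat (2 * k)) \<noteq> 0" using deriv_zeta_entire_trivial_zero[OF assms] by simp
qed auto

lemma filterlim_uminus_at: "filterlim uminus (at (- a)) (at a)" for a :: complex
  by (intro filterlim_atI tendsto_intros) (auto simp: eventually_at_filter)

lemma simple_pole_residue:
  assumes U: "open U" "p \<in> U" and h: "h holomorphic_on U" and g: "g holomorphic_on U - {p}"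
    and lim: "((\<lambda>z. (z - p) * g z) \<longlongrightarrow> \<mu>) (at p)"
  shows "residue (\<lambda>z. h z * g z) p = h p * \<mu>"
proof (rule residue_simple'[OF U])
  show "(\<lambda>z. h z * g z) holomorphic_on U - {p}"
    by (intro holomorphic_intros g holomorphic_on_subset[OF h]) auto
  have "isCont h p" using holomorphic_on_imp_continuous_on[OF h] U by (simp add: continuous_on_eq_continuous_at)
  then have "((\<lambda>z. h z * ((z - p) * g z)) \<longlongrightarrow> h p * \<mu>) (at p)" by (intro tendsto_intros lim) (simp add: isCont_def)
  then show "((\<lambda>z. h z * g z * (z - p)) \<longlongrightarrow> h p * \<mu>) (at p)" by (simp add: mult_ac)
qed

text \<open>Clearing the simple pole turns the integrand into
  \<open>\<alpha> x / (x - p) ^ 2\<close>, and Cauchy's formula for the derivative applies. So the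
  constant Laurent coefficients \<open>a_coeff\<close> and \<open>b_coeff\<close>, defined by
  contour integrals, become derivatives.\<close>

lemma laurent_constant_term:
  fixes f :: "complex \<Rightarrow> complex"
  assumes f: "f holomorphic_on ball p 1 - {p}" and lim: "((\<lambda>x. (x - p) * f x) \<longlongrightarrow> c) (at p)"
  defines "\<alpha> \<equiv> \<lambda>x. if x = p then c else (x - p) * f x"
  shows "\<alpha> holomorphic_on ball p 1"
    and "contour_integral (circlepath p (1/2)) (\<lambda>x. f x / (x - p)) = 2 * of_real pi * \<i> * deriv \<alpha> p"
proof -
  have "(\<lambda>x. (x - p) * f x) holomorphic_on ball p 1 - {p}" by (intro holomorphic_intros f)
  then show h: "\<alpha> holomorphic_on ball p 1"
    unfolding \<alpha>_def by (rule removable_singularity[OF _ _ lim]) auto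
  have "((\<lambda>u. \<alpha> u / (u - p) ^ Suc 1) has_contour_integral ((2 * pi * \<i>) / (fact 1) * (deriv ^^ 1) \<alpha> p)) (circlepath p (1/2))"
    by (rule Cauchy_has_contour_integral_higher_derivative_circlepath)
       (auto intro!: holomorphic_on_imp_continuous_on holomorphic_on_subset[OF h])
  then have "contour_integral (circlepath p (1/2)) (\<lambda>u. \<alpha> u / (u - p) ^ Suc 1) = 2 * of_real pi * \<i> * deriv \<alpha> p"
    by (simp add: contour_integral_unique)
  moreover have "contour_integral (circlepath p (1/2)) (\<lambda>u. \<alpha> u / (u - p) ^ Suc 1) = contour_integral (circlepath p (1/2)) (\<lambda>x. f x / (x - p))"
    by (rule contour_integral_eq) (auto simp: \<alpha>_def power2_eq_square)
  ultimately show "contour_integral (circlepath p (1/2)) (\<lambda>x. f x / (x - p)) = 2 * of_real pi * \<i> * deriv \<alpha> p" by simp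
qed

lemma ball_nonpos_Int: "x \<in> ball (- of_nat k) 1 - {- of_nat k} \<Longrightarrow> (x::complex) \<notin> \<int>\<^sub>\<le>\<^sub>0"
proof
  assume x: "x \<in> ball (- of_nat k) 1 - {- of_nat k}" "x \<in> \<int>\<^sub>\<le>\<^sub>0"
  then obtain n :: nat where n: "x = - of_nat n" by (auto elim!: nonpos_Ints_cases')
  have "norm (of_int (int n - int k) :: complex) < 1" using x(1) n by (simp add: dist_norm)
  then have "n = k" unfolding norm_of_int by linarith
  then show False using x(1) n by simp
qed

lemma Gamma_limit: "((\<lambda>x. (x - (- of_nat k)) * Gamma x) \<longlongrightarrow> (-1) ^ k / fact k) (at (- of_nat k :: complex))"
  using Gamma_residues[of k, where 'a = complex] by (simp add: mult.commute)

text \<open>The part of the \<open>z\<close>-plane to the right of all poles of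
  \<open>Gamma (s + z)\<close> and \<open>zeta(w + z)\<close>. For \<open>Re s > 1\<close> and
  \<open>Re w > 2\<close> it contains every point at which a residue is taken.\<close>

definition far_right :: "complex \<Rightarrow> complex \<Rightarrow> complex set" where
  "far_right s w = {z. - Re s < Re z} \<inter> {z. 1 - Re w < Re z}"

lemma open_far_right [simp]: "open (far_right s w)"
  unfolding far_right_def by (intro open_Int open_halfspace_Re_gt)

lemma holomorphic_far_right:
  "(\<lambda>z. Gamma (s + z) * riemann_zeta (w + z)) holomorphic_on far_right s w"
proof (intro holomorphic_on_mult holomorphic_Gamma' holomorphic_riemann_zeta' holomorphic_intros)
  fix z assume z: "z \<in> far_right s w"
  show "s + z \<notin> \<int>\<^sub>\<le>\<^sub>0" by (rule not_nonpos_Int_Re) (use z in \<open>simp add: far_right_def\<close>)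
  show "w + z \<noteq> 1" using z by (auto simp: far_right_def dest: arg_cong[of _ _ Re])
qed

text \<open>One punctured disc for all factors in \<open>- z\<close> at once, so that at each pole
  only the behaviour at the centre has to be examined.\<close>

lemma isolated_singularities:
  obtains e where "e > 0" "\<And>z. z \<in> ball p e - {p} \<Longrightarrow> zeta_entire (- z) \<noteq> 0 \<and> - z \<noteq> 1 \<and> - z \<notin> \<int>\<^sub>\<le>\<^sub>0"
proof -
  have "\<forall>\<^sub>F x in at (- p). x \<notin> \<int>\<^sub>\<le>\<^sub>0"
  proof (cases "- p \<in> \<int>\<^sub>\<le>\<^sub>0")
    case True
    then obtain k :: nat where k: "- p = - of_nat k" by (auto elim: nonpos_Ints_cases')
    have "\<forall>\<^sub>F x in at (- of_nat k). x \<in> ball (- of_nat k) 1 - {- of_nat k :: complex}"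
      by (intro eventually_at_in_open) auto
    then show ?thesis unfolding k by eventually_elim (rule ball_nonpos_Int)
  next
    case False
    then have "\<forall>\<^sub>F x in at (- p). x \<in> - \<int>\<^sub>\<le>\<^sub>0 - {- p}"
      by (intro eventually_at_in_open) (auto intro: open_Compl)
    then show ?thesis by eventually_elim simp
  qed
  then have "\<forall>\<^sub>F x in at (- p). zeta_entire x \<noteq> 0 \<and> x \<noteq> 1 \<and> x \<notin> \<int>\<^sub>\<le>\<^sub>0"
    using eventually_at_zeta_entire_nonzero[of "- p"] by eventually_elim simp
  then have "\<forall>\<^sub>F z in at p. zeta_entire (- z) \<noteq> 0 \<and> - z \<noteq> 1 \<and> - z \<notin> \<int>\<^sub>\<le>\<^sub>0"
    using filterlim_uminus_at[of p] unfolding filterlim_iff by (elim allE impE)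
  then obtain e where "e > 0" "\<forall>z. z \<noteq> p \<and> dist z p < e \<longrightarrow> zeta_entire (- z) \<noteq> 0 \<and> - z \<noteq> 1 \<and> - z \<notin> \<int>\<^sub>\<le>\<^sub>0"
    unfolding eventually_at by auto
  then show ?thesis using that[of e] by (simp add: dist_commute)
qed

lemma limit_uminus:
  fixes f :: "complex \<Rightarrow> complex"
  assumes "((\<lambda>x. (x - (- p)) * f x) \<longlongrightarrow> c) (at (- p))"
  shows "((\<lambda>z. (z - p) * f (- z)) \<longlongrightarrow> - c) (at p)"
proof -
  have "((\<lambda>z. - ((- z - (- p)) * f (- z))) \<longlongrightarrow> - c) (at p)"
    by (intro tendsto_minus filterlim_compose[OF assms filterlim_uminus_at])
  then show ?thesis by (simp add: algebra_simps)
qed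

context
  fixes s w :: complex
  assumes s: "Re s > 1" and w: "Re w > 2"
begin

text \<open>The pole of \<open>M_zeta\<close> at 1 has residue 1, and the reflection of the variable
  changes the sign; the factor \<open>Gamma (- z)\<close> is \<open>Gamma 1\<close> there.\<close>

lemma residue_at_minus_one: "residue (barnes_kernel s w) (-1) = - Gamma (s - 1) * riemann_zeta (w - 1)"
proof -
  obtain e where e: "e > 0" "\<And>z. z \<in> ball (-1) e - {-1} \<Longrightarrow> zeta_entire (- z) \<noteq> 0 \<and> - z \<noteq> 1 \<and> - z \<notin> \<int>\<^sub>\<le>\<^sub>0"
    using isolated_singularities[of "-1"] by blast
  define U where "U = far_right s w \<inter> ball (-1) e"
  define h where "h z = Gamma (- z) * (Gamma (s + z) * riemann_zeta (w + z))" for z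
  have "residue (\<lambda>z. h z * M_zeta (- z)) (-1) = h (-1) * (- 1)"
  proof (rule simple_pole_residue[of U])
    show "open U" by (simp add: U_def open_Int)
    show "-1 \<in> U" using s w e(1) by (auto simp: U_def far_right_def)
    show "h holomorphic_on U" unfolding h_def
    proof (rule holomorphic_on_mult)
      show "(\<lambda>z. Gamma (- z)) holomorphic_on U"
      proof (rule holomorphic_Gamma')
        fix z assume z: "z \<in> U"
        show "- z \<notin> \<int>\<^sub>\<le>\<^sub>0"
          by (cases "z = -1") (use z e(2) in \<open>auto simp: U_def not_nonpos_Int_Re\<close>)
      qed (intro holomorphic_intros)
      show "(\<lambda>z. Gamma (s + z) * riemann_zeta (w + z)) holomorphic_on U"
        using holomorphic_far_right by (rule holomorphic_on_subset) (simp add: U_def)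
    qed
    show "(\<lambda>z. M_zeta (- z)) holomorphic_on U - {-1}"
    proof (rule holomorphic_M_zeta')
      show "uminus holomorphic_on U - {-1}" by (intro holomorphic_intros)
    qed (use e(2) in \<open>auto simp: U_def\<close>)
    show "((\<lambda>z. (z - (-1)) * M_zeta (- z)) \<longlongrightarrow> - 1) (at (-1))"
      by (rule limit_uminus) (use M_zeta_limit_pole in simp)
  qed
  moreover have "(\<lambda>z. h z * M_zeta (- z)) = barnes_kernel s w"
    by (simp add: fun_eq_iff h_def barnes_kernel_def mult_ac)
  ultimately show ?thesis by (simp add: h_def)
qed

text \<open>At a zero \<open>M_zeta\<close> has residue minus the order, and the reflection of the
  variable restores the plus sign. The other factors are regular: \<open>r\<close> is neither 0,
  where zeta is \<open>- 1 / 2\<close>, nor another nonpositive integer.\<close>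

lemma residue_at_zeta_zero:
  assumes r: "r \<in> nontrivial_zeta_zeros"
  shows "residue (barnes_kernel s w) (- r) = zero_weight s w r"
proof -
  obtain e where e: "e > 0" "\<And>z. z \<in> ball (- r) e - {- r} \<Longrightarrow> zeta_entire (- z) \<noteq> 0 \<and> - z \<noteq> 1 \<and> - z \<notin> \<int>\<^sub>\<le>\<^sub>0"
    using isolated_singularities[of "- r"] by blast
  have Re_r: "0 \<le> Re r" "Re r \<le> 1" using nontrivial_zeta_zeros_Re[OF r] by auto
  have r0: "r \<noteq> 0" "r \<noteq> 1" using r by (auto simp: nontrivial_zeta_zeros_def riemann_zeta_0)
  have r': "r \<notin> \<int>\<^sub>\<le>\<^sub>0" using minus_not_nonpos_Int[of "- r"] Re_r r0 by simp
  define U where "U = far_right s w \<inter> ball (- r) e"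
  define h where "h z = Gamma (- z) * (Gamma (s + z) * riemann_zeta (w + z))" for z
  have "residue (\<lambda>z. h z * M_zeta (- z)) (- r) = h (- r) * (- (- of_int (zorder zeta_entire r)))"
  proof (rule simple_pole_residue[of U])
    show "open U" by (simp add: U_def open_Int)
    show "- r \<in> U" using s w e(1) Re_r by (auto simp: U_def far_right_def)
    show "h holomorphic_on U" unfolding h_def
    proof (rule holomorphic_on_mult)
      show "(\<lambda>z. Gamma (- z)) holomorphic_on U"
      proof (rule holomorphic_Gamma')
        fix z assume z: "z \<in> U"
        show "- z \<notin> \<int>\<^sub>\<le>\<^sub>0"
          by (cases "z = - r") (use z e(2) r' in \<open>auto simp: U_def\<close>)
      qed (intro holomorphic_intros)
      show "(\<lambda>z. Gamma (s + z) * riemann_zeta (w + z)) holomorphic_on U"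
        using holomorphic_far_right by (rule holomorphic_on_subset) (simp add: U_def)
    qed
    show "(\<lambda>z. M_zeta (- z)) holomorphic_on U - {- r}"
    proof (rule holomorphic_M_zeta')
      show "uminus holomorphic_on U - {- r}" by (intro holomorphic_intros)
    qed (use e(2) in \<open>auto simp: U_def\<close>)
    show "((\<lambda>z. (z - (- r)) * M_zeta (- z)) \<longlongrightarrow> - (- of_int (zorder zeta_entire r))) (at (- r))"
      by (rule limit_uminus) (use M_zeta_limit_zero[OF r0(2)] in simp)
  qed
  moreover have "(\<lambda>z. h z * M_zeta (- z)) = barnes_kernel s w"
    by (simp add: fun_eq_iff h_def barnes_kernel_def mult_ac)
  ultimately show ?thesis by (simp add: h_def zero_weight_def zorder_riemann_zeta[OF r0(2)] mult_ac)
qed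

text \<open>For these \<open>k\<close> the point \<open>- k\<close> is not a trivial zero, so
  \<open>M_zeta (- z)\<close> is regular and only \<open>Gamma (- z)\<close> has a pole.\<close>

lemma residue_at_nat_simple:
  assumes k: "k = 0 \<or> odd k"
  shows "residue (barnes_kernel s w) (of_nat k) =
    - ((-1) ^ k / fact k) * Gamma (s + of_nat k) * M_zeta (- of_nat k) * riemann_zeta (w + of_nat k)"
proof -
  obtain e where e: "e > 0" "\<And>z. z \<in> ball (of_nat k) e - {of_nat k} \<Longrightarrow> zeta_entire (- z) \<noteq> 0 \<and> - z \<noteq> 1 \<and> - z \<notin> \<int>\<^sub>\<le>\<^sub>0"
    using isolated_singularities[of "of_nat k"] by blast
  have nz: "zeta_entire (- of_nat k) \<noteq> 0"
  proof
    assume z: "zeta_entire (- of_nat k) = 0"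
    show False
    proof (cases "k = 0")
      case True
      then show False using z zeta_entire_eq[of 0] by (simp add: riemann_zeta_0)
    next
      case False
      then obtain m where m: "- of_nat k = - (of_nat (2 * m) :: complex)" using z zeta_entire_eq_0_left[of "- of_nat k"] by auto
      then have "(of_nat k :: complex) = of_nat (2 * m)" by simp
      then have "k = 2 * m" by (rule of_nat_eq_iff[THEN iffD1])
      then show False using k False by simp
    qed
  qed
  have m1: "- (of_nat k :: complex) \<noteq> 1" by (auto dest: arg_cong[of _ _ Re])
  define U where "U = far_right s w \<inter> ball (of_nat k) e"
  define h where "h z = M_zeta (- z) * (Gamma (s + z) * riemann_zeta (w + z))" for z
  have "residue (\<lambda>z. h z * Gamma (- z)) (of_nat k) = h (of_nat k) * (- ((-1) ^ k / fact k))"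
  proof (rule simple_pole_residue[of U])
    show "open U" by (simp add: U_def open_Int)
    show "of_nat k \<in> U" using s w e(1) by (auto simp: U_def far_right_def)
    show "h holomorphic_on U" unfolding h_def
    proof (rule holomorphic_on_mult)
      show "(\<lambda>z. M_zeta (- z)) holomorphic_on U"
      proof (rule holomorphic_M_zeta')
        show "uminus holomorphic_on U" by (intro holomorphic_intros)
        show "- z \<noteq> 1" "zeta_entire (- z) \<noteq> 0" if "z \<in> U" for z
          using e(2)[of z] nz m1 that by (cases "z = of_nat k"; force simp: U_def)+
      qed
      show "(\<lambda>z. Gamma (s + z) * riemann_zeta (w + z)) holomorphic_on U"
        using holomorphic_far_right by (rule holomorphic_on_subset) (simp add: U_def)
    qed
    show "(\<lambda>z. Gamma (- z)) holomorphic_on U - {of_nat k}"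
    proof (rule holomorphic_Gamma')
      show "uminus holomorphic_on U - {of_nat k}" by (intro holomorphic_intros)
    qed (use e(2) in \<open>auto simp: U_def\<close>)
    show "((\<lambda>z. (z - of_nat k) * Gamma (- z)) \<longlongrightarrow> - ((-1) ^ k / fact k)) (at (of_nat k :: complex))"
      by (rule limit_uminus[OF Gamma_limit])
  qed
  moreover have "(\<lambda>z. h z * Gamma (- z)) = barnes_kernel s w"
    by (simp add: fun_eq_iff h_def barnes_kernel_def mult_ac)
  ultimately show ?thesis by (simp add: h_def mult_ac)
qed

text \<open>
  At a double pole the residue is the derivative of the product of the two cleared factors and
  \<open>Gamma (s + z) * riemann_zeta (w + z)\<close>; \<open>b_coeff\<close> and \<open>a_coeff\<close> are the derivatives of the
  cleared factors.
\<close>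

lemma residue_at_nat_even:
  assumes k: "even k" "k \<noteq> 0"
  shows "residue (barnes_kernel s w) (of_nat k) =
    b_coeff k * (Gamma (s + of_nat k) * riemann_zeta (w + of_nat k))
    - a_coeff k / fact k * (Gamma (s + of_nat k) * riemann_zeta (w + of_nat k))
    - 1 / fact k * (deriv Gamma (s + of_nat k) * riemann_zeta (w + of_nat k)
        + Gamma (s + of_nat k) * deriv riemann_zeta (w + of_nat k))"
proof -
  define p :: complex where "p = of_nat k"
  \<comment> \<open>The values at \<open>- p\<close> are the limits: the residue of Gamma there is
    \<open>1 / fact k\<close> since \<open>k\<close> is even, and that of \<open>M_zeta\<close> is
    \<open>- 1\<close> since the trivial zero is simple.\<close>
  define \<alpha> where "\<alpha> x = (if x = - p then 1 / fact k else (x - (- p)) * Gamma x)" for x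
  define \<beta> where "\<beta> x = (if x = - p then - 1 else (x - (- p)) * M_zeta x)" for x
  define C where "C z = Gamma (s + z) * riemann_zeta (w + z)" for z
  define U where "U = far_right s w \<inter> ball p 1"
  have k2: "k \<ge> 2" using k by (cases "k = 1") auto
  have eq: "- (of_nat (2 * (k div 2)) :: complex) = - p" using k by (simp add: p_def flip: of_nat_mult)
  have zo: "zorder zeta_entire (- p) = 1" using zorder_trivial_zero[of "k div 2"] k2 unfolding eq by simp
  have G: "((\<lambda>x. (x - (- p)) * Gamma x) \<longlongrightarrow> 1 / fact k) (at (- p))"
    using Gamma_limit[of k] k by (simp add: p_def)
  have hG: "Gamma holomorphic_on ball (- p) 1 - {- p}"
    unfolding p_def using ball_nonpos_Int[of _ k] by (intro holomorphic_Gamma) blast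
  have hM: "M_zeta holomorphic_on ball (- p) 1 - {- p}"
  proof (rule holomorphic_M_zeta)
    fix x assume x: "x \<in> ball (- p) 1 - {- p}"
    have "\<bar>Re (- p - x)\<bar> < 1" using abs_Re_le_cmod[of "- p - x"] x by (simp add: dist_norm)
    then have "Re x < -1 + 1 - 1 + 1" using k2 by (simp add: p_def)
    then have "Re x < 0" by simp
    moreover have "x \<notin> \<int>\<^sub>\<le>\<^sub>0" by (rule ball_nonpos_Int[of _ k]) (use x in \<open>simp add: p_def\<close>)
    moreover have "- of_nat m \<in> (\<int>\<^sub>\<le>\<^sub>0 :: complex set)" for m by simp
    ultimately have "zeta_entire x \<noteq> 0" using zeta_entire_eq_0_left[of x] by blast
    then show "x \<noteq> 1 \<and> zeta_entire x \<noteq> 0" using \<open>Re x < 0\<close> by auto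
  qed
  have p1: "- p \<noteq> 1" by (auto simp: p_def dest: arg_cong[of _ _ Re])
  have M: "((\<lambda>x. (x - (- p)) * M_zeta x) \<longlongrightarrow> - 1) (at (- p))"
    using M_zeta_limit_zero[of "- p"] zo p1 by simp
  have a: "\<alpha> holomorphic_on ball (- p) 1" and b: "\<beta> holomorphic_on ball (- p) 1"
    using laurent_constant_term(1)[OF hG G] laurent_constant_term(1)[OF hM M] by (simp_all add: \<alpha>_def[abs_def] \<beta>_def[abs_def])
  have "contour_integral (circlepath (- p) (1/2)) (\<lambda>x. Gamma x / (x - (- p))) = 2 * of_real pi * \<i> * deriv \<alpha> (- p)"
    using laurent_constant_term(2)[OF hG G] by (simp add: \<alpha>_def[abs_def])
  then have da: "deriv \<alpha> (- p) = b_coeff k" by (simp add: b_coeff_def p_def)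
  have "contour_integral (circlepath (- p) (1/2)) (\<lambda>x. M_zeta x / (x - (- p))) = 2 * of_real pi * \<i> * deriv \<beta> (- p)"
    using laurent_constant_term(2)[OF hM M] by (simp add: \<beta>_def[abs_def])
  then have db: "deriv \<beta> (- p) = a_coeff k" by (simp add: a_coeff_def p_def)
  have pf: "p \<in> far_right s w" using s w by (simp add: far_right_def p_def)
  have U: "open U" "p \<in> U" using pf by (auto simp: U_def)
  have ball: "- z \<in> ball (- p) 1" if "z \<in> U" for z
    using that by (simp add: U_def dist_norm norm_minus_commute)
  have Da: "((\<lambda>z. \<alpha> (- z)) has_field_derivative (b_coeff k * - 1)) (at p)"
    by (rule DERIV_chain2[of \<alpha>])
       (use holomorphic_derivI[OF a open_ball, of "- p"] in \<open>auto simp: da intro!: derivative_eq_intros\<close>)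
  have Db: "((\<lambda>z. \<beta> (- z)) has_field_derivative (a_coeff k * - 1)) (at p)"
    by (rule DERIV_chain2[of \<beta>])
       (use holomorphic_derivI[OF b open_ball, of "- p"] in \<open>auto simp: db intro!: derivative_eq_intros\<close>)
  have sp: "s + p \<notin> \<int>\<^sub>\<le>\<^sub>0" by (rule not_nonpos_Int_Re) (use s in \<open>simp add: p_def\<close>)
  have wp: "w + p \<noteq> 1" using w by (auto simp: p_def dest: arg_cong[of _ _ Re])
  have D1: "(Gamma has_field_derivative deriv Gamma (s + p)) (at (s + p))"
    using field_differentiable_Gamma[OF sp] by (simp add: DERIV_deriv_iff_field_differentiable)
  have D2: "(riemann_zeta has_field_derivative deriv riemann_zeta (w + p)) (at (w + p))"
    by (rule holomorphic_derivI[OF holomorphic_riemann_zeta]) (use wp in auto)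
  have D1': "((\<lambda>z. Gamma (s + z)) has_field_derivative deriv Gamma (s + p)) (at p)"
    using DERIV_shift[of Gamma _ p s] D1 by (simp add: add.commute)
  have D2': "((\<lambda>z. riemann_zeta (w + z)) has_field_derivative deriv riemann_zeta (w + p)) (at p)"
    using DERIV_shift[of riemann_zeta _ p w] D2 by (simp add: add.commute)
  \<comment> \<open>The two reflected linear factors multiply to \<open>(z - p) ^ 2\<close>, so the
    kernel is \<open>F z / (z - p) ^ 2\<close> and its residue is \<open>deriv F p\<close>.\<close>
  define F where "F z = \<alpha> (- z) * \<beta> (- z) * C z" for z
  have hF: "F holomorphic_on U"
  proof -
    have "(\<alpha> \<circ> uminus) holomorphic_on U"
      by (rule holomorphic_on_compose_gen[OF _ a]) (use ball in \<open>auto intro!: holomorphic_intros\<close>)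
    moreover have "(\<beta> \<circ> uminus) holomorphic_on U"
      by (rule holomorphic_on_compose_gen[OF _ b]) (use ball in \<open>auto intro!: holomorphic_intros\<close>)
    moreover have "C holomorphic_on U" unfolding C_def
      using holomorphic_far_right by (rule holomorphic_on_subset) (simp add: U_def)
    ultimately show ?thesis unfolding F_def o_def by (intro holomorphic_on_mult)
  qed
  have a0: "\<alpha> (- p) = 1 / fact k" and b0: "\<beta> (- p) = - 1" by (simp_all add: \<alpha>_def \<beta>_def)
  have "(F has_field_derivative
     ((b_coeff k * - 1) * \<beta> (- p) + (a_coeff k * - 1) * \<alpha> (- p)) * C p
      + (deriv Gamma (s + p) * riemann_zeta (w + p) + deriv riemann_zeta (w + p) * Gamma (s + p)) * (\<alpha> (- p) * \<beta> (- p))) (at p)"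
    unfolding F_def C_def by (intro DERIV_mult Da Db D1' D2')
  then have dF: "deriv F p = b_coeff k * C p - a_coeff k / fact k * C p
      - 1 / fact k * (deriv Gamma (s + p) * riemann_zeta (w + p) + Gamma (s + p) * deriv riemann_zeta (w + p))"
    by (simp add: DERIV_imp_deriv a0 b0 algebra_simps add_divide_distrib)
  have "residue (barnes_kernel s w) p = residue (\<lambda>z. F z / (z - p) ^ Suc 1) p"
  proof (rule residue_cong)
    have "\<forall>\<^sub>F z in at p. z \<noteq> p" by (rule eventually_neq_at_within)
    then show "\<forall>\<^sub>F z in at p. barnes_kernel s w z = F z / (z - p) ^ Suc 1"
    proof eventually_elim
      case (elim z)
      have "- z \<noteq> - p" using elim by simp
      then have "F z = (- z - (- p)) * Gamma (- z) * ((- z - (- p)) * M_zeta (- z)) * C z" unfolding F_def \<alpha>_def \<beta>_def by simp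
      also have "\<dots> = (z - p) ^ 2 * barnes_kernel s w z"
        by (simp add: barnes_kernel_def C_def power2_eq_square algebra_simps)
      finally show ?case using elim by (simp add: power2_eq_square)
    qed
  qed simp
  also have "\<dots> = (deriv ^^ 1) F p / fact 1"
    by (rule residue_holomorphic_over_power[OF U hF])
  also have "\<dots> = deriv F p" by simp
  finally show ?thesis unfolding dF unfolding p_def C_def .
qed

end

subsection \<open>Shifting the line of integration\<close>

text \<open>Rate \<open>-3\<close> from the gamma factors, \<open>3/2\<close> from zeta, and a
  linear factor divided by the distance \<open>\<delta>\<close> to the zeros from
  \<open>M_zeta\<close>.\<close>

lemma barnes_kernel_decay:
  "\<exists>C>0. \<forall>s w z \<delta>. norm s \<le> A \<and> norm w \<le> A \<and> \<bar>Re z\<bar> \<le> A \<and> \<bar>Im z\<bar> \<ge> A + 1 \<and> 0 < \<delta> \<and> \<delta> \<le> 1 \<and>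
      (\<forall>x. zeta_entire x = 0 \<longrightarrow> \<delta> \<le> norm (- z - x)) \<longrightarrow>
     norm (barnes_kernel s w z) \<le> C / \<delta> * exp (- \<bar>Im z\<bar>)"
proof -
  obtain C1 where C1: "C1 > 0" "\<forall>s z d. \<bar>Re s\<bar> \<le> A \<and> \<bar>Im s\<bar> \<le> A \<and> \<bar>Re z\<bar> \<le> A \<and> \<bar>d\<bar> \<le> A \<and> \<bar>Im z\<bar> \<ge> A + 1 \<longrightarrow>
     norm (Gamma (s + z) * Gamma (of_real d - z)) \<le> C1 * exp (- 3 * \<bar>Im z\<bar>)"
    using Gamma_pair_bound'[of A] by blast
  obtain C2 where C2: "C2 > 0" "\<forall>s. \<bar>Re s\<bar> \<le> 2 * A \<and> norm (s - 1) \<ge> 1 \<longrightarrow> norm (riemann_zeta s) \<le> C2 * exp ((3/2) * \<bar>Im s\<bar>)"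
    using riemann_zeta_growth[of "2 * A"] by blast
  obtain C3 where C3: "C3 > 0" "\<forall>s \<delta>. \<bar>Re s\<bar> \<le> A \<and> 0 < \<delta> \<and> \<delta> \<le> 1 \<and> \<delta> \<le> norm (s - 1) \<and> (\<forall>z. zeta_entire z = 0 \<longrightarrow> \<delta> \<le> norm (s - z)) \<longrightarrow>
     norm (M_zeta s) \<le> C3 * (1 + \<bar>Im s\<bar>) / \<delta>"
    using M_zeta_bound[of A] by blast
  define C where "C = C1 * C2 * C3 * exp ((3/2) * A) * 2"
  have "norm (barnes_kernel s w z) \<le> C / \<delta> * exp (- \<bar>Im z\<bar>)"
    if h: "norm s \<le> A" "norm w \<le> A" "\<bar>Re z\<bar> \<le> A" "\<bar>Im z\<bar> \<ge> A + 1" "0 < \<delta>" "\<delta> \<le> 1"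
      "\<forall>x. zeta_entire x = 0 \<longrightarrow> \<delta> \<le> norm (- z - x)" for s w z and \<delta> :: real
  proof -
    define y where "y = \<bar>Im z\<bar>"
    have A0: "A \<ge> 0" using h(1) norm_ge_zero order_trans by blast
    have y1: "y \<ge> 1" using h(4) A0 by (simp add: y_def)
    have s: "\<bar>Re s\<bar> \<le> A" "\<bar>Im s\<bar> \<le> A"
      using abs_Re_le_cmod[of s] abs_Im_le_cmod[of s] h(1) by simp_all
    have w: "\<bar>Re w\<bar> \<le> A" "\<bar>Im w\<bar> \<le> A"
      using abs_Re_le_cmod[of w] abs_Im_le_cmod[of w] h(2) by simp_all
    have g: "norm (Gamma (s + z) * Gamma (- z)) \<le> C1 * exp (- 3 * y)"
      using C1(2)[rule_format, of s z 0] s h A0 by (simp add: y_def)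
    have iw: "\<bar>Im (w + z)\<bar> \<ge> 1" "\<bar>Im (w + z)\<bar> \<le> A + y"
      using w(2) h(4) by (auto simp: y_def)
    have "norm (riemann_zeta (w + z)) \<le> C2 * exp ((3/2) * \<bar>Im (w + z)\<bar>)"
    proof (rule C2(2)[rule_format], intro conjI)
      show "\<bar>Re (w + z)\<bar> \<le> 2 * A" using w(1) h(3) by auto
      show "1 \<le> norm (w + z - 1)" using abs_Im_le_cmod[of "w + z - 1"] iw(1) by simp
    qed
    also have "\<dots> \<le> C2 * exp ((3/2) * (A + y))"
      using iw(2) C2(1) by (intro mult_left_mono) auto
    finally have z: "norm (riemann_zeta (w + z)) \<le> C2 * exp ((3/2) * (A + y))" .
    have "norm (M_zeta (- z)) \<le> C3 * (1 + \<bar>Im (- z)\<bar>) / \<delta>"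
    proof (rule C3(2)[rule_format], intro conjI)
      show "\<delta> \<le> norm (- z - 1)" using abs_Im_le_cmod[of "- z - 1"] y1 h(6) by (simp add: y_def)
    qed (use h in auto)
    then have m: "norm (M_zeta (- z)) \<le> C3 * (1 + y) / \<delta>" by (simp add: y_def)
    have "norm (barnes_kernel s w z) = norm (Gamma (s + z) * Gamma (- z)) * norm (M_zeta (- z)) * norm (riemann_zeta (w + z))"
      by (simp add: barnes_kernel_def norm_mult)
    also have "\<dots> \<le> (C1 * exp (- 3 * y)) * (C3 * (1 + y) / \<delta>) * (C2 * exp ((3/2) * (A + y)))"
      using C1(1) C3(1) y1 h(5) by (intro mult_mono g m z) (auto intro!: mult_nonneg_nonneg divide_nonneg_nonneg)
    also have "\<dots> = C1 * C2 * C3 / \<delta> * (1 + y) * (exp (- 3 * y) * exp ((3/2) * (A + y)))"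
      by (simp add: mult_ac)
    \<comment> \<open>Of the remaining rate \<open>3/2\<close> a third is set aside to absorb the
      linear factor \<open>1 + y\<close>.\<close>
    also have "exp (- 3 * y) * exp ((3/2) * (A + y)) = exp ((3/2) * A) * exp (- y) * exp (- (y / 2))"
      unfolding mult_exp_exp by (rule arg_cong[where f = exp]) (simp add: field_simps)
    also have "C1 * C2 * C3 / \<delta> * (1 + y) * (exp ((3/2) * A) * exp (- y) * exp (- (y / 2)))
       = C1 * C2 * C3 / \<delta> * exp ((3/2) * A) * exp (- y) * ((1 + y) * exp (- (y / 2)))"
      by (simp add: mult_ac)
    also have "\<dots> \<le> C1 * C2 * C3 / \<delta> * exp ((3/2) * A) * exp (- y) * 2"
    proof (rule mult_left_mono)
      have "1 + y / 2 \<le> exp (y / 2)" by (rule exp_ge_add_one_self)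
      then have "1 + y \<le> 2 * exp (y / 2)" by argo
      then show "(1 + y) * exp (- (y / 2)) \<le> 2" by (simp add: exp_minus field_simps)
      show "0 \<le> C1 * C2 * C3 / \<delta> * exp ((3/2) * A) * exp (- y)" using C1(1) C2(1) C3(1) h(5) by simp
    qed
    also have "\<dots> = C / \<delta> * exp (- \<bar>Im z\<bar>)" by (simp add: C_def y_def)
    finally show ?thesis .
  qed
  moreover have "C > 0" using C1 C2 C3 by (simp add: C_def)
  ultimately show ?thesis by blast
qed

text \<open>The line \<open>Re z = c\<close> avoids the poles of \<open>Gamma (- z)\<close> and
  \<open>M_zeta (- z)\<close>. A zero \<open>x\<close> of zeta sits at \<open>z = - x\<close>, hence
  \<open>Re x + c\<close>; as there are infinitely many, a positive lower bound for the distance is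
  demanded and not only that the line misses them.\<close>

definition clear_line :: "real \<Rightarrow> bool" where
  "clear_line c \<longleftrightarrow> c \<noteq> -1 \<and> (\<forall>n::nat. c \<noteq> real n) \<and>
     (\<exists>\<delta>>0. \<delta> \<le> 1 \<and> (\<forall>x. zeta_entire x = 0 \<longrightarrow> \<delta> \<le> \<bar>Re x + c\<bar>))"

lemma clear_line_left:
  assumes "c < -1"
  shows "clear_line c"
proof -
  have "min 1 (- c - 1) \<le> \<bar>Re x + c\<bar>" if "zeta_entire x = 0" for x
    using zeta_entire_nonzero_right[of x] that assms by force
  then show ?thesis
    unfolding clear_line_def using assms by (intro conjI exI[of _ "min 1 (- c - 1)"]) auto
qed

text \<open>The abscissa is at least \<open>min \<epsilon> (1 - \<epsilon>)\<close> away from every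
  integer, in particular from the reflected trivial zeros; the reflected non-trivial zeros have
  nonpositive real part and lie at least \<open>1 - \<epsilon>\<close> to the left.\<close>

lemma clear_line_right:
  fixes N :: nat and \<epsilon> :: real
  assumes "N \<ge> 1" "0 < \<epsilon>" "\<epsilon> < 1"
  shows "clear_line (real N - \<epsilon>)"
proof -
  have int: "min \<epsilon> (1 - \<epsilon>) \<le> \<bar>real N - \<epsilon> - real m\<bar>" for m :: nat
  proof (cases "m < N")
    case True
    then have "real m + 1 \<le> real N" by simp
    then show ?thesis by simp
  next
    case False
    then have "real N \<le> real m" by simp
    then show ?thesis using assms by simp
  qed
  have "min \<epsilon> (1 - \<epsilon>) \<le> \<bar>Re x + (real N - \<epsilon>)\<bar>" if x0: "zeta_entire x = 0" for x
  proof (cases "Re x < 0")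
    case True
    then obtain k where k: "x = - of_nat (2 * k)" using x0 zeta_entire_eq_0_left by blast
    have "\<bar>Re x + (real N - \<epsilon>)\<bar> = \<bar>real N - \<epsilon> - real (2 * k)\<bar>" unfolding k by simp
    then show ?thesis using int[of "2 * k"] by simp
  next
    case False
    then show ?thesis using assms by simp
  qed
  moreover have "real N - \<epsilon> \<noteq> real n" for n using int[of n] assms by auto
  ultimately show ?thesis
    unfolding clear_line_def using assms by (intro conjI exI[of _ "min \<epsilon> (1 - \<epsilon>)"]) auto
qed

lemma barnes_kernel_decay_line:
  assumes "clear_line c"
  shows "\<exists>C. \<forall>s w z. norm s \<le> A \<and> norm w \<le> A \<and> Re z = c \<and> \<bar>Im z\<bar> \<ge> A + \<bar>c\<bar> + 1 \<longrightarrow>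
     norm (barnes_kernel s w z) \<le> C * exp (- 1 * \<bar>Im z\<bar>)"
proof -
  obtain \<delta> where \<delta>: "0 < \<delta>" "\<delta> \<le> 1" "\<And>x. zeta_entire x = 0 \<Longrightarrow> \<delta> \<le> \<bar>Re x + c\<bar>"
    using assms unfolding clear_line_def by blast
  obtain C where C: "\<forall>s w z \<delta>. norm s \<le> A + \<bar>c\<bar> \<and> norm w \<le> A + \<bar>c\<bar> \<and> \<bar>Re z\<bar> \<le> A + \<bar>c\<bar> \<and> \<bar>Im z\<bar> \<ge> A + \<bar>c\<bar> + 1 \<and> 0 < \<delta> \<and> \<delta> \<le> 1 \<and>
      (\<forall>x. zeta_entire x = 0 \<longrightarrow> \<delta> \<le> norm (- z - x)) \<longrightarrow>
     norm (barnes_kernel s w z) \<le> C / \<delta> * exp (- \<bar>Im z\<bar>)"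
    using barnes_kernel_decay[of "A + \<bar>c\<bar>"] by blast
  have "norm (barnes_kernel s w z) \<le> C / \<delta> * exp (- 1 * \<bar>Im z\<bar>)"
    if h: "norm s \<le> A" "norm w \<le> A" "Re z = c" "\<bar>Im z\<bar> \<ge> A + \<bar>c\<bar> + 1" for s w z
  proof -
    have A: "A \<ge> 0" using h(1) norm_ge_zero order_trans by blast
    have "\<delta> \<le> norm (- z - x)" if "zeta_entire x = 0" for x
      using \<delta>(3)[OF that] abs_Re_le_cmod[of "- z - x"] h(3) by (simp add: abs_minus_commute)
    then have "norm (barnes_kernel s w z) \<le> C / \<delta> * exp (- \<bar>Im z\<bar>)"
      by (intro C[rule_format]) (use h \<delta> A in auto)
    then show ?thesis by simp
  qed
  then show ?thesis by blast
qed

section \<open>The integral along a clear line as a function of its parameters\<close>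

lemma continuous_on_Gamma_compose:
  fixes f :: "'a::topological_space \<Rightarrow> complex"
  assumes "continuous_on A f" "\<And>x. x \<in> A \<Longrightarrow> f x \<notin> \<int>\<^sub>\<le>\<^sub>0"
  shows "continuous_on A (\<lambda>x. Gamma (f x))"
  by (rule continuous_on_compose2[OF continuous_on_Gamma assms(1), of "- \<int>\<^sub>\<le>\<^sub>0"]) (use assms(2) in auto)

lemma continuous_on_riemann_zeta:
  assumes "continuous_on A f" "\<And>x. x \<in> A \<Longrightarrow> f x \<noteq> 1"
  shows "continuous_on A (\<lambda>x. riemann_zeta (f x))"
  by (rule continuous_on_compose2[OF holomorphic_on_imp_continuous_on[OF holomorphic_riemann_zeta] assms(1)])
     (use assms(2) in auto)

lemma clear_line_regular:
  assumes c: "clear_line c" and z: "Re z = c"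
  shows "- z \<notin> \<int>\<^sub>\<le>\<^sub>0" "- z \<noteq> 1" "zeta_entire (- z) \<noteq> 0"
proof -
  show "- z \<notin> \<int>\<^sub>\<le>\<^sub>0"
  proof
    assume "- z \<in> \<int>\<^sub>\<le>\<^sub>0"
    then obtain n :: nat where "z = of_nat n" by (auto elim!: nonpos_Ints_cases')
    then show False using c z by (auto simp: clear_line_def)
  qed
  show "- z \<noteq> 1"
  proof
    assume "- z = 1"
    then have "z = - 1" by (simp add: minus_equation_iff)
    then show False using c z by (auto simp: clear_line_def)
  qed
  show "zeta_entire (- z) \<noteq> 0" using c z by (force simp: clear_line_def)
qed

text \<open>The pairs \<open>(s, w)\<close> for which the line \<open>Re z = c\<close> runs to the
  right of the poles of \<open>Gamma (s + z)\<close> and \<open>zeta(w + z)\<close>.\<close>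

definition right_region :: "real \<Rightarrow> (complex \<times> complex) set" where
  "right_region c = {s. - c < Re s} \<times> {w. 1 - c < Re w}"

lemma right_region_regular:
  assumes "- c < Re s" "1 - c < Re w" "Re z = c"
  shows "s + z \<notin> \<int>\<^sub>\<le>\<^sub>0" "w + z \<noteq> 1"
proof -
  show "s + z \<notin> \<int>\<^sub>\<le>\<^sub>0" by (rule not_nonpos_Int_Re) (use assms in simp)
  show "w + z \<noteq> 1" using assms by (auto dest: arg_cong[of _ _ Re])
qed

lemma continuous_on_barnes_kernel:
  assumes c: "clear_line c"
  shows "continuous_on (right_region c \<times> {z. Re z = c}) (\<lambda>p. barnes_kernel (fst (fst p)) (snd (fst p)) (snd p))"
proof -
  have M: "continuous_on (right_region c \<times> {z. Re z = c}) (\<lambda>p. M_zeta (- snd p))"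
  proof (rule continuous_on_compose2[of "uminus ` {z. Re z = c}" M_zeta])
    show "continuous_on (uminus ` {z. Re z = c}) M_zeta"
      by (intro holomorphic_on_imp_continuous_on holomorphic_M_zeta) (use clear_line_regular[OF c] in auto)
  qed (auto intro!: continuous_intros)
  show ?thesis
    unfolding barnes_kernel_def
    by (intro continuous_intros continuous_on_Gamma_compose continuous_on_riemann_zeta M)
       (use right_region_regular[of c] clear_line_regular[OF c] in \<open>auto simp: right_region_def\<close>)
qed

lemma barnes_kernel_dominated:
  assumes c: "clear_line c" and K: "compact K" "K \<subseteq> right_region c"
  shows "\<exists>C>0. \<forall>p\<in>K. \<forall>t. norm (barnes_kernel (fst p) (snd p) (Complex c t)) \<le> C * exp (- 1 * \<bar>t\<bar>)"
proof -
  obtain A where A: "\<And>p. p \<in> K \<Longrightarrow> norm p \<le> A" using compact_imp_bounded[OF K(1)] bounded_iff by blast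
  obtain C where C: "\<forall>s w z. norm s \<le> A \<and> norm w \<le> A \<and> Re z = c \<and> \<bar>Im z\<bar> \<ge> A + \<bar>c\<bar> + 1 \<longrightarrow>
     norm (barnes_kernel s w z) \<le> C * exp (- 1 * \<bar>Im z\<bar>)"
    using barnes_kernel_decay_line[OF c] by blast
  show ?thesis
  proof (rule line_dominated[OF K(1), of c "\<lambda>p. barnes_kernel (fst p) (snd p)"])
    show "continuous_on (K \<times> {z. Re z = c}) (\<lambda>p. barnes_kernel (fst (fst p)) (snd (fst p)) (snd p))"
      by (rule continuous_on_subset[OF continuous_on_barnes_kernel[OF c]]) (use K in auto)
    fix p z assume p: "p \<in> K" "Re z = c" "\<bar>Im z\<bar> \<ge> A + \<bar>c\<bar> + 1"
    have "norm (fst p) \<le> A" "norm (snd p) \<le> A"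
      using A[OF p(1)] norm_fst_le[of "fst p" "snd p"] norm_snd_le[of "snd p" "fst p"] by simp_all
    then show "norm (barnes_kernel (fst p) (snd p) z) \<le> C * exp (- 1 * \<bar>Im z\<bar>)"
      by (intro C[rule_format]) (use p in auto)
  qed
qed

definition line_part :: "real \<Rightarrow> complex \<Rightarrow> complex \<Rightarrow> complex" where
  "line_part c s w = (LINT t|lborel. barnes_kernel s w (Complex c t))"

lemma integrable_barnes_kernel:
  assumes c: "clear_line c" and s: "- c < Re s" and w: "1 - c < Re w"
  shows "integrable lborel (\<lambda>t. barnes_kernel s w (Complex c t))"
proof -
  obtain C where C: "\<And>t. norm (barnes_kernel s w (Complex c t)) \<le> C * exp (- 1 * \<bar>t\<bar>)"
    using barnes_kernel_dominated[OF c, of "{(s, w)}"] s w by (auto simp: right_region_def)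
  have "continuous_on {z. Re z = c} (\<lambda>z. (\<lambda>p. barnes_kernel (fst (fst p)) (snd (fst p)) (snd p)) ((s, w), z))"
    by (rule continuous_on_compose2[OF continuous_on_barnes_kernel[OF c]])
       (use s w in \<open>auto simp: right_region_def intro!: continuous_intros\<close>)
  then have "continuous_on {z. Re z = c} (barnes_kernel s w)" by simp
  then have m: "(\<lambda>t. barnes_kernel s w (Complex c t)) \<in> borel_measurable lborel"
    using borel_measurable_vertical by simp
  have "integrable lborel (\<lambda>t. C * exp (- 1 * \<bar>t\<bar>))" by (rule integrable_exp_abs) simp
  then show ?thesis
    by (rule Bochner_Integration.integrable_bound[OF _ m]) (auto intro!: AE_I2 order_trans[OF C])
qed

lemma line_part_bounded:
  assumes c: "clear_line c" and K: "compact K" "K \<subseteq> right_region c"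
  shows "\<exists>B. \<forall>p\<in>K. norm (line_part c (fst p) (snd p)) \<le> B"
proof -
  obtain C where C: "\<And>p t. p \<in> K \<Longrightarrow> norm (barnes_kernel (fst p) (snd p) (Complex c t)) \<le> C * exp (- 1 * \<bar>t\<bar>)"
    using barnes_kernel_dominated[OF assms] by blast
  have i: "integrable lborel (\<lambda>t. C * exp (- 1 * \<bar>t\<bar>))" by (rule integrable_exp_abs) simp
  have "norm (line_part c (fst p) (snd p)) \<le> (LINT t|lborel. C * exp (- 1 * \<bar>t\<bar>))" if p: "p \<in> K" for p
  proof -
    have j: "integrable lborel (\<lambda>t. barnes_kernel (fst p) (snd p) (Complex c t))"
      by (rule integrable_barnes_kernel[OF c]) (use K p in \<open>auto simp: right_region_def\<close>)
    show ?thesis unfolding line_part_def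
      by (rule order_trans[OF integral_norm_bound integral_mono[OF integrable_norm[OF j] i]]) (rule C[OF p])
  qed
  then show ?thesis by blast
qed

lemma line_part_holomorphic_fst:
  assumes c: "clear_line c" and w: "1 - c < Re w"
  shows "(\<lambda>s. line_part c s w) holomorphic_on {s. - c < Re s}"
  unfolding line_part_def
proof (rule line_integral_param(3))
  show U: "open {s. - c < Re s}" by (rule open_halfspace_Re_gt)
  have "continuous_on ({s. - c < Re s} \<times> {z. Re z = c})
     (\<lambda>q. (\<lambda>p. barnes_kernel (fst (fst p)) (snd (fst p)) (snd p)) ((fst q, w), snd q))"
    by (rule continuous_on_compose2[OF continuous_on_barnes_kernel[OF c]])
       (use w in \<open>auto simp: right_region_def intro!: continuous_intros\<close>)
  then show "continuous_on ({s. - c < Re s} \<times> {z. Re z = c}) (\<lambda>p. barnes_kernel (fst p) w (snd p))" by simp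
  show "(\<lambda>s. barnes_kernel s w z) holomorphic_on {s. - c < Re s}" if "Re z = c" for z
    unfolding barnes_kernel_def
    by (intro holomorphic_intros) (use right_region_regular(1)[of c _ w z] w that in auto)
  fix a assume "a \<in> {s. - c < Re s}"
  then obtain r where r: "r > 0" "cball a r \<subseteq> {s. - c < Re s}" using U open_contains_cball by blast
  obtain C where "\<forall>s w' z. norm s \<le> norm a + r + norm w \<and> norm w' \<le> norm a + r + norm w \<and> Re z = c \<and> \<bar>Im z\<bar> \<ge> (norm a + r + norm w) + \<bar>c\<bar> + 1 \<longrightarrow>
     norm (barnes_kernel s w' z) \<le> C * exp (- 1 * \<bar>Im z\<bar>)"
    using barnes_kernel_decay_line[OF c] by blast
  note C = this[rule_format]
  have "norm (barnes_kernel s w z) \<le> C * exp (- 1 * \<bar>Im z\<bar>)"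
    if "s \<in> cball a r" "Re z = c" "\<bar>Im z\<bar> \<ge> (norm a + r + norm w) + \<bar>c\<bar> + 1" for s z
  proof (rule C, intro conjI)
    have "norm s \<le> norm a + r" using that(1) norm_triangle_sub[of s a] by (simp add: dist_norm norm_minus_commute)
    then show "norm s \<le> norm a + r + norm w" by (simp add: add_increasing2)
  qed (use that r in auto)
  then show "\<exists>r>0. cball a r \<subseteq> {s. - c < Re s} \<and> (\<exists>R C d. d > 0 \<and>
        (\<forall>s\<in>cball a r. \<forall>z. Re z = c \<and> \<bar>Im z\<bar> \<ge> R \<longrightarrow> norm (barnes_kernel s w z) \<le> C * exp (- d * \<bar>Im z\<bar>)))"
    using r zero_less_one by blast
qed

lemma line_part_holomorphic_snd:
  assumes c: "clear_line c" and s: "- c < Re s"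
  shows "(\<lambda>w. line_part c s w) holomorphic_on {w. 1 - c < Re w}"
  unfolding line_part_def
proof (rule line_integral_param(3))
  show U: "open {w. 1 - c < Re w}" by (rule open_halfspace_Re_gt)
  have "continuous_on ({w. 1 - c < Re w} \<times> {z. Re z = c})
     (\<lambda>q. (\<lambda>p. barnes_kernel (fst (fst p)) (snd (fst p)) (snd p)) ((s, fst q), snd q))"
    by (rule continuous_on_compose2[OF continuous_on_barnes_kernel[OF c]])
       (use s in \<open>auto simp: right_region_def intro!: continuous_intros\<close>)
  then show "continuous_on ({w. 1 - c < Re w} \<times> {z. Re z = c}) (\<lambda>p. barnes_kernel s (fst p) (snd p))" by simp
  show "(\<lambda>w. barnes_kernel s w z) holomorphic_on {w. 1 - c < Re w}" if "Re z = c" for z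
    unfolding barnes_kernel_def
    by (intro holomorphic_intros) (use right_region_regular(2)[of c s _ z] s that in auto)
  fix a assume "a \<in> {w. 1 - c < Re w}"
  then obtain r where r: "r > 0" "cball a r \<subseteq> {w. 1 - c < Re w}" using U open_contains_cball by blast
  obtain C where "\<forall>s' w z. norm s' \<le> norm a + r + norm s \<and> norm w \<le> norm a + r + norm s \<and> Re z = c \<and> \<bar>Im z\<bar> \<ge> (norm a + r + norm s) + \<bar>c\<bar> + 1 \<longrightarrow>
     norm (barnes_kernel s' w z) \<le> C * exp (- 1 * \<bar>Im z\<bar>)"
    using barnes_kernel_decay_line[OF c] by blast
  note C = this[rule_format]
  have "norm (barnes_kernel s w z) \<le> C * exp (- 1 * \<bar>Im z\<bar>)"
    if "w \<in> cball a r" "Re z = c" "\<bar>Im z\<bar> \<ge> (norm a + r + norm s) + \<bar>c\<bar> + 1" for w z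
  proof (rule C, intro conjI)
    have "norm w \<le> norm a + r" using that(1) norm_triangle_sub[of w a] by (simp add: dist_norm norm_minus_commute)
    then show "norm w \<le> norm a + r + norm s" by (simp add: add_increasing2)
  qed (use that r in auto)
  then show "\<exists>r>0. cball a r \<subseteq> {w. 1 - c < Re w} \<and> (\<exists>R C d. d > 0 \<and>
        (\<forall>w\<in>cball a r. \<forall>z. Re z = c \<and> \<bar>Im z\<bar> \<ge> R \<longrightarrow> norm (barnes_kernel s w z) \<le> C * exp (- d * \<bar>Im z\<bar>)))"
    using r zero_less_one by blast
qed

text \<open>Minus the residue at \<open>k\<close>, divided by \<open>Gamma s\<close>. The case
  \<open>k = 0\<close> follows the pattern of odd \<open>k\<close>, as \<open>M_zeta\<close> is
  regular at 0. Writing \<open>rGamma s\<close> keeps the term meaningful at the poles of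
  Gamma.\<close>

definition pole_part :: "nat \<Rightarrow> complex \<Rightarrow> complex \<Rightarrow> complex" where
  "pole_part k s w =
     (if k = 0 \<or> odd k then ((- s) gchoose k) * M_zeta (- of_nat k) * riemann_zeta (w + of_nat k)
      else - (((- s) gchoose k) * ((- a_coeff k + fact k * b_coeff k) * riemann_zeta (w + of_nat k)
                - deriv riemann_zeta (w + of_nat k))
              - 1 / fact k * (deriv Gamma (s + of_nat k) * rGamma s) * riemann_zeta (w + of_nat k)))"

lemma Gamma_shift_gbinomial:
  assumes "s \<notin> \<int>\<^sub>\<le>\<^sub>0"
  shows "Gamma (s + of_nat k :: complex) = (-1) ^ k * fact k * ((- s) gchoose k) * Gamma s"
proof -
  have "Gamma (s + of_nat k) = pochhammer s k * Gamma s"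
    using pochhammer_Gamma[OF assms, of k] Gamma_eq_zero_iff[of s] assms by simp
  also have "pochhammer s k = (-1) ^ k * fact k * ((- s) gchoose k)"
    by (simp add: gbinomial_pochhammer flip: power_mult_distrib)
  finally show ?thesis .
qed

lemma residue_at_nat:
  assumes s: "Re s > 1" and w: "Re w > 2"
  shows "residue (barnes_kernel s w) (of_nat k) = - Gamma s * pole_part k s w"
proof -
  have s0: "s \<notin> \<int>\<^sub>\<le>\<^sub>0" by (rule not_nonpos_Int_Re) (use s in simp)
  have G0: "Gamma s \<noteq> 0" using s0 by (simp add: Gamma_eq_zero_iff)
  show ?thesis
  proof (cases "k = 0 \<or> odd k")
    case True
    have sq: "(-1) ^ k * ((-1) ^ k :: complex) = 1" by (simp flip: power_mult_distrib)
    have alg: "- (m / F) * (m * F * G * H) * M * Z = - (m * m) * (G * H * M * Z)" if "F \<noteq> 0" for m F G H M Z :: complex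
      using that by (simp add: field_simps)
    have "residue (barnes_kernel s w) (of_nat k) =
       - ((-1) ^ k * (-1) ^ k) * (((- s) gchoose k) * Gamma s * M_zeta (- of_nat k) * riemann_zeta (w + of_nat k))"
      unfolding residue_at_nat_simple[OF s w True] Gamma_shift_gbinomial[OF s0] by (rule alg) simp
    then show ?thesis using True by (simp add: pole_part_def sq mult_ac)
  next
    case False
    define G Z where "G = ((- s) gchoose k)" and "Z = riemann_zeta (w + of_nat k)"
    have even: "Gamma (s + of_nat k) = fact k * G * Gamma s"
      using False Gamma_shift_gbinomial[OF s0, of k] by (simp add: G_def)
    have "residue (barnes_kernel s w) (of_nat k) =
      b_coeff k * (fact k * G * Gamma s * Z) - a_coeff k / fact k * (fact k * G * Gamma s * Z)
       - 1 / fact k * (deriv Gamma (s + of_nat k) * Z + fact k * G * Gamma s * deriv riemann_zeta (w + of_nat k))"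
      using residue_at_nat_even[OF s w, of k] False even by (simp add: Z_def)
    also have "\<dots> = - Gamma s * pole_part k s w"
    proof -
      have alg: "b * (F * G * H * Z) - a / F * (F * G * H * Z) - 1 / F * (D * Z + F * G * H * Z')
          = - H * - (G * ((- a + F * b) * Z - Z') - 1 / F * (D * R) * Z)"
        if "F \<noteq> 0" "H * R = 1" for a b D F G H R Z Z' :: complex
      proof -
        have "- H * - (G * ((- a + F * b) * Z - Z') - 1 / F * (D * R) * Z)
            = H * G * ((- a + F * b) * Z - Z') - 1 / F * D * (H * R) * Z" by (simp add: algebra_simps)
        also have "\<dots> = b * (F * G * H * Z) - a / F * (F * G * H * Z) - 1 / F * (D * Z + F * G * H * Z')"
          unfolding that(2) using that(1) by (simp add: field_simps)
        finally show ?thesis by simp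
      qed
      have "pole_part k s w = - (G * ((- a_coeff k + fact k * b_coeff k) * Z - deriv riemann_zeta (w + of_nat k))
              - 1 / fact k * (deriv Gamma (s + of_nat k) * rGamma s) * Z)"
        using False by (simp add: pole_part_def G_def Z_def)
      then show ?thesis by (simp only:) (rule alg, simp_all add: G0 rGamma_inverse_Gamma)
    qed
    finally show ?thesis .
  qed
qed

text \<open>The singularities of the kernel between the starting line and the line with abscissa
  just below \<open>N\<close>. Trivial zeros need no entry of their own: reflected, they are even
  natural numbers.\<close>

definition poles :: "nat \<Rightarrow> complex set" where
  "poles N = insert (-1) (of_nat ` {..<N} \<union> uminus ` nontrivial_zeta_zeros)"

lemma barnes_kernel_holomorphic:
  assumes \<delta>: "- Re s \<le> a" "1 - Re w \<le> a" "b \<le> real N"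
  shows "barnes_kernel s w holomorphic_on {z. a < Re z \<and> Re z < b} - poles N"
proof -
  have reg: "s + z \<notin> \<int>\<^sub>\<le>\<^sub>0 \<and> w + z \<noteq> 1 \<and> - z \<notin> \<int>\<^sub>\<le>\<^sub>0 \<and> - z \<noteq> 1 \<and> zeta_entire (- z) \<noteq> 0"
    if z: "z \<in> {z. a < Re z \<and> Re z < b} - poles N" for z
  proof (intro conjI notI)
    have n: False if "z = of_nat n" for n
    proof -
      have "real n < real N" using z \<delta> that by simp
      then have "z \<in> poles N" using that by (simp add: poles_def)
      then show False using z by simp
    qed
    assume "s + z \<in> \<int>\<^sub>\<le>\<^sub>0" then show False using not_nonpos_Int_Re[of "s + z"] z \<delta> by auto
  next
    assume "w + z = 1"
    then have "Re (w + z) = 1" by simp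
    then show False using z \<delta> by simp
  next
    assume "- z \<in> \<int>\<^sub>\<le>\<^sub>0"
    then obtain n :: nat where n: "z = of_nat n" by (auto elim!: nonpos_Ints_cases')
    then have "real n < real N" using z \<delta> by simp
    then have "z \<in> poles N" using n by (simp add: poles_def)
    then show False using z by simp
  next
    assume "- z = 1"
    then have "z = -1" by (simp add: minus_equation_iff)
    then show False using z by (simp add: poles_def)
  next
    assume "zeta_entire (- z) = 0"
    then consider "- z \<in> nontrivial_zeta_zeros" | k where "- z = - of_nat (2 * k)" unfolding zeta_entire_eq_0_iff by blast
    then show False
    proof cases
      case 1
      then have "z \<in> poles N" unfolding poles_def by (metis UnI2 image_eqI insertI2 minus_minus)
      then show False using z by simp
    next
      case 2
      then have n: "z = of_nat (2 * k)" by simp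
      then have "real (2 * k) < real N" using z \<delta> by simp
      then have "z \<in> poles N" unfolding n poles_def by (intro insertI2 UnI1 imageI) simp
      then show False using z by simp
    qed
  qed
  show ?thesis unfolding barnes_kernel_def
    by (intro holomorphic_intros) (use reg in auto)
qed

text \<open>Zeros with bounded real part are avoided by the choice of the height, with distance of
  order \<open>1 / j\<close>; zeros further left or right are at distance at least 1 by their real
  part. The loss is polynomial in \<open>j\<close>, the decay exponential.\<close>

lemma kernel_heights:
  obtains T :: "nat \<Rightarrow> real" and E :: "nat \<Rightarrow> real"
  where "filterlim T at_top sequentially" "\<And>j. T j > 0" "E \<longlonglongrightarrow> 0"
    "\<And>j r. zeta_entire r = 0 \<Longrightarrow> \<bar>Re r\<bar> \<le> 1 \<Longrightarrow> \<bar>Im r\<bar> \<noteq> T j"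
    "\<And>j x. \<bar>x\<bar> \<le> A \<Longrightarrow> norm (barnes_kernel s w (Complex x (T j))) \<le> E j"
    "\<And>j x. \<bar>x\<bar> \<le> A \<Longrightarrow> norm (barnes_kernel s w (Complex x (- T j))) \<le> E j"
proof -
  define A' where "A' = \<bar>A\<bar> + norm s + norm w"
  have A0: "A' \<ge> 0" by (simp add: A'_def)
  have AA': "A \<le> A'" unfolding A'_def using norm_ge_zero[of s] norm_ge_zero[of w] by linarith
  obtain C where C0: "C > 0" and C: "\<forall>s w z \<delta>. norm s \<le> A' \<and> norm w \<le> A' \<and> \<bar>Re z\<bar> \<le> A' \<and> \<bar>Im z\<bar> \<ge> A' + 1 \<and> 0 < \<delta> \<and> \<delta> \<le> 1 \<and>
      (\<forall>x. zeta_entire x = 0 \<longrightarrow> \<delta> \<le> norm (- z - x)) \<longrightarrow>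
     norm (barnes_kernel s w z) \<le> C / \<delta> * exp (- \<bar>Im z\<bar>)"
    using barnes_kernel_decay[of A'] by blast
  obtain K where K: "K > 0" "\<forall>j::nat. \<exists>T. real j \<le> T \<and> T \<le> real j + 1 \<and>
     (\<forall>z. zeta_entire z = 0 \<and> \<bar>Re z\<bar> \<le> A' + 1 \<longrightarrow> 1 / (K * (1 + real j)) \<le> \<bar>\<bar>Im z\<bar> - T\<bar>)"
    using zeta_entire_heights[of "A' + 1"] by blast
  obtain T0 where T0: "\<And>j::nat. real j \<le> T0 j" "\<And>j z. zeta_entire z = 0 \<Longrightarrow> \<bar>Re z\<bar> \<le> A' + 1 \<Longrightarrow> 1 / (K * (1 + real j)) \<le> \<bar>\<bar>Im z\<bar> - T0 j\<bar>"
    using K(2) by metis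
  \<comment> \<open>Starting the sequence at \<open>j0\<close> puts every height above
    \<open>A' + 1\<close>, where the decay estimate is valid.\<close>
  define j0 where "j0 = nat \<lceil>A' + 1\<rceil>"
  have j0: "real j0 \<ge> A' + 1" unfolding j0_def by (rule real_nat_ceiling_ge)
  define T where "T j = T0 (j + j0)" for j
  define \<delta> where "\<delta> j = min 1 (1 / (K * (1 + real (j + j0))))" for j
  \<comment> \<open>The linear factor bounds \<open>1 / \<delta> j\<close>, with the summand 1 for
    the case that the minimum in \<open>\<delta> j\<close> is 1.\<close>
  define E where "E j = C * (1 + K * (1 + (real j + real j0))) * exp (- (real j + real j0))" for j
  have \<delta>: "0 < \<delta> j" "\<delta> j \<le> 1" "\<delta> j \<le> 1 / (K * (1 + real (j + j0)))" for j
    using K(1) by (auto simp: \<delta>_def add_pos_nonneg)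
  have T: "T j \<ge> real j + real j0" for j using T0(1)[of "j + j0"] by (simp add: T_def)
  have inv: "C / \<delta> j \<le> C * (1 + K * (1 + (real j + real j0)))" for j
  proof -
    have "1 / \<delta> j \<le> 1 + K * (1 + (real j + real j0))"
    proof (cases "1 \<le> 1 / (K * (1 + real (j + j0)))")
      case True
      then show ?thesis using K(1) by (simp add: \<delta>_def)
    next
      case False
      then show ?thesis by (simp add: \<delta>_def)
    qed
    from mult_left_mono[OF this, of C] show ?thesis using C0 by simp
  qed
  have bound: "norm (barnes_kernel s w z) \<le> E j" if z: "\<bar>Re z\<bar> \<le> A" "\<bar>Im z\<bar> = T j" for z j
  proof -
    have sep: "\<delta> j \<le> norm (- z - x)" if x: "zeta_entire x = 0" for x
    proof (cases "\<bar>Re x\<bar> \<le> A' + 1")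
      case True
      have "\<delta> j \<le> \<bar>\<bar>Im x\<bar> - T j\<bar>" using T0(2)[OF x True, of "j + j0"] \<delta>(3)[of j] by (simp add: T_def)
      also have "\<dots> \<le> \<bar>Im (- z - x)\<bar>" using z(2) by simp
      also have "\<dots> \<le> norm (- z - x)" by (rule abs_Im_le_cmod)
      finally show ?thesis .
    next
      case False
      have "\<bar>Re z\<bar> \<le> A'" using z(1) AA' by linarith
      then have "1 \<le> \<bar>Re (- z - x)\<bar>" using False by auto
      then show ?thesis using abs_Re_le_cmod[of "- z - x"] \<delta>(2)[of j] by linarith
    qed
    have "norm (barnes_kernel s w z) \<le> C / \<delta> j * exp (- \<bar>Im z\<bar>)"
    proof (rule C[rule_format], intro conjI allI impI)
      show "norm s \<le> A'" "norm w \<le> A'" by (auto simp: A'_def)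
      show "\<bar>Re z\<bar> \<le> A'" using z(1) AA' by linarith
      have "A' + 1 \<le> T j" using T[of j] j0 by simp
      then show "A' + 1 \<le> \<bar>Im z\<bar>" by (simp add: z(2))
    qed (use \<delta> sep in auto)
    also have "\<dots> \<le> (C * (1 + K * (1 + (real j + real j0)))) * exp (- (real j + real j0))"
      using T[of j] K(1) C0 by (intro mult_mono inv) (auto simp: z(2))
    finally show ?thesis by (simp add: E_def)
  qed
  show ?thesis
  proof (rule that[of T E])
    show "filterlim T at_top sequentially"
    proof (rule filterlim_at_top_mono[OF filterlim_real_sequentially])
      have "real j \<le> T j" for j using T[of j] by simp
      then show "\<forall>\<^sub>F j in sequentially. real j \<le> T j" by simp
    qed
    show Tpos: "T j > 0" for j using T[of j] j0 A0 by simp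
    show "E \<longlonglongrightarrow> 0" unfolding E_def using C0 K(1) by real_asymp
    show "\<bar>Im r\<bar> \<noteq> T j" if r: "zeta_entire r = 0" "\<bar>Re r\<bar> \<le> 1" for j r
    proof
      assume eq: "\<bar>Im r\<bar> = T j"
      have "1 / (K * (1 + real (j + j0))) \<le> \<bar>\<bar>Im r\<bar> - T j\<bar>" unfolding T_def by (rule T0(2)) (use r A0 in auto)
      moreover have "1 / (K * (1 + real (j + j0))) > 0" using K(1) by (simp add: add_pos_nonneg)
      ultimately show False using eq by simp
    qed
    show "norm (barnes_kernel s w (Complex x (T j))) \<le> E j" "norm (barnes_kernel s w (Complex x (- T j))) \<le> E j"
      if "\<bar>x\<bar> \<le> A" for j x using that Tpos[of j] by (auto intro!: bound)
  qed
qed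

text \<open>The three families of poles are disjoint: neither 0, where zeta is
  \<open>- 1 / 2\<close>, nor 1 is a non-trivial zero, and a non-trivial zero has nonnegative real
  part.\<close>

lemma sum_residues:
  assumes s: "Re s > 1" and w: "Re w > 2" and T: "T > 0"
  shows "(\<Sum>p | p \<in> poles N \<and> \<bar>Im p\<bar> < T. residue (barnes_kernel s w) p) =
    - Gamma (s - 1) * riemann_zeta (w - 1) - Gamma s * (\<Sum>k<N. pole_part k s w)
      + (\<Sum>r | r \<in> nontrivial_zeta_zeros \<and> \<bar>Im r\<bar> < T. zero_weight s w r)"
proof -
  define Z where "Z = {r \<in> nontrivial_zeta_zeros. \<bar>Im r\<bar> < T}"
  have fZ: "finite Z" unfolding Z_def by (rule finite_subset[OF _ finite_nontrivial_zeros[of T]]) auto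
  have eq: "{p. p \<in> poles N \<and> \<bar>Im p\<bar> < T} = insert (-1) (of_nat ` {..<N} \<union> uminus ` Z)"
    using T by (auto simp: poles_def Z_def)
  have d: "of_nat ` {..<N} \<inter> uminus ` Z = {}"
  proof -
    have False if "r \<in> nontrivial_zeta_zeros" "of_nat n = - r" for n r
    proof -
      have "r = - of_nat n" using that(2) by (simp add: minus_equation_iff)
      moreover have "0 \<le> Re r" using nontrivial_zeta_zeros_Re[OF that(1)] by simp
      ultimately have "r = 0" by simp
      then show False using that(1) by (simp add: nontrivial_zeta_zeros_def riemann_zeta_0)
    qed
    then show ?thesis by (auto simp: Z_def)
  qed
  have n1: "-1 \<notin> of_nat ` {..<N} \<union> uminus ` Z"
  proof -
    have "(-1 :: complex) \<noteq> of_nat n" for n by (auto dest: arg_cong[of _ _ Re])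
    moreover have "1 \<notin> nontrivial_zeta_zeros" by (simp add: nontrivial_zeta_zeros_def)
    ultimately show ?thesis by (auto simp: Z_def)
  qed
  have "(\<Sum>p | p \<in> poles N \<and> \<bar>Im p\<bar> < T. residue (barnes_kernel s w) p) =
     residue (barnes_kernel s w) (-1) + ((\<Sum>p\<in>of_nat ` {..<N}. residue (barnes_kernel s w) p) + (\<Sum>p\<in>uminus ` Z. residue (barnes_kernel s w) p))"
    unfolding eq using n1 d fZ by (subst sum.insert) (auto simp: sum.union_disjoint)
  also have "(\<Sum>p\<in>of_nat ` {..<N}. residue (barnes_kernel s w) p) = (\<Sum>k<N. - Gamma s * pole_part k s w)"
    by (subst sum.reindex) (auto simp: inj_on_def residue_at_nat[OF s w])
  also have "(\<Sum>p\<in>uminus ` Z. residue (barnes_kernel s w) p) = (\<Sum>r\<in>Z. zero_weight s w r)"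
    by (subst sum.reindex) (auto simp: Z_def inj_on_def residue_at_zeta_zero[OF s w])
  finally show ?thesis
    unfolding residue_at_minus_one[OF s w] by (simp add: Z_def sum_distrib_left sum_negf)
qed

text \<open>The right-hand side in the coordinates \<open>s\<close>, \<open>w\<close>, with the
  abscissa \<open>c\<close> of the line as a separate argument and \<open>rGamma s\<close> for the
  entire function \<open>1 / Gamma s\<close>.\<close>

definition formula :: "(nat \<Rightarrow> complex) \<Rightarrow> nat \<Rightarrow> real \<Rightarrow> complex \<Rightarrow> complex \<Rightarrow> complex" where
  "formula \<rho> N c s w = riemann_zeta (w - 1) / (s - 1) + (\<Sum>k<N. pole_part k s w)
     - rGamma s * (\<Sum>n. zero_weight s w (\<rho> (Suc n))) + rGamma s / (2 * of_real pi) * line_part c s w"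

text \<open>In this domain the integral along the starting line is the double series and that along
  the line at \<open>real N - \<epsilon>\<close> is the last term; the difference is
  \<open>2 * pi\<close> times the residues in between, and division by \<open>Gamma s2\<close> gives
  the formula.\<close>

lemma Phi2_eq_formula:
  assumes \<rho>: "enumerates_zeta_zeros \<rho>" and N: "N \<ge> 1" "0 < \<epsilon>" "\<epsilon> < 1"
    and s: "Re s2 > 1" and w: "Re (s1 + s2) > 2"
  shows "Phi2 s1 s2 = formula \<rho> N (real N - \<epsilon>) s2 (s1 + s2)"
proof -
  define b w where "b = real N - \<epsilon>" and "w = s1 + s2"
  have w: "Re w > 2" using w by (simp add: w_def)
  have b0: "b > 0" using N by (simp add: b_def)
  obtain c where c: "c < -1" "- Re s2 < c" "1 < Re w + c" using abscissa_exists[OF s w] .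
  define A where "A = \<bar>b\<bar> + \<bar>c\<bar>"
  obtain T E where T: "filterlim T at_top sequentially" "\<And>j. T j > 0" "E \<longlonglongrightarrow> 0"
    "\<And>j r. zeta_entire r = 0 \<Longrightarrow> \<bar>Re r\<bar> \<le> 1 \<Longrightarrow> \<bar>Im r\<bar> \<noteq> T j"
    "\<And>j x. \<bar>x\<bar> \<le> A \<Longrightarrow> norm (barnes_kernel s2 w (Complex x (T j))) \<le> E j"
    "\<And>j x. \<bar>x\<bar> \<le> A \<Longrightarrow> norm (barnes_kernel s2 w (Complex x (- T j))) \<le> E j"
    using kernel_heights[of A s2 w] by blast
  \<comment> \<open>The first entry keeps the enlarged strip to the left of the pole at
    \<open>N\<close>, the other two to the right of the poles of \<open>Gamma (s2 + z)\<close> and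
    \<open>zeta(w + z)\<close>.\<close>
  define \<delta> where "\<delta> = min \<epsilon> (min (c + Re s2) (Re w + c - 1))"
  have \<delta>0: "\<delta> > 0" using N c by (simp add: \<delta>_def)
  have cb: "c < b" using c(1) b0 by simp
  have poles_Re: "c < Re p \<and> Re p < b" if pN: "p \<in> poles N" for p
  proof -
    consider "p = -1" | k where "p = of_nat k" "k < N" | r where "p = - r" "r \<in> nontrivial_zeta_zeros"
      using pN by (auto simp: poles_def)
    then show ?thesis
    proof cases
      case 2
      then have "real k + 1 \<le> real N" by simp
      then show ?thesis using 2 c(1) N by (simp add: b_def)
    next
      case 3
      then show ?thesis using nontrivial_zeta_zeros_Re[OF 3(2)] c(1) b0 by simp
    qed (use c(1) b0 in simp)
  qed
  have shift: "(\<lambda>j. of_real (2*pi) * (\<Sum>p | p \<in> poles N \<and> \<bar>Im p\<bar> < T j. residue (barnes_kernel s2 w) p)) \<longlonglongrightarrow>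
     (LINT t|lborel. barnes_kernel s2 w (Complex b t)) - (LINT t|lborel. barnes_kernel s2 w (Complex c t))"
  proof (rule strip_shift[OF cb \<delta>0 poles_Re _ _ T(1,2) _ T(3)])
    show "finite {p \<in> poles N. \<bar>Im p\<bar> \<le> T}" for T
    proof (rule finite_subset)
      show "{p \<in> poles N. \<bar>Im p\<bar> \<le> T} \<subseteq> insert (-1) (of_nat ` {..<N} \<union> uminus ` {z \<in> nontrivial_zeta_zeros. \<bar>Im z\<bar> \<le> T})"
        by (auto simp: poles_def)
    qed (use finite_nontrivial_zeros in auto)
    show "barnes_kernel s2 w holomorphic_on {z. c - \<delta> < Re z \<and> Re z < b + \<delta>} - poles N"
      by (rule barnes_kernel_holomorphic) (auto simp: \<delta>_def b_def min_def)
    show "\<bar>Im p\<bar> \<noteq> T j" if pN: "p \<in> poles N" for j p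
    proof -
      consider "Im p = 0" | r where "p = - r" "r \<in> nontrivial_zeta_zeros" using pN by (auto simp: poles_def)
      then show ?thesis
      proof cases
        case 2
        then show ?thesis using T(4)[of r j] nontrivial_zeta_zeros_Re[OF 2(2)] 2(2) by (simp add: nontrivial_zeta_zeros_iff)
      qed (use T(2)[of j] in simp)
    qed
    show "norm (barnes_kernel s2 w (Complex x (T j))) \<le> E j" "norm (barnes_kernel s2 w (Complex x (- T j))) \<le> E j"
      if "x \<in> {c..b}" for j x using that by (auto intro!: T(5,6) simp: A_def)
    show "integrable lborel (\<lambda>t. barnes_kernel s2 w (Complex c t))"
      by (rule integrable_barnes_kernel[OF clear_line_left[OF c(1)]]) (use c in auto)
    show "integrable lborel (\<lambda>t. barnes_kernel s2 w (Complex b t))"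
      unfolding b_def by (rule integrable_barnes_kernel[OF clear_line_right[OF N]]) (use s w b0 in \<open>auto simp: b_def\<close>)
  qed
  define P where "P = - Gamma (s2 - 1) * riemann_zeta (w - 1) - Gamma s2 * (\<Sum>k<N. pole_part k s2 w)"
  define Z where "Z = (\<Sum>n. zero_weight s2 w (\<rho> (Suc n)))"
  have "(\<lambda>j. of_real (2*pi) * (\<Sum>p | p \<in> poles N \<and> \<bar>Im p\<bar> < T j. residue (barnes_kernel s2 w) p)) \<longlonglongrightarrow> of_real (2*pi) * (P + Z)"
    unfolding sum_residues[OF s w T(2)] P_def Z_def by (intro tendsto_intros tendsto_zero_sum[OF \<rho> T(1)])
  from LIMSEQ_unique[OF this shift]
  have "of_real (2*pi) * (P + Z) = line_part b s2 w - of_real (2*pi) * Gamma s2 * Phi2 s1 s2"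
    using barnes_kernel_integral_eq_Phi2[of c s2 s1] c by (simp add: line_part_def w_def)
  then have main: "Gamma s2 * Phi2 s1 s2 = line_part b s2 w / of_real (2*pi) - P - Z"
    by (simp add: field_simps)
  have s0: "s2 \<notin> \<int>\<^sub>\<le>\<^sub>0" "s2 - 1 \<notin> \<int>\<^sub>\<le>\<^sub>0" by (rule not_nonpos_Int_Re, use s in simp)+
  have G: "rGamma s2 * Gamma s2 = 1" using s0 by (simp add: rGamma_inverse_Gamma Gamma_eq_zero_iff)
  have "s2 - 1 \<noteq> 0" using s0(2) by auto
  \<comment> \<open>By the recurrence the residue at \<open>-1\<close>, divided by
    \<open>Gamma s2\<close>, becomes the term with denominator \<open>s2 - 1\<close>.\<close>
  then have G1: "Gamma (s2 - 1) = Gamma s2 / (s2 - 1)" using Gamma_plus1[OF s0(2)] by simp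
  have "Phi2 s1 s2 = rGamma s2 * (Gamma s2 * Phi2 s1 s2)" using G by (simp flip: mult.assoc)
  also have "\<dots> = rGamma s2 * (line_part b s2 w / of_real (2*pi) - Z) + rGamma s2 * Gamma s2 * (riemann_zeta (w - 1) / (s2 - 1) + (\<Sum>k<N. pole_part k s2 w))"
    unfolding main P_def G1 by (simp add: algebra_simps)
  also have "\<dots> = formula \<rho> N b s2 w" unfolding G formula_def by (simp add: Z_def algebra_simps)
  finally show ?thesis by (simp add: b_def w_def)
qed

subsection \<open>Functions with poles along two coordinate lines\<close>

text \<open>Separate holomorphy and boundedness of the numerator suffice, by Osgood's lemma.\<close>

definition pole2 :: "(complex \<Rightarrow> complex \<Rightarrow> complex) \<Rightarrow> complex \<Rightarrow> complex \<Rightarrow> bool" where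
  "pole2 f a b \<longleftrightarrow> (\<exists>r k g B. 0 < r \<and> r \<le> 1 \<and>
     (\<forall>w\<in>ball b r. (\<lambda>s. g s w) holomorphic_on ball a r) \<and>
     (\<forall>s\<in>ball a r. (\<lambda>w. g s w) holomorphic_on ball b r) \<and>
     (\<forall>s\<in>ball a r. \<forall>w\<in>ball b r. norm (g s w) \<le> B) \<and>
     (\<forall>s\<in>ball a r - {a}. \<forall>w\<in>ball b r - {b}. f s w = g s w / ((s - a) * (w - b)) ^ k))"

lemma pole2I:
  assumes "0 < r"
    "\<And>w. w \<in> ball b r \<Longrightarrow> (\<lambda>s. g s w) holomorphic_on ball a r"
    "\<And>s. s \<in> ball a r \<Longrightarrow> (\<lambda>w. g s w) holomorphic_on ball b r"
    "\<And>s w. s \<in> ball a r \<Longrightarrow> w \<in> ball b r \<Longrightarrow> norm (g s w) \<le> B"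
    "\<And>s w. s \<in> ball a r - {a} \<Longrightarrow> w \<in> ball b r - {b} \<Longrightarrow> f s w = g s w / ((s - a) * (w - b)) ^ k"
  shows "pole2 f a b"
  unfolding pole2_def
proof (rule exI[of _ "min r 1"], rule exI[of _ k], rule exI[of _ g], rule exI[of _ B], intro conjI ballI)
  fix w assume w: "w \<in> ball b (min r 1)"
  show "(\<lambda>s. g s w) holomorphic_on ball a (min r 1)"
    by (rule holomorphic_on_subset[OF assms(2)]) (use w in auto)
next
  fix s assume s: "s \<in> ball a (min r 1)"
  show "(\<lambda>w. g s w) holomorphic_on ball b (min r 1)"
    by (rule holomorphic_on_subset[OF assms(3)]) (use s in auto)
next
  fix s w assume "s \<in> ball a (min r 1)" "w \<in> ball b (min r 1)"
  then show "norm (g s w) \<le> B" by (intro assms(4)) auto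
next
  fix s w assume "s \<in> ball a (min r 1) - {a}" "w \<in> ball b (min r 1) - {b}"
  then show "f s w = g s w / ((s - a) * (w - b)) ^ k" by (intro assms(5)) auto
qed (use assms(1) in auto)

lemma pole2_cong:
  assumes "pole2 g a b" and \<delta>: "\<delta> > 0" "\<And>s w. s \<in> ball a \<delta> - {a} \<Longrightarrow> w \<in> ball b \<delta> - {b} \<Longrightarrow> f s w = g s w"
  shows "pole2 f a b"
proof -
  obtain r G B k where r': "0 < r" "r \<le> 1"
    "\<forall>w\<in>ball b r. (\<lambda>s. G s w) holomorphic_on ball a r"
    "\<forall>s\<in>ball a r. (\<lambda>w. G s w) holomorphic_on ball b r"
    "\<forall>s\<in>ball a r. \<forall>w\<in>ball b r. norm (G s w) \<le> B"
    "\<forall>s\<in>ball a r - {a}. \<forall>w\<in>ball b r - {b}. g s w = G s w / ((s - a) * (w - b)) ^ k"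
    using assms(1) unfolding pole2_def by blast
  note r = r'(1,2) r'(3)[rule_format] r'(4)[rule_format] r'(5)[rule_format] r'(6)[rule_format]
  show ?thesis
  proof (rule pole2I[of "min r \<delta>"])
    show "(\<lambda>s. G s w) holomorphic_on ball a (min r \<delta>)" if "w \<in> ball b (min r \<delta>)" for w
      by (rule holomorphic_on_subset[OF r(3)]) (use that in auto)
    show "(\<lambda>w. G s w) holomorphic_on ball b (min r \<delta>)" if "s \<in> ball a (min r \<delta>)" for s
      by (rule holomorphic_on_subset[OF r(4)]) (use that in auto)
    show "norm (G s w) \<le> B" if "s \<in> ball a (min r \<delta>)" "w \<in> ball b (min r \<delta>)" for s w
      using that by (intro r(5)) auto
    show "f s w = G s w / ((s - a) * (w - b)) ^ k" if "s \<in> ball a (min r \<delta>) - {a}" "w \<in> ball b (min r \<delta>) - {b}" for s w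
      using that r(6)[of s w] \<delta>(2)[of s w] by auto
  qed (use r \<delta> in auto)
qed

text \<open>The purpose of radii at most 1: multiplying a numerator by clearing factors, in order to
  reach a common denominator, keeps its bound.\<close>

lemma ball_product_power_le:
  assumes "s \<in> ball a r" "w \<in> ball b r" "r \<le> (1::real)"
  shows "norm (((s - a) * (w - b :: complex)) ^ k) \<le> 1"
  unfolding norm_power norm_mult
proof (intro power_le_one mult_le_one)
  show "norm (s - a) \<le> 1" "norm (w - b) \<le> 1" using assms by (auto simp: dist_norm norm_minus_commute)
qed auto

lemma pole2_combine:
  assumes f1: "pole2 f1 a b" and f2: "pole2 f2 a b"
  shows pole2_add: "pole2 (\<lambda>s w. f1 s w + f2 s w) a b"
    and pole2_mult: "pole2 (\<lambda>s w. f1 s w * f2 s w) a b"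
proof -
  obtain r1 g1 B1 k1 where P1: "0 < r1" "r1 \<le> 1"
    "\<forall>w\<in>ball b r1. (\<lambda>s. g1 s w) holomorphic_on ball a r1"
    "\<forall>s\<in>ball a r1. (\<lambda>w. g1 s w) holomorphic_on ball b r1"
    "\<forall>s\<in>ball a r1. \<forall>w\<in>ball b r1. norm (g1 s w) \<le> B1"
    "\<forall>s\<in>ball a r1 - {a}. \<forall>w\<in>ball b r1 - {b}. f1 s w = g1 s w / ((s - a) * (w - b)) ^ k1"
    using f1 unfolding pole2_def by blast
  note 1 = P1(1,2) P1(3)[rule_format] P1(4)[rule_format] P1(5)[rule_format] P1(6)[rule_format]
  obtain r2 g2 B2 k2 where P2: "0 < r2" "r2 \<le> 1"
    "\<forall>w\<in>ball b r2. (\<lambda>s. g2 s w) holomorphic_on ball a r2"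
    "\<forall>s\<in>ball a r2. (\<lambda>w. g2 s w) holomorphic_on ball b r2"
    "\<forall>s\<in>ball a r2. \<forall>w\<in>ball b r2. norm (g2 s w) \<le> B2"
    "\<forall>s\<in>ball a r2 - {a}. \<forall>w\<in>ball b r2 - {b}. f2 s w = g2 s w / ((s - a) * (w - b)) ^ k2"
    using f2 unfolding pole2_def by blast
  note 2 = P2(1,2) P2(3)[rule_format] P2(4)[rule_format] P2(5)[rule_format] P2(6)[rule_format]
  define r where "r = min r1 r2"
  have r: "0 < r" "r \<le> 1" "ball a r \<subseteq> ball a r1" "ball a r \<subseteq> ball a r2" "ball b r \<subseteq> ball b r1" "ball b r \<subseteq> ball b r2"
    using 1 2 by (auto simp: r_def)
  have h: "(\<lambda>s. g1 s w) holomorphic_on ball a r" "(\<lambda>s. g2 s w) holomorphic_on ball a r" if "w \<in> ball b r" for w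
    by (rule holomorphic_on_subset[OF 1(3)], use that r in blast, use r in blast)
       (rule holomorphic_on_subset[OF 2(3)], use that r in blast, use r in blast)
  have h': "(\<lambda>w. g1 s w) holomorphic_on ball b r" "(\<lambda>w. g2 s w) holomorphic_on ball b r" if "s \<in> ball a r" for s
    by (rule holomorphic_on_subset[OF 1(4)], use that r in blast, use r in blast)
       (rule holomorphic_on_subset[OF 2(4)], use that r in blast, use r in blast)
  have n: "norm (g1 s w) \<le> B1" "norm (g2 s w) \<le> B2" if "s \<in> ball a r" "w \<in> ball b r" for s w
    using 1(5)[of s w] 2(5)[of s w] that r by blast+
  have e: "f1 s w = g1 s w / ((s - a) * (w - b)) ^ k1" "f2 s w = g2 s w / ((s - a) * (w - b)) ^ k2"
    if "s \<in> ball a r - {a}" "w \<in> ball b r - {b}" for s w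
    using 1(6)[of s w] 2(6)[of s w] that r by blast+
  show "pole2 (\<lambda>s w. f1 s w + f2 s w) a b"
  proof (rule pole2I[OF r(1)])
    show "(\<lambda>s. g1 s w * ((s - a) * (w - b)) ^ k2 + g2 s w * ((s - a) * (w - b)) ^ k1) holomorphic_on ball a r"
      if "w \<in> ball b r" for w by (intro holomorphic_intros h that)
    show "(\<lambda>w. g1 s w * ((s - a) * (w - b)) ^ k2 + g2 s w * ((s - a) * (w - b)) ^ k1) holomorphic_on ball b r"
      if "s \<in> ball a r" for s by (intro holomorphic_intros h' that)
    show "norm (g1 s w * ((s - a) * (w - b)) ^ k2 + g2 s w * ((s - a) * (w - b)) ^ k1) \<le> B1 * 1 + B2 * 1"
      if sw: "s \<in> ball a r" "w \<in> ball b r" for s w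
    proof (rule norm_triangle_mono; unfold norm_mult[of "g1 s w"] norm_mult[of "g2 s w"]; intro mult_mono n sw ball_product_power_le[OF sw r(2)])
      show "0 \<le> B1" "0 \<le> B2" using n[OF sw] norm_ge_zero order_trans by blast+
    qed auto
    show "f1 s w + f2 s w = (g1 s w * ((s - a) * (w - b)) ^ k2 + g2 s w * ((s - a) * (w - b)) ^ k1) / ((s - a) * (w - b)) ^ (k1 + k2)"
      if sw: "s \<in> ball a r - {a}" "w \<in> ball b r - {b}" for s w
    proof -
      have "(s - a) * (w - b) \<noteq> 0" using sw by auto
      then show ?thesis unfolding e[OF sw] power_add by (simp add: add_divide_distrib)
    qed
  qed
  show "pole2 (\<lambda>s w. f1 s w * f2 s w) a b"
  proof (rule pole2I[OF r(1)])
    show "(\<lambda>s. g1 s w * g2 s w) holomorphic_on ball a r"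
      if "w \<in> ball b r" for w by (intro holomorphic_intros h that)
    show "(\<lambda>w. g1 s w * g2 s w) holomorphic_on ball b r"
      if "s \<in> ball a r" for s by (intro holomorphic_intros h' that)
    show "norm (g1 s w * g2 s w) \<le> B1 * B2"
      if sw: "s \<in> ball a r" "w \<in> ball b r" for s w
      unfolding norm_mult
    proof (intro mult_mono n sw)
      show "0 \<le> B1" using n[OF sw] norm_ge_zero order_trans by blast
    qed auto
    show "f1 s w * f2 s w = (g1 s w * g2 s w) / ((s - a) * (w - b)) ^ (k1 + k2)"
      if sw: "s \<in> ball a r - {a}" "w \<in> ball b r - {b}" for s w
      unfolding e[OF sw] power_add by simp
  qed
qed

text \<open>The order of \<open>f\<close> at \<open>a\<close> is split by sign, since the
  denominator must be a natural power; a function vanishing identically near \<open>a\<close> is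
  treated apart, with numerator 0.\<close>

lemma meromorphic_local_form:
  assumes "f meromorphic_on {a}"
  obtains r h B k where "0 < r" "r \<le> 1" "h holomorphic_on ball a r" "\<And>s. s \<in> ball a r \<Longrightarrow> norm (h s) \<le> B"
    "\<And>s. s \<in> ball a r - {a} \<Longrightarrow> f s = h s / (s - a) ^ k"
proof -
  have "\<exists>r k h. 0 < r \<and> h holomorphic_on cball a r \<and> (\<forall>s\<in>cball a r - {a}. f s = h s / (s - a) ^ k)"
  proof (cases "\<exists>\<^sub>F s in at a. f s \<noteq> 0")
    case True
    obtain r where r: "r > 0" "zor_poly f a holomorphic_on cball a r"
      "\<forall>s\<in>cball a r - {a}. f s = zor_poly f a s * (s - a) powi zorder f a"
      using zorder_exist[OF meromorphic_on_isolated_singularity[OF assms] meromorphic_on_not_essential[OF assms] True] by blast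
    show ?thesis
    proof (cases "zorder f a \<ge> 0")
      case T: True
      have "(\<lambda>s. zor_poly f a s * (s - a) ^ nat (zorder f a)) holomorphic_on cball a r" by (intro holomorphic_intros r(2))
      then show ?thesis using r T
        by (intro exI[of _ r] exI[of _ "0::nat"] exI[of _ "\<lambda>s. zor_poly f a s * (s - a) ^ nat (zorder f a)"]) (auto simp: power_int_def)
    next
      case F: False
      then show ?thesis using r
        by (intro exI[of _ r] exI[of _ "nat (- zorder f a)"] exI[of _ "zor_poly f a"]) (auto simp: power_int_def divide_inverse power_inverse)
    qed
  next
    case False
    then have "\<forall>\<^sub>F s in at a. f s = 0" by (simp add: frequently_def)
    then obtain d where d: "d > 0" "\<And>s. s \<noteq> a \<Longrightarrow> dist s a < d \<Longrightarrow> f s = 0" unfolding eventually_at by auto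
    then show ?thesis
      by (intro exI[of _ "d / 2"] exI[of _ "0::nat"] exI[of _ "\<lambda>_. 0"]) (auto simp: dist_commute)
  qed
  then obtain r k h where r: "0 < r" "h holomorphic_on cball a r" "\<And>s. s \<in> cball a r - {a} \<Longrightarrow> f s = h s / (s - a) ^ k" by blast
  have "compact (h ` cball a r)"
    by (intro compact_continuous_image holomorphic_on_imp_continuous_on r(2)) simp
  then obtain B where B: "\<And>s. s \<in> cball a r \<Longrightarrow> norm (h s) \<le> B" using compact_imp_bounded bounded_iff by (metis image_eqI)
  show ?thesis
  proof (rule that[of "min r 1" h B k])
    show "h holomorphic_on ball a (min r 1)" by (rule holomorphic_on_subset[OF r(2)]) auto
  qed (use r B in auto)
qed

lemma pole2_fst:
  assumes "f meromorphic_on {a}"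
  shows "pole2 (\<lambda>s w. f s) a b"
proof -
  obtain r h B k where r: "0 < r" "r \<le> 1" "h holomorphic_on ball a r" "\<And>s. s \<in> ball a r \<Longrightarrow> norm (h s) \<le> B"
    "\<And>s. s \<in> ball a r - {a} \<Longrightarrow> f s = h s / (s - a) ^ k"
  proof (rule meromorphic_local_form[OF assms])
    fix r k h B
    assume "0 < r" "r \<le> 1" "h holomorphic_on ball a r" "\<And>s. s \<in> ball a r \<Longrightarrow> norm (h s) \<le> B"
      "\<And>s. s \<in> ball a r - {a} \<Longrightarrow> f s = h s / (s - a) ^ k"
    then show thesis by (rule that)
  qed
  show ?thesis
  proof (rule pole2I[OF r(1)])
    \<comment> \<open>One exponent serves both variables in \<open>pole2\<close>, so the numerator
      has to supply the unwanted power of \<open>w - b\<close>.\<close>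
    show "(\<lambda>s. h s * (w - b) ^ k) holomorphic_on ball a r" for w by (intro holomorphic_intros r(3))
    show "(\<lambda>w. h s * (w - b) ^ k) holomorphic_on ball b r" for s by (intro holomorphic_intros)
    show "norm (h s * (w - b) ^ k) \<le> B * 1" if sw: "s \<in> ball a r" "w \<in> ball b r" for s w
      unfolding norm_mult norm_power
    proof (intro mult_mono r(4) power_le_one sw)
      show "norm (w - b) \<le> 1" using sw r(2) by (simp add: dist_norm norm_minus_commute)
      show "0 \<le> B" using r(4)[OF sw(1)] norm_ge_zero order_trans by blast
    qed auto
    show "f s = (h s * (w - b) ^ k) / ((s - a) * (w - b)) ^ k" if "s \<in> ball a r - {a}" "w \<in> ball b r - {b}" for s w
      using that r(5)[of s] by (simp add: power_mult_distrib)
  qed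
qed

lemma pole2_swap:
  assumes "pole2 (\<lambda>s w. f w s) b a"
  shows "pole2 f a b"
proof -
  obtain r g B k where r': "0 < r" "r \<le> 1"
    "\<forall>w\<in>ball a r. (\<lambda>s. g s w) holomorphic_on ball b r"
    "\<forall>s\<in>ball b r. (\<lambda>w. g s w) holomorphic_on ball a r"
    "\<forall>s\<in>ball b r. \<forall>w\<in>ball a r. norm (g s w) \<le> B"
    "\<forall>s\<in>ball b r - {b}. \<forall>w\<in>ball a r - {a}. f w s = g s w / ((s - b) * (w - a)) ^ k"
    using assms unfolding pole2_def by blast
  note r = r'(1,2) r'(3)[rule_format] r'(4)[rule_format] r'(5)[rule_format] r'(6)[rule_format]
  show ?thesis
    by (rule pole2I[OF r(1), where g = "\<lambda>s w. g w s" and B = B and k = k]) (use r in \<open>auto simp: mult.commute\<close>)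
qed

lemma pole2_snd:
  assumes "f meromorphic_on {b}"
  shows "pole2 (\<lambda>s w. f w) a b"
  by (rule pole2_swap) (rule pole2_fst[OF assms])

lemma pole2_const: "pole2 (\<lambda>s w. c) a b"
  by (rule pole2_fst) (rule meromorphic_on_const)

lemma pole2_sum:
  assumes "\<And>i. i \<in> I \<Longrightarrow> pole2 (f i) a b"
  shows "pole2 (\<lambda>s w. \<Sum>i\<in>I. f i s w) a b"
  using assms by (induction I rule: infinite_finite_induct) (auto intro: pole2_const pole2_add)

lemma pole2_diff:
  assumes "pole2 f a b" "pole2 g a b"
  shows "pole2 (\<lambda>s w. f s w - g s w) a b"
  using pole2_add[OF assms(1) pole2_mult[OF pole2_const[of "-1"] assms(2)]] by simp

lemma pole2_holomorphic:
  assumes "0 < r"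
    "\<And>w. w \<in> ball b r \<Longrightarrow> (\<lambda>s. g s w) holomorphic_on ball a r"
    "\<And>s. s \<in> ball a r \<Longrightarrow> (\<lambda>w. g s w) holomorphic_on ball b r"
    "\<And>s w. s \<in> ball a r \<Longrightarrow> w \<in> ball b r \<Longrightarrow> norm (g s w) \<le> B"
  shows "pole2 g a b"
  by (rule pole2I[OF assms, where k = 0]) simp_all

text \<open>Gamma is the reciprocal of an entire function, also at its poles, where both have the
  value 0 by convention.\<close>

lemma meromorphic_Gamma_shift [meromorphic_intros]: "(\<lambda>s. Gamma (s + c)) meromorphic_on A"
proof -
  have "(\<lambda>s. 1 / rGamma (s + c)) meromorphic_on A"
    by (intro meromorphic_intros analytic_on_imp_meromorphic_on) (auto intro!: analytic_intros)
  then show ?thesis by (simp add: Gamma_def divide_inverse)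
qed

lemma meromorphic_riemann_zeta_shift [meromorphic_intros]: "(\<lambda>w. riemann_zeta (w + c)) meromorphic_on A"
proof -
  have "(\<lambda>w. zeta_entire (w + c)) analytic_on UNIV"
    unfolding analytic_on_open[OF open_UNIV]
    by (rule holomorphic_on_compose_gen[of "\<lambda>w. w + c" _ zeta_entire UNIV, unfolded o_def]) (auto intro!: holomorphic_intros)
  then have "(\<lambda>w. zeta_entire (w + c)) analytic_on A" by (rule analytic_on_subset) auto
  then have "(\<lambda>w. zeta_entire (w + c) / (w + c - 1)) meromorphic_on A"
    by (intro meromorphic_intros analytic_on_imp_meromorphic_on) (auto intro!: analytic_intros)
  \<comment> \<open>At the pole both sides are 0, the left one by division by zero, the right one by
    its dummy value.\<close>
  moreover have "zeta_entire (w + c) / (w + c - 1) = riemann_zeta (w + c)" for w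
    by (cases "w + c = 1") (auto simp: riemann_zeta_altdef)
  ultimately show ?thesis by simp
qed

lemma deriv_shift: "deriv (f :: complex \<Rightarrow> complex) (s + c) = deriv (\<lambda>x. f (x + c)) s"
  unfolding deriv_def by (simp add: DERIV_shift)

lemma meromorphic_deriv_shift:
  assumes "(\<lambda>x. f (x + c)) meromorphic_on A"
  shows "(\<lambda>x. deriv f (x + c)) meromorphic_on A"
  unfolding deriv_shift by (rule meromorphic_on_deriv[OF assms])

lemma gbinomial_uminus_holomorphic: "(\<lambda>s::complex. (- s) gchoose k) holomorphic_on A"
  unfolding gbinomial_prod_rev by (intro holomorphic_intros) auto

lemma gbinomial_uminus_meromorphic: "(\<lambda>s::complex. (- s) gchoose k) meromorphic_on A"
proof -
  have "(\<lambda>s::complex. (- s) gchoose k) analytic_on UNIV"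
    unfolding analytic_on_open[OF open_UNIV] by (rule gbinomial_uminus_holomorphic)
  then show ?thesis using analytic_on_imp_meromorphic_on meromorphic_on_subset by blast
qed

subsection \<open>The continuation\<close>

text \<open>The derivative of \<open>Gamma (s + k)\<close> occurs for even \<open>k \<ge> 2\<close> only, hence the shift by \<open>2\<close>.\<close>

definition bad_s :: "complex set" where
  "bad_s = insert 1 ({s. s + 2 \<in> \<int>\<^sub>\<le>\<^sub>0} \<union> (\<Union>r\<in>nontrivial_zeta_zeros. {s. s - r \<in> \<int>\<^sub>\<le>\<^sub>0}))"

text \<open>Like \<open>bad_s\<close>, the set does not depend on \<open>N\<close>, so that the
  formulas for different \<open>N\<close> have a common domain of holomorphy.\<close>

definition bad_w :: "complex set" where
  "bad_w = insert 2 ({w. \<exists>k::nat. w + of_nat k = 1} \<union> (\<Union>r\<in>nontrivial_zeta_zeros. {w. w - r = 1}))"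

lemma finite_bounded_sparse:
  fixes E :: "complex set"
  assumes "\<And>R. finite (E \<inter> cball 0 R)"
  shows "E sparse_in UNIV"
  unfolding sparse_in_eventually_iff[OF open_UNIV]
proof
  fix a :: complex
  have "\<forall>\<^sub>F y in at a. y \<notin> E \<inter> cball 0 (norm a + 1)"
    using finite_imp_sparse[OF assms[of "norm a + 1"]] sparse_in_eventually_iff[OF open_UNIV] by blast
  moreover have "\<forall>\<^sub>F y in at a. y \<in> ball a 1 - {a}" by (intro eventually_at_in_open) auto
  ultimately show "\<forall>\<^sub>F y in at a. y \<notin> E"
  proof eventually_elim
    case (elim y)
    have "norm y \<le> norm a + 1" using norm_triangle_sub[of y a] elim(2) by (simp add: dist_norm norm_minus_commute)
    then show ?case using elim(1) by simp
  qed
qed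

lemma bad_s_sparse: "bad_s sparse_in UNIV"
proof (rule finite_bounded_sparse)
  fix R :: real
  define m where "m = nat \<lceil>\<bar>R\<bar> + 3\<rceil>"
  have m: "real m \<ge> \<bar>R\<bar> + 3" unfolding m_def by (rule real_nat_ceiling_ge)
  have "bad_s \<inter> cball 0 R \<subseteq> insert 1 ((\<lambda>n. - of_nat n - 2) ` {..m} \<union>
      (\<lambda>(r, n). r - of_nat n) ` ({r \<in> nontrivial_zeta_zeros. \<bar>Im r\<bar> \<le> R} \<times> {..m}))" (is "_ \<subseteq> ?X")
  proof
    fix s assume s: "s \<in> bad_s \<inter> cball 0 R"
    then have R: "\<bar>Re s\<bar> \<le> R" "\<bar>Im s\<bar> \<le> R"
      using abs_Re_le_cmod[of s] abs_Im_le_cmod[of s] by simp_all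
    consider "s = 1" | "s + 2 \<in> \<int>\<^sub>\<le>\<^sub>0" | r where "r \<in> nontrivial_zeta_zeros" "s - r \<in> \<int>\<^sub>\<le>\<^sub>0"
      using s by (auto simp: bad_s_def)
    then show "s \<in> ?X"
    proof cases
      case 2
      then obtain n :: nat where n: "s = - of_nat n - 2" by (auto elim!: nonpos_Ints_cases' simp: algebra_simps)
      then have "Re s = - real n - 2" by simp
      then have "real n \<le> real m" using R m by linarith
      then show ?thesis unfolding n by simp
    next
      case 3
      then obtain n :: nat where n: "s = r - of_nat n" by (auto elim!: nonpos_Ints_cases' simp: algebra_simps)
      then have "Re s = Re r - real n" "Im s = Im r" by simp_all
      then have "real n \<le> real m" "\<bar>Im r\<bar> \<le> R" using R m nontrivial_zeta_zeros_Re[OF 3(1)] by linarith+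
      then have "(r, n) \<in> {r \<in> nontrivial_zeta_zeros. \<bar>Im r\<bar> \<le> R} \<times> {..m}" using 3(1) by simp
      then show ?thesis unfolding n by (intro insertI2 UnI2) force
    qed simp
  qed
  then show "finite (bad_s \<inter> cball 0 R)"
    by (rule finite_subset) (use finite_nontrivial_zeros in simp)
qed

lemma bad_w_sparse: "bad_w sparse_in UNIV"
proof (rule finite_bounded_sparse)
  fix R :: real
  define m where "m = nat \<lceil>\<bar>R\<bar> + 3\<rceil>"
  have m: "real m \<ge> \<bar>R\<bar> + 3" unfolding m_def by (rule real_nat_ceiling_ge)
  have "bad_w \<inter> cball 0 R \<subseteq> insert 2 ((\<lambda>n. 1 - of_nat n) ` {..m} \<union>
      (\<lambda>r. 1 + r) ` {r \<in> nontrivial_zeta_zeros. \<bar>Im r\<bar> \<le> R})" (is "_ \<subseteq> ?X")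
  proof
    fix w assume w: "w \<in> bad_w \<inter> cball 0 R"
    then have R: "\<bar>Re w\<bar> \<le> R" "\<bar>Im w\<bar> \<le> R"
      using abs_Re_le_cmod[of w] abs_Im_le_cmod[of w] by simp_all
    consider "w = 2" | k :: nat where "w + of_nat k = 1" | r where "r \<in> nontrivial_zeta_zeros" "w - r = 1"
      using w by (auto simp: bad_w_def)
    then show "w \<in> ?X"
    proof cases
      case 2
      then have n: "w = 1 - of_nat k" by (simp add: algebra_simps)
      then have "Re w = 1 - real k" by simp
      then have "real k \<le> real m" using R m by linarith
      then show ?thesis unfolding n by simp
    next
      case 3
      then have n: "w = 1 + r" by (simp add: algebra_simps)
      then have "\<bar>Im r\<bar> \<le> R" using R by simp
      then show ?thesis unfolding n using 3(1) by simp
    qed simp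
  qed
  then show "finite (bad_w \<inter> cball 0 R)"
    by (rule finite_subset) (use finite_nontrivial_zeros in simp)
qed

text \<open>For \<open>s\<close> and \<open>w\<close> in a ball, only the finitely many zeros with
  ordinate at most \<open>R + 1\<close> can produce a pole. The tail \<open>T\<close> is holomorphic
  in each variable and bounded, under a majorant that depends only on \<open>R\<close>.\<close>

lemma zero_sum_split:
  assumes \<rho>: "enumerates_zeta_zeros \<rho>"
  shows "\<exists>n0 T B.
    (\<forall>s w. (\<Sum>n. zero_weight s w (\<rho> (Suc n))) = (\<Sum>n<n0. zero_weight s w (\<rho> (Suc n))) + T s w) \<and>
    (\<forall>w\<in>ball 0 R. (\<lambda>s. T s w) holomorphic_on ball 0 R) \<and>
    (\<forall>s\<in>ball 0 R. (\<lambda>w. T s w) holomorphic_on ball 0 R) \<and>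
    (\<forall>s\<in>ball 0 R. \<forall>w\<in>ball 0 R. norm (T s w) \<le> B)"
proof -
  obtain C where C: "\<forall>s w r. norm s \<le> R \<and> norm w \<le> R \<and> r \<in> nontrivial_zeta_zeros \<and> \<bar>Im r\<bar> \<ge> R + 1 \<longrightarrow>
     norm (zero_weight s w r) \<le> C * (\<bar>real_of_int (zorder riemann_zeta r)\<bar> * exp (- (3/2) * \<bar>Im r\<bar>))"
    using zero_weight_bound[of R] by blast
  obtain n0 where n0: "{n. \<bar>Im (\<rho> (Suc n))\<bar> \<le> R + 1} \<subseteq> {..<n0}"
    using finite_nat_iff_bounded[of "{n. \<bar>Im (\<rho> (Suc n))\<bar> \<le> R + 1}"] finite_small_zeros[OF \<rho>] by auto
  define f where "f n s w = zero_weight s w (\<rho> (Suc (n + n0)))" for n s w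
  define g where "g n = C * (\<bar>real_of_int (zorder riemann_zeta (\<rho> (Suc (n + n0))))\<bar> * exp (- (3/2) * \<bar>Im (\<rho> (Suc (n + n0)))\<bar>))" for n
  have Im: "\<bar>Im (\<rho> (Suc (n + n0)))\<bar> > R + 1" for n
    using n0 by (auto simp: subset_iff not_le[symmetric])
  have sg: "summable g" unfolding g_def
    by (intro summable_mult summable_ignore_initial_segment[of "\<lambda>n. \<bar>real_of_int (zorder riemann_zeta (\<rho> (Suc n)))\<bar> * exp (- (3/2) * \<bar>Im (\<rho> (Suc n))\<bar>)"] summable_zeros[OF \<rho>]) simp
  have fg: "norm (f n s w) \<le> g n" if "s \<in> ball 0 R" "w \<in> ball 0 R" for n s w
    unfolding f_def g_def by (rule C[rule_format]) (use that Im[of n] enumerates_zeta_zeros_mem[OF \<rho>] in auto)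
  have reg: "s - \<rho> (Suc (n + n0)) \<notin> \<int>\<^sub>\<le>\<^sub>0" "s - \<rho> (Suc (n + n0)) \<noteq> 1" if "s \<in> ball 0 R" for s n
  proof -
    have "\<bar>Im s\<bar> < R" using abs_Im_le_cmod[of s] that by simp
    then have "Im (s - \<rho> (Suc (n + n0))) \<noteq> 0" using Im[of n] by auto
    then show "s - \<rho> (Suc (n + n0)) \<notin> \<int>\<^sub>\<le>\<^sub>0" "s - \<rho> (Suc (n + n0)) \<noteq> 1"
      by (rule Im_nonzero_not_nonpos_Int, metis one_complex.sel(2))
  qed
  have hs: "(\<lambda>s. f n s w) holomorphic_on ball 0 R" for n w
    unfolding f_def zero_weight_def by (intro holomorphic_intros) (use reg in auto)
  have hw: "(\<lambda>w. f n s w) holomorphic_on ball 0 R" for n s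
    unfolding f_def zero_weight_def by (intro holomorphic_intros) (use reg in auto)
  show ?thesis
  proof (rule exI[of _ n0], rule exI[of _ "\<lambda>s w. \<Sum>n. f n s w"], rule exI[of _ "suminf g"], intro conjI allI ballI)
    show "(\<Sum>n. zero_weight s w (\<rho> (Suc n))) = (\<Sum>n<n0. zero_weight s w (\<rho> (Suc n))) + (\<Sum>n. f n s w)" for s w
      using suminf_split_initial_segment[OF summable_norm_cancel[OF summable_zero_weight[OF \<rho>, of s w]], of n0]
      by (simp add: f_def add.commute)
    show "(\<lambda>s. \<Sum>n. f n s w) holomorphic_on ball 0 R" if w: "w \<in> ball 0 R" for w
    proof (rule holomorphic_on_suminf_dominated)
      fix a assume "a \<in> ball (0::complex) R"
      then obtain r where r: "r > 0" "ball a r \<subseteq> ball 0 R" by (meson open_ball open_contains_ball)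
      show "\<exists>r>0. \<exists>g. (\<forall>n. (\<lambda>s. f n s w) holomorphic_on ball a r) \<and> summable g \<and> (\<forall>s\<in>ball a r. \<forall>n. norm (f n s w) \<le> g n)"
        by (rule exI[of _ r], intro conjI exI[of _ g] allI ballI sg r(1) holomorphic_on_subset[OF hs r(2)] fg w) (use r(2) in blast)
    qed
    show "(\<lambda>w. \<Sum>n. f n s w) holomorphic_on ball 0 R" if s: "s \<in> ball 0 R" for s
    proof (rule holomorphic_on_suminf_dominated)
      fix a assume "a \<in> ball (0::complex) R"
      then obtain r where r: "r > 0" "ball a r \<subseteq> ball 0 R" by (meson open_ball open_contains_ball)
      show "\<exists>r>0. \<exists>g. (\<forall>n. (\<lambda>w. f n s w) holomorphic_on ball a r) \<and> summable g \<and> (\<forall>w\<in>ball a r. \<forall>n. norm (f n s w) \<le> g n)"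
        by (rule exI[of _ r], intro conjI exI[of _ g] allI ballI sg r(1) holomorphic_on_subset[OF hw r(2)] fg s) (use r(2) in blast)
    qed
    show "norm (\<Sum>n. f n s w) \<le> suminf g" if "s \<in> ball 0 R" "w \<in> ball 0 R" for s w
      by (rule norm_suminf_le[OF fg[OF that] sg])
  qed
qed

text \<open>The splitting of the sum over the zeros depends on the radius, so holomorphy is obtained
  ball by ball. The balls may be taken large enough to contain \<open>p\<close>, the other variable,
  which is held fixed.\<close>

lemma holomorphic_on_exhaustion:
  fixes p :: complex
  assumes "\<And>R. R > norm p \<Longrightarrow> f holomorphic_on (ball 0 R \<inter> U)" "open U"
  shows "f holomorphic_on U"
proof -
  have "f holomorphic_on (\<Union>R\<in>{norm p<..}. ball 0 R \<inter> U)"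
    by (rule holomorphic_on_UN_open) (use assms in auto)
  moreover have "(\<Union>R\<in>{norm p<..}. ball 0 R \<inter> U) = U"
  proof safe
    fix x assume "x \<in> U"
    then show "x \<in> (\<Union>R\<in>{norm p<..}. ball 0 R \<inter> U)"
      by (intro UN_I[of "norm p + norm x + 1"]) (simp_all add: add_nonneg_pos add_strict_increasing2 add.assoc)
  qed
  ultimately show ?thesis by simp
qed

section \<open>Separate holomorphy of the formula and its independence of \<open>N\<close>\<close>

lemma open_Compl_bad: "open (- bad_s)" "open (- bad_w)"
  using sparse_in_UNIV_imp_closed[OF bad_s_sparse] sparse_in_UNIV_imp_closed[OF bad_w_sparse] by (auto intro: open_Compl)

lemma zero_sum_holomorphic_fst:
  assumes \<rho>: "enumerates_zeta_zeros \<rho>"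
  shows "(\<lambda>s. \<Sum>n. zero_weight s w (\<rho> (Suc n))) holomorphic_on - bad_s"
proof (rule holomorphic_on_exhaustion[OF _ open_Compl_bad(1), of w])
  fix R assume R: "R > norm w"
  obtain n0 T where T': "\<forall>s w. (\<Sum>n. zero_weight s w (\<rho> (Suc n))) = (\<Sum>n<n0. zero_weight s w (\<rho> (Suc n))) + T s w"
    "\<forall>w\<in>ball 0 R. (\<lambda>s. T s w) holomorphic_on ball 0 R"
    using zero_sum_split[OF \<rho>, of R] by blast
  note T = T'[rule_format]
  have "(\<lambda>s. T s w) holomorphic_on (ball 0 R \<inter> - bad_s)"
    by (rule holomorphic_on_subset[OF T(2)]) (use R in auto)
  then show "(\<lambda>s. \<Sum>n. zero_weight s w (\<rho> (Suc n))) holomorphic_on (ball 0 R \<inter> - bad_s)"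
    unfolding T(1) unfolding zero_weight_def
    by (intro holomorphic_on_add holomorphic_on_sum holomorphic_on_mult holomorphic_on_const holomorphic_Gamma' holomorphic_intros)
       (use enumerates_zeta_zeros_mem[OF \<rho>] in \<open>auto simp: bad_s_def\<close>)
qed

lemma zero_sum_holomorphic_snd:
  assumes \<rho>: "enumerates_zeta_zeros \<rho>"
  shows "(\<lambda>w. \<Sum>n. zero_weight s w (\<rho> (Suc n))) holomorphic_on - bad_w"
proof (rule holomorphic_on_exhaustion[OF _ open_Compl_bad(2), of s])
  fix R assume R: "R > norm s"
  obtain n0 T where T': "\<forall>s w. (\<Sum>n. zero_weight s w (\<rho> (Suc n))) = (\<Sum>n<n0. zero_weight s w (\<rho> (Suc n))) + T s w"
    "\<forall>s\<in>ball 0 R. (\<lambda>w. T s w) holomorphic_on ball 0 R"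
    using zero_sum_split[OF \<rho>, of R] by blast
  note T = T'[rule_format]
  have "(\<lambda>w. T s w) holomorphic_on (ball 0 R \<inter> - bad_w)"
    by (rule holomorphic_on_subset[OF T(2)]) (use R in auto)
  then show "(\<lambda>w. \<Sum>n. zero_weight s w (\<rho> (Suc n))) holomorphic_on (ball 0 R \<inter> - bad_w)"
    unfolding T(1) unfolding zero_weight_def
    by (intro holomorphic_on_add holomorphic_on_sum holomorphic_on_mult holomorphic_on_const holomorphic_riemann_zeta' holomorphic_intros)
       (use enumerates_zeta_zeros_mem[OF \<rho>] in \<open>auto simp: bad_w_def\<close>)
qed

lemma holomorphic_deriv_shift:
  assumes "f holomorphic_on S" "open S" "\<And>x. x \<in> A \<Longrightarrow> x + c \<in> S"
  shows "(\<lambda>x. deriv f (x + c)) holomorphic_on A"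
proof -
  have "(deriv f \<circ> (\<lambda>x. x + c)) holomorphic_on A"
    by (rule holomorphic_on_compose_gen[OF _ holomorphic_deriv[OF assms(1,2)]]) (use assms(3) in \<open>auto intro!: holomorphic_intros\<close>)
  then show ?thesis by (simp add: o_def)
qed

lemma bad_s_even_shift:
  assumes "s \<notin> bad_s" "\<not> (k = 0 \<or> odd k)"
  shows "s + of_nat k \<notin> \<int>\<^sub>\<le>\<^sub>0"
proof
  assume "s + of_nat k \<in> \<int>\<^sub>\<le>\<^sub>0"
  then obtain n :: nat where n: "s + of_nat k = - of_nat n" by (auto elim!: nonpos_Ints_cases')
  have k2: "k \<ge> 2" using assms(2) by (cases "k = 1") auto
  have "s + 2 = - of_nat (n + (k - 2))" using n k2 by (simp add: of_nat_diff algebra_simps eq_neg_iff_add_eq_0)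
  then have "s + 2 \<in> \<int>\<^sub>\<le>\<^sub>0" by (simp only: minus_of_nat_in_nonpos_Ints)
  then show False using assms(1) by (simp add: bad_s_def)
qed

lemma pole_part_holomorphic_fst: "(\<lambda>s. pole_part k s w) holomorphic_on - bad_s"
proof (cases "k = 0 \<or> odd k")
  case True
  then show ?thesis unfolding pole_part_def
    by (simp add: holomorphic_on_mult gbinomial_uminus_holomorphic)
next
  case False
  have "(\<lambda>s. deriv Gamma (s + of_nat k)) holomorphic_on - bad_s"
    by (rule holomorphic_deriv_shift[of Gamma "- \<int>\<^sub>\<le>\<^sub>0"])
       (use bad_s_even_shift[OF _ False] in \<open>auto intro!: holomorphic_Gamma open_Compl\<close>)
  then show ?thesis unfolding pole_part_def if_not_P[OF False]
    by (intro holomorphic_on_minus holomorphic_on_diff holomorphic_on_mult holomorphic_on_const gbinomial_uminus_holomorphic holomorphic_rGamma)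
qed

lemma pole_part_holomorphic_snd: "(\<lambda>w. pole_part k s w) holomorphic_on - bad_w"
proof -
  have nb: "w + of_nat k \<noteq> 1" if "w \<in> - bad_w" for w using that by (auto simp: bad_w_def)
  have "(\<lambda>w. deriv riemann_zeta (w + of_nat k)) holomorphic_on - bad_w"
    by (rule holomorphic_deriv_shift[OF holomorphic_riemann_zeta]) (use nb in auto)
  moreover have "(\<lambda>w. riemann_zeta (w + of_nat k)) holomorphic_on - bad_w"
    by (intro holomorphic_riemann_zeta' holomorphic_intros) (use nb in auto)
  ultimately show ?thesis unfolding pole_part_def
    by (cases "k = 0 \<or> odd k"; simp only: if_True if_False)
       (intro holomorphic_on_minus holomorphic_on_diff holomorphic_on_mult holomorphic_on_const; assumption)+
qed

lemma formula_holomorphic_fst: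
  assumes \<rho>: "enumerates_zeta_zeros \<rho>" and c: "clear_line c" and w: "1 - c < Re w"
  shows "(\<lambda>s. formula \<rho> N c s w) holomorphic_on {s. - c < Re s} - bad_s"
proof -
  have "(\<lambda>s. \<Sum>n. zero_weight s w (\<rho> (Suc n))) holomorphic_on {s. - c < Re s} - bad_s"
    using zero_sum_holomorphic_fst[OF \<rho>] by (rule holomorphic_on_subset) auto
  moreover have "(\<lambda>s. pole_part k s w) holomorphic_on {s. - c < Re s} - bad_s" for k
    using pole_part_holomorphic_fst by (rule holomorphic_on_subset) auto
  moreover have "(\<lambda>s. line_part c s w) holomorphic_on {s. - c < Re s} - bad_s"
    using line_part_holomorphic_fst[OF c w] by (rule holomorphic_on_subset) auto
  ultimately show ?thesis unfolding formula_def
    by (intro holomorphic_on_add holomorphic_on_diff holomorphic_on_mult holomorphic_on_sum holomorphic_on_divide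
          holomorphic_rGamma holomorphic_on_const holomorphic_on_ident) (auto simp: bad_s_def)
qed

lemma formula_holomorphic_snd:
  assumes \<rho>: "enumerates_zeta_zeros \<rho>" and c: "clear_line c" and s: "- c < Re s" "s \<notin> bad_s"
  shows "(\<lambda>w. formula \<rho> N c s w) holomorphic_on {w. 1 - c < Re w} - bad_w"
proof -
  have s1: "s - 1 \<noteq> 0" using s by (auto simp: bad_s_def)
  have "(\<lambda>w. \<Sum>n. zero_weight s w (\<rho> (Suc n))) holomorphic_on {w. 1 - c < Re w} - bad_w"
    using zero_sum_holomorphic_snd[OF \<rho>] by (rule holomorphic_on_subset) auto
  moreover have "(\<lambda>w. pole_part k s w) holomorphic_on {w. 1 - c < Re w} - bad_w" for k
    using pole_part_holomorphic_snd by (rule holomorphic_on_subset) auto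
  moreover have "(\<lambda>w. line_part c s w) holomorphic_on {w. 1 - c < Re w} - bad_w"
    using line_part_holomorphic_snd[OF c s(1)] by (rule holomorphic_on_subset) auto
  moreover have "(\<lambda>w. riemann_zeta (w - 1)) holomorphic_on {w. 1 - c < Re w} - bad_w"
    by (intro holomorphic_riemann_zeta' holomorphic_intros) (auto simp: bad_w_def)
  ultimately show ?thesis unfolding formula_def
    by (intro holomorphic_on_add holomorphic_on_diff holomorphic_on_mult holomorphic_on_sum holomorphic_on_divide
          holomorphic_on_const s1)
qed

text \<open>Both sides equal the double series for large real parts. With \<open>Re s > 1\<close>
  fixed, continuation in \<open>w\<close> reaches the full half-plane of \<open>w\<close>; with such
  a \<open>w\<close> fixed, continuation in \<open>s\<close> does the rest.\<close>

lemma formula_agree: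
  assumes \<rho>: "enumerates_zeta_zeros \<rho>"
    and N: "N \<ge> 1" "0 < \<epsilon>" "\<epsilon> < 1" and N': "N' \<ge> 1" "0 < \<epsilon>'" "\<epsilon>' < 1"
    and s: "s \<notin> bad_s" "- (real N - \<epsilon>) < Re s" "- (real N' - \<epsilon>') < Re s"
    and w: "w \<notin> bad_w" "1 - (real N - \<epsilon>) < Re w" "1 - (real N' - \<epsilon>') < Re w"
  shows "formula \<rho> N (real N - \<epsilon>) s w = formula \<rho> N' (real N' - \<epsilon>') s w"
proof -
  define c c' d where "c = real N - \<epsilon>" and "c' = real N' - \<epsilon>'" and "d = min c c'"
  have c: "clear_line c" "clear_line c'" using clear_line_right[OF N] clear_line_right[OF N'] by (simp_all add: c_def c'_def)
  have cpos: "c > 0" "c' > 0" using N N' by (simp_all add: c_def c'_def)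
  have eq1: "formula \<rho> N c s w = formula \<rho> N' c' s w" if "Re s > 1" "Re w > 2" for s w
    using Phi2_eq_formula[OF \<rho> N, of s "w - s"] Phi2_eq_formula[OF \<rho> N', of s "w - s"] that by (simp add: c_def c'_def)
  \<comment> \<open>A half-plane minus a sparse set is still open and connected, as the identity
    theorem requires.\<close>
  have conn: "connected ({z. x < Re z} - E)" "open ({z. x < Re z} - E)" if E: "E sparse_in UNIV" for x and E :: "complex set"
  proof -
    have o: "open {z. x < Re z}" by (rule open_halfspace_Re_gt)
    have E': "E sparse_in {z. x < Re z}" by (rule sparse_in_subset[OF E]) simp
    show "connected ({z. x < Re z} - E)"
      by (rule sparse_imp_connected[OF _ convex_connected[OF convex_halfspace_Re_gt] o E']) simp
    show "open ({z. x < Re z} - E)" by (rule open_diff_sparse_pts[OF o E'])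
  qed
  have eq2: "formula \<rho> N c s w = formula \<rho> N' c' s w"
    if s: "Re s > 1" "s \<notin> bad_s" and w: "w \<notin> bad_w" "1 - d < Re w" for s w
  proof (rule analytic_continuation_open[of "{w. 2 < Re w} - bad_w" "{w. 1 - d < Re w} - bad_w" "\<lambda>w. formula \<rho> N c s w" "\<lambda>w. formula \<rho> N' c' s w"])
    have "3 \<notin> bad_w"
    proof -
      have "3 + of_nat k \<noteq> (1 :: complex)" for k by (auto dest: arg_cong[of _ _ Re])
      moreover have "3 - r \<noteq> 1" if "r \<in> nontrivial_zeta_zeros" for r
        using nontrivial_zeta_zeros_Re[OF that] by (auto dest: arg_cong[of _ _ Re])
      ultimately show ?thesis by (auto simp: bad_w_def)
    qed
    then have "3 \<in> {w. 2 < Re w} - bad_w" by simp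
    then show "{w. 2 < Re w} - bad_w \<noteq> {}" by blast
    show "{w. 2 < Re w} - bad_w \<subseteq> {w. 1 - d < Re w} - bad_w" using cpos by (auto simp: d_def)
    show "(\<lambda>w. formula \<rho> N c s w) holomorphic_on {w. 1 - d < Re w} - bad_w"
      by (rule holomorphic_on_subset[OF formula_holomorphic_snd[OF \<rho> c(1)]]) (use s cpos in \<open>auto simp: d_def\<close>)
    show "(\<lambda>w. formula \<rho> N' c' s w) holomorphic_on {w. 1 - d < Re w} - bad_w"
      by (rule holomorphic_on_subset[OF formula_holomorphic_snd[OF \<rho> c(2)]]) (use s cpos in \<open>auto simp: d_def\<close>)
  qed (use conn[OF bad_w_sparse] eq1 s w in auto)
  have "formula \<rho> N c s w = formula \<rho> N' c' s w"
  proof (rule analytic_continuation_open[of "{s. 1 < Re s} - bad_s" "{s. - d < Re s} - bad_s" "\<lambda>s. formula \<rho> N c s w" "\<lambda>s. formula \<rho> N' c' s w"])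
    have "2 \<notin> bad_s"
    proof -
      have "2 - r \<notin> \<int>\<^sub>\<le>\<^sub>0" if "r \<in> nontrivial_zeta_zeros" for r
        by (rule not_nonpos_Int_Re) (use nontrivial_zeta_zeros_Re[OF that] in simp)
      moreover have "2 + 2 \<notin> (\<int>\<^sub>\<le>\<^sub>0 :: complex set)" by (rule not_nonpos_Int_Re) simp
      ultimately show ?thesis by (auto simp: bad_s_def)
    qed
    then have "2 \<in> {s. 1 < Re s} - bad_s" by simp
    then show "{s. 1 < Re s} - bad_s \<noteq> {}" by blast
    show "{s. 1 < Re s} - bad_s \<subseteq> {s. - d < Re s} - bad_s" using cpos by (auto simp: d_def)
    show "(\<lambda>s. formula \<rho> N c s w) holomorphic_on {s. - d < Re s} - bad_s"
      by (rule holomorphic_on_subset[OF formula_holomorphic_fst[OF \<rho> c(1)]]) (use w in \<open>auto simp: d_def c_def\<close>)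
    show "(\<lambda>s. formula \<rho> N' c' s w) holomorphic_on {s. - d < Re s} - bad_s"
      by (rule holomorphic_on_subset[OF formula_holomorphic_fst[OF \<rho> c(2)]]) (use w in \<open>auto simp: d_def c'_def\<close>)
    show "s \<in> {s. - d < Re s} - bad_s" using s by (simp add: d_def c_def c'_def min_def)
    show "formula \<rho> N c z w = formula \<rho> N' c' z w" if "z \<in> {s. 1 < Re s} - bad_s" for z
      by (rule eq2) (use that w in \<open>auto simp: d_def c_def c'_def min_def\<close>)
  qed (use conn[OF bad_s_sparse] in auto)
  then show ?thesis by (simp add: c_def c'_def)
qed

section \<open>The parts of the formula as functions with poles along coordinate lines\<close>

lemma zero_sum_pole2:
  assumes \<rho>: "enumerates_zeta_zeros \<rho>"
  shows "pole2 (\<lambda>s w. \<Sum>n. zero_weight s w (\<rho> (Suc n))) a b"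
proof -
  define R where "R = norm a + norm b + 1"
  obtain n0 T B where T': "\<forall>s w. (\<Sum>n. zero_weight s w (\<rho> (Suc n))) = (\<Sum>n<n0. zero_weight s w (\<rho> (Suc n))) + T s w"
    "\<forall>w\<in>ball 0 R. (\<lambda>s. T s w) holomorphic_on ball 0 R"
    "\<forall>s\<in>ball 0 R. (\<lambda>w. T s w) holomorphic_on ball 0 R"
    "\<forall>s\<in>ball 0 R. \<forall>w\<in>ball 0 R. norm (T s w) \<le> B"
    using zero_sum_split[OF \<rho>, of R] by blast
  note T = T'[rule_format]
  have sub: "ball a 1 \<subseteq> ball 0 R" "ball b 1 \<subseteq> ball 0 R"
  proof -
    have "ball x 1 \<subseteq> ball 0 (norm x + 1)" for x :: complex
      by (rule subsetI) (use norm_triangle_sub in \<open>simp add: dist_norm norm_minus_commute, smt (verit)\<close>)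
    moreover have "norm a + 1 \<le> R" "norm b + 1 \<le> R" by (simp_all add: R_def)
    ultimately show "ball a 1 \<subseteq> ball 0 R" "ball b 1 \<subseteq> ball 0 R" by (meson order_trans subset_ball)+
  qed
  have "pole2 T a b"
  proof (rule pole2_holomorphic[OF zero_less_one])
    show "(\<lambda>s. T s w) holomorphic_on ball a 1" if "w \<in> ball b 1" for w
      by (rule holomorphic_on_subset[OF T(2)]) (use that sub in blast)+
    show "(\<lambda>w. T s w) holomorphic_on ball b 1" if "s \<in> ball a 1" for s
      by (rule holomorphic_on_subset[OF T(3)]) (use that sub in blast)+
    show "norm (T s w) \<le> B" if "s \<in> ball a 1" "w \<in> ball b 1" for s w
      by (rule T(4)) (use that sub in blast)+
  qed
  moreover have "pole2 (\<lambda>s w. zero_weight s w r) a b" for r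
    unfolding zero_weight_def
    using meromorphic_Gamma_shift[of "- r"] meromorphic_riemann_zeta_shift[of "- r"]
    by (intro pole2_mult pole2_const) (simp_all add: pole2_fst pole2_snd)
  ultimately show ?thesis unfolding T(1) by (intro pole2_add pole2_sum)
qed

lemma pole_part_pole2: "pole2 (\<lambda>s w. pole_part k s w) a b"
proof -
  have G: "pole2 (\<lambda>s w. (- s) gchoose k) a b" by (intro pole2_fst gbinomial_uminus_meromorphic)
  have Z: "pole2 (\<lambda>s w. riemann_zeta (w + of_nat k)) a b" by (intro pole2_snd meromorphic_riemann_zeta_shift)
  have Z': "pole2 (\<lambda>s w. deriv riemann_zeta (w + of_nat k)) a b"
    by (intro pole2_snd meromorphic_deriv_shift meromorphic_riemann_zeta_shift)
  have "pole2 (\<lambda>s w. deriv Gamma (s + of_nat k)) a b"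
    by (intro pole2_fst meromorphic_deriv_shift meromorphic_Gamma_shift)
  moreover have "pole2 (\<lambda>s w. rGamma s) a b"
    by (intro pole2_fst analytic_on_imp_meromorphic_on analytic_rGamma)
  ultimately have "pole2 (\<lambda>s w. 0 - (((- s) gchoose k) * ((- a_coeff k + fact k * b_coeff k) * riemann_zeta (w + of_nat k)
                - deriv riemann_zeta (w + of_nat k))
              - 1 / fact k * (deriv Gamma (s + of_nat k) * rGamma s) * riemann_zeta (w + of_nat k))) a b"
    by (intro pole2_diff pole2_mult pole2_const G Z Z')
  moreover have "pole2 (\<lambda>s w. ((- s) gchoose k) * M_zeta (- of_nat k) * riemann_zeta (w + of_nat k)) a b"
    by (intro pole2_mult pole2_const G Z)
  ultimately show ?thesis unfolding pole_part_def by (cases "k = 0 \<or> odd k") (simp_all only: if_True if_False diff_0)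
qed

lemma line_part_pole2:
  assumes c: "clear_line c" and a: "- c < Re a" and b: "1 - c < Re b"
  shows "pole2 (line_part c) a b"
proof -
  define r where "r = min (Re a + c) (Re b - 1 + c) / 2"
  have r: "r > 0" "r < Re a + c" "r < Re b - 1 + c" using a b by (auto simp: r_def min_def)
  have sub: "cball a r \<subseteq> {s. - c < Re s}" "cball b r \<subseteq> {w. 1 - c < Re w}"
  proof -
    show "cball a r \<subseteq> {s. - c < Re s}"
    proof safe
      fix x assume "x \<in> cball a r"
      then have "\<bar>Re (a - x)\<bar> \<le> r" using abs_Re_le_cmod[of "a - x"] by (simp add: dist_norm)
      then show "- c < Re x" using r by simp
    qed
    show "cball b r \<subseteq> {w. 1 - c < Re w}"
    proof safe
      fix x assume "x \<in> cball b r"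
      then have "\<bar>Re (b - x)\<bar> \<le> r" using abs_Re_le_cmod[of "b - x"] by (simp add: dist_norm)
      then show "1 - c < Re x" using r by simp
    qed
  qed
  have "cball a r \<times> cball b r \<subseteq> right_region c" using sub by (auto simp: right_region_def)
  then obtain B where B: "\<forall>p\<in>cball a r \<times> cball b r. norm (line_part c (fst p) (snd p)) \<le> B"
    using line_part_bounded[OF c compact_Times[OF compact_cball compact_cball]] by blast
  show ?thesis
  proof (rule pole2_holomorphic[OF r(1)])
    show "(\<lambda>s. line_part c s w) holomorphic_on ball a r" if "w \<in> ball b r" for w
      by (rule holomorphic_on_subset[OF line_part_holomorphic_fst[OF c]]) (use that sub ball_subset_cball in blast)+
    show "(\<lambda>w. line_part c s w) holomorphic_on ball b r" if "s \<in> ball a r" for s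
      by (rule holomorphic_on_subset[OF line_part_holomorphic_snd[OF c]]) (use that sub ball_subset_cball in blast)+
    show "norm (line_part c s w) \<le> B" if "s \<in> ball a r" "w \<in> ball b r" for s w
      using B[rule_format, of "(s, w)"] that by simp
  qed
qed

lemma formula_pole2:
  assumes \<rho>: "enumerates_zeta_zeros \<rho>" and c: "clear_line c" "- c < Re a" "1 - c < Re b"
  shows "pole2 (formula \<rho> N c) a b"
proof -
  have "pole2 (\<lambda>s w. 1 / (s - 1)) a b"
    by (intro pole2_fst meromorphic_intros)
  moreover have "pole2 (\<lambda>s w. riemann_zeta (w + (- 1))) a b" by (intro pole2_snd meromorphic_riemann_zeta_shift)
  moreover have "pole2 (\<lambda>s w. rGamma s) a b"
    by (intro pole2_fst analytic_on_imp_meromorphic_on analytic_rGamma)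
  ultimately have "pole2 (\<lambda>s w. riemann_zeta (w + (- 1)) * (1 / (s - 1)) + (\<Sum>k<N. pole_part k s w)
     - rGamma s * (\<Sum>n. zero_weight s w (\<rho> (Suc n))) + rGamma s * (1 / (2 * of_real pi)) * line_part c s w) a b"
    by (intro pole2_add pole2_diff pole2_mult pole2_sum pole2_const pole_part_pole2 zero_sum_pole2[OF \<rho>] line_part_pole2[OF c])
  then show ?thesis unfolding formula_def[abs_def] by simp
qed

text \<open>At each point some \<open>N\<close> is taken that is large enough for the point to lie
  in the region of the formula; away from the exceptional values every other admissible choice of
  \<open>N\<close> and abscissa gives the same value.\<close>

definition continuation :: "(nat \<Rightarrow> complex) \<Rightarrow> complex \<Rightarrow> complex \<Rightarrow> complex" where
  "continuation \<rho> s w = (let N = nat \<lceil>\<bar>Re s\<bar> + \<bar>Re w\<bar>\<rceil> + 2 in formula \<rho> N (real N - 1 / 2) s w)"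

lemma continuation_eq_formula:
  assumes \<rho>: "enumerates_zeta_zeros \<rho>" and N: "N \<ge> 1" "0 < \<epsilon>" "\<epsilon> < 1"
    and s: "s \<notin> bad_s" "- (real N - \<epsilon>) < Re s" and w: "w \<notin> bad_w" "1 - (real N - \<epsilon>) < Re w"
  shows "continuation \<rho> s w = formula \<rho> N (real N - \<epsilon>) s w"
proof -
  define m where "m = nat \<lceil>\<bar>Re s\<bar> + \<bar>Re w\<bar>\<rceil>"
  have m: "\<bar>Re s\<bar> + \<bar>Re w\<bar> \<le> real m" unfolding m_def by (rule real_nat_ceiling_ge)
  have "formula \<rho> (m + 2) (real (m + 2) - 1 / 2) s w = formula \<rho> N (real N - \<epsilon>) s w"
    by (rule formula_agree[OF \<rho>]) (use N s w m in auto)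
  then show ?thesis by (simp add: continuation_def m_def Let_def)
qed

lemma continuation_pole2:
  assumes \<rho>: "enumerates_zeta_zeros \<rho>"
  shows "pole2 (continuation \<rho>) a b"
proof -
  \<comment> \<open>The summand 4 leaves room for unit balls around \<open>a\<close> and
    \<open>b\<close>, so one \<open>N\<close> describes the function near the whole point.\<close>
  define N where "N = nat \<lceil>\<bar>Re a\<bar> + \<bar>Re b\<bar>\<rceil> + 4"
  have "\<bar>Re a\<bar> + \<bar>Re b\<bar> \<le> real (nat \<lceil>\<bar>Re a\<bar> + \<bar>Re b\<bar>\<rceil>)" by (rule real_nat_ceiling_ge)
  then have N: "N \<ge> 1" "\<bar>Re a\<bar> + \<bar>Re b\<bar> + 4 \<le> real N" by (simp_all add: N_def)
  have "\<forall>\<^sub>F s in at a. s \<notin> bad_s" "\<forall>\<^sub>F w in at b. w \<notin> bad_w"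
    using bad_s_sparse bad_w_sparse sparse_in_eventually_iff[OF open_UNIV] by blast+
  then obtain d1 d2 where d: "d1 > 0" "d2 > 0" "\<And>s. s \<noteq> a \<Longrightarrow> dist s a < d1 \<Longrightarrow> s \<notin> bad_s" "\<And>w. w \<noteq> b \<Longrightarrow> dist w b < d2 \<Longrightarrow> w \<notin> bad_w"
    unfolding eventually_at by auto
  show ?thesis
  proof (rule pole2_cong[OF formula_pole2[OF \<rho>, of "real N - 1/2" a b N], where \<delta> = "min 1 (min d1 d2)"])
    show "clear_line (real N - 1 / 2)" by (rule clear_line_right) (use N in auto)
    show "- (real N - 1 / 2) < Re a" "1 - (real N - 1 / 2) < Re b" using N by auto
    fix s w assume sw: "s \<in> ball a (min 1 (min d1 d2)) - {a}" "w \<in> ball b (min 1 (min d1 d2)) - {b}"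
    have "\<bar>Re (a - s)\<bar> < 1" "\<bar>Re (b - w)\<bar> < 1"
      using abs_Re_le_cmod[of "a - s"] abs_Re_le_cmod[of "b - w"] sw by (auto simp: dist_norm)
    then show "continuation \<rho> s w = formula \<rho> N (real N - 1 / 2) s w"
      by (intro continuation_eq_formula[OF \<rho>]) (use sw d(3)[of s] d(4)[of w] N in \<open>auto simp: dist_commute\<close>)
  qed (use d in auto)
qed

section \<open>Return to the variables \<open>s1\<close> and \<open>s2\<close>, and meromorphy in
  two variables\<close>

lemma holomorphic2_on_shear:
  assumes g1: "\<And>w. w \<in> ball b r \<Longrightarrow> (\<lambda>s. g s w) holomorphic_on ball a r"
    and g2: "\<And>s. s \<in> ball a r \<Longrightarrow> (\<lambda>w. g s w) holomorphic_on ball b r"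
    and B: "\<And>s w. s \<in> ball a r \<Longrightarrow> w \<in> ball b r \<Longrightarrow> norm (g s w) \<le> B"
  shows "holomorphic2_on (\<lambda>(s1, s2). g s2 (s1 + s2)) {(s1, s2). s2 \<in> ball a r \<and> s1 + s2 \<in> ball b r}"
  unfolding holomorphic2_on_def
proof
  fix p assume "p \<in> {(s1, s2). s2 \<in> ball a r \<and> s1 + s2 \<in> ball b r}"
  then obtain u v where p: "p = (u, v)" and uv: "v \<in> ball a r" "u + v \<in> ball b r" by auto
  obtain e1 e2 where e: "e1 > 0" "e2 > 0" "ball v e1 \<subseteq> ball a r" "ball (u + v) e2 \<subseteq> ball b r"
    using uv by (meson open_ball open_contains_ball)
  define e where "e = min e1 e2"
  have sub: "e > 0" "ball v e \<subseteq> ball a r" "ball (u + v) e \<subseteq> ball b r" using e by (auto simp: e_def)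
  \<comment> \<open>Osgood's lemma speaks of the centre of the balls, so it is applied on smaller
    balls around the point in question; the linear change of variables is then composed by the chain
    rule.\<close>
  have "\<exists>A C. ((\<lambda>(x, y). g x y) has_derivative (\<lambda>(h, k). A * h + C * k)) (at (v, u + v))"
  proof (rule osgood[OF sub(1), of _ _ _ B])
    show "norm ((\<lambda>(x, y). g x y) (x, y)) \<le> B" if "x \<in> ball v e" "y \<in> ball (u + v) e" for x y
      unfolding prod.case by (rule B) (use that sub in blast)+
    show "(\<lambda>x. (\<lambda>(x, y). g x y) (x, y)) holomorphic_on ball v e" if "y \<in> ball (u + v) e" for y
      unfolding prod.case by (rule holomorphic_on_subset[OF g1 sub(2)]) (use that sub in blast)
    show "(\<lambda>y. (\<lambda>(x, y). g x y) (x, y)) holomorphic_on ball (u + v) e" if "x \<in> ball v e" for x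
      unfolding prod.case by (rule holomorphic_on_subset[OF g2 sub(3)]) (use that sub in blast)
  qed
  then obtain A C where AC: "((\<lambda>(x, y). g x y) has_derivative (\<lambda>(h, k). A * h + C * k)) (at (v, u + v))" by blast
  have sh: "((\<lambda>q. (snd q, fst q + snd q)) has_derivative (\<lambda>q. (snd q, fst q + snd q))) (at p)"
    by (intro derivative_intros)
  have "(((\<lambda>(x, y). g x y) \<circ> (\<lambda>q. (snd q, fst q + snd q))) has_derivative
     ((\<lambda>(h, k). A * h + C * k) \<circ> (\<lambda>q. (snd q, fst q + snd q)))) (at p)"
    by (rule diff_chain_at[OF sh]) (use AC in \<open>simp add: p\<close>)
  moreover have "(\<lambda>(x, y). g x y) \<circ> (\<lambda>q. (snd q, fst q + snd q)) = (\<lambda>(s1, s2). g s2 (s1 + s2))" by auto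
  moreover have "(\<lambda>(h, k). A * h + C * k) \<circ> (\<lambda>q. (snd q, fst q + snd q)) = (\<lambda>(h1, h2). C * h1 + (A + C) * h2)"
    by (auto simp: algebra_simps)
  ultimately show "\<exists>a b. ((\<lambda>(s1, s2). g s2 (s1 + s2)) has_derivative (\<lambda>(h1, h2). a * h1 + b * h2)) (at p)" by metis
qed

lemma pole2_imp_meromorphic2:
  assumes f: "\<And>a b. pole2 f a b"
  shows "meromorphic2_on (\<lambda>(s1, s2). f s2 (s1 + s2)) UNIV"
  unfolding meromorphic2_on_def
proof
  fix p :: "complex \<times> complex"
  define a b where "a = snd p" and "b = fst p + snd p"
  obtain r k g B where r0: "0 < r" "r \<le> 1"
    and G: "\<forall>w\<in>ball b r. (\<lambda>s. g s w) holomorphic_on ball a r"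
    "\<forall>s\<in>ball a r. (\<lambda>w. g s w) holomorphic_on ball b r"
    "\<forall>s\<in>ball a r. \<forall>w\<in>ball b r. norm (g s w) \<le> B"
    "\<forall>s\<in>ball a r - {a}. \<forall>w\<in>ball b r - {b}. f s w = g s w / ((s - a) * (w - b)) ^ k"
    using f[of a b] unfolding pole2_def by blast
  note g = G[rule_format]
  define V where "V = {(s1, s2). s2 \<in> ball a r \<and> s1 + s2 \<in> ball b r}"
  \<comment> \<open>One extra power in numerator and denominator: even for \<open>k = 0\<close> the
    denominator now vanishes on both lines, where nothing is known about the values of
    \<open>f\<close>.\<close>
  define g' where "g' s w = g s w * ((s - a) * (w - b)) ^ 1" for s w
  define h where "h s w = ((s - a) * (w - b)) ^ Suc k" for s w
  have V: "V = (\<lambda>q. (snd q, fst q + snd q)) -` (ball a r \<times> ball b r)" by (auto simp: V_def)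
  have lin: "linear (\<lambda>q :: complex \<times> complex. (snd q, fst q + snd q))"
    by (rule linearI) (auto simp: algebra_simps)
  have oV: "open V" unfolding V
    by (intro open_vimage open_Times open_ball continuous_intros)
  have cV: "connected V" unfolding V
    by (intro convex_connected convex_linear_vimage[OF lin] convex_Times convex_ball)
  have pV: "p \<in> V" using r0 by (simp add: V_def a_def b_def case_prod_unfold)
  have hg: "holomorphic2_on (\<lambda>(s1, s2). g' s2 (s1 + s2)) V" unfolding V_def
  proof (rule holomorphic2_on_shear)
    show "(\<lambda>s. g' s w) holomorphic_on ball a r" if "w \<in> ball b r" for w
      unfolding g'_def by (intro holomorphic_intros g(1) that)
    show "(\<lambda>w. g' s w) holomorphic_on ball b r" if "s \<in> ball a r" for s
      unfolding g'_def by (intro holomorphic_intros g(2) that)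
    show "norm (g' s w) \<le> B * 1" if sw: "s \<in> ball a r" "w \<in> ball b r" for s w
      unfolding g'_def norm_mult[of "g s w"]
    proof (intro mult_mono g(3) sw ball_product_power_le[OF sw r0(2)])
      show "0 \<le> B" using g(3)[OF sw] norm_ge_zero order_trans by blast
    qed auto
  qed
  have hh: "holomorphic2_on (\<lambda>(s1, s2). h s2 (s1 + s2)) V" unfolding V_def
  proof (rule holomorphic2_on_shear)
    show "(\<lambda>s. h s w) holomorphic_on ball a r" for w unfolding h_def by (intro holomorphic_intros)
    show "(\<lambda>w. h s w) holomorphic_on ball b r" for s unfolding h_def by (intro holomorphic_intros)
    show "norm (h s w) \<le> 1" if sw: "s \<in> ball a r" "w \<in> ball b r" for s w
      unfolding h_def by (rule ball_product_power_le[OF sw r0(2)])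
  qed
  have q: "\<exists>q\<in>V. (\<lambda>(s1, s2). h s2 (s1 + s2)) q \<noteq> 0"
  \<comment> \<open>In the coordinates \<open>s\<close>, \<open>w\<close> this is the point
    \<open>(a + r / 2, b + r / 2)\<close>, off both lines.\<close>
  proof (rule bexI[of _ "(b - a, a + of_real (r / 2))"])
    show "(b - a, a + of_real (r / 2)) \<in> V" using r0 by (simp add: V_def dist_norm norm_divide)
    show "(\<lambda>(s1, s2). h s2 (s1 + s2)) (b - a, a + of_real (r / 2)) \<noteq> 0" using r0 by (simp add: h_def)
  qed
  have quot: "\<forall>q\<in>V. (\<lambda>(s1, s2). h s2 (s1 + s2)) q \<noteq> 0 \<longrightarrow>
     (\<lambda>(s1, s2). f s2 (s1 + s2)) q = (\<lambda>(s1, s2). g' s2 (s1 + s2)) q / (\<lambda>(s1, s2). h s2 (s1 + s2)) q"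
  proof safe
    fix s1 s2 assume V12: "(s1, s2) \<in> V" and h0: "h s2 (s1 + s2) \<noteq> 0"
    have nz: "s2 - a \<noteq> 0" "s1 + s2 - b \<noteq> 0" using h0 by (auto simp: h_def)
    have "f s2 (s1 + s2) = g s2 (s1 + s2) / ((s2 - a) * (s1 + s2 - b)) ^ k"
      by (rule g(4)) (use V12 nz in \<open>auto simp: V_def\<close>)
    then show "f s2 (s1 + s2) = g' s2 (s1 + s2) / h s2 (s1 + s2)" using nz by (simp add: g'_def h_def)
  qed
  show "\<exists>V g h. open V \<and> connected V \<and> p \<in> V \<and> holomorphic2_on g V \<and> holomorphic2_on h V \<and>
     (\<exists>q\<in>V. h q \<noteq> 0) \<and> (\<forall>q\<in>V. h q \<noteq> 0 \<longrightarrow> (\<lambda>(s1, s2). f s2 (s1 + s2)) q = g q / h q)"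
    by (rule exI[of _ V], rule exI[of _ "\<lambda>(s1, s2). g' s2 (s1 + s2)"], rule exI[of _ "\<lambda>(s1, s2). h s2 (s1 + s2)"],
        intro conjI oV cV pV hg hh q quot)
qed

text \<open>Regularity excludes only the poles of the terms with \<open>k < N\<close>, while the
  exceptional sets contain the poles for all \<open>k\<close>; the remaining ones lie outside the
  half-planes assumed for \<open>s2\<close> and \<open>s1 + s2\<close>.\<close>

lemma regular_point_not_bad:
  assumes reg: "regular_point N s1 s2" and N: "N \<ge> 1" "0 < \<epsilon>"
    and s: "- (real N - \<epsilon>) < Re s2" and w: "1 - (real N - \<epsilon>) < Re (s1 + s2)"
  shows "s2 \<notin> bad_s" "s1 + s2 \<notin> bad_w"
proof -
  have R: "s2 \<noteq> 1" "s1 + s2 - 1 \<noteq> 1" "\<And>k. k < N \<Longrightarrow> s1 + s2 + of_nat k \<noteq> 1"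
    "\<And>k. k \<in> {1..N - 1} \<Longrightarrow> even k \<Longrightarrow> s2 + of_nat k \<notin> \<int>\<^sub>\<le>\<^sub>0"
    "\<And>r. r \<in> nontrivial_zeta_zeros \<Longrightarrow> s2 - r \<notin> \<int>\<^sub>\<le>\<^sub>0" "\<And>r. r \<in> nontrivial_zeta_zeros \<Longrightarrow> s1 + s2 - r \<noteq> 1"
    using reg unfolding regular_point_def by blast+
  \<comment> \<open>If this failed, the real part of \<open>s2\<close> would be at most
    \<open>-2\<close>, hence \<open>N > 2\<close>, so that \<open>k = 2\<close> occurs in the sum
    and is excluded by regularity.\<close>
  have "s2 + 2 \<notin> \<int>\<^sub>\<le>\<^sub>0"
  proof
    assume i: "s2 + 2 \<in> \<int>\<^sub>\<le>\<^sub>0"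
    then obtain n :: nat where "s2 + 2 = - of_nat n" by (auto elim!: nonpos_Ints_cases')
    then have "Re (s2 + 2) = - real n" by simp
    then have "2 < real N" using s N by simp
    then have "2 < N" by simp
    then have "2 \<in> {1..N - 1}" by simp
    from R(4)[OF this] show False using i by simp
  qed
  then show "s2 \<notin> bad_s" using R(1,5) unfolding bad_s_def by blast
  have "s1 + s2 + of_nat k \<noteq> 1" for k
  proof
    assume e: "s1 + s2 + of_nat k = 1"
    then have "Re (s1 + s2 + of_nat k) = 1" by simp
    then have "real k < real N" using w N by simp
    then have "k < N" by simp
    then show False using e R(3) by blast
  qed
  moreover have "s1 + s2 \<noteq> 2" using R(2) by auto
  ultimately show "s1 + s2 \<notin> bad_w" using R(6) unfolding bad_w_def by blast
qed

text \<open>The term \<open>k = 0\<close> supplies the logarithm through the value of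
  \<open>M_zeta\<close> at 0. Dividing by \<open>Gamma s\<close> agrees with multiplying by
  \<open>rGamma s\<close> also at nonpositive integers, where both give 0.\<close>

lemma sum_pole_part:
  assumes "N \<ge> 1"
  shows "(\<Sum>k<N. pole_part k s w) = - (of_real (ln (2 * pi)) * riemann_zeta w)
     + (\<Sum>k\<in>{k\<in>{1..N - 1}. odd k}. ((- s) gchoose k) * M_zeta (- of_nat k) * riemann_zeta (w + of_nat k))
     - (\<Sum>k\<in>{k\<in>{1..N - 1}. even k}. ((- s) gchoose k) *
          ((- a_coeff k + fact k * b_coeff k) * riemann_zeta (w + of_nat k) - deriv riemann_zeta (w + of_nat k))
          - 1 / fact k * (deriv Gamma (s + of_nat k) / Gamma s) * riemann_zeta (w + of_nat k))"
proof -
  define Od Ev where "Od = {k\<in>{1..N - 1}. odd k}" and "Ev = {k\<in>{1..N - 1}. even k}"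
  have eq: "{..<N} = insert 0 (Od \<union> Ev)" using assms unfolding Od_def Ev_def by auto
  have fin: "finite Od" "finite Ev" and disj: "Od \<inter> Ev = {}" and zero: "0 \<notin> Od \<union> Ev" by (auto simp: Od_def Ev_def)
  have "(\<Sum>k<N. pole_part k s w) = pole_part 0 s w + (\<Sum>k\<in>Od \<union> Ev. pole_part k s w)"
    unfolding eq using fin zero by (intro sum.insert) auto
  also have "(\<Sum>k\<in>Od \<union> Ev. pole_part k s w) = (\<Sum>k\<in>Od. pole_part k s w) + (\<Sum>k\<in>Ev. pole_part k s w)"
    by (rule sum.union_disjoint[OF fin disj])
  also have "pole_part 0 s w = - (of_real (ln (2 * pi)) * riemann_zeta w)"
    by (simp add: pole_part_def M_zeta_0)
  also have "(\<Sum>k\<in>Od. pole_part k s w) = (\<Sum>k\<in>Od. ((- s) gchoose k) * M_zeta (- of_nat k) * riemann_zeta (w + of_nat k))"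
    by (intro sum.cong) (simp_all add: pole_part_def Od_def)
  also have "(\<Sum>k\<in>Ev. pole_part k s w) = - (\<Sum>k\<in>Ev. ((- s) gchoose k) *
          ((- a_coeff k + fact k * b_coeff k) * riemann_zeta (w + of_nat k) - deriv riemann_zeta (w + of_nat k))
          - 1 / fact k * (deriv Gamma (s + of_nat k) / Gamma s) * riemann_zeta (w + of_nat k))"
    unfolding sum_negf[symmetric]
  proof (intro sum.cong refl)
    fix k assume "k \<in> Ev"
    then have "\<not> (k = 0 \<or> odd k)" by (auto simp: Ev_def)
    then show "pole_part k s w = - (((- s) gchoose k) *
          ((- a_coeff k + fact k * b_coeff k) * riemann_zeta (w + of_nat k) - deriv riemann_zeta (w + of_nat k))
          - 1 / fact k * (deriv Gamma (s + of_nat k) / Gamma s) * riemann_zeta (w + of_nat k))"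
      unfolding pole_part_def rGamma_inverse_Gamma divide_inverse[of "deriv Gamma (s + of_nat k)"] by (simp only: if_False)
  qed
  finally show ?thesis unfolding Od_def Ev_def by (simp only: add_uminus_conv_diff add_diff_eq)
qed

theorem theorem2p1:
  fixes \<rho> :: "nat \<Rightarrow> complex"
  assumes "enumerates_zeta_zeros \<rho>"
  shows
    "(\<forall>s1 s2. Re s2 > 1 \<and> Re (s1 + s2) > 2 \<longrightarrow>
        (\<lambda>(m1, m2). norm (Phi2_term s1 s2 m1 m2)) summable_on ({1..} \<times> {1..})) \<and>
     (\<exists>F :: complex \<times> complex \<Rightarrow> complex.
        meromorphic2_on F UNIV \<and>
        (\<forall>s1 s2. Re s2 > 1 \<and> Re (s1 + s2) > 2 \<longrightarrow> F (s1, s2) = Phi2 s1 s2) \<and>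
        (\<forall>(N::nat) (\<epsilon>::real) s1 s2.
           N \<ge> 1 \<and> 0 < \<epsilon> \<and> \<epsilon> < 1 \<and>
           Re s2 > - real N + \<epsilon> \<and> Re (s1 + s2) > 1 - real N + \<epsilon> \<and> regular_point N s1 s2 \<longrightarrow>
           summable (\<lambda>n. zero_term s1 s2 (\<rho> (Suc n))) \<and>
           vertical_integrable (real N - \<epsilon>) (line_integrand s1 s2) \<and>
           F (s1, s2) =
             riemann_zeta (s1 + s2 - 1) / (s2 - 1)
             - of_real (ln (2 * pi)) * riemann_zeta (s1 + s2)
             + (\<Sum>k\<in>{k\<in>{1..N - 1}. odd k}.
                  ((- s2) gchoose k) * M_zeta (- of_nat k) * riemann_zeta (s1 + s2 + of_nat k))
             - (\<Sum>k\<in>{k\<in>{1..N - 1}. even k}.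
                  ((- s2) gchoose k) *
                    ((- a_coeff k + fact k * b_coeff k) * riemann_zeta (s1 + s2 + of_nat k)
                     - deriv riemann_zeta (s1 + s2 + of_nat k))
                  - 1 / fact k * (deriv Gamma (s2 + of_nat k) / Gamma s2)
                      * riemann_zeta (s1 + s2 + of_nat k))
             - 1 / Gamma s2 * (\<Sum>n. zero_term s1 s2 (\<rho> (Suc n)))
             + 1 / (2 * of_real pi * \<i> * Gamma s2)
                 * vertical_integral (real N - \<epsilon>) (line_integrand s1 s2)))"
proof -
  note \<rho> = assms
  define F where "F = (\<lambda>(s1, s2). continuation \<rho> s2 (s1 + s2))"
  have 1: "(\<lambda>(m1, m2). norm (Phi2_term s1 s2 m1 m2)) summable_on ({1..} \<times> {1..})"
    if "Re s2 > 1 \<and> Re (s1 + s2) > 2" for s1 s2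
    by (rule Phi2_abs_summable) (use that in simp_all)
  have 2: "meromorphic2_on F UNIV"
    unfolding F_def by (rule pole2_imp_meromorphic2[OF continuation_pole2[OF \<rho>]])
  have 3: "F (s1, s2) = Phi2 s1 s2" if h: "Re s2 > 1 \<and> Re (s1 + s2) > 2" for s1 s2
  proof -
    define N where "N = nat \<lceil>\<bar>Re s2\<bar> + \<bar>Re (s1 + s2)\<bar>\<rceil> + 2"
    have "Phi2 s1 s2 = formula \<rho> N (real N - 1 / 2) s2 (s1 + s2)"
      by (rule Phi2_eq_formula[OF \<rho>]) (use h in \<open>simp_all add: N_def del: plus_complex.sel\<close>)
    then show ?thesis unfolding F_def continuation_def prod.case Let_def N_def[symmetric] by (rule sym)
  qed
  have 4: "summable (\<lambda>n. zero_term s1 s2 (\<rho> (Suc n))) \<and>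
           vertical_integrable (real N - \<epsilon>) (line_integrand s1 s2) \<and>
           F (s1, s2) =
             riemann_zeta (s1 + s2 - 1) / (s2 - 1)
             - of_real (ln (2 * pi)) * riemann_zeta (s1 + s2)
             + (\<Sum>k\<in>{k\<in>{1..N - 1}. odd k}.
                  ((- s2) gchoose k) * M_zeta (- of_nat k) * riemann_zeta (s1 + s2 + of_nat k))
             - (\<Sum>k\<in>{k\<in>{1..N - 1}. even k}.
                  ((- s2) gchoose k) *
                    ((- a_coeff k + fact k * b_coeff k) * riemann_zeta (s1 + s2 + of_nat k)
                     - deriv riemann_zeta (s1 + s2 + of_nat k))
                  - 1 / fact k * (deriv Gamma (s2 + of_nat k) / Gamma s2)
                      * riemann_zeta (s1 + s2 + of_nat k))
             - 1 / Gamma s2 * (\<Sum>n. zero_term s1 s2 (\<rho> (Suc n)))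
             + 1 / (2 * of_real pi * \<i> * Gamma s2)
                 * vertical_integral (real N - \<epsilon>) (line_integrand s1 s2)"
    if h: "N \<ge> 1 \<and> 0 < \<epsilon> \<and> \<epsilon> < 1 \<and> Re s2 > - real N + \<epsilon> \<and> Re (s1 + s2) > 1 - real N + \<epsilon> \<and> regular_point N s1 s2"
    for N :: nat and \<epsilon> :: real and s1 s2
  proof (intro conjI)
    have N: "N \<ge> 1" "0 < \<epsilon>" "\<epsilon> < 1" using h by blast+
    have s: "- (real N - \<epsilon>) < Re s2" and w: "1 - (real N - \<epsilon>) < Re (s1 + s2)" using h by argo+
    have good: "s2 \<notin> bad_s" "s1 + s2 \<notin> bad_w" by (rule regular_point_not_bad[OF _ N(1,2) s w], use h in simp)+
    have li: "line_integrand s1 s2 = barnes_kernel s2 (s1 + s2)"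
      by (simp add: fun_eq_iff line_integrand_def barnes_kernel_def)
    show "summable (\<lambda>n. zero_term s1 s2 (\<rho> (Suc n)))"
      unfolding zero_term_eq by (rule summable_norm_cancel[OF summable_zero_weight[OF \<rho>]])
    show "vertical_integrable (real N - \<epsilon>) (line_integrand s1 s2)"
      unfolding vertical_integrable_def li by (rule integrable_barnes_kernel[OF clear_line_right[OF N] s w])
    \<comment> \<open>The factor \<open>\<i>\<close> of \<open>dz\<close> cancels that of
      \<open>2 * pi * \<i>\<close>. The case \<open>G = 0\<close> is that of \<open>s2\<close> at a
      nonpositive integer, where both sides are 0.\<close>
    have cancel_i: "1 / (2 * of_real pi * \<i> * G) * (\<i> * L) = inverse G / (2 * of_real pi) * L" for G L :: complex
      by (cases "G = 0") (simp_all add: field_simps)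
    have line: "1 / (2 * of_real pi * \<i> * Gamma s2) * vertical_integral (real N - \<epsilon>) (line_integrand s1 s2)
        = rGamma s2 / (2 * of_real pi) * line_part (real N - \<epsilon>) s2 (s1 + s2)"
      unfolding vertical_integral_def li line_part_def rGamma_inverse_Gamma by (rule cancel_i)
    have alg: "z + (- x + y - e) - r + l = z - x + y - e - r + l" for x y z e r l :: complex
      by (simp only: diff_conv_add_uminus add.assoc)
    have zs: "1 / Gamma s2 * (\<Sum>n. zero_term s1 s2 (\<rho> (Suc n))) = rGamma s2 * (\<Sum>n. zero_weight s2 (s1 + s2) (\<rho> (Suc n)))"
      unfolding zero_term_eq rGamma_inverse_Gamma inverse_eq_divide ..
    have "F (s1, s2) = formula \<rho> N (real N - \<epsilon>) s2 (s1 + s2)"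
      unfolding F_def prod.case by (rule continuation_eq_formula[OF \<rho> N good(1) s good(2) w])
    then show "F (s1, s2) =
             riemann_zeta (s1 + s2 - 1) / (s2 - 1)
             - of_real (ln (2 * pi)) * riemann_zeta (s1 + s2)
             + (\<Sum>k\<in>{k\<in>{1..N - 1}. odd k}.
                  ((- s2) gchoose k) * M_zeta (- of_nat k) * riemann_zeta (s1 + s2 + of_nat k))
             - (\<Sum>k\<in>{k\<in>{1..N - 1}. even k}.
                  ((- s2) gchoose k) *
                    ((- a_coeff k + fact k * b_coeff k) * riemann_zeta (s1 + s2 + of_nat k)
                     - deriv riemann_zeta (s1 + s2 + of_nat k))
                  - 1 / fact k * (deriv Gamma (s2 + of_nat k) / Gamma s2)
                      * riemann_zeta (s1 + s2 + of_nat k))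
             - 1 / Gamma s2 * (\<Sum>n. zero_term s1 s2 (\<rho> (Suc n)))
             + 1 / (2 * of_real pi * \<i> * Gamma s2)
                 * vertical_integral (real N - \<epsilon>) (line_integrand s1 s2)"
      unfolding line zs formula_def sum_pole_part[OF N(1)] by (rule trans[OF _ alg])
  qed
  show ?thesis
    by (rule conjI, intro allI impI, erule 1, rule exI[of _ F], rule conjI, rule 2, rule conjI,
        intro allI impI, erule 3, intro allI impI, erule 4)
qed

end
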